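(* Let $\mu>0$, $a\in\mathbb{R}$, $x\in\mathbb{R}$. As $T\to\infty$, the distributions $\{\mathbf{Q}^\mu_{T,x}\}$ weakly converge to the probability distribution $\mathbf{P}^\mu_x$.
   Context: $\xi(t)$, $t\ge 0$, is a one-dimensional symmetric Lévy process with $\mathbf{E}e^{ip\xi(t)}=e^{-t\Psi(p)}$, $\Psi(p)=\frac{\sigma^2p^2}{2}+\int_{|y|>0}(1-\cos(py))\,\Pi(dy)$, where $\sigma^2\ge0$ and $\Pi$ is a symmetric $\sigma$-finite measure with $\int_{|y|>0}\min(1,y^2)\,\Pi(dy)<\infty$. It is assumed that the local time of $\xi$ exists, equivalently $\int_{\mathbb{R}}\frac{dp}{1+\Psi(p)}<\infty$. $L(t,\cdot)$ is the local time, i.e. the density with respect to Lebesgue measure of the occupation measure $\Gamma\mapsto\mathrm{mes}\{\tau<t:\xi(\tau)\in\Gamma\}$; it is taken to be continuous in both variables with probability 1. $\xi_x(t)=x-\xi(t)$. For $\lambda\in\mathbb{C}\setminus(-\infty,0]$, $\psi_\lambda(x)=\frac1{2\pi}\int_{\mathbb{R}}\frac{e^{-ipx}}{\Psi(p)+\lambda}\,dp$. The number $\nu>0$ is the one determined by $\mu\,\psi_\nu(0)=1$. Let $p_\mu(t,x,y)$, $t>0$, be the integral kernel of the $C_0$-semigroup on $L_2(\mathbb{R})$ that acts on $f\in L_2(\mathbb{R})\cap C_b(\mathbb{R})$ by $f\mapsto\mathbf{E}f(\xi_x(t))e^{\mu L(t,x-a)}$, and let $Z_\mu(t,x)=\int_{\mathbb{R}}p_\mu(t,x,y)\,dy=\mathbf{E}\,e^{\mu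 L(t,x-a)}$ (with $Z_\mu(0,x)=1$). $\mathbf{P}_{T,x}$ is the law of $\xi_x(t)$, $t\le T$, on $\Omega_{T,x}=\{\omega\in\mathbb{D}([0,T],\mathbb{R}):\omega(0)=x\}$, where $\mathbb{D}$ denotes the Skorokhod space of right-continuous functions with left limits. The measure $$\mathbf{Q}^\mu_{T,x}=\frac{e^{\mu L(T,x-a)}}{\mathbf{E}\,e^{\mu L(T,x-a)}}\,\mathbf{P}_{T,x}$$ on $\Omega_{T,x}$ is given on cylindrical sets, for $0<t_1<\dots<t_n\le T$ and Borel sets $B_1,\dots,B_n\subset\mathbb{R}$, by $$\mathbf{Q}^\mu_{T,x}\{\omega(t_1)\in B_1,\dots,\omega(t_n)\in B_n\}=\frac{1}{Z_\mu(T,x)}\int_{B_1}\!\!\dots\int_{B_n}p_\mu(t_1,x,x_1)\prod_{k=2}^n p_\mu(t_k-t_{k-1},x_{k-1},x_k)\,Z_\mu(T-t_n,x_n)\,dx_1\dots dx_n .$$ $\mathbf{P}^\mu_x$ is the measure of the Markov process $\zeta(t)$, $t\ge0$, started at $x$, with sample paths in $\mathbb{D}([0,\infty),\mathbb{R})$ and transition density $$\rho_\mu(t,x,y)=e^{-\nu t}\,\frac{p_\mu(t,x,y)\,\psi_\nu(y-a)}{\psi_\nu(x-a)} .$$ *)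

theory Defs
  imports "HOL-Probability.Probability"
begin

section \<open>Path spaces\<close>

definition cadlag_on :: "real set \<Rightarrow> (real \<Rightarrow> real) \<Rightarrow> bool" where
  "cadlag_on I \<omega> \<longleftrightarrow>
     (\<forall>t\<in>I. continuous (at t within (I \<inter> {t..})) \<omega> \<and>
            (\<exists>l. (\<omega> \<longlongrightarrow> l) (at t within (I \<inter> {..<t}))))"

text \<open>Paths are extensional functions on the time set \<open>I\<close>, so that two paths are equal iff they
  agree on \<open>I\<close>. The time sets used are \<open>{0..T}\<close> and \<open>{0..}\<close>.\<close>

definition cadlag_paths :: "real set \<Rightarrow> (real \<Rightarrow> real) set" where
  "cadlag_paths I = {\<omega> \<in> extensional I. cadlag_on I \<omega>}"

text \<open>The \<open>\<sigma>\<close>-algebra generated by the cylindrical sets. On \<open>{0..S}\<close> it is the Borel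
  \<open>\<sigma>\<close>-algebra of the Skorokhod topology below.\<close>

definition path_space :: "real set \<Rightarrow> (real \<Rightarrow> real) measure" where
  "path_space I = restrict_space (\<Pi>\<^sub>M t\<in>I. borel) (cadlag_paths I)"

definition time_changes :: "real \<Rightarrow> (real \<Rightarrow> real) set" where
  "time_changes S =
     {\<tau>. strict_mono_on {0..S} \<tau> \<and> continuous_on {0..S} \<tau> \<and> \<tau> ` {0..S} = {0..S}}"

text \<open>The value off the path space is irrelevant for the topology; it is chosen such that
  \<^const>\<open>Metric_space\<close> (which asks for nonnegativity everywhere) holds.\<close>

definition skorokhod_dist :: "real \<Rightarrow> (real \<Rightarrow> real) \<Rightarrow> (real \<Rightarrow> real) \<Rightarrow> real" where
  "skorokhod_dist S \<omega> \<eta> =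
     (if \<omega> \<in> cadlag_paths {0..S} \<and> \<eta> \<in> cadlag_paths {0..S}
      then Inf {e. 0 \<le> e \<and> (\<exists>\<tau>\<in>time_changes S. \<forall>t\<in>{0..S}.
             \<bar>\<tau> t - t\<bar> \<le> e \<and> \<bar>\<omega> t - \<eta> (\<tau> t)\<bar> \<le> e)}
      else 0)"

lemma time_changes_endpoint:
  assumes "\<tau> \<in> time_changes S" "0 \<le> S"
  shows "\<tau> S = S"
proof -
  have im: "\<tau> ` {0..S} = {0..S}" and sm: "strict_mono_on {0..S} \<tau>"
    using assms(1) by (auto simp: time_changes_def)
  have "S \<in> \<tau> ` {0..S}" using im assms(2) by auto
  then obtain t where t: "t \<in> {0..S}" "\<tau> t = S" by auto
  have "\<tau> S \<in> {0..S}" using im assms(2) by auto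
  moreover have "\<tau> t \<le> \<tau> S"
    using t assms(2) sm by (intro strict_mono_on_leD[OF sm]) auto
  ultimately show ?thesis using t by auto
qed

lemma time_changes_id: "id \<in> time_changes S"
  by (auto simp: time_changes_def strict_mono_on_def continuous_on_id id_def)

lemma time_changes_comp:
  assumes "\<tau> \<in> time_changes S" "\<kappa> \<in> time_changes S"
  shows "\<kappa> \<circ> \<tau> \<in> time_changes S"
proof -
  have a: "\<tau> ` {0..S} = {0..S}" "\<kappa> ` {0..S} = {0..S}"
    using assms by (auto simp: time_changes_def)
  have "strict_mono_on {0..S} (\<kappa> \<circ> \<tau>)"
  proof (rule strict_mono_onI)
    fix r s assume rs: "r \<in> {0..S}" "s \<in> {0..S}" "r < s"
    have sm: "strict_mono_on {0..S} \<tau>" "strict_mono_on {0..S} \<kappa>"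
      using assms by (auto simp: time_changes_def)
    have "\<tau> r \<in> {0..S}" "\<tau> s \<in> {0..S}" using a(1) rs by blast+
    moreover have "\<tau> r < \<tau> s" using sm(1) rs by (rule strict_mono_onD)
    ultimately show "(\<kappa> \<circ> \<tau>) r < (\<kappa> \<circ> \<tau>) s"
      unfolding o_def by (rule strict_mono_onD[OF sm(2)])
  qed
  moreover have "continuous_on {0..S} (\<kappa> \<circ> \<tau>)"
    using assms a by (intro continuous_on_compose) (auto simp: time_changes_def)
  moreover have "(\<kappa> \<circ> \<tau>) ` {0..S} = {0..S}"
    unfolding image_comp[symmetric] a by (rule refl)
  ultimately show ?thesis by (simp add: time_changes_def)
qed

lemma time_changes_inv:
  assumes "\<tau> \<in> time_changes S"
  shows "the_inv_into {0..S} \<tau> \<in> time_changes S"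
proof -
  let ?k = "the_inv_into {0..S} \<tau>"
  have im: "\<tau> ` {0..S} = {0..S}" and sm: "strict_mono_on {0..S} \<tau>"
    and ct: "continuous_on {0..S} \<tau>"
    using assms by (auto simp: time_changes_def)
  have inj: "inj_on \<tau> {0..S}" using sm by (rule strict_mono_on_imp_inj_on)
  have k1: "\<And>t. t \<in> {0..S} \<Longrightarrow> ?k (\<tau> t) = t" using inj by (rule the_inv_into_f_f)
  have k2: "\<And>t. t \<in> {0..S} \<Longrightarrow> \<tau> (?k t) = t" using inj im by (metis f_the_inv_into_f)
  have k3: "?k ` {0..S} = {0..S}" using inj im by (metis the_inv_into_onto)
  have "continuous_on (\<tau> ` {0..S}) ?k"
    by (rule continuous_on_inv[OF ct compact_Icc]) (auto simp: k1)
  moreover have "strict_mono_on {0..S} ?k"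
  proof (rule strict_mono_onI)
    fix r s assume rs: "r \<in> {0..S}" "s \<in> {0..S}" "r < s"
    have *: "?k r \<in> {0..S}" "?k s \<in> {0..S}" using k3 rs by blast+
    show "?k r < ?k s"
    proof (rule ccontr)
      assume "\<not> ?k r < ?k s"
      then have "\<tau> (?k s) \<le> \<tau> (?k r)" using * by (intro strict_mono_on_leD[OF sm]) auto
      then show False using rs k2 by auto
    qed
  qed
  ultimately show ?thesis using im k3 by (simp add: time_changes_def)
qed

lemma cadlag_bounded:
  assumes "cadlag_on {0..S} \<omega>" "0 \<le> S"
  shows "\<exists>K. \<forall>t\<in>{0..S}. \<bar>\<omega> t\<bar> \<le> K"
proof -
  let ?P = "\<lambda>a b. \<exists>K. \<forall>t\<in>{0..S} \<inter> {a..b}. \<bar>\<omega> t\<bar> \<le> K"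
  have "?P 0 S"
  using assms(2) proof (induction rule: Bolzano[where P = ?P])
    case (trans a b c)
    then obtain K K' where "\<forall>t\<in>{0..S} \<inter> {a..b}. \<bar>\<omega> t\<bar> \<le> K" "\<forall>t\<in>{0..S} \<inter> {b..c}. \<bar>\<omega> t\<bar> \<le> K'"
      by blast
    then have "\<forall>t\<in>{0..S} \<inter> {a..c}. \<bar>\<omega> t\<bar> \<le> max K K'"
      by (auto simp: le_max_iff_disj)
    then show ?case by blast
  next
    case (local x)
    then have x: "x \<in> {0..S}" by auto
    obtain l where l: "(\<omega> \<longlongrightarrow> l) (at x within ({0..S} \<inter> {..<x}))"
      and r: "(\<omega> \<longlongrightarrow> \<omega> x) (at x within ({0..S} \<inter> {x..}))"
      using assms(1) x unfolding cadlag_on_def continuous_within by blast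
    obtain d1 where d1: "d1 > 0"
      "\<And>y. y \<in> {0..S} \<inter> {..<x} \<Longrightarrow> y \<noteq> x \<and> dist y x < d1 \<Longrightarrow> dist (\<omega> y) l < 1"
      using tendstoD[OF l, of 1] unfolding eventually_at by auto
    obtain d2 where d2: "d2 > 0"
      "\<And>y. y \<in> {0..S} \<inter> {x..} \<Longrightarrow> y \<noteq> x \<and> dist y x < d2 \<Longrightarrow> dist (\<omega> y) (\<omega> x) < 1"
      using tendstoD[OF r, of 1] unfolding eventually_at by auto
    have "\<bar>\<omega> y\<bar> \<le> 1 + \<bar>l\<bar> + \<bar>\<omega> x\<bar>"
      if y: "y \<in> {0..S}" "\<bar>y - x\<bar> < min d1 d2" for y
    proof (cases y x rule: linorder_cases)
      case less
      then show ?thesis using d1(2)[of y] y by (auto simp: dist_real_def)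
    next
      case greater
      then show ?thesis using d2(2)[of y] y by (auto simp: dist_real_def)
    qed auto
    then have "\<forall>a b. a \<le> x \<and> x \<le> b \<and> b - a < min d1 d2 \<longrightarrow>
        (\<forall>t\<in>{0..S} \<inter> {a..b}. \<bar>\<omega> t\<bar> \<le> 1 + \<bar>l\<bar> + \<bar>\<omega> x\<bar>)"
      by (auto simp: abs_less_iff)
    then have "\<forall>a b. a \<le> x \<and> x \<le> b \<and> b - a < min d1 d2 \<longrightarrow> ?P a b" by blast
    moreover have "min d1 d2 > 0" using d1(1) d2(1) by simp
    ultimately show ?case by blast
  qed
  then show ?thesis by auto
qed


lemma skorokhod_dist_lessD:
  assumes "skorokhod_dist S \<omega> \<eta> < e" "0 \<le> S"
    "\<omega> \<in> cadlag_paths {0..S}" "\<eta> \<in> cadlag_paths {0..S}"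
  shows "\<exists>\<tau>\<in>time_changes S. \<forall>t\<in>{0..S}. \<bar>\<tau> t - t\<bar> \<le> e \<and> \<bar>\<omega> t - \<eta> (\<tau> t)\<bar> \<le> e"
proof -
  let ?A = "{e. 0 \<le> e \<and> (\<exists>\<tau>\<in>time_changes S. \<forall>t\<in>{0..S}.
             \<bar>\<tau> t - t\<bar> \<le> e \<and> \<bar>\<omega> t - \<eta> (\<tau> t)\<bar> \<le> e)}"
  obtain K K' where K: "\<forall>t\<in>{0..S}. \<bar>\<omega> t\<bar> \<le> K" "\<forall>t\<in>{0..S}. \<bar>\<eta> t\<bar> \<le> K'"
    using cadlag_bounded[OF _ assms(2)] assms(3,4) unfolding cadlag_paths_def by blast
  have "0 \<in> {0..S}" using assms(2) by simp
  then have "\<bar>\<omega> 0\<bar> \<le> K" "\<bar>\<eta> 0\<bar> \<le> K'" using K by blast+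
  then have K0: "0 \<le> K + K'" by linarith
  have "\<bar>id t - t\<bar> \<le> K + K' \<and> \<bar>\<omega> t - \<eta> (id t)\<bar> \<le> K + K'" if "t \<in> {0..S}" for t
  proof -
    have "\<bar>\<omega> t\<bar> \<le> K" "\<bar>\<eta> t\<bar> \<le> K'" using K that by blast+
    then show ?thesis using K0 by (simp add: abs_le_iff)
  qed
  then have "K + K' \<in> ?A" using K0 time_changes_id[of S] by blast
  then obtain e' where "e' \<in> ?A" "e' < e"
    using assms cInf_lessD[of ?A e] unfolding skorokhod_dist_def by auto
  then obtain \<tau> where \<tau>: "\<tau> \<in> time_changes S"
    "\<And>t. t \<in> {0..S} \<Longrightarrow> \<bar>\<tau> t - t\<bar> \<le> e' \<and> \<bar>\<omega> t - \<eta> (\<tau> t)\<bar> \<le> e'" by blast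
  show ?thesis
  proof (intro bexI[OF _ \<tau>(1)] ballI)
    fix t assume "t \<in> {0..S}"
    from \<tau>(2)[OF this] \<open>e' < e\<close>
    show "\<bar>\<tau> t - t\<bar> \<le> e \<and> \<bar>\<omega> t - \<eta> (\<tau> t)\<bar> \<le> e" by linarith
  qed
qed

lemma skorokhod_dist_leI:
  assumes "\<tau> \<in> time_changes S" "0 \<le> e"
    "\<And>t. t \<in> {0..S} \<Longrightarrow> \<bar>\<tau> t - t\<bar> \<le> e \<and> \<bar>\<omega> t - \<eta> (\<tau> t)\<bar> \<le> e"
  shows "skorokhod_dist S \<omega> \<eta> \<le> e"
proof (cases "\<omega> \<in> cadlag_paths {0..S} \<and> \<eta> \<in> cadlag_paths {0..S}")
  case True
  have "bdd_below {e. 0 \<le> e \<and> (\<exists>\<tau>\<in>time_changes S. \<forall>t\<in>{0..S}.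
             \<bar>\<tau> t - t\<bar> \<le> e \<and> \<bar>\<omega> t - \<eta> (\<tau> t)\<bar> \<le> e)}"
    by (rule bdd_belowI[of _ 0]) simp
  moreover have "e \<in> {e. 0 \<le> e \<and> (\<exists>\<tau>\<in>time_changes S. \<forall>t\<in>{0..S}.
             \<bar>\<tau> t - t\<bar> \<le> e \<and> \<bar>\<omega> t - \<eta> (\<tau> t)\<bar> \<le> e)}"
    using assms by blast
  ultimately show ?thesis using True by (simp only: skorokhod_dist_def simp_thms if_True cInf_lower)
qed (use assms(2) in \<open>auto simp: skorokhod_dist_def\<close>)

lemma skorokhod_dist_nonneg:
  assumes "0 \<le> S"
  shows "0 \<le> skorokhod_dist S \<omega> \<eta>"
proof (cases "\<omega> \<in> cadlag_paths {0..S} \<and> \<eta> \<in> cadlag_paths {0..S}")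
  case True
  show ?thesis
  proof (rule ccontr)
    assume "\<not> 0 \<le> skorokhod_dist S \<omega> \<eta>"
    then obtain e where e: "skorokhod_dist S \<omega> \<eta> < e" "e < 0" by (meson dense not_le)
    from skorokhod_dist_lessD[OF e(1) assms] True obtain \<tau>
      where "\<forall>t\<in>{0..S}. \<bar>\<tau> t - t\<bar> \<le> e" by blast
    moreover have "0 \<in> {0..S}" using assms by simp
    ultimately have "\<bar>\<tau> 0 - 0\<bar> \<le> e" by blast
    then show False using e by linarith
  qed
qed (auto simp: skorokhod_dist_def)

lemma skorokhod_dist_commute_le:
  assumes "0 \<le> S" "\<omega> \<in> cadlag_paths {0..S}" "\<eta> \<in> cadlag_paths {0..S}"
  shows "skorokhod_dist S \<eta> \<omega> \<le> skorokhod_dist S \<omega> \<eta>"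
proof (rule field_le_epsilon)
  fix e :: real assume "0 < e"
  let ?e = "skorokhod_dist S \<omega> \<eta> + e"
  obtain \<tau> where t: "\<tau> \<in> time_changes S"
    "\<And>t. t \<in> {0..S} \<Longrightarrow> \<bar>\<tau> t - t\<bar> \<le> ?e \<and> \<bar>\<omega> t - \<eta> (\<tau> t)\<bar> \<le> ?e"
    using skorokhod_dist_lessD[of S \<omega> \<eta> ?e] \<open>0 < e\<close> assms by auto
  let ?k = "the_inv_into {0..S} \<tau>"
  have k: "?k \<in> time_changes S" by (rule time_changes_inv[OF t(1)])
  have inj: "inj_on \<tau> {0..S}"
    using t(1) by (auto simp: time_changes_def intro: strict_mono_on_imp_inj_on)
  show "skorokhod_dist S \<eta> \<omega> \<le> ?e"
  proof (rule skorokhod_dist_leI[OF k])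
    show "0 \<le> ?e" using \<open>0 < e\<close> skorokhod_dist_nonneg[OF assms(1), of \<omega> \<eta>] by linarith
    fix u assume u: "u \<in> {0..S}"
    have "?k u \<in> {0..S}" using k u by (auto simp: time_changes_def)
    moreover have "\<tau> (?k u) = u"
      using u t(1) by (intro f_the_inv_into_f[OF inj]) (auto simp: time_changes_def)
    ultimately show "\<bar>?k u - u\<bar> \<le> ?e \<and> \<bar>\<eta> u - \<omega> (?k u)\<bar> \<le> ?e"
      using t(2)[of "?k u"] by (simp add: abs_minus_commute)
  qed
qed

lemma skorokhod_dist_eq_0:
  assumes S: "0 \<le> S" and D: "\<omega> \<in> cadlag_paths {0..S}" "\<eta> \<in> cadlag_paths {0..S}"
    and 0: "skorokhod_dist S \<omega> \<eta> = 0"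
  shows "\<omega> = \<eta>"
proof (rule extensionalityI)
  show "\<omega> \<in> extensional {0..S}" "\<eta> \<in> extensional {0..S}"
    using D by (auto simp: cadlag_paths_def)
  fix t assume t: "t \<in> {0..S}"
  have ap: "\<exists>\<tau>\<in>time_changes S. \<forall>t\<in>{0..S}. \<bar>\<tau> t - t\<bar> \<le> e \<and> \<bar>\<omega> t - \<eta> (\<tau> t)\<bar> \<le> e"
    if "0 < e" for e
    using skorokhod_dist_lessD[OF _ S D, of e] 0 that by auto
  show "\<omega> t = \<eta> t"
  proof (cases "t = S")
    case True
    have "\<bar>\<omega> S - \<eta> S\<bar> \<le> 0 + e" if "0 < e" for e
    proof -
      obtain \<tau> where \<tau>: "\<tau> \<in> time_changes S" "\<forall>t\<in>{0..S}. \<bar>\<omega> t - \<eta> (\<tau> t)\<bar> \<le> e"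
        using ap[OF \<open>0 < e\<close>] by blast
      have "S \<in> {0..S}" using S by auto
      then show ?thesis using \<tau> time_changes_endpoint[OF \<tau>(1) S] by (metis add_0)
    qed
    then have "\<bar>\<omega> S - \<eta> S\<bar> \<le> 0" by (rule field_le_epsilon)
    then show ?thesis using True by auto
  next
    case False
    then have tS: "t < S" using t by auto
    have "\<bar>\<omega> t - \<eta> t\<bar> \<le> 0 + e" if e: "0 < e" for e
    proof -
      have c: "(\<omega> \<longlongrightarrow> \<omega> t) (at t within ({0..S} \<inter> {t..}))"
          "(\<eta> \<longlongrightarrow> \<eta> t) (at t within ({0..S} \<inter> {t..}))"
        using D t unfolding cadlag_paths_def cadlag_on_def continuous_within by blast+
      have e3: "0 < e / 3" using e by simp
      obtain d1 where d1: "d1 > 0"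
        "\<And>y. y \<in> {0..S} \<inter> {t..} \<Longrightarrow> y \<noteq> t \<and> dist y t < d1 \<Longrightarrow> dist (\<omega> y) (\<omega> t) < e / 3"
        using tendstoD[OF c(1) e3] unfolding eventually_at by auto
      obtain d2 where d2: "d2 > 0"
        "\<And>y. y \<in> {0..S} \<inter> {t..} \<Longrightarrow> y \<noteq> t \<and> dist y t < d2 \<Longrightarrow> dist (\<eta> y) (\<eta> t) < e / 3"
        using tendstoD[OF c(2) e3] unfolding eventually_at by auto
      define d where "d = min (min d1 d2) (S - t)"
      have d: "0 < d" "d \<le> d1" "d \<le> d2" "d \<le> S - t" using d1(1) d2(1) tS by (auto simp: d_def)
      define s where "s = t + d / 2"
      have s: "s \<in> {0..S}" "t < s" "s - t < d1" using d t by (auto simp: s_def)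
      obtain \<tau> where tau: "\<tau> \<in> time_changes S"
        "\<And>u. u \<in> {0..S} \<Longrightarrow> \<bar>\<tau> u - u\<bar> \<le> min (e / 3) (d / 4) \<and> \<bar>\<omega> u - \<eta> (\<tau> u)\<bar> \<le> min (e / 3) (d / 4)"
        using ap[of "min (e / 3) (d / 4)"] e d(1) by auto
      have a: "\<bar>\<tau> s - s\<bar> \<le> d / 4" "\<bar>\<omega> s - \<eta> (\<tau> s)\<bar> \<le> e / 3" using tau(2)[OF s(1)] by auto
      have "\<tau> s \<in> {0..S}" using tau(1) s(1) by (auto simp: time_changes_def)
      moreover have "t < \<tau> s" "\<tau> s - t < d2" using a(1) d unfolding s_def by linarith+
      ultimately have "\<bar>\<eta> (\<tau> s) - \<eta> t\<bar> < e / 3"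
        using d2(2)[of "\<tau> s"] by (auto simp: dist_real_def)
      moreover have "\<bar>\<omega> s - \<omega> t\<bar> < e / 3"
        using d1(2)[of s] s by (auto simp: dist_real_def)
      ultimately show ?thesis using a(2) by linarith
    qed
    then have "\<bar>\<omega> t - \<eta> t\<bar> \<le> 0" by (rule field_le_epsilon)
    then show ?thesis by auto
  qed
qed

lemma skorokhod_dist_triangle:
  assumes S: "0 \<le> S" and D: "\<omega> \<in> cadlag_paths {0..S}" "\<eta> \<in> cadlag_paths {0..S}" "\<theta> \<in> cadlag_paths {0..S}"
  shows "skorokhod_dist S \<omega> \<theta> \<le> skorokhod_dist S \<omega> \<eta> + skorokhod_dist S \<eta> \<theta>"
proof (rule field_le_epsilon)
  fix e :: real assume e: "0 < e"
  let ?a = "skorokhod_dist S \<omega> \<eta> + e / 2" and ?b = "skorokhod_dist S \<eta> \<theta> + e / 2"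
  obtain \<tau> where t: "\<tau> \<in> time_changes S"
    "\<And>t. t \<in> {0..S} \<Longrightarrow> \<bar>\<tau> t - t\<bar> \<le> ?a \<and> \<bar>\<omega> t - \<eta> (\<tau> t)\<bar> \<le> ?a"
    using skorokhod_dist_lessD[of S \<omega> \<eta> ?a] e S D by auto
  obtain \<kappa> where k: "\<kappa> \<in> time_changes S"
    "\<And>t. t \<in> {0..S} \<Longrightarrow> \<bar>\<kappa> t - t\<bar> \<le> ?b \<and> \<bar>\<eta> t - \<theta> (\<kappa> t)\<bar> \<le> ?b"
    using skorokhod_dist_lessD[of S \<eta> \<theta> ?b] e S D by auto
  have "skorokhod_dist S \<omega> \<theta> \<le> ?a + ?b"
  proof (rule skorokhod_dist_leI[OF time_changes_comp[OF t(1) k(1)]])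
    show "0 \<le> ?a + ?b"
      using e skorokhod_dist_nonneg[OF S, of \<omega> \<eta>] skorokhod_dist_nonneg[OF S, of \<eta> \<theta>] by linarith
    fix u assume u: "u \<in> {0..S}"
    then have "\<tau> u \<in> {0..S}" using t(1) by (auto simp: time_changes_def)
    from t(2)[OF u] k(2)[OF this]
    show "\<bar>(\<kappa> \<circ> \<tau>) u - u\<bar> \<le> ?a + ?b \<and> \<bar>\<omega> u - \<theta> ((\<kappa> \<circ> \<tau>) u)\<bar> \<le> ?a + ?b"
      unfolding o_def by linarith
  qed
  then show "skorokhod_dist S \<omega> \<theta> \<le> skorokhod_dist S \<omega> \<eta> + skorokhod_dist S \<eta> \<theta> + e" by simp
qed

lemma Metric_space_skorokhod:
  assumes S: "0 \<le> S"
  shows "Metric_space (cadlag_paths {0..S}) (skorokhod_dist S)"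
proof
  fix \<omega> \<eta> \<theta>
  show "0 \<le> skorokhod_dist S \<omega> \<eta>" by (rule skorokhod_dist_nonneg[OF S])
  show "skorokhod_dist S \<omega> \<eta> = skorokhod_dist S \<eta> \<omega>"
  proof (cases "\<omega> \<in> cadlag_paths {0..S} \<and> \<eta> \<in> cadlag_paths {0..S}")
    case True
    then show ?thesis using skorokhod_dist_commute_le[OF S] by (meson order_antisym)
  next
    case False
    then show ?thesis by (auto simp: skorokhod_dist_def)
  qed
  show "skorokhod_dist S \<omega> \<eta> = 0 \<longleftrightarrow> \<omega> = \<eta>"
    if "\<omega> \<in> cadlag_paths {0..S}" "\<eta> \<in> cadlag_paths {0..S}"
  proof
    show "\<omega> = \<eta>" if "skorokhod_dist S \<omega> \<eta> = 0"
      using skorokhod_dist_eq_0[OF S] that \<open>\<omega> \<in> _\<close> \<open>\<eta> \<in> _\<close> by blast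
    assume "\<omega> = \<eta>"
    then have "skorokhod_dist S \<omega> \<eta> \<le> 0"
      by (intro skorokhod_dist_leI[OF time_changes_id]) auto
    then show "skorokhod_dist S \<omega> \<eta> = 0" using skorokhod_dist_nonneg[OF S, of \<omega> \<eta>] by linarith
  qed
  show "skorokhod_dist S \<omega> \<theta> \<le> skorokhod_dist S \<omega> \<eta> + skorokhod_dist S \<eta> \<theta>"
    if "\<omega> \<in> cadlag_paths {0..S}" "\<eta> \<in> cadlag_paths {0..S}" "\<theta> \<in> cadlag_paths {0..S}"
    by (rule skorokhod_dist_triangle[OF S that])
qed

definition skorokhod_topology :: "real \<Rightarrow> (real \<Rightarrow> real) topology" where
  "skorokhod_topology S = Metric_space.mtopology (cadlag_paths {0..S}) (skorokhod_dist S)"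

text \<open>Weak convergence of laws \<open>Q T\<close> on paths over \<open>[0,T]\<close> to a law \<open>P\<close> on paths over
  \<open>[0,\<infinity>)\<close>: for every fixed horizon \<open>S\<close>, the images of \<open>Q T\<close> (\<open>T \<ge> S\<close>) under restriction of
  paths to \<open>[0,S]\<close> converge weakly in the Skorokhod space over \<open>[0,S]\<close> to the image of \<open>P\<close>.\<close>

definition weakly_converges_paths ::
    "(real \<Rightarrow> (real \<Rightarrow> real) measure) \<Rightarrow> (real \<Rightarrow> real) measure \<Rightarrow> bool" where
  "weakly_converges_paths Q P \<longleftrightarrow>
     (\<forall>S>0. \<forall>F :: (real \<Rightarrow> real) \<Rightarrow> real.
        continuous_map (skorokhod_topology S) euclideanreal F \<and>
        bounded (F ` cadlag_paths {0..S}) \<longrightarrow>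
        ((\<lambda>T. LINT \<omega>|Q T. F (restrict \<omega> {0..S})) \<longlongrightarrow>
           (LINT \<omega>|P. F (restrict \<omega> {0..S}))) at_top)"


section \<open>The Levy process and its local time\<close>

definition symmetric_levy_measure :: "real measure \<Rightarrow> bool" where
  "symmetric_levy_measure \<Lambda> \<longleftrightarrow>
     sets \<Lambda> = sets borel \<and> sigma_finite_measure \<Lambda> \<and> distr \<Lambda> borel uminus = \<Lambda> \<and>
     (\<integral>\<^sup>+y\<in>-{0}. ennreal (min 1 (y\<^sup>2)) \<partial>\<Lambda>) < \<infinity>"

definition levy_exponent :: "real \<Rightarrow> real measure \<Rightarrow> real \<Rightarrow> real" where
  "levy_exponent \<sigma> \<Lambda> q = \<sigma>\<^sup>2 * q\<^sup>2 / 2 + (LINT y:-{0}|\<Lambda>. 1 - cos (q * y))"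

definition levy_process :: "'w measure \<Rightarrow> (real \<Rightarrow> 'w \<Rightarrow> real) \<Rightarrow> bool" where
  "levy_process M \<xi> \<longleftrightarrow>
     prob_space M \<and>
     (\<forall>t\<ge>0. \<xi> t \<in> borel_measurable M) \<and>
     (\<forall>w\<in>space M. \<xi> 0 w = 0 \<and> cadlag_on {0..} (\<lambda>t. \<xi> t w)) \<and>
     (\<forall>(n::nat) (s :: nat \<Rightarrow> real). 0 \<le> s 0 \<and> (\<forall>i<n. s i \<le> s (Suc i)) \<longrightarrow>
        prob_space.indep_vars M (\<lambda>_. borel) (\<lambda>i w. \<xi> (s (Suc i)) w - \<xi> (s i) w) {..<n}) \<and>
     (\<forall>s\<ge>0. \<forall>t\<ge>0. distr M borel (\<lambda>w. \<xi> (s + t) w - \<xi> s w) = distr M borel (\<xi> t))"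

definition local_time ::
    "'w measure \<Rightarrow> (real \<Rightarrow> 'w \<Rightarrow> real) \<Rightarrow> (real \<Rightarrow> real \<Rightarrow> 'w \<Rightarrow> real) \<Rightarrow> bool" where
  "local_time M \<xi> L \<longleftrightarrow>
     (\<forall>t\<ge>0. \<forall>v. L t v \<in> borel_measurable M) \<and>
     (AE w in M.
        (\<forall>t\<ge>0. \<forall>v. 0 \<le> L t v w) \<and>
        (\<forall>t\<ge>0. \<forall>\<Gamma>\<in>sets borel. emeasure lborel {\<tau>. 0 \<le> \<tau> \<and> \<tau> < t \<and> \<xi> \<tau> w \<in> \<Gamma>} =
            (\<integral>\<^sup>+v\<in>\<Gamma>. ennreal (L t v w) \<partial>lborel)) \<and>
        continuous_on ({0..} \<times> UNIV) (\<lambda>(t, v). L t v w))"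


section \<open>The kernel of the Feynman-Kac semigroup\<close>

definition L2_fun :: "(real \<Rightarrow> complex) set" where
  "L2_fun = {f \<in> borel_measurable borel. integrable lborel (\<lambda>x. (cmod (f x))\<^sup>2)}"

definition L2_nrm :: "(real \<Rightarrow> complex) \<Rightarrow> real" where
  "L2_nrm f = sqrt (LINT x|lborel. (cmod (f x))\<^sup>2)"

definition Cb_fun :: "(real \<Rightarrow> complex) set" where
  "Cb_fun = {f. continuous_on UNIV f \<and> bounded (range f)}"

text \<open>Elements of $L_2$ are represented by functions, hence the equalities almost everywhere.\<close>

definition C0_semigroup_L2 :: "(real \<Rightarrow> (real \<Rightarrow> complex) \<Rightarrow> real \<Rightarrow> complex) \<Rightarrow> bool" where
  "C0_semigroup_L2 U \<longleftrightarrow>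
     (\<forall>t\<ge>0. \<forall>f\<in>L2_fun. U t f \<in> L2_fun) \<and>
     (\<forall>t\<ge>0. \<forall>f\<in>L2_fun. \<forall>g\<in>L2_fun. \<forall>c d.
        AE x in lborel. U t (\<lambda>y. c * f y + d * g y) x = c * U t f x + d * U t g x) \<and>
     (\<forall>t\<ge>0. \<exists>C. \<forall>f\<in>L2_fun. L2_nrm (U t f) \<le> C * L2_nrm f) \<and>
     (\<forall>f\<in>L2_fun. AE x in lborel. U 0 f x = f x) \<and>
     (\<forall>s\<ge>0. \<forall>t\<ge>0. \<forall>f\<in>L2_fun. AE x in lborel. U (s + t) f x = U s (U t f) x) \<and>
     (\<forall>f\<in>L2_fun. ((\<lambda>t. L2_nrm (\<lambda>x. U t f x - f x)) \<longlongrightarrow> 0) (at_right 0))"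

definition fk_functional ::
    "'w measure \<Rightarrow> (real \<Rightarrow> 'w \<Rightarrow> real) \<Rightarrow> (real \<Rightarrow> real \<Rightarrow> 'w \<Rightarrow> real) \<Rightarrow> real \<Rightarrow> real \<Rightarrow>
     real \<Rightarrow> (real \<Rightarrow> complex) \<Rightarrow> real \<Rightarrow> complex" where
  "fk_functional M \<xi> L \<mu> a t f x =
     (LINT w|M. f (x - \<xi> t w) * of_real (exp (\<mu> * L t (x - a) w)))"

text \<open>\<open>p\<close> is the integral kernel of the $C_0$-semigroup on $L_2$ acting on $L_2 \cap C_b$ by
  \<^const>\<open>fk_functional\<close>. As an $L_2$ kernel it would only be determined for almost every \<open>x\<close>,
  whereas it is used below at a fixed starting point; the last clause selects the version for
  which the probabilistic representation holds at every \<open>x\<close> (and which is then unique up to a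
  null set of \<open>y\<close> for each \<open>t\<close> and \<open>x\<close>).\<close>

definition feynman_kac_kernel ::
    "'w measure \<Rightarrow> (real \<Rightarrow> 'w \<Rightarrow> real) \<Rightarrow> (real \<Rightarrow> real \<Rightarrow> 'w \<Rightarrow> real) \<Rightarrow> real \<Rightarrow> real \<Rightarrow>
     (real \<Rightarrow> real \<Rightarrow> real \<Rightarrow> real) \<Rightarrow> bool" where
  "feynman_kac_kernel M \<xi> L \<mu> a p \<longleftrightarrow>
     (\<forall>t>0. (\<lambda>(x, y). p t x y) \<in> borel_measurable (borel \<Otimes>\<^sub>M borel)) \<and>
     (\<exists>U. C0_semigroup_L2 U \<and>
        (\<forall>t\<ge>0. \<forall>f\<in>L2_fun \<inter> Cb_fun. AE x in lborel. U t f x = fk_functional M \<xi> L \<mu> a t f x) \<and>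
        (\<forall>t>0. \<forall>f\<in>L2_fun. AE x in lborel.
           integrable lborel (\<lambda>y. of_real (p t x y) * f y) \<and>
           U t f x = (LINT y|lborel. of_real (p t x y) * f y))) \<and>
     (\<forall>t>0. \<forall>x. \<forall>f\<in>L2_fun \<inter> Cb_fun.
        integrable lborel (\<lambda>y. of_real (p t x y) * f y) \<and>
        (LINT y|lborel. of_real (p t x y) * f y) = fk_functional M \<xi> L \<mu> a t f x)"


section \<open>The penalized laws and the limit process\<close>

text \<open>$e^{\mu L(T,x-a)} / \mathbf{E} e^{\mu L(T,x-a)} \cdot \mathbf{P}_{T,x}$, as the law of the path
  \<open>x - \<xi>\<close> on \<open>[0,T]\<close> under the reweighted measure; \<open>L T (x - a)\<close> is almost surely a function of
  that path.\<close>

definition penalized_law ::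
    "'w measure \<Rightarrow> (real \<Rightarrow> 'w \<Rightarrow> real) \<Rightarrow> (real \<Rightarrow> real \<Rightarrow> 'w \<Rightarrow> real) \<Rightarrow> real \<Rightarrow> real \<Rightarrow>
     real \<Rightarrow> real \<Rightarrow> (real \<Rightarrow> real) measure" where
  "penalized_law M \<xi> L \<mu> a x T =
     distr
       (density M (\<lambda>w. ennreal (exp (\<mu> * L T (x - a) w) / (LINT w'|M. exp (\<mu> * L T (x - a) w')))))
       (path_space {0..T})
       (\<lambda>w. \<lambda>t\<in>{0..T}. x - \<xi> t w)"

definition psi :: "(real \<Rightarrow> real) \<Rightarrow> complex \<Rightarrow> real \<Rightarrow> complex" where
  "psi \<Psi> z x =
     1 / (2 * of_real pi) * (CLINT q|lborel. exp (- \<i> * of_real (q * x)) / (of_real (\<Psi> q) + z))"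

text \<open>For real \<open>\<nu> > 0\<close> and even \<open>\<Psi>\<close> the function \<^term>\<open>psi \<Psi> (of_real \<nu>)\<close> is real-valued.\<close>

definition rho ::
    "(real \<Rightarrow> real) \<Rightarrow> (real \<Rightarrow> real \<Rightarrow> real \<Rightarrow> real) \<Rightarrow> real \<Rightarrow> real \<Rightarrow> real \<Rightarrow> real \<Rightarrow> real \<Rightarrow> real" where
  "rho \<Psi> p \<nu> a t x y =
     exp (- \<nu> * t) * (p t x y * Re (psi \<Psi> (of_real \<nu>) (y - a)) / Re (psi \<Psi> (of_real \<nu>) (x - a)))"

definition natural_filtration :: "real \<Rightarrow> (real \<Rightarrow> real) measure" where
  "natural_filtration s =
     vimage_algebra (cadlag_paths {0..}) (\<lambda>\<omega>. restrict \<omega> {0..s}) (\<Pi>\<^sub>M t\<in>{0..s}. borel)"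

definition markov_law ::
    "(real \<Rightarrow> real \<Rightarrow> real \<Rightarrow> real) \<Rightarrow> real \<Rightarrow> (real \<Rightarrow> real) measure \<Rightarrow> bool" where
  "markov_law \<rho> x P \<longleftrightarrow>
     prob_space P \<and> space P = cadlag_paths {0..} \<and> sets P = sets (path_space {0..}) \<and>
     (AE \<omega> in P. \<omega> 0 = x) \<and>
     (\<forall>s\<ge>0. \<forall>t>0. \<forall>B\<in>sets borel. AE \<omega> in P.
        real_cond_exp P (natural_filtration s) (\<lambda>\<omega>. indicator B (\<omega> (s + t))) \<omega> =
        (LINT y:B|lborel. \<rho> t (\<omega> s) y))"

end

(*
  The exponential moment Z(t, v) = E exp(mu L(t, v)) satisfies the Volterra equation
  Z(t, v) = 1 + mu int_0^t g(s, v) Z(t - s, 0) ds, where g(s, .) is the density of xi(s). Since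
  mu psi_nu(0) = 1, for v = 0 this is a renewal equation for exp(-nu t) Z(t, 0) whose kernel
  mu exp(-nu s) g(s, 0) is a probability density, so exp(-nu t) Z(t, v) tends to c psi_nu(v) with c > 0.
  By the Markov property the penalized law with horizon T has, on paths up to time S, the density
  exp(mu L(S, x - a)) Z(T - S, x - a - xi(S)) / Z(T, x - a) relative to the law of x - xi. As T tends to
  infinity it converges pointwise to
  exp(-nu S) exp(mu L(S, x - a)) psi_nu(x - a - xi(S)) / psi_nu(x - a), which is the density of the limit
  law. The latter has total mass 1, so Scheffe's lemma yields convergence in total variation on every
  [0, S], in particular weak convergence in the Skorokhod topology.
*)
theory Submission
  imports Defs
begin

text \<open>The local time is only an almost sure limit of occupation averages, so the Volterra
  equation is first derived for averages over a shrinking window, where the exponential can be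
  expanded and the Markov property applied. The passage to the limit rests on a bound for
  exponential moments that is uniform in the window; it comes from a contraction in an exponentially
  weighted supremum, because \<open>u l 0\<close> tends to 0 as \<open>l\<close> grows. The renewal
  theorem works with a kernel of which only positivity, mass 1 and a first moment are at hand: the
  extremal limit points of the solution are identified by its convolution with the tail of the
  kernel, which is explicit. That \<open>u \<nu>\<close> is an eigenfunction of the semigroup is
  never proved. Fatou's lemma gives an inequality, which keeps the transition functions finite; the
  total mass 1 that Scheffe's lemma asks for, and the positivity of \<open>u \<nu>\<close> at the
  starting point, are read off from the limit law being a probability measure with the prescribed
  transition density.\<close>

section \<open>A renewal theorem\<close>

text \<open>Along times \<open>t n\<close> at which \<open>c * z\<close> comes close to its upper limit \<open>c * \<theta>\<close>, the renewal equation is an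
  average of values that are asymptotically at most \<open>c * \<theta>\<close>; hence \<open>z (t n - s)\<close> tends to \<open>\<theta>\<close> for almost
  every \<open>s\<close> along a subsequence. The second convolution then identifies \<open>\<theta>\<close>. The sign \<open>c\<close> covers
  the upper and the lower limit at once.\<close>

lemma renewal_limit_point:
  fixes k K z e :: "real \<Rightarrow> real" and c C \<theta> \<beta> :: real and t :: "nat \<Rightarrow> real"
  assumes k: "integrable lborel k" "\<And>s. 0 < s \<Longrightarrow> 0 < k s" "\<And>s. 0 \<le> k s" "(LINT s|lborel. k s) = 1"
    and K: "integrable lborel K" "\<And>s. s < 0 \<Longrightarrow> K s = 0"
    and z [measurable]: "z \<in> borel_measurable borel" and z_bd: "\<And>t. \<bar>z t\<bar> \<le> C"
    and zeq: "\<And>t. 0 \<le> t \<Longrightarrow> z t = e t + (LINT s|lborel. k s * z (t - s))"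
    and e: "(e \<longlongrightarrow> 0) at_top"
    and lim: "((\<lambda>t. LINT s|lborel. K s * z (t - s)) \<longlongrightarrow> \<beta>) at_top"
    and c: "c = 1 \<or> c = -1"
    and ub: "\<And>d. 0 < d \<Longrightarrow> eventually (\<lambda>t. c * z t \<le> c * \<theta> + d) at_top"
    and t: "filterlim t at_top sequentially" and zt: "(\<lambda>n. z (t n)) \<longlonglongrightarrow> \<theta>"
  shows "\<theta> * (LINT s|lborel. K s) = \<beta>"
proof -
  have [measurable]: "k \<in> borel_measurable borel" "K \<in> borel_measurable borel"
    using k(1) K(1) by auto
  have C0: "0 \<le> C" using z_bd[of 0] by linarith
  \<comment> \<open>By \<open>ub\<close> the negative part of \<open>d n\<close> vanishes in the
    limit, and the integral of \<open>d n\<close> is the defect of the renewal equation at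
    \<open>t n\<close>, which tends to 0. Together this gives convergence to 0 in L1.\<close>
  define d where "d = (\<lambda>n s. k s * (c * (\<theta> - z (t n - s))))"
  have c_bd: "\<bar>c * (\<theta> - z u)\<bar> \<le> \<bar>\<theta>\<bar> + C" for u
  proof -
    have "\<bar>c * (\<theta> - z u)\<bar> = \<bar>\<theta> - z u\<bar>" using c by (auto simp: abs_mult)
    then show ?thesis using z_bd[of u] by linarith
  qed
  have d_bd: "\<bar>d n s\<bar> \<le> k s * (\<bar>\<theta>\<bar> + C)" for n s
    unfolding d_def abs_mult[of "k s"] using k(3)[of s] c_bd by (auto intro!: mult_left_mono)
  have dom: "integrable lborel (\<lambda>s. k s * (\<bar>\<theta>\<bar> + C))" using k(1) by simp
  have [measurable]: "d n \<in> borel_measurable lborel" for n unfolding d_def by measurable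
  have d_int: "integrable lborel (d n)" for n
    by (rule Bochner_Integration.integrable_bound[OF dom])
       (use d_bd C0 k(3) in \<open>auto simp: abs_mult\<close>)
  have kz: "integrable lborel (\<lambda>s. k s * z (t n - s))" for n
    by (rule Bochner_Integration.integrable_bound[of _ "\<lambda>s. k s * C"])
       (use k z_bd C0 in \<open>auto simp: abs_mult intro!: mult_left_mono\<close>)
  have d_eq: "(LINT s|lborel. d n s) = c * (\<theta> - (z (t n) - e (t n)))" if "0 \<le> t n" for n
  proof -
    have "(LINT s|lborel. d n s) = (LINT s|lborel. (c * \<theta>) * k s - c * (k s * z (t n - s)))"
      unfolding d_def by (intro Bochner_Integration.integral_cong) (auto simp: algebra_simps)
    also have "\<dots> = (c * \<theta>) * 1 - c * (LINT s|lborel. k s * z (t n - s))"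
      using k kz[of n] by (subst Bochner_Integration.integral_diff) auto
    finally show ?thesis using zeq[OF that] by (simp add: algebra_simps)
  qed
  have et: "(\<lambda>n. e (t n)) \<longlonglongrightarrow> 0" using filterlim_compose[OF e t] .
  have "(\<lambda>n. c * (\<theta> - (z (t n) - e (t n)))) \<longlonglongrightarrow> c * (\<theta> - (\<theta> - 0))"
    by (intro tendsto_intros zt et)
  moreover have "eventually (\<lambda>n. c * (\<theta> - (z (t n) - e (t n))) = (LINT s|lborel. d n s)) sequentially"
    using filterlim_at_top[THEN iffD1, OF t, rule_format, of 0]
    by eventually_elim (use d_eq in auto)
  ultimately have int_d: "(\<lambda>n. LINT s|lborel. d n s) \<longlonglongrightarrow> 0"
    by (auto dest: Lim_transform_eventually)
  have t_sub: "filterlim (\<lambda>n. t n - s) at_top sequentially" for s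
  proof -
    have "filterlim (\<lambda>n. -s + t n) at_top sequentially"
      by (rule filterlim_tendsto_add_at_top[OF tendsto_const t])
    then show ?thesis by simp
  qed
  have neg0: "(\<lambda>n. LINT s|lborel. max 0 (- d n s)) \<longlonglongrightarrow> (LINT s|(lborel :: real measure). 0)"
  proof (rule integral_dominated_convergence[where w = "\<lambda>s. k s * (\<bar>\<theta>\<bar> + C)"])
    show "AE s in lborel. (\<lambda>n. max 0 (- d n s)) \<longlonglongrightarrow> 0"
    proof (rule AE_I2, rule tendstoI)
      fix s e :: real assume "0 < e"
      \<comment> \<open>Chosen so that \<open>k s * q < e\<close>; the \<open>+ 1\<close> covers
        \<open>k s = 0\<close>.\<close>
      define q where "q = e / (2 * (k s + 1))"
      have q: "0 < q" using \<open>0 < e\<close> k(3)[of s] by (auto simp: q_def)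
      have "k s * e < e * (2 * (k s + 1))" using \<open>0 < e\<close> k(3)[of s] by (simp add: algebra_simps) (use mult_nonneg_nonneg[of e "k s"] in linarith)
      then have kq: "k s * q < e" using k(3)[of s] by (simp add: q_def divide_less_eq)
      have "eventually (\<lambda>n. c * z (t n - s) \<le> c * \<theta> + q) sequentially"
        using filterlim_iff[THEN iffD1, OF t_sub[of s], rule_format, OF ub[OF q]] .
      then show "eventually (\<lambda>n. dist (max 0 (- d n s)) 0 < e) sequentially"
      proof eventually_elim
        case (elim n)
        then have "- (c * (\<theta> - z (t n - s))) \<le> q" by (simp add: algebra_simps)
        then have "k s * - (c * (\<theta> - z (t n - s))) \<le> k s * q" using k(3)[of s] by (rule mult_left_mono)
        then have "- d n s < e" using kq unfolding d_def by auto
        then show ?case using \<open>0 < e\<close> by (auto simp: dist_real_def)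
      qed
    qed
    show "AE s in lborel. norm (max 0 (- d n s)) \<le> k s * (\<bar>\<theta>\<bar> + C)" for n
    proof (rule AE_I2)
      fix s show "norm (max 0 (- d n s)) \<le> k s * (\<bar>\<theta>\<bar> + C)"
        using d_bd[of n s] by (auto simp: max_def)
    qed
  qed (use dom in auto)
  have "(LINT s|lborel. norm (d n s)) = (LINT s|lborel. d n s) + 2 * (LINT s|lborel. max 0 (- d n s))" for n
  proof -
    have "(LINT s|lborel. norm (d n s)) = (LINT s|lborel. d n s + 2 * max 0 (- d n s))"
      by (intro Bochner_Integration.integral_cong) auto
    also have "\<dots> = (LINT s|lborel. d n s) + 2 * (LINT s|lborel. max 0 (- d n s))"
      using d_int[of n] by (subst Bochner_Integration.integral_add) auto
    finally show ?thesis .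
  qed
  moreover have "(\<lambda>n. (LINT s|lborel. d n s) + 2 * (LINT s|lborel. max 0 (- d n s))) \<longlonglongrightarrow> 0 + 2 * 0"
    using neg0 by (intro tendsto_intros int_d) simp
  ultimately have "(\<lambda>n. LINT s|lborel. norm (d n s)) \<longlonglongrightarrow> 0" by simp
  from tendsto_L1_AE_subseq[OF d_int this] obtain r where r: "strict_mono r"
    "AE s in lborel. (\<lambda>n. d (r n) s) \<longlonglongrightarrow> 0" by auto
  have "(\<lambda>n. LINT s|lborel. K s * z (t (r n) - s)) \<longlonglongrightarrow> (LINT s|lborel. K s * \<theta>)"
  proof (rule integral_dominated_convergence[where w = "\<lambda>s. \<bar>K s\<bar> * C"])
    show "AE s in lborel. (\<lambda>n. K s * z (t (r n) - s)) \<longlonglongrightarrow> K s * \<theta>"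
      \<comment> \<open>Dividing \<open>d\<close> by \<open>k s\<close> recovers \<open>z\<close>.
        The point 0 is dropped because \<open>k\<close> is known to be positive only for
        \<open>0 < s\<close>; at negative \<open>s\<close> the factor \<open>K s\<close> is
        0.\<close>
      using r(2) AE_lborel_singleton[of 0]
    proof eventually_elim
      case (elim s)
      show ?case
      proof (cases "s < 0")
        case False
        then have s: "0 < k s" using elim k(2)[of s] by auto
        have c2: "c * c = 1" using c by auto
        have "(\<lambda>n. \<theta> - c * (d (r n) s / k s)) \<longlonglongrightarrow> \<theta> - c * (0 / k s)"
          by (intro tendsto_intros elim) (use s in auto)
        also have "(\<lambda>n. \<theta> - c * (d (r n) s / k s)) = (\<lambda>n. z (t (r n) - s))"
          using s c2 unfolding d_def by (auto simp: mult.assoc[symmetric])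
        finally show ?thesis by (auto intro!: tendsto_intros)
      qed (simp add: K(2))
    qed
    show "AE s in lborel. norm (K s * z (t (r n) - s)) \<le> \<bar>K s\<bar> * C" for n
      using z_bd by (auto simp: abs_mult intro!: AE_I2 mult_left_mono)
  qed (use K(1) in auto)
  moreover have "(\<lambda>n. LINT s|lborel. K s * z (t (r n) - s)) \<longlonglongrightarrow> \<beta>"
    using LIMSEQ_subseq_LIMSEQ[OF filterlim_compose[OF lim t] r(1)] by (simp add: o_def)
  ultimately have "(LINT s|lborel. K s * \<theta>) = \<beta>" by (rule LIMSEQ_unique)
  then show ?thesis by (simp add: mult.commute)
qed

text \<open>The limit is the infimum of the eventual upper bounds, which is real because
  \<open>z\<close> is bounded. The times form a sequence since L1 convergence yields almost
  everywhere convergence only along subsequences. Applied to \<open>- z\<close> it handles the lower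
  limit.\<close>

lemma Limsup_sequence_at_top:
  fixes z :: "real \<Rightarrow> real"
  assumes "\<And>t. \<bar>z t\<bar> \<le> C"
  shows "\<exists>\<theta> t. (\<forall>d>0. eventually (\<lambda>u. z u \<le> \<theta> + d) at_top) \<and>
    filterlim t at_top sequentially \<and> (\<lambda>n. z (t n)) \<longlonglongrightarrow> \<theta>"
proof -
  define A where "A = {c. eventually (\<lambda>u. z u \<le> c) at_top}"
  define \<theta> where "\<theta> = Inf A"
  have zC: "z u \<le> C" "- C \<le> z u" for u using assms[of u] by auto
  have "C \<in> A" unfolding A_def using zC by simp
  have bdd: "bdd_below A"
  proof (rule bdd_belowI[of _ "-C"])
    fix c assume "c \<in> A"
    then have "eventually (\<lambda>u. z u \<le> c) at_top" by (simp add: A_def)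
    then obtain u where "z u \<le> c" by (auto simp: eventually_at_top_linorder)
    then show "- C \<le> c" using zC(2)[of u] by linarith
  qed
  have ub: "eventually (\<lambda>u. z u \<le> \<theta> + d) at_top" if d: "0 < d" for d
  proof -
    obtain c where c: "c \<in> A" "c < \<theta> + d"
      using cInf_lessD[of A "\<theta> + d"] \<open>C \<in> A\<close> d unfolding \<theta>_def by auto
    from c(1) have "eventually (\<lambda>u. z u \<le> c) at_top" by (simp add: A_def)
    then show ?thesis by eventually_elim (use c(2) in linarith)
  qed
  have "\<exists>u. real n \<le> u \<and> \<theta> - 1 / real (Suc n) \<le> z u" for n
  proof (rule ccontr)
    assume "\<not> ?thesis"
    then have "\<And>u. real n \<le> u \<Longrightarrow> z u \<le> \<theta> - 1 / real (Suc n)" by (meson linear)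
    then have "eventually (\<lambda>u. z u \<le> \<theta> - 1 / real (Suc n)) at_top"
      unfolding eventually_at_top_linorder by (intro exI[of _ "real n"]) blast
    then have "\<theta> - 1 / real (Suc n) \<in> A" by (simp add: A_def)
    then have "\<theta> \<le> \<theta> - 1 / real (Suc n)" unfolding \<theta>_def by (rule cInf_lower[OF _ bdd])
    then show False by simp
  qed
  then obtain t where t: "\<And>n. real n \<le> t n" "\<And>n. \<theta> - 1 / real (Suc n) \<le> z (t n)" by metis
  have t_top: "filterlim t at_top sequentially"
    by (rule filterlim_at_top_mono[OF filterlim_real_sequentially]) (use t(1) in auto)
  have "(\<lambda>n. z (t n)) \<longlonglongrightarrow> \<theta>"
  proof (rule tendstoI)
    fix e :: real assume e: "0 < e"
    have "eventually (\<lambda>n. z (t n) \<le> \<theta> + e / 2) sequentially"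
      using filterlim_iff[THEN iffD1, OF t_top, rule_format, OF ub[of "e/2"]] e by simp
    moreover have "eventually (\<lambda>n. 1 / real (Suc n) < e) sequentially"
      using order_tendstoD(2)[OF LIMSEQ_Suc[OF lim_1_over_n] e] by simp
    ultimately show "eventually (\<lambda>n. dist (z (t n)) \<theta> < e) sequentially"
    proof eventually_elim
      case (elim n)
      then show ?case using t(2)[of n] e unfolding dist_real_def by linarith
    qed
  qed
  then show ?thesis using ub t_top by blast
qed

text \<open>Upper and lower limit of \<open>z\<close> are both identified with the same number by
  \<open>renewal_limit_point\<close>, so \<open>z\<close> converges.\<close>

lemma renewal_limit:
  fixes k K z e :: "real \<Rightarrow> real" and C \<beta> :: real
  assumes k: "integrable lborel k" "\<And>s. 0 < s \<Longrightarrow> 0 < k s" "\<And>s. 0 \<le> k s" "(LINT s|lborel. k s) = 1"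
    and K: "integrable lborel K" "\<And>s. s < 0 \<Longrightarrow> K s = 0" "(LINT s|lborel. K s) \<noteq> 0"
    and z: "z \<in> borel_measurable borel" and z_bd: "\<And>t. \<bar>z t\<bar> \<le> C"
    and zeq: "\<And>t. 0 \<le> t \<Longrightarrow> z t = e t + (LINT s|lborel. k s * z (t - s))"
    and e: "(e \<longlongrightarrow> 0) at_top"
    and lim: "((\<lambda>t. LINT s|lborel. K s * z (t - s)) \<longlongrightarrow> \<beta>) at_top"
  shows "(z \<longlongrightarrow> \<beta> / (LINT s|lborel. K s)) at_top"
proof -
  obtain \<theta> t where 1: "\<And>d. 0 < d \<Longrightarrow> eventually (\<lambda>u. z u \<le> \<theta> + d) at_top"
    "filterlim t at_top sequentially" "(\<lambda>n. z (t n)) \<longlonglongrightarrow> \<theta>"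
    using Limsup_sequence_at_top[of z C, OF z_bd] by blast
  have z_bd': "\<bar>- z t\<bar> \<le> C" for t using z_bd by simp
  obtain \<kappa> t' where 2: "\<And>d. 0 < d \<Longrightarrow> eventually (\<lambda>u. - z u \<le> \<kappa> + d) at_top"
    "filterlim t' at_top sequentially" "(\<lambda>n. - z (t' n)) \<longlonglongrightarrow> \<kappa>"
    using Limsup_sequence_at_top[of "\<lambda>u. - z u" C, OF z_bd'] by blast
  have "\<theta> * (LINT s|lborel. K s) = \<beta>"
    by (rule renewal_limit_point[OF k K(1,2) z z_bd zeq e lim _ _ 1(2,3), where c=1]) (use 1(1) in auto)
  then have l: "\<theta> = \<beta> / (LINT s|lborel. K s)" using K(3) by (simp add: nonzero_eq_divide_eq)
  \<comment> \<open>\<open>\<kappa>\<close> is the upper limit of \<open>- z\<close>, so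
    \<open>- \<kappa>\<close> is the lower limit of \<open>z\<close>; the sign \<open>c = -1\<close>
    turns the bound for \<open>- z\<close> into the form of \<open>ub\<close>.\<close>
  have "(\<lambda>n. z (t' n)) \<longlonglongrightarrow> - \<kappa>" using tendsto_minus[OF 2(3)] by simp
  then have "- \<kappa> * (LINT s|lborel. K s) = \<beta>"
    by (intro renewal_limit_point[OF k K(1,2) z z_bd zeq e lim _ _ 2(2), where c="-1"]) (use 2(1) in auto)
  then have kap: "- \<kappa> = \<beta> / (LINT s|lborel. K s)" using K(3) by (simp add: nonzero_eq_divide_eq)
  show ?thesis
  proof (rule tendstoI)
    fix d :: real assume d: "0 < d"
    have h: "0 < d / 2" using d by simp
    from 1(1)[OF h] 2(1)[OF h] show "eventually (\<lambda>u. dist (z u) (\<beta> / (LINT s|lborel. K s)) < d) at_top"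
    proof eventually_elim
      case (elim u)
      then show ?case using l kap d unfolding dist_real_def by linarith
    qed
  qed
qed

text \<open>Used to refute a vanishing integral of a function that is positive on an
  interval.\<close>

lemma not_AE_interval:
  fixes a b :: real
  assumes "a < b" shows "\<not> (AE x in lborel. \<not> (a < x \<and> x < b))"
proof
  assume "AE x in lborel. \<not> (a < x \<and> x < b)"
  then have "AE x in lborel. x \<notin> {a<..<b}" by auto
  then have "emeasure lborel {a<..<b} = 0" by (subst (asm) AE_iff_measurable) auto
  then show False using assms by auto
qed

lemma nn_integral_lborel_shift:
  fixes f :: "real \<Rightarrow> ennreal"
  assumes [measurable]: "f \<in> borel_measurable borel"
  shows "(\<integral>\<^sup>+x. f (x + c) \<partial>lborel) = (\<integral>\<^sup>+x. f x \<partial>lborel)"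
  using nn_integral_real_affine[of f 1 c] by (simp add: add.commute)

lemma nn_integral_lborel_reflect:
  fixes f :: "real \<Rightarrow> ennreal"
  assumes [measurable]: "f \<in> borel_measurable borel"
  shows "(\<integral>\<^sup>+x. f (c - x) \<partial>lborel) = (\<integral>\<^sup>+x. f x \<partial>lborel)"
  using nn_integral_real_affine[of f "-1" c] by simp

lemma nn_integral_exp_Icc:
  fixes \<nu> t :: real assumes "0 < \<nu>" "0 \<le> t"
  shows "(\<integral>\<^sup>+r. ennreal (exp (- \<nu> * r)) * indicator {0..t} r \<partial>lborel) = ennreal ((1 - exp (- \<nu> * t)) / \<nu>)"
proof -
  have "(\<integral>\<^sup>+r. ennreal (exp (- \<nu> * r)) * indicator {0..t} r \<partial>lborel) =
    ennreal (- exp (- \<nu> * t) / \<nu> - (- exp (- \<nu> * 0) / \<nu>))"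
    using assms by (intro nn_integral_FTC_Icc) (auto intro!: derivative_eq_intros)
  then show ?thesis using assms by (simp add: field_simps)
qed

text \<open>Convolving the renewal equation with the tail of \<open>k\<close> (called \<open>Kb\<close> below) removes the unknown from the
  right-hand side: the result is the integral of the forcing term, which converges.\<close>

lemma renewal_exponential:
  fixes k z :: "real \<Rightarrow> real" and \<nu> :: real
  assumes k: "integrable lborel k" "\<And>s. 0 < s \<Longrightarrow> 0 < k s" "\<And>s. s \<le> 0 \<Longrightarrow> k s = 0" "(LINT s|lborel. k s) = 1"
    and k1: "integrable lborel (\<lambda>s. s * k s)"
    and \<nu>: "0 < \<nu>"
    and z [measurable]: "z \<in> borel_measurable borel" and z0: "\<And>t. 0 \<le> z t" "\<And>t. t < 0 \<Longrightarrow> z t = 0"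
    and mono: "\<And>s t. 0 \<le> s \<Longrightarrow> s \<le> t \<Longrightarrow> exp (\<nu> * s) * z s \<le> exp (\<nu> * t) * z t"
    and zeq: "\<And>t. 0 \<le> t \<Longrightarrow> ennreal (z t) = ennreal (exp (- \<nu> * t)) + (\<integral>\<^sup>+s. ennreal (k s * z (t - s)) \<partial>lborel)"
  shows "(\<exists>C. \<forall>t. z t \<le> C) \<and> (\<exists>c>0. (z \<longlongrightarrow> c) at_top)"
proof -
  have [measurable]: "k \<in> borel_measurable borel" using k(1) by auto
  have k0: "0 \<le> k s" for s using k(2)[of s] k(3)[of s] by (cases "0 < s") auto
  have k_tot: "(\<integral>\<^sup>+s. ennreal (k s) \<partial>lborel) = 1"
    using nn_integral_eq_integral[OF k(1)] k0 k(4) by simp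
  define H :: "real \<Rightarrow> ennreal" where "H u = (if 0 \<le> u then 1 else 0)" for u
  \<comment> \<open>The tail is taken first as an extended integral, so that Tonelli needs no
    integrability. Its real version \<open>Kb\<close> is cut off at 0, as is \<open>z\<close>, and
    convolutions can run over the whole line.\<close>
  define Ke where "Ke u = (\<integral>\<^sup>+s. ennreal (k s) * (if u < s then 1 else 0) \<partial>lborel)" for u
  define Kb where "Kb u = (if 0 \<le> u then enn2real (Ke u) else 0)" for u
  have Ke_meas [measurable]: "Ke \<in> borel_measurable borel"
    unfolding Ke_def by measurable
  have [measurable]: "Kb \<in> borel_measurable borel" "H \<in> borel_measurable borel"
    unfolding Kb_def H_def by measurable
  have Ke1: "Ke u \<le> 1" for u
    unfolding Ke_def by (subst k_tot[symmetric]) (intro nn_integral_mono, auto)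
  have KbE: "ennreal (Kb u) = H u * Ke u" for u
    using Ke1[of u] by (auto simp: Kb_def H_def less_top[symmetric] top_unique ennreal_enn2real_if)
  have Kb0: "0 \<le> Kb u" for u by (simp add: Kb_def)
  have Ke_pos: "0 < Ke u" if "0 \<le> u" for u
  proof (rule ccontr)
    assume "\<not> 0 < Ke u"
    then have "AE s in lborel. ennreal (k s) * (if u < s then 1 else 0) = 0"
      unfolding Ke_def by (subst (asm) not_gr_zero, subst (asm) nn_integral_0_iff_AE) auto
    then have "AE s in lborel. \<not> (u < s \<and> s < u + 1)"
    proof eventually_elim
      case (elim s)
      then show ?case using k(2)[of s] that by (auto simp: ennreal_eq_0_iff)
    qed
    then show False using not_AE_interval[of u "u+1"] by simp
  qed
  have Kb_pos: "0 < Kb u" if "0 \<le> u" for u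
    using Ke_pos[OF that] Ke1[of u] that by (auto simp: Kb_def enn2real_positive_iff less_top[symmetric] top_unique)
  \<comment> \<open>By Tonelli the total mass of the tail is the first moment of \<open>k\<close>,
    finite by \<open>k1\<close>.\<close>
  have "(\<integral>\<^sup>+u. ennreal (Kb u) \<partial>lborel) =
      (\<integral>\<^sup>+u. \<integral>\<^sup>+s. H u * (ennreal (k s) * (if u < s then 1 else 0)) \<partial>lborel \<partial>lborel)"
    unfolding KbE Ke_def by (subst nn_integral_cmult) auto
  also have "\<dots> = (\<integral>\<^sup>+s. \<integral>\<^sup>+u. H u * (ennreal (k s) * (if u < s then 1 else 0)) \<partial>lborel \<partial>lborel)"
    by (rule lborel_pair.Fubini') measurable
  also have "\<dots> = (\<integral>\<^sup>+s. ennreal (s * k s) \<partial>lborel)"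
  proof (rule nn_integral_cong)
    fix s :: real
    have "(\<integral>\<^sup>+u. H u * (ennreal (k s) * (if u < s then 1 else 0)) \<partial>lborel) =
       (\<integral>\<^sup>+u. ennreal (k s) * indicator {0..<s} u \<partial>lborel)"
      by (intro nn_integral_cong) (auto simp: H_def split: split_indicator)
    also have "\<dots> = ennreal (k s) * emeasure lborel {0..<s}" by (subst nn_integral_cmult_indicator) auto
    also have "\<dots> = ennreal (s * k s)" using k(3)[of s] k0[of s]
      by (cases "0 \<le> s") (auto simp: ennreal_mult mult.commute)
    finally show "(\<integral>\<^sup>+u. H u * (ennreal (k s) * (if u < s then 1 else 0)) \<partial>lborel) = ennreal (s * k s)" .
  qed
  also have "\<dots> < \<infinity>"
  proof -
    have "0 \<le> s * k s" for s using k(3)[of s] k0[of s] by (cases "0 \<le> s") auto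
    then show ?thesis using nn_integral_eq_integral[OF k1] by simp
  qed
  finally have Kb_int: "integrable lborel Kb"
    using Kb0 by (intro integrableI_bounded) auto
  \<comment> \<open>The convolution identity \<open>H * k + Kb = H\<close>: the mass 1 of
    \<open>k\<close> splits into the parts up to \<open>u\<close> and beyond
    \<open>u\<close>.\<close>
  have HK: "(\<integral>\<^sup>+s. H (u - s) * ennreal (k s) \<partial>lborel) + ennreal (Kb u) = H u" for u
  proof (cases "0 \<le> u")
    case True
    have "(\<integral>\<^sup>+s. H (u - s) * ennreal (k s) \<partial>lborel) + Ke u =
       (\<integral>\<^sup>+s. H (u - s) * ennreal (k s) + ennreal (k s) * (if u < s then 1 else 0) \<partial>lborel)"
      unfolding Ke_def by (subst nn_integral_add) auto
    also have "\<dots> = (\<integral>\<^sup>+s. ennreal (k s) \<partial>lborel)"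
      by (intro nn_integral_cong) (auto simp: H_def)
    finally show ?thesis unfolding KbE using True k_tot by (simp add: H_def)
  next
    case False
    have "(\<integral>\<^sup>+s. H (u - s) * ennreal (k s) \<partial>lborel) = (\<integral>\<^sup>+s. 0 \<partial>(lborel :: real measure))"
      by (intro nn_integral_cong) (use False k(3) in \<open>auto simp: H_def\<close>)
    then show ?thesis using False by (simp add: H_def Kb_def)
  qed
  have zall: "ennreal (z r) = H r * ennreal (exp (- \<nu> * r)) + (\<integral>\<^sup>+s. ennreal (k s) * ennreal (z (r - s)) \<partial>lborel)" for r
  proof (cases "0 \<le> r")
    case True
    then show ?thesis using zeq[OF True] k0 z0(1) by (simp add: H_def ennreal_mult)
  next
    case False
    have "(\<integral>\<^sup>+s. ennreal (k s) * ennreal (z (r - s)) \<partial>lborel) = (\<integral>\<^sup>+s. 0 \<partial>(lborel :: real measure))"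
    proof (intro nn_integral_cong)
      fix s show "ennreal (k s) * ennreal (z (r - s)) = 0"
        using False k(3)[of s] z0(2)[of "r - s"] by (cases "s \<le> 0") auto
    qed
    then show ?thesis using False z0(2)[of r] by (simp add: H_def)
  qed
  \<comment> \<open>The convolution \<open>I\<close> of \<open>z\<close> with \<open>H\<close> is
    computed twice. Inserting the renewal equation for \<open>z\<close> gives the integrated forcing
    term plus \<open>J\<close>; inserting \<open>HK\<close> for \<open>H\<close> gives
    \<open>J\<close> plus the convolution of \<open>z\<close> with \<open>Kb\<close>. Cancelling
    \<open>J\<close> leaves the claim.\<close>
  have conv: "(\<integral>\<^sup>+s. ennreal (Kb s * z (t - s)) \<partial>lborel) = ennreal ((1 - exp (- \<nu> * t)) / \<nu>)" if t: "0 \<le> t" for t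
  proof -
    define I where "I = (\<integral>\<^sup>+r. ennreal (z r) * H (t - r) \<partial>lborel)"
    define J where "J = (\<integral>\<^sup>+r. ennreal (z r) * (\<integral>\<^sup>+s. H (t - r - s) * ennreal (k s) \<partial>lborel) \<partial>lborel)"
    \<comment> \<open>Only the finiteness of \<open>I\<close> is wanted, since it makes
      \<open>J\<close> finite and hence cancellable.\<close>
    have "I \<le> (\<integral>\<^sup>+r. ennreal (exp (\<nu> * t) * z t) * indicator {0..t} r \<partial>lborel)"
      unfolding I_def
    proof (rule nn_integral_mono)
      fix r
      show "ennreal (z r) * H (t - r) \<le> ennreal (exp (\<nu> * t) * z t) * indicator {0..t} r"
      proof (cases "0 \<le> r \<and> r \<le> t")
        case True
        have "1 * z r \<le> exp (\<nu> * r) * z r" using True \<nu> z0(1) by (intro mult_right_mono) auto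
        also have "\<dots> \<le> exp (\<nu> * t) * z t" using mono True by auto
        finally show ?thesis using True by (auto simp: H_def intro!: ennreal_leI)
      qed (use z0(2)[of r] in \<open>auto simp: H_def\<close>)
    qed
    also have "\<dots> < \<infinity>" using t by (subst nn_integral_cmult_indicator) (auto simp: ennreal_mult_less_top)
    finally have I_fin: "I < \<infinity>" .
    have "I = (\<integral>\<^sup>+r. H r * ennreal (exp (- \<nu> * r)) * H (t - r) +
        (\<integral>\<^sup>+s. ennreal (k s) * ennreal (z (r - s)) * H (t - r) \<partial>lborel) \<partial>lborel)"
      unfolding I_def by (subst zall) (auto simp: distrib_right nn_integral_multc intro!: nn_integral_cong)
    also have "\<dots> = (\<integral>\<^sup>+r. H r * ennreal (exp (- \<nu> * r)) * H (t - r) \<partial>lborel) +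
        (\<integral>\<^sup>+r. \<integral>\<^sup>+s. ennreal (k s) * ennreal (z (r - s)) * H (t - r) \<partial>lborel \<partial>lborel)"
      by (subst nn_integral_add) auto
    also have "(\<integral>\<^sup>+r. \<integral>\<^sup>+s. ennreal (k s) * ennreal (z (r - s)) * H (t - r) \<partial>lborel \<partial>lborel) =
        (\<integral>\<^sup>+s. \<integral>\<^sup>+r. ennreal (k s) * ennreal (z (r - s)) * H (t - r) \<partial>lborel \<partial>lborel)"
      by (rule lborel_pair.Fubini') measurable
    also have "\<dots> = (\<integral>\<^sup>+s. \<integral>\<^sup>+r. ennreal (k s) * ennreal (z r) * H (t - r - s) \<partial>lborel \<partial>lborel)"
    proof (rule nn_integral_cong)
      fix s
      have "(\<integral>\<^sup>+r. ennreal (k s) * ennreal (z (r - s)) * H (t - r) \<partial>lborel) =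
         (\<integral>\<^sup>+r. ennreal (k s) * ennreal (z ((r + s) - s)) * H (t - (r + s)) \<partial>lborel)"
        by (rule nn_integral_lborel_shift[symmetric, of "\<lambda>r. ennreal (k s) * ennreal (z (r - s)) * H (t - r)"]) auto
      then show "(\<integral>\<^sup>+r. ennreal (k s) * ennreal (z (r - s)) * H (t - r) \<partial>lborel) =
         (\<integral>\<^sup>+r. ennreal (k s) * ennreal (z r) * H (t - r - s) \<partial>lborel)"
        by (simp add: algebra_simps)
    qed
    also have "\<dots> = (\<integral>\<^sup>+r. \<integral>\<^sup>+s. ennreal (k s) * ennreal (z r) * H (t - r - s) \<partial>lborel \<partial>lborel)"
      by (rule lborel_pair.Fubini') measurable
    also have "\<dots> = J"
      unfolding J_def by (intro nn_integral_cong) (subst nn_integral_cmult[symmetric], auto simp: ac_simps)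
    also have "(\<integral>\<^sup>+r. H r * ennreal (exp (- \<nu> * r)) * H (t - r) \<partial>lborel) =
        (\<integral>\<^sup>+r. ennreal (exp (- \<nu> * r)) * indicator {0..t} r \<partial>lborel)"
      by (intro nn_integral_cong) (auto simp: H_def split: split_indicator)
    also have "\<dots> = ennreal ((1 - exp (- \<nu> * t)) / \<nu>)" by (rule nn_integral_exp_Icc[OF \<nu> t])
    finally have 1: "I = ennreal ((1 - exp (- \<nu> * t)) / \<nu>) + J" .
    have "I = (\<integral>\<^sup>+r. ennreal (z r) * (\<integral>\<^sup>+s. H (t - r - s) * ennreal (k s) \<partial>lborel) + ennreal (z r) * ennreal (Kb (t - r)) \<partial>lborel)"
      unfolding I_def
    proof (rule nn_integral_cong)
      fix r
      show "ennreal (z r) * H (t - r) = ennreal (z r) * (\<integral>\<^sup>+s. H (t - r - s) * ennreal (k s) \<partial>lborel) + ennreal (z r) * ennreal (Kb (t - r))"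
        using arg_cong[OF HK[of "t - r"], of "\<lambda>h. ennreal (z r) * h"] by (simp add: distrib_left)
    qed
    also have "\<dots> = J + (\<integral>\<^sup>+r. ennreal (z r) * ennreal (Kb (t - r)) \<partial>lborel)"
      unfolding J_def by (subst nn_integral_add) auto
    finally have 2: "I = J + (\<integral>\<^sup>+r. ennreal (z r) * ennreal (Kb (t - r)) \<partial>lborel)" .
    have "J \<noteq> \<infinity>" using 1 I_fin by auto
    then have "(\<integral>\<^sup>+r. ennreal (z r) * ennreal (Kb (t - r)) \<partial>lborel) = ennreal ((1 - exp (- \<nu> * t)) / \<nu>)"
      using 1 2 by (metis ennreal_add_left_cancel add.commute infinity_ennreal_def)
    moreover have "(\<integral>\<^sup>+s. ennreal (Kb s * z (t - s)) \<partial>lborel) = (\<integral>\<^sup>+r. ennreal (z r) * ennreal (Kb (t - r)) \<partial>lborel)"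
      using nn_integral_lborel_reflect[of "\<lambda>s. ennreal (Kb s * z (t - s))" t] Kb0 z0(1)
      by (simp add: ennreal_mult mult.commute)
    ultimately show ?thesis by simp
  qed
  define c0 where "c0 = (LINT s|lborel. indicator {0..1} s * Kb s)"
  have c0_int: "integrable lborel (\<lambda>s. indicator {0..1} s * Kb s)"
    by (rule Bochner_Integration.integrable_bound[OF Kb_int]) (auto split: split_indicator)
  have c0: "0 < c0"
  proof -
    have "0 \<le> c0" unfolding c0_def using Kb0 by (intro Bochner_Integration.integral_nonneg) auto
    moreover have "c0 \<noteq> 0"
    proof
      assume "c0 = 0"
      then have "AE s in lborel. indicator {0..1} s * Kb s = 0"
        unfolding c0_def using Kb0 by (subst (asm) integral_nonneg_eq_0_iff_AE[OF c0_int]) auto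
      then have "AE s::real in lborel. \<not> (0 < s \<and> s < 1)"
      proof eventually_elim
        case (elim s)
        then show ?case using Kb_pos[of s] by (auto split: split_indicator_asm)
      qed
      then show False using not_AE_interval[of 0 1] by simp
    qed
    ultimately show ?thesis by simp
  qed
  \<comment> \<open>For \<open>s\<close> in \<open>{0..1}\<close>, \<open>mono\<close> gives
    \<open>exp (- \<nu>) * z t \<le> z (t + 1 - s)\<close>, so the integral in \<open>conv\<close>
    at time \<open>t + 1\<close> is at least \<open>exp (- \<nu>) * z t * c0\<close>, while its
    value is at most \<open>1 / \<nu>\<close>.\<close>
  define C where "C = exp \<nu> / (\<nu> * c0)"
  have C: "z t \<le> C" for t
  proof (cases "0 \<le> t")
    case False
    then show ?thesis using z0(2)[of t] \<nu> c0 by (auto simp: C_def)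
  next
    case True
    have "ennreal (exp (- \<nu>) * z t * c0) = (\<integral>\<^sup>+s. ennreal (exp (- \<nu>) * z t * (indicator {0..1} s * Kb s)) \<partial>lborel)"
      using c0_int Kb0 z0(1) by (subst nn_integral_eq_integral) (auto simp: c0_def)
    also have "\<dots> \<le> (\<integral>\<^sup>+s. ennreal (Kb s * z (t + 1 - s)) \<partial>lborel)"
    proof (rule nn_integral_mono, rule ennreal_leI)
      fix s
      show "exp (- \<nu>) * z t * (indicator {0..1} s * Kb s) \<le> Kb s * z (t + 1 - s)"
      proof (cases "s \<in> {0..1}")
        case s: True
        have "exp (\<nu> * t) * z t \<le> exp (\<nu> * (t + 1 - s)) * z (t + 1 - s)"
          using True s by (intro mono) auto
        also have "\<dots> \<le> exp (\<nu> * (t + 1)) * z (t + 1 - s)"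
          using s \<nu> z0(1) by (intro mult_right_mono) auto
        finally have "exp (- (\<nu> * (t + 1))) * (exp (\<nu> * t) * z t) \<le> exp (- (\<nu> * (t + 1))) * (exp (\<nu> * (t + 1)) * z (t + 1 - s))"
          by (intro mult_left_mono) auto
        then have "exp (- \<nu>) * z t \<le> z (t + 1 - s)"
          by (simp add: mult.assoc[symmetric] exp_add[symmetric] algebra_simps)
        then have "Kb s * (exp (- \<nu>) * z t) \<le> Kb s * z (t + 1 - s)" using Kb0 by (rule mult_left_mono)
        then show ?thesis using s by (simp add: ac_simps)
      qed (use Kb0 z0 in auto)
    qed
    also have "\<dots> = ennreal ((1 - exp (- \<nu> * (t + 1))) / \<nu>)" using True by (intro conv) auto
    finally have "exp (- \<nu>) * z t * c0 \<le> (1 - exp (- \<nu> * (t + 1))) / \<nu>"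
      using True \<nu> by (subst (asm) ennreal_le_iff) auto
    also have "\<dots> \<le> 1 / \<nu>" using \<nu> by (intro divide_right_mono) auto
    finally have "exp \<nu> * (exp (- \<nu>) * z t * c0) \<le> exp \<nu> * (1 / \<nu>)" by (intro mult_left_mono) auto
    then have "z t * c0 \<le> exp \<nu> / \<nu>" by (simp add: mult.assoc[symmetric] exp_add[symmetric])
    then show ?thesis using c0 \<nu> by (simp add: C_def field_simps)
  qed
  have z_bd: "\<bar>z t\<bar> \<le> C" for t using C[of t] z0(1)[of t] by simp
  have m: "(LINT s|lborel. Kb s) \<noteq> 0" "0 \<le> (LINT s|lborel. Kb s)"
  proof -
    have "c0 \<le> (LINT s|lborel. Kb s)" unfolding c0_def
      by (intro Bochner_Integration.integral_mono c0_int Kb_int) (use Kb0 in \<open>auto split: split_indicator\<close>)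
    then show "(LINT s|lborel. Kb s) \<noteq> 0" "0 \<le> (LINT s|lborel. Kb s)" using c0 by auto
  qed
  have "(z \<longlongrightarrow> (1 / \<nu>) / (LINT s|lborel. Kb s)) at_top"
  proof (rule renewal_limit[OF k(1,2) k0 k(4) Kb_int _ m(1) z z_bd])
    show "Kb s = 0" if "s < 0" for s using that by (simp add: Kb_def)
    show "z t = exp (- \<nu> * t) + (LINT s|lborel. k s * z (t - s))" if "0 \<le> t" for t
    proof -
      have "z t = enn2real (ennreal (exp (- \<nu> * t)) + (\<integral>\<^sup>+s. ennreal (k s * z (t - s)) \<partial>lborel))"
        using zeq[OF that] z0(1)[of t] by (metis enn2real_ennreal)
      also have "\<dots> = exp (- \<nu> * t) + enn2real (\<integral>\<^sup>+s. ennreal (k s * z (t - s)) \<partial>lborel)"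
      proof (subst enn2real_plus)
        have "(\<integral>\<^sup>+s. ennreal (k s * z (t - s)) \<partial>lborel) \<le> ennreal (z t)" using zeq[OF that] by simp
        then show "(\<integral>\<^sup>+s. ennreal (k s * z (t - s)) \<partial>lborel) < top" using le_less_trans ennreal_less_top by blast
      qed auto
      also have "enn2real (\<integral>\<^sup>+s. ennreal (k s * z (t - s)) \<partial>lborel) = (LINT s|lborel. k s * z (t - s))"
        using k0 z0(1) by (subst integral_eq_nn_integral) auto
      finally show ?thesis .
    qed
    have tend: "((\<lambda>t. exp (- \<nu> * t)) \<longlongrightarrow> 0) at_top"
      by (rule filterlim_compose[OF exp_at_bot], rule filterlim_tendsto_neg_mult_at_bot[OF tendsto_const _ filterlim_ident])
        (use \<nu> in auto)
    then show "((\<lambda>t. exp (- \<nu> * t)) \<longlongrightarrow> 0) at_top" .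
    have "eventually (\<lambda>t. (1 - exp (- \<nu> * t)) / \<nu> = (LINT s|lborel. Kb s * z (t - s))) at_top"
      using eventually_ge_at_top[of 0]
    proof eventually_elim
      case (elim t)
      have "(LINT s|lborel. Kb s * z (t - s)) = enn2real (\<integral>\<^sup>+s. ennreal (Kb s * z (t - s)) \<partial>lborel)"
        using Kb0 z0(1) by (subst integral_eq_nn_integral) auto
      then show ?case using conv[OF elim] \<nu> elim by simp
    qed
    moreover have "((\<lambda>t. (1 - exp (- \<nu> * t)) / \<nu>) \<longlongrightarrow> (1 - 0) / \<nu>) at_top"
      by (intro tendsto_intros tend) (use \<nu> in auto)
    ultimately show "((\<lambda>t. LINT s|lborel. Kb s * z (t - s)) \<longlongrightarrow> 1 / \<nu>) at_top"
      by (auto dest: Lim_transform_eventually)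
  qed
  moreover have "0 < (1 / \<nu>) / (LINT s|lborel. Kb s)" using m \<nu> by (auto simp: order_less_le)
  ultimately show ?thesis using C by blast
qed

section \<open>Densities from integrable characteristic functions\<close>

text \<open>The Fourier inversion integral of a real characteristic function, reduced to its real
  part.\<close>

definition cos_transform :: "(real \<Rightarrow> real) \<Rightarrow> real \<Rightarrow> real" where
  "cos_transform \<phi> v = (LINT q|lborel. cos (q * v) * \<phi> q) / (2 * pi)"

lemma cos_transform_abs_le:
  assumes "integrable lborel \<phi>"
  shows "\<bar>cos_transform \<phi> v\<bar> \<le> (LINT q|lborel. \<bar>\<phi> q\<bar>) / (2 * pi)"
proof -
  have "\<bar>LINT q|lborel. cos (q * v) * \<phi> q\<bar> \<le> (LINT q|lborel. \<bar>cos (q * v) * \<phi> q\<bar>)"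
    by (rule integral_abs_bound)
  also have "\<dots> \<le> (LINT q|lborel. \<bar>\<phi> q\<bar>)"
    using assms by (intro integral_mono_AE') (auto simp: abs_mult intro!: AE_I2 mult_left_le_one_le)
  finally show ?thesis by (simp add: cos_transform_def abs_mult divide_right_mono)
qed

lemma continuous_cos_transform:
  assumes \<phi>: "integrable lborel \<phi>"
  shows "continuous_on UNIV (cos_transform \<phi>)"
proof -
  have "cos_transform \<phi> \<midarrow>x\<rightarrow> cos_transform \<phi> x" for x
    unfolding cos_transform_def tendsto_at_iff_sequentially comp_def
  proof (intro allI impI tendsto_intros)
    fix X :: "nat \<Rightarrow> real" assume X: "X \<longlonglongrightarrow> x"
    show "(\<lambda>n. LINT q|lborel. cos (q * X n) * \<phi> q) \<longlonglongrightarrow> (LINT q|lborel. cos (q * x) * \<phi> q)"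
      by (rule integral_dominated_convergence[where w="\<lambda>q. \<bar>\<phi> q\<bar>"])
        (use \<phi> X in \<open>auto simp: abs_mult intro!: tendsto_intros AE_I2 mult_left_le_one_le\<close>)
  qed simp
  then show ?thesis by (auto simp: continuous_on_eq_continuous_at isCont_def)
qed

text \<open>Writes the kernel of Levy's inversion formula as an integral over the interval, so that
  Fubini can bring the density to the outside.\<close>

lemma iexp_diff_quotient_eq_integral:
  fixes a b q :: real
  assumes "a \<le> b" "q \<noteq> 0"
  shows "(CLINT u|lborel. indicator {a..b} u *\<^sub>R iexp (- (q * u))) = (iexp (- (q * a)) - iexp (- (q * b))) / (\<i> * q)"
proof -
  let ?F = "\<lambda>u. iexp (- (q * u)) / (- \<i> * q)"
  have "(CLINT u|lborel. indicator {a..b} u *\<^sub>R iexp (- (q * u))) = ?F b - ?F a"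
  proof (rule integral_FTC_Icc[OF assms(1)])
    show "(?F has_vector_derivative iexp (- (q * u))) (at u within {a..b})" for u
    proof -
      have "((\<lambda>z. exp (\<i> * (- (of_real q * z))) / (- \<i> * q)) has_field_derivative iexp (- (q * u))) (at (of_real u))"
        using assms(2) by (auto intro!: derivative_eq_intros) (simp add: complex_eq_iff)
      from has_vector_derivative_real_field[OF this] show ?thesis by simp
    qed
    show "continuous_on {a..b} (\<lambda>u. iexp (- (q * u)))" by (intro continuous_intros)
  qed
  then show ?thesis using assms(2) by (simp add: field_simps)
qed

locale integrable_real_char = real_distribution M for M :: "real measure" +
  fixes \<phi> :: "real \<Rightarrow> real"
  assumes char_eq: "\<And>q. char M q = of_real (\<phi> q)"
    and \<phi>_int: "integrable lborel \<phi>"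
begin

abbreviation g where "g \<equiv> cos_transform \<phi>"

lemma g_meas [measurable]: "g \<in> borel_measurable borel"
  by (rule borel_measurable_continuous_onI[OF continuous_cos_transform[OF \<phi>_int]])

text \<open>Levy's inversion formula with an integrable integrand: the difference quotient is at
  most \<open>b - a\<close> in modulus, so the truncated integrals converge by dominated
  convergence. The endpoints must be free of atoms because the inversion formula asks for
  it.\<close>

lemma prob_Ioc_atoms:
  assumes ab: "a \<le> b" and atoms: "prob {a} = 0" "prob {b} = 0"
  shows "prob {a<..b} = (LINT u|lborel. indicator {a..b} u * g u)"
proof -
  define F where "F q = (iexp (- (q * a)) - iexp (- (q * b))) / (\<i> * q) * of_real (\<phi> q)" for q
  have [measurable]: "\<phi> \<in> borel_measurable borel" using \<phi>_int by auto
  have [measurable]: "F \<in> borel_measurable borel" unfolding F_def by measurable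
  have F_bd: "cmod (F q) \<le> (b - a) * \<bar>\<phi> q\<bar>" for q
  proof (cases "q = 0")
    case False
    then have "cmod ((iexp (- q * a) - iexp (- q * b)) / (\<i> * (- q))) \<le> b - a"
      using Levy_Inversion_aux2[of a b "- q"] ab by (auto simp: norm_minus_commute norm_divide)
    then have "cmod ((iexp (- (q * a)) - iexp (- (q * b))) / (\<i> * q)) \<le> b - a"
      by (simp add: norm_divide norm_mult)
    then show ?thesis unfolding F_def norm_mult by (auto intro!: mult_right_mono)
  qed (use ab in \<open>auto simp: F_def\<close>)
  have dom: "integrable lborel (\<lambda>q. (b - a) * \<bar>\<phi> q\<bar>)" using \<phi>_int by auto
  have F_int: "integrable lborel F"
    by (rule Bochner_Integration.integrable_bound[OF dom]) (use F_bd ab in auto)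
  have \<phi>u_int: "integrable lborel (\<lambda>q. iexp (- (q * u)) * of_real (\<phi> q))" for u
    by (rule Bochner_Integration.integrable_bound[OF \<phi>_int]) (auto simp: norm_mult)
  have G_int: "integrable (lborel \<Otimes>\<^sub>M lborel) (\<lambda>(u, q). indicator {a..b} u *\<^sub>R (iexp (- (q * u)) * of_real (\<phi> q)))"
  proof (rule lborel_pair.Fubini_integrable)
    have "integrable lborel (\<lambda>u. indicator {a..b} u *\<^sub>R (LINT q|lborel. \<bar>\<phi> q\<bar>))"
      by (simp add: integrable_indicator_iff emeasure_lborel_Icc_eq)
    then show "integrable lborel (\<lambda>u. LINT q|lborel. norm (case (u, q) of (u, q) \<Rightarrow> indicator {a..b} u *\<^sub>R (iexp (- (q * u)) * of_real (\<phi> q))))"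
      by (simp add: norm_mult)
    show "AE u in lborel. integrable lborel (\<lambda>q. case (u, q) of (u, q) \<Rightarrow> indicator {a..b} u *\<^sub>R (iexp (- (q * u)) * of_real (\<phi> q)))"
      using \<phi>u_int by auto
  qed measurable
  have "(\<lambda>T::nat. CLBINT q=-real T..real T. F q) \<longlonglongrightarrow> (CLINT q|lborel. F q)"
  proof -
    have "(\<lambda>T::nat. CLINT q|lborel. indicator {-real T<..<real T} q *\<^sub>R F q) \<longlonglongrightarrow> (CLINT q|lborel. F q)"
    proof (rule integral_dominated_convergence[OF _ _ dom])
      show "AE q in lborel. (\<lambda>T. indicator {- real T<..<real T} q *\<^sub>R F q) \<longlonglongrightarrow> F q"
      proof (rule AE_I2)
        fix q :: real
        obtain n :: nat where n: "\<bar>q\<bar> < real n" using reals_Archimedean2 by blast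
        have "eventually (\<lambda>T. indicator {- real T<..<real T} q *\<^sub>R F q = F q) sequentially"
          using eventually_ge_at_top[of n] by eventually_elim (use n in \<open>auto simp: abs_less_iff\<close>)
        then show "(\<lambda>T. indicator {- real T<..<real T} q *\<^sub>R F q) \<longlonglongrightarrow> F q"
          by (simp add: tendsto_eventually)
      qed
      show "AE q in lborel. cmod (indicator {- real T<..<real T} q *\<^sub>R F q) \<le> (b - a) * \<bar>\<phi> q\<bar>" for T
        using F_bd ab by (auto split: split_indicator)
    qed auto
    then show ?thesis
      by (simp add: interval_lebesgue_integral_def set_lebesgue_integral_def)
  qed
  then have "(\<lambda>T::nat. 1 / (2 * pi) * (CLBINT q=-real T..real T. F q)) \<longlonglongrightarrow> 1 / (2 * pi) * (CLINT q|lborel. F q)"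
    by (intro tendsto_intros)
  moreover have "(\<lambda>T::nat. 1 / (2 * pi) * (CLBINT q=-real T..real T. F q)) \<longlonglongrightarrow> prob {a<..b}"
    using Levy_Inversion[OF ab atoms] unfolding char_eq F_def by simp
  ultimately have "of_real (prob {a<..b}) = 1 / (2 * pi) * (CLINT q|lborel. F q)"
    by (rule LIMSEQ_unique[symmetric])
  also have "(CLINT q|lborel. F q) = (CLINT q|lborel. CLINT u|lborel. indicator {a..b} u *\<^sub>R (iexp (- (q * u)) * of_real (\<phi> q)))"
  proof (rule integral_cong_AE)
    show "AE q in lborel. F q = (CLINT u|lborel. indicator {a..b} u *\<^sub>R (iexp (- (q * u)) * of_real (\<phi> q)))"
      using AE_lborel_singleton[of 0]
    proof eventually_elim
      case (elim q)
      have "(CLINT u|lborel. indicator {a..b} u *\<^sub>R (iexp (- (q * u)) * of_real (\<phi> q))) =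
        (CLINT u|lborel. (indicator {a..b} u *\<^sub>R iexp (- (q * u))) * of_real (\<phi> q))" by simp
      also have "\<dots> = (CLINT u|lborel. indicator {a..b} u *\<^sub>R iexp (- (q * u))) * of_real (\<phi> q)"
        by (rule integral_mult_left_zero)
      finally show ?case unfolding iexp_diff_quotient_eq_integral[OF ab elim] F_def by simp
    qed
  qed measurable
  also have "\<dots> = (CLINT u|lborel. CLINT q|lborel. indicator {a..b} u *\<^sub>R (iexp (- (q * u)) * of_real (\<phi> q)))"
  proof (rule lborel_pair.Fubini_integral)
    show "integrable (lborel \<Otimes>\<^sub>M lborel) (\<lambda>(u, q). indicator {a..b} u *\<^sub>R (iexp (- (q * u)) * of_real (\<phi> q)))"
      by (rule G_int)
  qed
  finally have "prob {a<..b} = Re (1 / (2 * pi) * (CLINT u|lborel. CLINT q|lborel. indicator {a..b} u *\<^sub>R (iexp (- (q * u)) * of_real (\<phi> q))))"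
    by (metis Re_complex_of_real)
  also have "\<dots> = 1 / (2 * pi) * Re (CLINT u|lborel. CLINT q|lborel. indicator {a..b} u *\<^sub>R (iexp (- (q * u)) * of_real (\<phi> q)))"
    by (simp add: Re_divide_of_real)
  also have "Re (CLINT u|lborel. CLINT q|lborel. indicator {a..b} u *\<^sub>R (iexp (- (q * u)) * of_real (\<phi> q))) =
      (LINT u|lborel. Re (CLINT q|lborel. indicator {a..b} u *\<^sub>R (iexp (- (q * u)) * of_real (\<phi> q))))"
    using lborel_pair.integrable_fst[OF G_int] by (rule integral_Re[symmetric])
  also have "\<dots> = (LINT u|lborel. 2 * pi * (indicator {a..b} u * g u))"
  proof (rule Bochner_Integration.integral_cong[OF refl])
    fix u
    have "Re (CLINT q|lborel. indicator {a..b} u *\<^sub>R (iexp (- (q * u)) * of_real (\<phi> q))) =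
        indicator {a..b} u * Re (CLINT q|lborel. iexp (- (q * u)) * of_real (\<phi> q))"
      by (subst integral_scaleR_right) simp
    also have "Re (CLINT q|lborel. iexp (- (q * u)) * of_real (\<phi> q)) = (LINT q|lborel. Re (iexp (- (q * u)) * of_real (\<phi> q)))"
      by (rule integral_Re[OF \<phi>u_int, symmetric])
    also have "\<dots> = 2 * pi * g u"
      by (simp add: cos_transform_def Re_exp)
    finally show "Re (CLINT q|lborel. indicator {a..b} u *\<^sub>R (iexp (- (q * u)) * of_real (\<phi> q))) = 2 * pi * (indicator {a..b} u * g u)"
      by (simp only: mult.left_commute)
  qed
  finally show ?thesis by simp
qed


text \<open>There are only countably many atoms, so \<open>a\<close> can be enclosed between two
  points of mass 0 as closely as desired, and the inversion formula bounds the mass in between by a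
  constant times the length.\<close>

lemma prob_singleton: "prob {a} = 0"
proof -
  define C where "C = (LINT q|lborel. \<bar>\<phi> q\<bar>) / (2 * pi)"
  have gC: "\<bar>g u\<bar> \<le> C" for u unfolding C_def by (rule cos_transform_abs_le[OF \<phi>_int])
  have C0: "0 \<le> C" using gC[of 0] by linarith
  have ex: "\<exists>u. c < u \<and> u < d \<and> prob {u} = 0" if "c < d" for c d
  proof -
    have "uncountable ({c<..<d} - {x. 0 < prob {x}})"
      using that countable_atoms by (intro uncountable_minus_countable) (auto simp: uncountable_open_interval)
    then have "{c<..<d} - {x. 0 < prob {x}} \<noteq> {}" by (metis countable_empty)
    then show ?thesis using measure_nonneg[of M] by (auto simp: not_less order_antisym)
  qed
  have "prob {a} \<le> 0 + e" if e: "0 < e" for e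
  proof -
    \<comment> \<open>The enclosing interval is shorter than \<open>2 * d\<close>, so its mass is at
      most \<open>2 * d * C\<close>, which is at most \<open>e\<close>. The \<open>+ 1\<close>
      covers \<open>C = 0\<close>.\<close>
    define d where "d = e / (2 * (C + 1))"
    have d: "0 < d" using e C0 by (auto simp: d_def)
    obtain u v where u: "a - d < u" "u < a" "prob {u} = 0" and v: "a < v" "v < a + d" "prob {v} = 0"
      using ex[of "a - d" a] ex[of a "a + d"] d by auto
    have "prob {a} \<le> prob {u<..v}" using u v by (intro finite_measure_mono) auto
    also have "\<dots> = (LINT y|lborel. indicator {u..v} y * g y)"
      using u v by (intro prob_Ioc_atoms) auto
    also have "\<dots> \<le> (LINT y|lborel. indicator {u..v} y * C)"
    proof (rule integral_mono_AE')
      show "AE y in lborel. indicator {u..v} y * g y \<le> indicator {u..v} y * C"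
        using gC by (auto simp: abs_le_iff split: split_indicator)
    qed (use C0 u v in auto)
    also have "\<dots> = (v - u) * C" using u v by simp
    also have "\<dots> \<le> (2 * d) * C" using u v C0 by (intro mult_right_mono) auto
    also have "\<dots> = e * (C / (C + 1))" using C0 by (simp add: d_def divide_simps)
    also have "\<dots> \<le> e * 1" using e C0 by (intro mult_left_mono) auto
    finally show ?thesis by simp
  qed
  then have "prob {a} \<le> 0" by (rule field_le_epsilon)
  then show ?thesis by (simp add: measure_le_0_iff)
qed

lemma prob_Ioc: "a \<le> b \<Longrightarrow> prob {a<..b} = (LINT u|lborel. indicator {a..b} u * g u)"
  by (intro prob_Ioc_atoms prob_singleton)

text \<open>By continuity a negative value would persist on an interval, whose probability would
  then be negative.\<close>

lemma g_nonneg: "0 \<le> g v"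
proof (rule ccontr)
  assume "\<not> 0 \<le> g v"
  then have neg: "g v < g v / 2" by simp
  have "isCont g v" using continuous_cos_transform[OF \<phi>_int] by (simp add: continuous_on_eq_continuous_at)
  then have "(g \<longlongrightarrow> g v) (nhds v)" by (simp add: isCont_def tendsto_nhds_iff)
  from order_tendstoD(2)[OF this neg] have "eventually (\<lambda>u. g u < g v / 2) (nhds v)" .
  then obtain d where d: "0 < d" "\<And>u. dist u v < d \<Longrightarrow> g u < g v / 2"
    by (auto simp: eventually_nhds_metric)
  have "prob {v<..v + d / 2} = (LINT u|lborel. indicator {v..v + d / 2} u * g u)"
    using d by (intro prob_Ioc) auto
  also have "\<dots> \<le> (LINT u|lborel. indicator {v..v + d / 2} u * (g v / 2))"
  proof (rule Bochner_Integration.integral_mono)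
    show "integrable lborel (\<lambda>u. indicat_real {v..v + d / 2} u * g u)"
      using borel_integrable_compact[of "{v..v + d / 2}" g] continuous_cos_transform[OF \<phi>_int]
      by (auto intro: continuous_on_subset)
    show "indicator {v..v + d / 2} u * g u \<le> indicator {v..v + d / 2} u * (g v / 2)" for u
      using d(1) d(2)[of u] by (auto simp: dist_real_def abs_less_iff split: split_indicator)
  qed (use d in auto)
  also have "\<dots> = d / 2 * (g v / 2)" using d by simp
  also have "\<dots> < 0" using d \<open>\<not> 0 \<le> g v\<close> by (intro mult_pos_neg) auto
  finally show False using measure_nonneg[of M "{v<..v + d / 2}"] by linarith
qed

lemma g_le: "g v \<le> g 0" if "\<And>q. 0 \<le> \<phi> q" for v
proof -
  have "\<bar>g v\<bar> \<le> (LINT q|lborel. \<bar>\<phi> q\<bar>) / (2 * pi)" by (rule cos_transform_abs_le[OF \<phi>_int])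
  also have "\<dots> = g 0" using that by (simp add: cos_transform_def)
  finally show ?thesis by simp
qed

text \<open>The inversion formula speaks of bounded half-open intervals; half-lines, which determine
  a measure on the line, are their increasing unions.\<close>

lemma density_eq: "M = density lborel (\<lambda>v. ennreal (g v))"
proof -
  let ?D = "density lborel (\<lambda>v. ennreal (g v))"
  have Ioc: "emeasure M {a<..b} = emeasure ?D {a<..b}" if "a \<le> b" for a b
  proof -
    have int: "integrable lborel (\<lambda>u. indicat_real {a..b} u * g u)"
      using borel_integrable_compact[of "{a..b}" g] continuous_cos_transform[OF \<phi>_int]
      by (auto intro: continuous_on_subset)
    have "emeasure ?D {a<..b} = (\<integral>\<^sup>+u. ennreal (g u) * indicator {a<..b} u \<partial>lborel)"
      by (rule emeasure_density) auto
    also have "\<dots> = (\<integral>\<^sup>+u. ennreal (indicator {a..b} u * g u) \<partial>lborel)"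
    proof (rule nn_integral_cong_AE)
      show "AE u in lborel. ennreal (g u) * indicator {a<..b} u = ennreal (indicator {a..b} u * g u)"
        using AE_lborel_singleton[of a] by eventually_elim (auto split: split_indicator)
    qed
    also have "\<dots> = ennreal (LINT u|lborel. indicator {a..b} u * g u)"
      using int g_nonneg by (intro nn_integral_eq_integral) auto
    finally show ?thesis using prob_Ioc[OF that] by (simp add: emeasure_eq_measure)
  qed
  show ?thesis
  proof (rule measure_eqI_lessThan)
    fix x :: real
    have U: "{x<..} = (\<Union>n. {x<..x + real n})"
    proof safe
      fix y assume "x < y"
      obtain n :: nat where "y - x < real n" using reals_Archimedean2 by blast
      then show "y \<in> (\<Union>n. {x<..x + real n})" using \<open>x < y\<close> by (auto intro!: exI[of _ n])
    qed auto
    have inc: "incseq (\<lambda>n. {x<..x + real n})" by (auto simp: incseq_def)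
    have "emeasure M {x<..} = (SUP n. emeasure M {x<..x + real n})"
      unfolding U by (rule SUP_emeasure_incseq[symmetric]) (use inc in auto)
    also have "\<dots> = (SUP n. emeasure ?D {x<..x + real n})"
      by (intro SUP_cong refl Ioc) auto
    also have "\<dots> = emeasure ?D {x<..}"
      unfolding U by (rule SUP_emeasure_incseq) (use inc in auto)
    finally show "emeasure M {x<..} = emeasure ?D {x<..}" .
  qed (auto simp: emeasure_eq_measure)
qed

end

section \<open>Measurability on path spaces\<close>

lemma cadlag_on_cong:
  assumes "\<And>t. t \<in> I \<Longrightarrow> f t = g t"
  shows "cadlag_on I f \<longleftrightarrow> cadlag_on I g"
proof -
  have "(f \<longlongrightarrow> l) (at t within (I \<inter> U)) = (g \<longlongrightarrow> l) (at t within (I \<inter> U))" for t l U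
    by (rule Lim_cong_within) (use assms in auto)
  then show ?thesis unfolding cadlag_on_def continuous_within using assms by simp
qed

lemma cadlag_on_subset: "cadlag_on I f \<Longrightarrow> J \<subseteq> I \<Longrightarrow> cadlag_on J f"
  unfolding cadlag_on_def
  by (meson Int_mono continuous_within_subset order_refl subsetD tendsto_within_subset)

lemma cadlag_on_diff_const: "cadlag_on I f \<Longrightarrow> cadlag_on I (\<lambda>t. f t - c)"
  unfolding cadlag_on_def by (force intro: continuous_intros tendsto_intros)

lemma cadlag_on_const_diff: "cadlag_on I f \<Longrightarrow> cadlag_on I (\<lambda>t. c - f t)"
  unfolding cadlag_on_def by (force intro: continuous_intros tendsto_intros)

lemma cadlag_on_shift:
  assumes f: "cadlag_on {0..} f" and s: "0 \<le> s"
  shows "cadlag_on {0..} (\<lambda>u. f (s + u))"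
  unfolding cadlag_on_def
proof (intro ballI conjI)
  fix t :: real assume t: "t \<in> {0..}"
  then have st: "s + t \<in> {0..}" using s by auto
  have 1: "(f \<longlongrightarrow> f (s + t)) (at (s + t) within ({0..} \<inter> {s + t..}))"
    using f st unfolding cadlag_on_def continuous_within by blast
  have "filterlim (\<lambda>u. s + u) (at (s + t) within ({0..} \<inter> {s + t..})) (at t within ({0..} \<inter> {t..}))"
    unfolding filterlim_at using t s
    by (auto intro!: tendsto_intros simp: eventually_at_filter)
  from filterlim_compose[OF 1 this] show "continuous (at t within {0..} \<inter> {t..}) (\<lambda>u. f (s + u))"
    unfolding continuous_within .
  obtain l where 2: "(f \<longlongrightarrow> l) (at (s + t) within ({0..} \<inter> {..<s + t}))"
    using f st unfolding cadlag_on_def by blast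
  have "filterlim (\<lambda>u. s + u) (at (s + t) within ({0..} \<inter> {..<s + t})) (at t within ({0..} \<inter> {..<t}))"
    unfolding filterlim_at using t s
    by (auto intro!: tendsto_intros simp: eventually_at_filter)
  from filterlim_compose[OF 2 this] show "\<exists>l. ((\<lambda>u. f (s + u)) \<longlongrightarrow> l) (at t within {0..} \<inter> {..<t})" by blast
qed

text \<open>Freezing a path at time \<open>S\<close> makes it a path on \<open>{0..}\<close>, so
  that functionals of infinite paths, such as the local time, can be evaluated on the past
  alone.\<close>

lemma cadlag_on_stop:
  assumes f: "cadlag_on {0..S} f" and S: "0 \<le> S"
  shows "cadlag_on {0..} (\<lambda>u. f (min u S))"
  unfolding cadlag_on_def
proof (intro ballI conjI)
  fix t :: real assume t: "t \<in> {0..}"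
  show "continuous (at t within {0..} \<inter> {t..}) (\<lambda>u. f (min u S))"
  proof (cases "t < S")
    case True
    have 1: "(f \<longlongrightarrow> f t) (at t within ({0..S} \<inter> {t..}))"
      using f t True unfolding cadlag_on_def continuous_within by auto
    have "at t within ({0..} \<inter> {t..}) = at t within ({0..S} \<inter> {t..})"
      by (rule at_within_nhd[of _ "{..<S}"]) (use True in auto)
    moreover have "((\<lambda>u. f (min u S)) \<longlongrightarrow> f t) (at t within ({0..S} \<inter> {t..}))"
      using 1 by (rule Lim_cong_within[THEN iffD1, rotated -1]) auto
    ultimately show ?thesis using True unfolding continuous_within by simp
  next
    case False
    have "((\<lambda>u. f S) \<longlongrightarrow> f S) (at t within ({0..} \<inter> {t..}))" by simp
    then have "((\<lambda>u. f (min u S)) \<longlongrightarrow> f S) (at t within ({0..} \<inter> {t..}))"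
      by (rule Lim_cong_within[THEN iffD1, rotated -1]) (use False in auto)
    then show ?thesis using False unfolding continuous_within by simp
  qed
  show "\<exists>l. ((\<lambda>u. f (min u S)) \<longlongrightarrow> l) (at t within {0..} \<inter> {..<t})"
  proof (cases "t \<le> S")
    case True
    obtain l where "(f \<longlongrightarrow> l) (at t within ({0..S} \<inter> {..<t}))"
      using f t True unfolding cadlag_on_def by (metis atLeastAtMost_iff atLeast_iff)
    moreover have "{0..S} \<inter> {..<t} = {0..} \<inter> {..<t}" using True by auto
    ultimately have "(f \<longlongrightarrow> l) (at t within ({0..} \<inter> {..<t}))" by simp
    then have "((\<lambda>u. f (min u S)) \<longlongrightarrow> l) (at t within ({0..} \<inter> {..<t}))"
      by (rule Lim_cong_within[THEN iffD1, rotated -1]) (use True in auto)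
    then show ?thesis by blast
  next
    case False
    have eq: "at t within ({0..} \<inter> {..<t}) = at t within ({0..} \<inter> {S<..<t})"
      by (rule at_within_nhd[of _ "{S<..}"]) (use False in auto)
    have "((\<lambda>u. f S) \<longlongrightarrow> f S) (at t within ({0..} \<inter> {S<..<t}))" by simp
    then have "((\<lambda>u. f (min u S)) \<longlongrightarrow> f S) (at t within ({0..} \<inter> {S<..<t}))"
      by (rule Lim_cong_within[THEN iffD1, rotated -1]) auto
    then show ?thesis unfolding eq by blast
  qed
qed

lemma space_path_space: "space (path_space I) = cadlag_paths I"
  by (auto simp: path_space_def space_restrict_space space_PiM cadlag_paths_def PiE_def)

lemma measurable_path_space_eval:
  assumes "t \<in> I" shows "(\<lambda>\<omega>. \<omega> t) \<in> borel_measurable (path_space I)"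
  unfolding path_space_def using assms
  by (intro measurable_restrict_space1 measurable_component_singleton)

text \<open>The \<open>\<sigma>\<close>-algebra is the trace of a product and paths are extensional,
  so the coordinates decide.\<close>

lemma measurable_into_path_space:
  assumes "\<And>t. t \<in> I \<Longrightarrow> (\<lambda>w. X w t) \<in> borel_measurable N" "\<And>w. w \<in> space N \<Longrightarrow> X w \<in> cadlag_paths I"
  shows "X \<in> measurable N (path_space I)"
  unfolding path_space_def
proof (rule measurable_restrict_space2)
  show "X \<in> space N \<rightarrow> cadlag_paths I" using assms(2) by auto
  have ext: "X w = (\<lambda>t\<in>I. X w t)" if "w \<in> space N" for w
    using assms(2)[OF that] unfolding cadlag_paths_def by (simp add: extensional_restrict)
  have "(\<lambda>w. \<lambda>t\<in>I. X w t) \<in> measurable N (Pi\<^sub>M I (\<lambda>_. borel))"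
    using assms(1) by (rule measurable_restrict)
  then show "X \<in> measurable N (Pi\<^sub>M I (\<lambda>_. borel))"
    by (rule measurable_cong[THEN iffD2, rotated]) (rule ext)
qed

lemma restrict_cadlag_paths:
  assumes "cadlag_on I f" "J \<subseteq> I" shows "restrict f J \<in> cadlag_paths J"
proof -
  have "cadlag_on J f" by (rule cadlag_on_subset[OF assms])
  then have "cadlag_on J (restrict f J)" by (subst cadlag_on_cong[of J _ f]) auto
  then show ?thesis by (simp add: cadlag_paths_def)
qed

lemma measurable_restrict_path:
  assumes "J \<subseteq> I" shows "(\<lambda>\<omega>. restrict \<omega> J) \<in> measurable (path_space I) (path_space J)"
proof (rule measurable_into_path_space)
  show "(\<lambda>\<omega>. restrict \<omega> J t) \<in> borel_measurable (path_space I)" if "t \<in> J" for t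
    using that assms by (auto intro: measurable_path_space_eval)
  show "restrict \<omega> J \<in> cadlag_paths J" if "\<omega> \<in> space (path_space I)" for \<omega>
    using that assms unfolding space_path_space
    by (auto simp: cadlag_paths_def intro!: restrict_cadlag_paths[unfolded cadlag_paths_def, simplified])
qed

lemma measurable_stop_path:
  assumes "0 \<le> S"
  shows "(\<lambda>\<omega>. \<lambda>u\<in>{0..}. \<omega> (min u S)) \<in> measurable (path_space {0..S}) (path_space {0..})"
proof (rule measurable_into_path_space)
  show "(\<lambda>\<omega>. (\<lambda>u\<in>{0..}. \<omega> (min u S)) t) \<in> borel_measurable (path_space {0..S})" if "t \<in> {0..}" for t
    using that assms by (auto intro!: measurable_path_space_eval)
  show "(\<lambda>u\<in>{0..}. \<omega> (min u S)) \<in> cadlag_paths {0..}" if "\<omega> \<in> space (path_space {0..S})" for \<omega>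
    using that assms unfolding space_path_space
    by (intro restrict_cadlag_paths[OF cadlag_on_stop]) (auto simp: cadlag_paths_def)
qed

text \<open>Right continuity makes evaluation at a variable time a limit of evaluations at grid
  times, each of which is a countable case distinction over fixed times.\<close>

lemma measurable_path_eval:
  "(\<lambda>(u, \<omega>). \<omega> (max 0 u)) \<in> borel_measurable (borel \<Otimes>\<^sub>M path_space {0..})"
proof (rule borel_measurable_LIMSEQ_metric)
  \<comment> \<open>The least multiple of \<open>1 / Suc n\<close> that is strictly greater than
    \<open>max 0 u\<close>. Strictness matters because the limit from the right is taken in a
    punctured neighbourhood.\<close>
  let ?q = "\<lambda>n u. (real (nat \<lfloor>real (Suc n) * max 0 u\<rfloor>) + 1) / real (Suc n)"
  show "(\<lambda>(u, \<omega>). \<omega> (?q n u)) \<in> borel_measurable (borel \<Otimes>\<^sub>M path_space {0..})" for n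
  proof -
    have "(\<lambda>x. (\<lambda>k (u, \<omega>). \<omega> ((real k + 1) / real (Suc n))) (nat \<lfloor>real (Suc n) * max 0 (fst x)\<rfloor>) x) \<in> borel_measurable (borel \<Otimes>\<^sub>M path_space {0..})"
    proof (rule measurable_compose_countable[where f = "\<lambda>k (u, \<omega>). \<omega> ((real k + 1) / real (Suc n))" and g = "\<lambda>x. nat \<lfloor>real (Suc n) * max 0 (fst x)\<rfloor>"])
      show "(\<lambda>(u::real, \<omega>). \<omega> ((real k + 1) / real (Suc n))) \<in> borel_measurable (borel \<Otimes>\<^sub>M path_space {0..})" for k
        unfolding split_beta by (rule measurable_compose[OF measurable_snd measurable_path_space_eval]) auto
    qed measurable
    then show ?thesis by (simp add: split_beta)
  qed
  fix x assume x: "x \<in> space ((borel :: real measure) \<Otimes>\<^sub>M path_space {0..})"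
  obtain u \<omega> where x_eq: "x = (u, \<omega>)" by (cases x)
  then have \<omega>: "cadlag_on {0..} \<omega>" using x by (auto simp: space_pair_measure space_path_space cadlag_paths_def)
  define v where "v = max 0 u"
  have v: "0 \<le> v" by (simp add: v_def)
  have lim: "(\<omega> \<longlongrightarrow> \<omega> v) (at v within ({0..} \<inter> {v..}))"
    using \<omega> v unfolding cadlag_on_def continuous_within by auto
  have q: "v < ?q n u" "?q n u \<le> v + 1 / real (Suc n)" for n
  proof -
    have "0 \<le> \<lfloor>real (Suc n) * v\<rfloor>" using v by simp
    then have e: "real (nat \<lfloor>real (Suc n) * max 0 u\<rfloor>) = of_int \<lfloor>real (Suc n) * v\<rfloor>"
      unfolding v_def[symmetric] by simp
    show "v < ?q n u" unfolding e by (subst pos_less_divide_eq) (simp_all del: of_nat_Suc add: mult.commute)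
    show "?q n u \<le> v + 1 / real (Suc n)" unfolding e
      by (subst divide_le_eq) (simp add: field_simps del: of_nat_Suc)
  qed
  have "(\<lambda>n. ?q n u) \<longlonglongrightarrow> v"
  proof (rule tendsto_sandwich[OF _ _ tendsto_const])
    have "(\<lambda>n. v + 1 / real (Suc n)) \<longlonglongrightarrow> v + 0"
      by (intro tendsto_intros LIMSEQ_Suc[OF lim_1_over_n])
    then show "(\<lambda>n. v + 1 / real (Suc n)) \<longlonglongrightarrow> v" by simp
    show "\<forall>\<^sub>F n in sequentially. v \<le> ?q n u" using q(1) by (auto intro!: always_eventually less_imp_le)
    show "\<forall>\<^sub>F n in sequentially. ?q n u \<le> v + 1 / real (Suc n)" using q(2) by (auto intro!: always_eventually)
  qed
  then have "filterlim (\<lambda>n. ?q n u) (at v within ({0..} \<inter> {v..})) sequentially"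
    unfolding filterlim_at
  proof (intro conjI)
    show "\<forall>\<^sub>F n in sequentially. ?q n u \<in> {0..} \<inter> {v..} \<and> ?q n u \<noteq> v"
    proof (rule always_eventually, rule allI)
      fix n show "?q n u \<in> {0..} \<inter> {v..} \<and> ?q n u \<noteq> v"
        using q(1)[of n] v by auto
    qed
  qed
  from filterlim_compose[OF lim this]
  show "(\<lambda>n. (\<lambda>(u, \<omega>). \<omega> (?q n u)) x) \<longlonglongrightarrow> (\<lambda>(u, \<omega>). \<omega> (max 0 u)) x"
    unfolding x_eq by (simp add: v_def)
qed

lemma cylinder_sets_path_space:
  assumes "finite J" "J \<subseteq> I" "\<And>t. t \<in> J \<Longrightarrow> A t \<in> sets borel"
  shows "{\<omega> \<in> cadlag_paths I. \<forall>t\<in>J. \<omega> t \<in> A t} \<in> sets (path_space I)"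
proof -
  have "{\<omega> \<in> space (path_space I). \<forall>t\<in>J. \<omega> t \<in> A t} \<in> sets (path_space I)"
  proof (rule sets.sets_Collect_finite_All[OF _ assms(1)])
    fix t assume t: "t \<in> J"
    show "{\<omega> \<in> space (path_space I). \<omega> t \<in> A t} \<in> sets (path_space I)"
      using measurable_sets[OF measurable_path_space_eval assms(3)[OF t], of t I] t assms(2)
      by (auto simp: vimage_def Int_def conj_commute)
  qed
  then show ?thesis by (simp add: space_path_space)
qed

text \<open>The inclusion of the path space into the full product carries the question to a product
  \<open>\<sigma>\<close>-algebra, where finite-dimensional cylinders determine a finite measure.
  Nothing is lost on the way because every measurable set of paths is the trace of one in the
  product.\<close>

lemma path_space_measure_eqI:
  assumes P: "sets P = sets (path_space I)" and Q: "sets Q = sets (path_space I)"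
    and fin: "finite_measure P"
    and eq: "\<And>J A. finite J \<Longrightarrow> J \<subseteq> I \<Longrightarrow> (\<And>t. t \<in> J \<Longrightarrow> A t \<in> sets borel) \<Longrightarrow>
      emeasure P {\<omega> \<in> cadlag_paths I. \<forall>t\<in>J. \<omega> t \<in> A t} = emeasure Q {\<omega> \<in> cadlag_paths I. \<forall>t\<in>J. \<omega> t \<in> A t}"
  shows "P = Q"
proof -
  let ?\<Pi> = "\<Pi>\<^sub>M t\<in>I. borel :: real measure"
  have sp: "space P = cadlag_paths I" "space Q = cadlag_paths I"
    using sets_eq_imp_space_eq[OF P] sets_eq_imp_space_eq[OF Q] by (auto simp: space_path_space)
  have id: "(\<lambda>\<omega>. \<omega>) \<in> measurable (path_space I) ?\<Pi>"
    unfolding path_space_def by (rule measurable_restrict_space1) simp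
  have idP: "(\<lambda>\<omega>. \<omega>) \<in> measurable P ?\<Pi>" "(\<lambda>\<omega>. \<omega>) \<in> measurable Q ?\<Pi>"
    using id measurable_cong_sets[OF P refl] measurable_cong_sets[OF Q refl] by auto
  have "distr P ?\<Pi> (\<lambda>\<omega>. \<omega>) = distr Q ?\<Pi> (\<lambda>\<omega>. \<omega>)"
  proof (rule measure_eqI_PiM_infinite)
    fix A :: "real \<Rightarrow> real set" and J assume J: "finite J" "J \<subseteq> I" "\<And>i. i \<in> J \<Longrightarrow> A i \<in> sets borel"
    let ?E = "prod_emb I (\<lambda>_. borel) J (Pi\<^sub>E J A)"
    have E: "?E \<in> sets ?\<Pi>" using J by (intro sets_PiM_I) auto
    have "(\<lambda>\<omega>. \<omega>) -` ?E \<inter> cadlag_paths I = {\<omega> \<in> cadlag_paths I. \<forall>t\<in>J. \<omega> t \<in> A t}"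
    proof -
      have "restrict \<omega> J \<in> Pi\<^sub>E J A \<longleftrightarrow> (\<forall>t\<in>J. \<omega> t \<in> A t)" for \<omega>
        by (simp add: PiE_iff)
      moreover have "\<omega> \<in> ?E \<longleftrightarrow> restrict \<omega> J \<in> Pi\<^sub>E J A" if "\<omega> \<in> cadlag_paths I" for \<omega>
        using that by (simp add: prod_emb_def cadlag_paths_def PiE_iff)
      ultimately show ?thesis by blast
    qed
    then show "emeasure (distr P ?\<Pi> (\<lambda>\<omega>. \<omega>)) ?E = emeasure (distr Q ?\<Pi> (\<lambda>\<omega>. \<omega>)) ?E"
      using eq[OF J] by (simp add: emeasure_distr[OF idP(1) E] emeasure_distr[OF idP(2) E] sp)
  qed (auto intro!: finite_measure.finite_measure_distr[OF fin idP(1)])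
  show ?thesis
  proof (rule measure_eqI)
    fix A assume "A \<in> sets P"
    then obtain A' where A': "A' \<in> sets ?\<Pi>" "A = cadlag_paths I \<inter> A'"
      unfolding P path_space_def sets_restrict_space by auto
    have "emeasure P A = emeasure (distr P ?\<Pi> (\<lambda>\<omega>. \<omega>)) A'"
      unfolding emeasure_distr[OF idP(1) A'(1)] A'(2) sp by (simp add: vimage_def Int_def conj_commute)
    also have "\<dots> = emeasure Q A"
      unfolding \<open>distr P ?\<Pi> (\<lambda>\<omega>. \<omega>) = _\<close> emeasure_distr[OF idP(2) A'(1)] A'(2) sp
      by (simp add: vimage_def Int_def conj_commute)
    finally show "emeasure P A = emeasure Q A" .
  qed (simp add: P Q)
qed

text \<open>Lists a finite set of times in increasing order, with \<open>idx\<close> inverse to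
  \<open>ts\<close>: the form in which independence of increments is stated. \<open>n\<close> is the
  index of the last time, hence the number of increments.\<close>

lemma finite_grid:
  fixes T :: "real set"
  assumes "finite T" "T \<noteq> {}"
  obtains ts idx n where "\<And>i. i < n \<Longrightarrow> ts i < ts (Suc i)" "\<And>i. i \<le> n \<Longrightarrow> ts i \<in> T"
    "\<And>t. t \<in> T \<Longrightarrow> idx t \<le> n" "\<And>t. t \<in> T \<Longrightarrow> ts (idx t) = t"
    "\<And>s t. s \<in> T \<Longrightarrow> t \<in> T \<Longrightarrow> s \<le> t \<Longrightarrow> idx s \<le> idx t" "idx (Min T) = (0 :: nat)" "n = card T - 1"
proof -
  let ?l = "sorted_list_of_set T"
  have len: "length ?l = card T" "card T > 0" using assms by (auto simp: card_gt_0_iff)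
  have set: "set ?l = T" using assms by simp
  define idx where "idx t = (LEAST i. ?l ! i = t)" for t
  have idx: "idx t < card T" "?l ! idx t = t" if "t \<in> T" for t
  proof -
    obtain i where i: "i < card T" "?l ! i = t" using \<open>t \<in> T\<close> set len in_set_conv_nth[of t ?l] by metis
    show "?l ! idx t = t" unfolding idx_def by (rule LeastI[of _ i]) (rule i(2))
    have "idx t \<le> i" unfolding idx_def by (rule Least_le) (rule i(2))
    then show "idx t < card T" using i by simp
  qed
  have strict: "?l ! i < ?l ! j" if "i < j" "j < card T" for i j
    using sorted_wrt_nth_less[OF strict_sorted_list_of_set, of i j T] that len by simp
  show ?thesis
  proof
    show "?l ! i < ?l ! Suc i" if "i < card T - 1" for i using that strict by auto
    show "?l ! i \<in> T" if "i \<le> card T - 1" for i using that len set nth_mem[of i ?l] by auto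
    show "idx t \<le> card T - 1" if "t \<in> T" for t using idx(1)[OF that] by simp
    show "?l ! idx t = t" if "t \<in> T" for t by (rule idx(2)[OF that])
    show "idx s \<le> idx t" if "s \<in> T" "t \<in> T" "s \<le> t" for s t
    proof (rule ccontr)
      assume "\<not> idx s \<le> idx t"
      then have "?l ! idx t < ?l ! idx s" by (intro strict idx(1) that(1)) simp
      then show False using that(3) unfolding idx(2)[OF that(1)] idx(2)[OF that(2)] by simp
    qed
    show "idx (Min T) = 0"
    proof (rule ccontr)
      assume "idx (Min T) \<noteq> 0"
      then have "?l ! 0 < ?l ! idx (Min T)" using strict idx(1)[of "Min T"] assms by auto
      moreover have "?l ! 0 \<in> T" using len set nth_mem[of 0 ?l] by auto
      ultimately show False using idx(2)[of "Min T"] assms by (auto simp: not_less)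
    qed
  qed simp
qed

text \<open>The law of \<open>X\<close> on the event \<open>A\<close>. As a measure on paths it is
  accessible to \<open>path_space_measure_eqI\<close>, which yields independence one factor at a
  time.\<close>

lemma emeasure_distr_density_indicator:
  assumes "X \<in> measurable M N" "A \<in> sets M" "B \<in> sets N"
  shows "emeasure (distr (density M (indicator A)) N X) B = emeasure M (X -` B \<inter> space M \<inter> A)"
proof -
  have X: "X \<in> measurable (density M (indicator A)) N" using assms(1) by simp
  have B: "X -` B \<inter> space M \<in> sets M" using assms by (auto intro: measurable_sets)
  have "emeasure (distr (density M (indicator A)) N X) B = emeasure (density M (indicator A)) (X -` B \<inter> space M)"
    using emeasure_distr[OF X assms(3)] by simp
  also have "\<dots> = (\<integral>\<^sup>+w. indicator A w * indicator (X -` B \<inter> space M) w \<partial>M)"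
    using assms B by (subst emeasure_density) auto
  also have "\<dots> = (\<integral>\<^sup>+w. indicator (X -` B \<inter> space M \<inter> A) w \<partial>M)"
    by (intro nn_integral_cong) (auto split: split_indicator)
  finally show ?thesis using assms B by simp
qed

lemma (in finite_measure) finite_measure_distr_density_indicator:
  assumes "X \<in> measurable M N" "A \<in> sets M"
  shows "finite_measure (distr (density M (indicator A)) N X)"
proof (rule finite_measureI)
  have "emeasure (distr (density M (indicator A)) N X) (space N) \<noteq> \<infinity>"
    using assms by (subst emeasure_distr_density_indicator) auto
  then show "emeasure (distr (density M (indicator A)) N X) (space (distr (density M (indicator A)) N X)) \<noteq> \<infinity>"
    by simp
qed

section \<open>The Markov property of a Levy process\<close>

locale levy =
  fixes M :: "'w measure" and \<xi> :: "real \<Rightarrow> 'w \<Rightarrow> real"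
  assumes levy: "levy_process M \<xi>"

sublocale levy \<subseteq> prob_space M using levy unfolding levy_process_def by blast

context levy begin

lemma \<xi>_meas: "0 \<le> t \<Longrightarrow> \<xi> t \<in> borel_measurable M"
  using levy unfolding levy_process_def by blast

lemma \<xi>_0: "w \<in> space M \<Longrightarrow> \<xi> 0 w = 0"
  using levy unfolding levy_process_def by blast

lemma \<xi>_cadlag: "w \<in> space M \<Longrightarrow> cadlag_on {0..} (\<lambda>t. \<xi> t w)"
  using levy unfolding levy_process_def by blast

lemma indep_increments:
  fixes f :: "nat \<Rightarrow> real"
  assumes "0 \<le> f 0" "\<And>i. i < n \<Longrightarrow> f i \<le> f (Suc i)"
  shows "indep_vars (\<lambda>_. borel) (\<lambda>i w. \<xi> (f (Suc i)) w - \<xi> (f i) w) {..<n}"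
  using levy assms unfolding levy_process_def by blast

lemma distr_increment:
  "0 \<le> s \<Longrightarrow> 0 \<le> t \<Longrightarrow> distr M borel (\<lambda>w. \<xi> (s + t) w - \<xi> s w) = distr M borel (\<xi> t)"
  using levy unfolding levy_process_def by blast

definition shifted :: "real \<Rightarrow> real \<Rightarrow> 'w \<Rightarrow> real" where
  "shifted s u w = \<xi> (s + u) w - \<xi> s w"

lemma shifted_meas: "0 \<le> s \<Longrightarrow> 0 \<le> u \<Longrightarrow> shifted s u \<in> borel_measurable M"
  unfolding shifted_def by (intro borel_measurable_diff \<xi>_meas) auto

text \<open>The values at the times of \<open>K\<close> are partial sums of grid increments. These
  are independent with laws that depend only on the lengths of the steps, so the joint law is the
  image under \<open>G\<close> of a product measure in which the starting time \<open>c\<close> no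
  longer occurs.\<close>

lemma shifted_finite_distr:
  assumes s: "0 \<le> s" and K: "finite K" "K \<subseteq> {0..}"
  shows "distr M (\<Pi>\<^sub>M u\<in>K. borel) (\<lambda>w. \<lambda>u\<in>K. shifted s u w) = distr M (\<Pi>\<^sub>M u\<in>K. borel) (\<lambda>w. \<lambda>u\<in>K. \<xi> u w)"
proof -
  \<comment> \<open>0 is the base point of the partial sums; 1 guarantees at least one increment, as
    the product description of independence needs a nonempty index set.\<close>
  define T where "T = {0, 1} \<union> K"
  have T: "finite T" "T \<noteq> {}" "\<And>t. t \<in> T \<Longrightarrow> 0 \<le> t" using K by (auto simp: T_def)
  have MinT: "Min T = 0" using T K by (intro Min_eqI) (auto simp: T_def)
  have "card {0 :: real, 1} \<le> card T" using T by (intro card_mono) (auto simp: T_def)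
  then have c: "1 < card T" by simp
  obtain ts idx n where ts: "\<And>i. i < n \<Longrightarrow> ts i < ts (Suc i)" "\<And>i. i \<le> n \<Longrightarrow> ts i \<in> T"
    "\<And>t. t \<in> T \<Longrightarrow> idx t \<le> n" "\<And>t. t \<in> T \<Longrightarrow> ts (idx t) = t"
    "\<And>s t. s \<in> T \<Longrightarrow> t \<in> T \<Longrightarrow> s \<le> t \<Longrightarrow> idx s \<le> idx t" "idx (Min T) = (0 :: nat)" "n = card T - 1"
    by (rule finite_grid[OF T(1,2)], rule that)
  have n: "0 < n" using ts(7) c by simp
  have ts0: "ts 0 = 0" using ts(4)[of 0] ts(6) MinT by (simp add: T_def)
  have tspos: "0 \<le> ts i" if "i \<le> n" for i using ts(2)[OF that] T(3) by auto
  let ?d = "\<lambda>c i w. \<xi> (c + ts (Suc i)) w - \<xi> (c + ts i) w"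
  have d_ind: "indep_vars (\<lambda>_. borel) (?d c) {..<n}" if "0 \<le> c" for c
    using indep_increments[of "\<lambda>i. c + ts i" n] ts0 ts(1) that by (auto intro: less_imp_le)
  have d_meas: "?d c i \<in> borel_measurable M" if "0 \<le> c" "i \<in> {..<n}" for c i
    using that tspos[of i] tspos[of "Suc i"] by (intro borel_measurable_diff \<xi>_meas) auto
  have d_distr: "distr M borel (?d c i) = distr M borel (\<xi> (ts (Suc i) - ts i))" if "0 \<le> c" "i \<in> {..<n}" for c i
    using distr_increment[of "c + ts i" "ts (Suc i) - ts i"] that tspos[of i] ts(1)[of i] by (auto simp: less_imp_le)
  have joint: "distr M (\<Pi>\<^sub>M i\<in>{..<n}. borel) (\<lambda>w. \<lambda>i\<in>{..<n}. ?d c i w) =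
      (\<Pi>\<^sub>M i\<in>{..<n}. distr M borel (\<xi> (ts (Suc i) - ts i)))" if "0 \<le> c" for c
  proof -
    have "distr M (\<Pi>\<^sub>M i\<in>{..<n}. borel) (\<lambda>w. \<lambda>i\<in>{..<n}. ?d c i w) = (\<Pi>\<^sub>M i\<in>{..<n}. distr M borel (?d c i))"
      by (rule indep_vars_iff_distr_eq_PiM'[THEN iffD1, OF _ _ d_ind[OF that]]) (use n in force, rule d_meas[OF that])
    also have "\<dots> = (\<Pi>\<^sub>M i\<in>{..<n}. distr M borel (\<xi> (ts (Suc i) - ts i)))"
      by (intro PiM_cong refl d_distr that)
    finally show ?thesis .
  qed
  define G where "G a = (\<lambda>u\<in>K. \<Sum>i<idx u. a i :: real)" for a
  have G_meas: "G \<in> measurable (\<Pi>\<^sub>M i\<in>{..<n}. borel) (\<Pi>\<^sub>M u\<in>K. borel)"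
    unfolding G_def
  proof (rule measurable_restrict)
    fix u assume "u \<in> K"
    then have "idx u \<le> n" using ts(3)[of u] by (auto simp: T_def)
    then show "(\<lambda>a. \<Sum>i<idx u. a i :: real) \<in> borel_measurable (\<Pi>\<^sub>M i\<in>{..<n}. borel)"
      by (intro borel_measurable_sum[of "{..<idx u}" "\<lambda>i a. a i"] measurable_component_singleton) auto
  qed
  have main: "distr M (\<Pi>\<^sub>M u\<in>K. borel) (\<lambda>w. \<lambda>u\<in>K. \<xi> (c + u) w - \<xi> c w) =
      distr (\<Pi>\<^sub>M i\<in>{..<n}. distr M borel (\<xi> (ts (Suc i) - ts i))) (\<Pi>\<^sub>M u\<in>K. borel) G" if c: "0 \<le> c" for c
  proof -
    have "distr M (\<Pi>\<^sub>M u\<in>K. borel) (\<lambda>w. \<lambda>u\<in>K. \<xi> (c + u) w - \<xi> c w) =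
       distr M (\<Pi>\<^sub>M u\<in>K. borel) (G \<circ> (\<lambda>w. \<lambda>i\<in>{..<n}. ?d c i w))"
    proof (rule distr_cong[OF refl refl])
      fix w assume "w \<in> space M"
      show "(\<lambda>u\<in>K. \<xi> (c + u) w - \<xi> c w) = (G \<circ> (\<lambda>w. \<lambda>i\<in>{..<n}. ?d c i w)) w"
        unfolding G_def o_def
      proof (rule restrict_ext)
        fix u assume "u \<in> K"
        then have u: "idx u \<le> n" "ts (idx u) = u" using ts(3,4)[of u] by (auto simp: T_def)
        have "(\<Sum>i<idx u. (\<lambda>i\<in>{..<n}. ?d c i w) i) = (\<Sum>i<idx u. ?d c i w)"
          using u by (intro sum.cong) auto
        also have "\<dots> = \<xi> (c + u) w - \<xi> c w"
          by (subst sum_lessThan_telescope[of "\<lambda>i. \<xi> (c + ts i) w"]) (simp add: u ts0)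
        finally show "\<xi> (c + u) w - \<xi> c w = (\<Sum>i<idx u. (\<lambda>i\<in>{..<n}. ?d c i w) i)" by simp
      qed
    qed
    also have "\<dots> = distr (distr M (\<Pi>\<^sub>M i\<in>{..<n}. borel) (\<lambda>w. \<lambda>i\<in>{..<n}. ?d c i w)) (\<Pi>\<^sub>M u\<in>K. borel) G"
      by (subst distr_distr[OF G_meas]) (use d_meas[OF c] in \<open>auto intro!: measurable_restrict\<close>)
    finally show ?thesis unfolding joint[OF c] .
  qed
  have "distr M (\<Pi>\<^sub>M u\<in>K. borel) (\<lambda>w. \<lambda>u\<in>K. \<xi> u w) = distr M (\<Pi>\<^sub>M u\<in>K. borel) (\<lambda>w. \<lambda>u\<in>K. \<xi> (0 + u) w - \<xi> 0 w)"
    by (intro distr_cong refl) (simp add: \<xi>_0)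
  then show ?thesis using main[OF s] main[of 0] unfolding shifted_def by simp
qed

text \<open>With \<open>s\<close> itself on the grid, at index \<open>m\<close>, the past is a
  function of the increments before \<open>m\<close> and the shifted values are functions of those
  from \<open>m\<close> on. These are disjoint blocks of an independent family.\<close>

lemma past_shifted_finite_indep:
  assumes s: "0 \<le> s" and J: "finite J" "J \<subseteq> {0..s}" and K: "finite K" "K \<subseteq> {0..}"
    and A: "\<And>t. t \<in> J \<Longrightarrow> A t \<in> sets borel" and B: "\<And>u. u \<in> K \<Longrightarrow> B u \<in> sets borel"
  shows "prob ({w \<in> space M. \<forall>t\<in>J. \<xi> t w \<in> A t} \<inter> {w \<in> space M. \<forall>u\<in>K. shifted s u w \<in> B u}) =
    prob {w \<in> space M. \<forall>t\<in>J. \<xi> t w \<in> A t} * prob {w \<in> space M. \<forall>u\<in>K. shifted s u w \<in> B u}"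
proof -
  define T where "T = {0, s} \<union> J \<union> (\<lambda>u. s + u) ` K"
  have T: "finite T" "T \<noteq> {}" "\<And>t. t \<in> T \<Longrightarrow> 0 \<le> t" using s J K by (auto simp: T_def)
  have MinT: "Min T = 0" using T by (intro Min_eqI) (auto simp: T_def)
  obtain ts idx n where ts: "\<And>i. i < n \<Longrightarrow> ts i < ts (Suc i)" "\<And>i. i \<le> n \<Longrightarrow> ts i \<in> T"
    "\<And>t. t \<in> T \<Longrightarrow> idx t \<le> n" "\<And>t. t \<in> T \<Longrightarrow> ts (idx t) = t"
    "\<And>s t. s \<in> T \<Longrightarrow> t \<in> T \<Longrightarrow> s \<le> t \<Longrightarrow> idx s \<le> idx t"
    "idx (Min T) = (0 :: nat)" "n = card T - 1"
    by (rule finite_grid[OF T(1,2)], rule that)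
  have ts0: "ts 0 = 0" using ts(4)[of 0] ts(6) MinT by (simp add: T_def)
  define m where "m = idx s"
  have m: "m \<le> n" "ts m = s" using ts(3,4)[of s] by (auto simp: m_def T_def)
  let ?d = "\<lambda>i w. \<xi> (ts (Suc i)) w - \<xi> (ts i) w"
  have d_ind: "indep_vars (\<lambda>_. borel) ?d {..<n}"
    using indep_increments[of ts n] ts0 ts(1) by (auto intro: less_imp_le)
  have ind: "indep_var (PiM {..<m} (\<lambda>_. borel)) (\<lambda>w. restrict (\<lambda>i. ?d i w) {..<m})
      (PiM {m..<n} (\<lambda>_. borel)) (\<lambda>w. restrict (\<lambda>i. ?d i w) {m..<n})"
    by (rule indep_var_restrict[OF d_ind]) (use m in auto)
  define A' where "A' = {a \<in> space (PiM {..<m} (\<lambda>_. borel :: real measure)). \<forall>t\<in>J. (\<Sum>i<idx t. a i) \<in> A t}"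
  define B' where "B' = {b \<in> space (PiM {m..<n} (\<lambda>_. borel :: real measure)). \<forall>u\<in>K. (\<Sum>i\<in>{m..<idx (s + u)}. b i) \<in> B u}"
  have idxJ: "idx t \<le> m" "ts (idx t) = t" if "t \<in> J" for t
    using that ts(5)[of t s] ts(4)[of t] J by (auto simp: m_def T_def)
  have idxK: "m \<le> idx (s + u)" "idx (s + u) \<le> n" "ts (idx (s + u)) = s + u" if "u \<in> K" for u
    using that ts(5)[of s "s + u"] ts(3,4)[of "s + u"] K by (auto simp: m_def T_def)
  have A'_sets: "A' \<in> sets (PiM {..<m} (\<lambda>_. borel))"
    unfolding A'_def
  proof (rule sets.sets_Collect_finite_All[OF _ J(1)])
    fix t assume t: "t \<in> J"
    have "(\<lambda>a. \<Sum>i<idx t. a i :: real) \<in> borel_measurable (PiM {..<m} (\<lambda>_. borel :: real measure))"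
      using idxJ[OF t] by (intro borel_measurable_sum[of "{..<idx t}" "\<lambda>i a. a i"] measurable_component_singleton) auto
    from measurable_sets[OF this A[OF t]]
    show "{a \<in> space (PiM {..<m} (\<lambda>_. borel :: real measure)). (\<Sum>i<idx t. a i) \<in> A t} \<in> sets (PiM {..<m} (\<lambda>_. borel))"
      by (simp add: vimage_def Int_def conj_commute)
  qed
  have B'_sets: "B' \<in> sets (PiM {m..<n} (\<lambda>_. borel))"
    unfolding B'_def
  proof (rule sets.sets_Collect_finite_All[OF _ K(1)])
    fix u assume u: "u \<in> K"
    have "(\<lambda>b. \<Sum>i\<in>{m..<idx (s + u)}. b i :: real) \<in> borel_measurable (PiM {m..<n} (\<lambda>_. borel :: real measure))"
      using idxK[OF u] by (intro borel_measurable_sum[of "{m..<idx (s + u)}" "\<lambda>i a. a i"] measurable_component_singleton) auto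
    from measurable_sets[OF this B[OF u]]
    show "{b \<in> space (PiM {m..<n} (\<lambda>_. borel :: real measure)). (\<Sum>i\<in>{m..<idx (s + u)}. b i) \<in> B u} \<in> sets (PiM {m..<n} (\<lambda>_. borel))"
      by (simp add: vimage_def Int_def conj_commute)
  qed
  have eqA: "(\<lambda>w. restrict (\<lambda>i. ?d i w) {..<m}) -` A' \<inter> space M = {w \<in> space M. \<forall>t\<in>J. \<xi> t w \<in> A t}"
  proof -
    have "(\<Sum>i<idx t. restrict (\<lambda>i. ?d i w) {..<m} i) = \<xi> t w" if "t \<in> J" "w \<in> space M" for t w
    proof -
      have "(\<Sum>i<idx t. restrict (\<lambda>i. ?d i w) {..<m} i) = (\<Sum>i<idx t. ?d i w)"
        using idxJ[OF that(1)] by (intro sum.cong) auto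
      also have "\<dots> = \<xi> t w"
        by (subst sum_lessThan_telescope[of "\<lambda>i. \<xi> (ts i) w"]) (simp add: idxJ[OF that(1)] ts0 \<xi>_0 that(2))
      finally show ?thesis .
    qed
    then show ?thesis unfolding A'_def by (auto simp: space_PiM)
  qed
  have eqB: "(\<lambda>w. restrict (\<lambda>i. ?d i w) {m..<n}) -` B' \<inter> space M = {w \<in> space M. \<forall>u\<in>K. shifted s u w \<in> B u}"
  proof -
    have "(\<Sum>i\<in>{m..<idx (s + u)}. restrict (\<lambda>i. ?d i w) {m..<n} i) = shifted s u w" if "u \<in> K" for u w
    proof -
      have "(\<Sum>i\<in>{m..<idx (s + u)}. restrict (\<lambda>i. ?d i w) {m..<n} i) = (\<Sum>i\<in>{m..<idx (s + u)}. ?d i w)"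
        using idxK[OF that] by (intro sum.cong) auto
      also have "\<dots> = shifted s u w"
        by (subst sum_Suc_diff'[OF idxK(1)[OF that], of "\<lambda>i. \<xi> (ts i) w"]) (simp add: idxK[OF that] m shifted_def)
      finally show ?thesis .
    qed
    then show ?thesis unfolding B'_def by (auto simp: space_PiM)
  qed
  show ?thesis
    using indep_varD[OF ind A'_sets B'_sets] unfolding eqA[symmetric] eqB[symmetric]
    by (simp add: vimage_Times Int_assoc Int_left_commute Int_commute vimage_def conj_ac Int_def)
qed

definition full_path :: "'w \<Rightarrow> real \<Rightarrow> real" where "full_path w = (\<lambda>t\<in>{0..}. \<xi> t w)"
definition past :: "real \<Rightarrow> 'w \<Rightarrow> real \<Rightarrow> real" where "past s w = (\<lambda>t\<in>{0..s}. \<xi> t w)"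
definition shift_path :: "real \<Rightarrow> 'w \<Rightarrow> real \<Rightarrow> real" where "shift_path s w = (\<lambda>u\<in>{0..}. shifted s u w)"
definition W :: "(real \<Rightarrow> real) measure" where "W = distr M (path_space {0..}) full_path"

lemma full_path_meas: "full_path \<in> measurable M (path_space {0..})"
proof (rule measurable_into_path_space)
  show "full_path w \<in> cadlag_paths {0..}" if "w \<in> space M" for w
    unfolding full_path_def by (rule restrict_cadlag_paths[OF \<xi>_cadlag[OF that]]) simp
  show "(\<lambda>w. full_path w t) \<in> borel_measurable M" if "t \<in> {0..}" for t
    using \<xi>_meas[of t] that by (simp add: full_path_def)
qed

lemma past_meas: "past s \<in> measurable M (path_space {0..s})"
proof (rule measurable_into_path_space)
  show "past s w \<in> cadlag_paths {0..s}" if "w \<in> space M" for w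
    unfolding past_def by (rule restrict_cadlag_paths[OF \<xi>_cadlag[OF that]]) auto
  show "(\<lambda>w. past s w t) \<in> borel_measurable M" if "t \<in> {0..s}" for t
    using \<xi>_meas[of t] that by (simp add: past_def)
qed

lemma shift_path_meas:
  assumes s: "0 \<le> s" shows "shift_path s \<in> measurable M (path_space {0..})"
proof (rule measurable_into_path_space)
  show "shift_path s w \<in> cadlag_paths {0..}" if "w \<in> space M" for w
    unfolding shift_path_def shifted_def
    by (rule restrict_cadlag_paths[OF cadlag_on_diff_const[OF cadlag_on_shift[OF \<xi>_cadlag[OF that] s]]]) simp
  show "(\<lambda>w. shift_path s w t) \<in> borel_measurable M" if "t \<in> {0..}" for t
    using shifted_meas[OF s, of t] that by (simp add: shift_path_def)
qed

lemma sets_W [simp, measurable_cong]: "sets W = sets (path_space {0..})"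
  by (simp add: W_def)

lemma space_W: "space W = cadlag_paths {0..}"
  by (simp add: W_def space_path_space)

lemma prob_space_W: "prob_space W"
  unfolding W_def by (rule prob_space_distr[OF full_path_meas])

lemma vimage_cylinder:
  assumes "X \<in> measurable M (path_space I)"
  shows "X -` {\<omega> \<in> cadlag_paths I. \<forall>t\<in>J. \<omega> t \<in> A t} \<inter> space M = {w \<in> space M. \<forall>t\<in>J. X w t \<in> A t}"
  using measurable_space[OF assms] by (auto simp: space_path_space)

lemma distr_shift_path:
  assumes s: "0 \<le> s"
  shows "distr M (path_space {0..}) (shift_path s) = W"
  unfolding W_def
proof (rule path_space_measure_eqI[where I="{0..}"])
  fix J and A :: "real \<Rightarrow> real set" assume J: "finite J" "J \<subseteq> {0..}" "\<And>t. t \<in> J \<Longrightarrow> A t \<in> sets borel"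
  have C: "{\<omega> \<in> cadlag_paths {0..}. \<forall>t\<in>J. \<omega> t \<in> A t} \<in> sets (path_space {0..})"
    by (rule cylinder_sets_path_space[OF J(1,2)]) (rule J(3))
  have PE: "Pi\<^sub>E J A \<in> sets (\<Pi>\<^sub>M u\<in>J. borel)" using J by (intro sets_PiM_I_finite) auto
  have 1: "emeasure (distr M (\<Pi>\<^sub>M u\<in>J. borel) (\<lambda>w. \<lambda>u\<in>J. X u w)) (Pi\<^sub>E J A) = emeasure M {w \<in> space M. \<forall>t\<in>J. X t w \<in> A t}"
    if "\<And>u. u \<in> J \<Longrightarrow> X u \<in> borel_measurable M" for X
  proof -
    have "(\<lambda>w. \<lambda>u\<in>J. X u w) -` Pi\<^sub>E J A \<inter> space M = {w \<in> space M. \<forall>t\<in>J. X t w \<in> A t}"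
      by (auto simp: PiE_iff)
    then show ?thesis using that by (subst emeasure_distr[OF _ PE]) (auto intro!: measurable_restrict)
  qed
  have Jpos: "0 \<le> t" if "t \<in> J" for t using J(2) that by auto
  have "{w \<in> space M. \<forall>t\<in>J. shift_path s w t \<in> A t} = {w \<in> space M. \<forall>t\<in>J. shifted s t w \<in> A t}"
    using Jpos by (auto simp: shift_path_def)
  moreover have "{w \<in> space M. \<forall>t\<in>J. full_path w t \<in> A t} = {w \<in> space M. \<forall>t\<in>J. \<xi> t w \<in> A t}"
    using Jpos by (auto simp: full_path_def)
  moreover have "emeasure M {w \<in> space M. \<forall>t\<in>J. shifted s t w \<in> A t} = emeasure M {w \<in> space M. \<forall>t\<in>J. \<xi> t w \<in> A t}"
    using 1[of "shifted s"] 1[of \<xi>] shifted_finite_distr[OF s J(1,2)] Jpos s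
    by (simp add: shifted_meas \<xi>_meas)
  moreover have "emeasure (distr M (path_space {0..}) X) {\<omega> \<in> cadlag_paths {0..}. \<forall>t\<in>J. \<omega> t \<in> A t} =
      emeasure M {w \<in> space M. \<forall>t\<in>J. X w t \<in> A t}" if X: "X \<in> measurable M (path_space {0..})" for X
    using emeasure_distr[OF X C] vimage_cylinder[OF X, of J A] by simp
  ultimately show "emeasure (distr M (path_space {0..}) (shift_path s)) {\<omega> \<in> cadlag_paths {0..}. \<forall>t\<in>J. \<omega> t \<in> A t} =
     emeasure (distr M (path_space {0..}) full_path) {\<omega> \<in> cadlag_paths {0..}. \<forall>t\<in>J. \<omega> t \<in> A t}"
    by (simp add: shift_path_meas[OF s] full_path_meas)
qed (auto intro!: finite_measure_distr shift_path_meas s)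

text \<open>Independence is extended from cylinders in two rounds. With a cylinder \<open>B\<close>
  fixed, both sides are measures in \<open>A\<close> that agree on cylinders; then an arbitrary
  \<open>A\<close> is fixed and the same is done in \<open>B\<close>.\<close>

lemma emeasure_past_shift_path:
  assumes s: "0 \<le> s" and A: "A \<in> sets (path_space {0..s})" and B: "B \<in> sets (path_space {0..})"
  shows "emeasure M ((past s -` A \<inter> space M) \<inter> (shift_path s -` B \<inter> space M)) =
    emeasure M (past s -` A \<inter> space M) * emeasure M (shift_path s -` B \<inter> space M)"
proof -
  note pm = past_meas[of s] and sm = shift_path_meas[OF s]
  have step1: "emeasure M ((past s -` A \<inter> space M) \<inter> (shift_path s -` B \<inter> space M)) =
    emeasure M (past s -` A \<inter> space M) * emeasure M (shift_path s -` B \<inter> space M)"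
    if A: "A \<in> sets (path_space {0..s})" and B: "B = {\<omega> \<in> cadlag_paths {0..}. \<forall>u\<in>K. \<omega> u \<in> E u}"
      and K: "finite K" "K \<subseteq> {0..}" "\<And>u. u \<in> K \<Longrightarrow> E u \<in> sets borel" for A B K E
  proof -
    have Bs: "B \<in> sets (path_space {0..})" unfolding B by (rule cylinder_sets_path_space[OF K])
    let ?B = "shift_path s -` B \<inter> space M"
    have Bm: "?B \<in> sets M" by (rule measurable_sets[OF sm Bs])
    have Beq: "?B = {w \<in> space M. \<forall>u\<in>K. shifted s u w \<in> E u}"
      unfolding B vimage_cylinder[OF sm] using K(2) by (auto simp: shift_path_def)
    have "distr (density M (indicator ?B)) (path_space {0..s}) (past s) =
      scale_measure (emeasure M ?B) (distr M (path_space {0..s}) (past s))"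
    proof (rule path_space_measure_eqI[where I="{0..s}"])
      fix J :: "real set" and D assume J: "finite J" "J \<subseteq> {0..s}" "\<And>t. t \<in> J \<Longrightarrow> D t \<in> sets (borel :: real measure)"
      have C: "{\<omega> \<in> cadlag_paths {0..s}. \<forall>t\<in>J. \<omega> t \<in> D t} \<in> sets (path_space {0..s})"
        by (rule cylinder_sets_path_space[OF J(1,2)]) (rule J(3))
      have "past s -` {\<omega> \<in> cadlag_paths {0..s}. \<forall>t\<in>J. \<omega> t \<in> D t} \<inter> space M = {w \<in> space M. \<forall>t\<in>J. \<xi> t w \<in> D t}"
        unfolding vimage_cylinder[OF pm] using J(2) by (auto simp: past_def)
      moreover have "emeasure M ({w \<in> space M. \<forall>t\<in>J. \<xi> t w \<in> D t} \<inter> ?B) = emeasure M {w \<in> space M. \<forall>t\<in>J. \<xi> t w \<in> D t} * emeasure M ?B"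
        unfolding Beq emeasure_eq_measure
        by (subst past_shifted_finite_indep[OF s J(1,2) K(1,2) J(3) K(3)]) (simp_all add: ennreal_mult)
      ultimately show "emeasure (distr (density M (indicator ?B)) (path_space {0..s}) (past s)) {\<omega> \<in> cadlag_paths {0..s}. \<forall>t\<in>J. \<omega> t \<in> D t} =
        emeasure (scale_measure (emeasure M ?B) (distr M (path_space {0..s}) (past s))) {\<omega> \<in> cadlag_paths {0..s}. \<forall>t\<in>J. \<omega> t \<in> D t}"
        by (simp add: emeasure_distr_density_indicator[OF pm Bm C] emeasure_distr[OF pm C] mult.commute)
    qed (auto intro!: finite_measure_distr_density_indicator pm Bm)
    from arg_cong[OF this, of "\<lambda>N. emeasure N A"] show ?thesis
      by (simp add: emeasure_distr_density_indicator[OF pm Bm A] emeasure_distr[OF pm A] mult.commute)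
  qed
  let ?A = "past s -` A \<inter> space M"
  have Am: "?A \<in> sets M" by (rule measurable_sets[OF pm A])
  have "distr (density M (indicator ?A)) (path_space {0..}) (shift_path s) =
      scale_measure (emeasure M ?A) (distr M (path_space {0..}) (shift_path s))"
  proof (rule path_space_measure_eqI[where I="{0..}"])
    fix J :: "real set" and D assume J: "finite J" "J \<subseteq> {0..}" "\<And>t. t \<in> J \<Longrightarrow> D t \<in> sets (borel :: real measure)"
    have C: "{\<omega> \<in> cadlag_paths {0..}. \<forall>t\<in>J. \<omega> t \<in> D t} \<in> sets (path_space {0..})"
      by (rule cylinder_sets_path_space[OF J(1,2)]) (rule J(3))
    show "emeasure (distr (density M (indicator ?A)) (path_space {0..}) (shift_path s)) {\<omega> \<in> cadlag_paths {0..}. \<forall>t\<in>J. \<omega> t \<in> D t} =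
      emeasure (scale_measure (emeasure M ?A) (distr M (path_space {0..}) (shift_path s))) {\<omega> \<in> cadlag_paths {0..}. \<forall>t\<in>J. \<omega> t \<in> D t}"
      unfolding emeasure_distr_density_indicator[OF sm Am C] emeasure_scale_measure emeasure_distr[OF sm C]
      using step1[OF A refl J(1,2), of D, OF J(3)] by (simp only: Int_commute)
  qed (auto intro!: finite_measure_distr_density_indicator sm Am)
  from arg_cong[OF this, of "\<lambda>N. emeasure N B"] show ?thesis
    unfolding emeasure_distr_density_indicator[OF sm Am B] emeasure_scale_measure emeasure_distr[OF sm B]
    by (metis Int_commute)
qed

lemma distr_past_shift_path:
  assumes s: "0 \<le> s"
  shows "distr M (path_space {0..s} \<Otimes>\<^sub>M path_space {0..}) (\<lambda>w. (past s w, shift_path s w)) =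
    distr M (path_space {0..s}) (past s) \<Otimes>\<^sub>M W"
proof (rule pair_measure_eqI[symmetric])
  note pm = past_meas[of s] and sm = shift_path_meas[OF s]
  interpret p: prob_space "distr M (path_space {0..s}) (past s)" by (rule prob_space_distr[OF pm])
  interpret W: prob_space W by (rule prob_space_W)
  show "sigma_finite_measure (distr M (path_space {0..s}) (past s))" "sigma_finite_measure W" by unfold_locales
  fix A B assume "A \<in> sets (distr M (path_space {0..s}) (past s))" "B \<in> sets W"
  then have A: "A \<in> sets (path_space {0..s})" and B: "B \<in> sets (path_space {0..})" by auto
  have pair: "(\<lambda>w. (past s w, shift_path s w)) \<in> measurable M (path_space {0..s} \<Otimes>\<^sub>M path_space {0..})"
    using pm sm by measurable
  have "(\<lambda>w. (past s w, shift_path s w)) -` (A \<times> B) \<inter> space M = (past s -` A \<inter> space M) \<inter> (shift_path s -` B \<inter> space M)"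
    by auto
  then show "emeasure (distr M (path_space {0..s}) (past s)) A * emeasure W B =
      emeasure (distr M (path_space {0..s} \<Otimes>\<^sub>M path_space {0..}) (\<lambda>w. (past s w, shift_path s w))) (A \<times> B)"
    using A B emeasure_past_shift_path[OF s A B] pair
    by (simp add: distr_shift_path[OF s, symmetric] emeasure_distr[OF pm A] emeasure_distr[OF sm B] emeasure_distr[OF pair])
qed (simp cong: sets_pair_measure_cong)

text \<open>The joint law of past and shifted path is a product, so Tonelli applies. A jointly
  measurable \<open>h\<close> is allowed because the level at which the future is observed will
  depend on the position reached at time \<open>s\<close>.\<close>

lemma markov_property:
  assumes s: "0 \<le> s" and h [measurable]: "h \<in> borel_measurable (path_space {0..s} \<Otimes>\<^sub>M path_space {0..})"
  shows "(\<integral>\<^sup>+w. h (past s w, shift_path s w) \<partial>M) = (\<integral>\<^sup>+w. \<integral>\<^sup>+\<omega>. h (past s w, \<omega>) \<partial>W \<partial>M)"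
proof -
  note pm = past_meas[of s] and sm = shift_path_meas[OF s]
  interpret W: prob_space W by (rule prob_space_W)
  have pair: "(\<lambda>w. (past s w, shift_path s w)) \<in> measurable M (path_space {0..s} \<Otimes>\<^sub>M path_space {0..})"
    using pm sm by measurable
  have h': "h \<in> borel_measurable (distr M (path_space {0..s}) (past s) \<Otimes>\<^sub>M W)"
    using h by (simp cong: measurable_cong_sets sets_pair_measure_cong)
  have "(\<integral>\<^sup>+w. h (past s w, shift_path s w) \<partial>M) = (\<integral>\<^sup>+q. h q \<partial>(distr M (path_space {0..s}) (past s) \<Otimes>\<^sub>M W))"
    unfolding distr_past_shift_path[OF s, symmetric] by (rule nn_integral_distr[OF pair, symmetric]) simp
  also have "\<dots> = (\<integral>\<^sup>+\<eta>. \<integral>\<^sup>+\<omega>. h (\<eta>, \<omega>) \<partial>W \<partial>(distr M (path_space {0..s}) (past s)))"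
    by (rule W.nn_integral_fst[OF h', symmetric])
  also have "\<dots> = (\<integral>\<^sup>+w. \<integral>\<^sup>+\<omega>. h (past s w, \<omega>) \<partial>W \<partial>M)"
    by (rule nn_integral_distr[OF pm]) measurable
  finally show ?thesis .
qed

end

section \<open>Approximate occupation densities\<close>

text \<open>\<open>A\<close> is absolutely continuous but need not be differentiable everywhere, so the fundamental theorem of
  calculus is replaced by the observation that \<open>A\<close> maps the measure \<open>V s ds\<close> to Lebesgue measure
  on the interval from \<open>0\<close> to \<open>A 0\<close>.\<close>

lemma nn_integral_exp_functional:
  fixes V :: "real \<Rightarrow> real" and C t \<mu> :: real
  defines "A \<equiv> (\<lambda>s. LINT u|lborel. indicator {s..<t} u * V u)"
  assumes V [measurable]: "V \<in> borel_measurable borel" and V0: "\<And>u. 0 \<le> V u" "\<And>u. V u \<le> C"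
    and t: "0 \<le> t" and \<mu>: "0 \<le> \<mu>"
  shows "ennreal (exp (\<mu> * A 0)) = 1 + (\<integral>\<^sup>+s. indicator {0..<t} s * ennreal (\<mu> * V s * exp (\<mu> * A s)) \<partial>lborel)"
proof -
  have C: "0 \<le> C" using V0[of 0] by linarith
  have int: "integrable lborel (\<lambda>u. indicator {a..<b} u * V u)" for a b
  proof (rule Bochner_Integration.integrable_bound)
    show "integrable lborel (\<lambda>u. indicator {a..<b} u * C)"
      by (cases "a \<le> b") (auto simp: integrable_indicator_iff)
  qed (use V0 C in \<open>auto split: split_indicator\<close>)
  have A_split: "A a = (LINT u|lborel. indicator {a..<b} u * V u) + A b" if "a \<le> b" "b \<le> t" for a b
    unfolding A_def using that
    by (subst Bochner_Integration.integral_add[symmetric, OF int int])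
      (auto intro!: Bochner_Integration.integral_cong split: split_indicator)
  have piece: "0 \<le> (LINT u|lborel. indicator {a..<b} u * V u)" "(LINT u|lborel. indicator {a..<b} u * V u) \<le> C * (b - a)" if "a \<le> b" for a b
  proof -
    show "0 \<le> (LINT u|lborel. indicator {a..<b} u * V u)"
      using V0 by (intro Bochner_Integration.integral_nonneg) auto
    have "(LINT u|lborel. indicator {a..<b} u * V u) \<le> (LINT u|lborel. indicator {a..<b} u * C)"
      by (intro integral_mono_AE' AE_I2) (use V0 C that in \<open>auto split: split_indicator simp: integrable_indicator_iff\<close>)
    then show "(LINT u|lborel. indicator {a..<b} u * V u) \<le> C * (b - a)" using that by (simp add: mult.commute)
  qed
  have A_anti: "A b \<le> A a" if "a \<le> b" "b \<le> t" for a b using A_split[OF that] piece(1)[OF that(1)] by linarith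
  have A0: "0 \<le> A s" for s
    unfolding A_def using V0 by (intro Bochner_Integration.integral_nonneg) auto
  have At: "A t = 0" by (simp add: A_def)
  have A_cont: "continuous_on {0..t} A"
  proof -
    have "C-lipschitz_on {0..t} A"
    proof (rule lipschitz_onI[OF _ C])
      fix a b assume ab: "a \<in> {0..t}" "b \<in> {0..t}"
      show "dist (A a) (A b) \<le> C * dist a b"
      proof (cases "a \<le> b")
        case True
        then show ?thesis using A_split[of a b] piece[of a b] ab by (auto simp: dist_real_def)
      next
        case False
        then show ?thesis using A_split[of b a] piece[of b a] ab by (auto simp: dist_real_def)
      qed
    qed
    then show ?thesis by (rule lipschitz_on_continuous_on)
  qed
  have A_meas [measurable]: "A \<in> borel_measurable borel"
  proof -
    have "(\<lambda>s. LINT u|lborel. (if s \<le> u \<and> u < t then 1 else 0) * V u) \<in> borel_measurable borel" by measurable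
    also have "(\<lambda>s. LINT u|lborel. (if s \<le> u \<and> u < t then 1 else 0) * V u) = A"
      unfolding A_def by (auto intro!: ext Bochner_Integration.integral_cong split: split_indicator)
    finally show ?thesis .
  qed
  define D where "D = distr (density lborel (\<lambda>s. ennreal (indicator {0..<t} s * V s))) borel A"
  define E where "E = density lborel (indicator {0..<A 0} :: real \<Rightarrow> ennreal)"
  have D_em: "emeasure D B = (\<integral>\<^sup>+s. ennreal (indicator {0..<t} s * V s) * indicator (A -` B) s \<partial>lborel)" if "B \<in> sets borel" for B
    unfolding D_def using that measurable_sets[OF A_meas, of B]
    by (subst emeasure_distr) (auto simp: emeasure_density)
  have nn: "(\<integral>\<^sup>+s. ennreal (indicator {0..<b} s * V s) \<partial>lborel) = ennreal (A 0 - A b)" if "0 \<le> b" "b \<le> t" for b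
    using A_split[of 0 b] that by (subst nn_integral_eq_integral[OF int]) (use V0 in auto)
  have D_gt: "emeasure D {c<..} = ennreal (A 0 - max 0 (min c (A 0)))" for c
  proof -
    consider "c < 0" | "A 0 \<le> c" "0 \<le> c" | "0 \<le> c" "c < A 0" by linarith
    then show ?thesis
    proof cases
      case 1
      have "emeasure D {c<..} = (\<integral>\<^sup>+s. ennreal (indicator {0..<t} s * V s) \<partial>lborel)"
        unfolding D_em[OF borel_open[OF open_greaterThan]]
      proof (rule nn_integral_cong)
        fix s show "ennreal (indicator {0..<t} s * V s) * indicator (A -` {c<..}) s = ennreal (indicator {0..<t} s * V s)"
          using A0[of s] 1 by (auto split: split_indicator)
      qed
      then show ?thesis using nn[of t] t 1 At A0[of 0] by (auto simp: max_def min_def)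
    next
      case 2
      have "emeasure D {c<..} = (\<integral>\<^sup>+s. 0 \<partial>(lborel :: real measure))"
        unfolding D_em[OF borel_open[OF open_greaterThan]]
      proof (rule nn_integral_cong)
        fix s show "ennreal (indicator {0..<t} s * V s) * indicator (A -` {c<..}) s = 0"
          using A_anti[of 0 s] 2 by (auto split: split_indicator)
      qed
      then show ?thesis using 2 A0[of 0] by (auto simp: max_def min_def)
    next
      \<comment> \<open>\<open>A\<close> decreases continuously from \<open>A 0\<close> to 0. With
        \<open>b\<close> the first time at which \<open>A\<close> is at most \<open>c\<close>, the
        set \<open>{s. c < A s}\<close> within \<open>{0..t}\<close> is \<open>{0..<b}\<close>, of
        mass \<open>A 0 - A b = A 0 - c\<close>.\<close>
      case 3
      have "compact {s \<in> {0..t}. A s \<le> c}"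
      proof -
        have "closed {s \<in> {0..t}. A s \<le> c}"
          using continuous_closed_preimage[OF A_cont closed_atLeastAtMost closed_atMost[of c]]
          by (simp add: vimage_def Int_def)
        then show ?thesis
          using compact_Int_closed[OF compact_Icc[of 0 t], of "{s \<in> {0..t}. A s \<le> c}"] by (simp add: Int_def conj_ac)
      qed
      moreover have "{s \<in> {0..t}. A s \<le> c} \<noteq> {}" using At t 3 by auto
      ultimately obtain b where b: "b \<in> {0..t}" "A b \<le> c" "\<And>s. s \<in> {0..t} \<Longrightarrow> A s \<le> c \<Longrightarrow> b \<le> s"
        using compact_attains_inf[of "{s \<in> {0..t}. A s \<le> c}"] by auto
      have "A b = c"
      proof -
        have "\<exists>x\<ge>0. x \<le> b \<and> A x = c"
          using b 3 A_cont by (intro IVT2') (auto intro: continuous_on_subset)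
        then obtain x where x: "0 \<le> x" "x \<le> b" "A x = c" by auto
        then have "b \<le> x" using b(1) by (intro b(3)) auto
        then show ?thesis using x by simp
      qed
      have "emeasure D {c<..} = (\<integral>\<^sup>+s. ennreal (indicator {0..<b} s * V s) \<partial>lborel)"
        unfolding D_em[OF borel_open[OF open_greaterThan]]
      proof (rule nn_integral_cong)
        fix s show "ennreal (indicator {0..<t} s * V s) * indicator (A -` {c<..}) s = ennreal (indicator {0..<b} s * V s)"
        proof (cases "0 \<le> s \<and> s < b")
          case True
          then have "s \<in> {0..t}" using b(1) by auto
          then have "c < A s" using b(3)[of s] True by linarith
          then show ?thesis using True b(1) by (auto split: split_indicator)
        next
          case False
          then show ?thesis using A_anti[of b s] b(1) \<open>A b = c\<close> by (auto split: split_indicator)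
        qed
      qed
      then show ?thesis using nn[of b] b \<open>A b = c\<close> 3 by (auto simp: max_def min_def)
    qed
  qed
  have E_gt: "emeasure E {c<..} = ennreal (A 0 - max 0 (min c (A 0)))" for c
  proof -
    have "emeasure E {c<..} = emeasure lborel ({0..<A 0} \<inter> {c<..})"
      unfolding E_def by (subst emeasure_density) (auto simp: indicator_inter_arith[symmetric])
    also have "\<dots> = emeasure lborel {max 0 (min c (A 0))<..<A 0}"
    proof (rule emeasure_eq_AE)
      show "AE r in lborel. r \<in> {0..<A 0} \<inter> {c<..} \<longleftrightarrow> r \<in> {max 0 (min c (A 0))<..<A 0}"
        using AE_lborel_singleton[of 0] by eventually_elim auto
    qed auto
    finally show ?thesis using A0[of 0] by simp
  qed
  have DE: "D = E"
    by (rule measure_eqI_lessThan) (auto simp: D_gt E_gt, auto simp: D_def E_def)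
  \<comment> \<open>Change of variables \<open>r = A s\<close>: the integral of \<open>V s\<close>
    against a function of \<open>A s\<close> becomes a Lebesgue integral over
    \<open>{0..<A 0}\<close>, where the exponential has an antiderivative.\<close>
  have "(\<integral>\<^sup>+s. indicator {0..<t} s * ennreal (\<mu> * V s * exp (\<mu> * A s)) \<partial>lborel) =
      (\<integral>\<^sup>+s. ennreal (indicator {0..<t} s * V s) * ennreal (\<mu> * exp (\<mu> * A s)) \<partial>lborel)"
    using V0 \<mu> by (intro nn_integral_cong) (auto simp: ennreal_mult[symmetric] ac_simps split: split_indicator)
  also have "\<dots> = (\<integral>\<^sup>+r. ennreal (\<mu> * exp (\<mu> * r)) \<partial>D)"
    unfolding D_def by (subst nn_integral_distr) (auto simp: nn_integral_density)
  also have "\<dots> = (\<integral>\<^sup>+r. indicator {0..<A 0} r * ennreal (\<mu> * exp (\<mu> * r)) \<partial>lborel)"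
    unfolding DE E_def by (subst nn_integral_density) auto
  also have "\<dots> = (\<integral>\<^sup>+r. ennreal (\<mu> * exp (\<mu> * r)) * indicator {0..A 0} r \<partial>lborel)"
  proof (rule nn_integral_cong_AE)
    show "AE r in lborel. indicator {0..<A 0} r * ennreal (\<mu> * exp (\<mu> * r)) = ennreal (\<mu> * exp (\<mu> * r)) * indicator {0..A 0} r"
      using AE_lborel_singleton[of "A 0"] by eventually_elim (auto split: split_indicator)
  qed
  also have "\<dots> = ennreal (exp (\<mu> * A 0) - exp (\<mu> * 0))"
    using A0[of 0] \<mu> by (intro nn_integral_FTC_Icc) (auto intro!: derivative_eq_intros)
  finally show ?thesis using A0[of 0] \<mu>
    by (simp add: ennreal_1[symmetric] ennreal_plus[symmetric] del: ennreal_1 ennreal_plus)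
qed

text \<open>The uniform probability density on an interval shrinking to 0; the occupation integral
  against it is a local average of the local time.\<close>

definition bump :: "nat \<Rightarrow> real \<Rightarrow> real" where
  "bump n y = real (Suc n) / 2 * indicator {- 1 / real (Suc n)<..<1 / real (Suc n)} y"

lemma bump_meas [measurable]: "bump n \<in> borel_measurable borel"
  unfolding bump_def by measurable

lemma bump_nonneg: "0 \<le> bump n y" and bump_le: "bump n y \<le> real (Suc n) / 2"
  by (auto simp: bump_def split: split_indicator)

lemma nn_integral_bump: "(\<integral>\<^sup>+y. ennreal (bump n y) \<partial>lborel) = 1"
proof -
  have "(\<integral>\<^sup>+y. ennreal (bump n y) \<partial>lborel) = (\<integral>\<^sup>+y. ennreal (real (Suc n) / 2) * indicator {- 1 / real (Suc n)<..<1 / real (Suc n)} y \<partial>lborel)"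
    by (intro nn_integral_cong) (auto simp: bump_def split: split_indicator)
  also have "\<dots> = ennreal (real (Suc n) / 2) * ennreal (2 / real (Suc n))"
    by (subst nn_integral_cmult_indicator) (auto simp: divide_simps)
  also have "\<dots> = 1" by (subst ennreal_mult[symmetric]) (auto simp del: of_nat_Suc)
  finally show ?thesis .
qed

text \<open>Paths are arbitrary at negative times, hence \<open>max 0 u\<close>.\<close>

definition occ :: "nat \<Rightarrow> real \<Rightarrow> real \<Rightarrow> (real \<Rightarrow> real) \<Rightarrow> real" where
  "occ n t v \<omega> = (LINT u|lborel. indicator {0..<t} u * bump n (v - \<omega> (max 0 u)))"

lemma occ_meas:
  assumes "T \<in> borel_measurable N" "V \<in> borel_measurable N" "X \<in> measurable N (path_space {0..})"
  shows "(\<lambda>x. occ n (T x) (V x) (X x)) \<in> borel_measurable N"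
proof -
  note [measurable] = assms
  have [measurable]: "(\<lambda>(x, u). X x (max 0 u)) \<in> borel_measurable (N \<Otimes>\<^sub>M borel)"
    using measurable_compose[OF _ measurable_path_eval, of "\<lambda>(x, u). (u, X x)" "N \<Otimes>\<^sub>M borel"]
    by (simp add: split_beta)
  have "(\<lambda>x. LINT u|lborel. (if 0 \<le> u \<and> u < T x then 1 else 0) * bump n (V x - X x (max 0 u))) \<in> borel_measurable N"
    by measurable
  also have "(\<lambda>x. LINT u|lborel. (if 0 \<le> u \<and> u < T x then 1 else 0) * bump n (V x - X x (max 0 u))) = (\<lambda>x. occ n (T x) (V x) (X x))"
    unfolding occ_def by (auto intro!: ext Bochner_Integration.integral_cong split: split_indicator)
  finally show ?thesis .
qed

lemma occ_nonneg: "0 \<le> occ n t v \<omega>"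
  unfolding occ_def by (intro Bochner_Integration.integral_nonneg) (auto simp: bump_nonneg)

lemma occ_le: "0 \<le> t \<Longrightarrow> occ n t v \<omega> \<le> t * (real (Suc n) / 2)"
proof -
  assume t: "0 \<le> t"
  have "occ n t v \<omega> \<le> (LINT u|lborel. indicator {0..<t} u * (real (Suc n) / 2))"
    unfolding occ_def
    by (intro integral_mono_AE' AE_I2) (use bump_le t in \<open>auto split: split_indicator simp: integrable_indicator_iff\<close>)
  then show ?thesis using t by simp
qed

lemma nn_integral_exp_Ioi:
  fixes c :: real assumes "0 < c"
  shows "(\<integral>\<^sup>+s. ennreal (exp (- c * s)) * indicator {0<..} s \<partial>lborel) = ennreal (1 / c)"
proof -
  have "(\<integral>\<^sup>+s. ennreal (exp (- c * s)) * indicator {0<..} s \<partial>lborel) = (\<integral>\<^sup>+s. ennreal (exp (- c * s)) * indicator {0..} s \<partial>lborel)"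
  proof (rule nn_integral_cong_AE)
    show "AE s in lborel. ennreal (exp (- c * s)) * indicator {0<..} s = ennreal (exp (- c * s)) * indicator {0..} s"
      using AE_lborel_singleton[of 0] by eventually_elim (auto split: split_indicator)
  qed
  also have "\<dots> = ennreal (0 - - exp (- c * 0) / c)"
  proof (rule nn_integral_FTC_atLeast)
    have "((\<lambda>s. - exp (- c * s) / c) \<longlongrightarrow> - 0 / c) at_top"
      by (intro tendsto_intros filterlim_compose[OF exp_at_bot])
        (rule filterlim_tendsto_neg_mult_at_bot[OF tendsto_const _ filterlim_ident], use assms in auto)
    then show "((\<lambda>s. - exp (- c * s) / c) \<longlongrightarrow> 0) at_top" by simp
  qed (use assms in \<open>auto intro!: derivative_eq_intros\<close>)
  finally show ?thesis by simp
qed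

section \<open>Transition densities and the resolvent density\<close>

locale levy_exponential = levy +
  fixes \<Psi> :: "real \<Rightarrow> real"
  assumes \<Psi>_nonneg: "\<And>q. 0 \<le> \<Psi> q"
    and \<Psi>_char: "\<And>t q. 0 \<le> t \<Longrightarrow> char (distr M borel (\<xi> t)) q = of_real (exp (- t * \<Psi> q))"
    and \<Psi>_int: "integrable lborel (\<lambda>q. 1 / (1 + \<Psi> q))"
begin

lemma \<Psi>_meas [measurable]: "\<Psi> \<in> borel_measurable borel"
proof -
  have [measurable]: "(\<lambda>q. 1 / (1 + \<Psi> q)) \<in> borel_measurable borel" using \<Psi>_int by auto
  have "(\<lambda>q. 1 / (1 / (1 + \<Psi> q)) - 1) \<in> borel_measurable borel" by measurable
  then show ?thesis by simp
qed

text \<open>The denominators \<open>1 + \<Psi> q\<close> and \<open>\<Psi> q + l\<close> are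
  comparable, with the constant \<open>max 1 (1 / l)\<close>.\<close>

lemma resolvent_int:
  assumes "0 < l" shows "integrable lborel (\<lambda>q. 1 / (\<Psi> q + l))"
proof (rule Bochner_Integration.integrable_bound)
  show "integrable lborel (\<lambda>q. max 1 (1 / l) * (1 / (1 + \<Psi> q)))" by (intro integrable_mult_right \<Psi>_int)
  show "AE q in lborel. norm (1 / (\<Psi> q + l)) \<le> norm (max 1 (1 / l) * (1 / (1 + \<Psi> q)))"
  proof (rule AE_I2)
    fix q
    have "1 + \<Psi> q \<le> max 1 (1 / l) * (\<Psi> q + l)"
    proof (cases "1 \<le> l")
      case True
      then show ?thesis using \<Psi>_nonneg[of q] assms by (simp add: max_def divide_simps)
    next
      case False
      then have "\<Psi> q * l \<le> \<Psi> q * 1" using \<Psi>_nonneg[of q] assms by (intro mult_left_mono) auto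
      then show ?thesis using False assms by (simp add: max_def divide_simps algebra_simps)
    qed
    then have "1 / (\<Psi> q + l) \<le> max 1 (1 / l) / (1 + \<Psi> q)"
      using assms \<Psi>_nonneg[of q] by (subst pos_divide_le_eq) (auto simp: field_simps)
    then show "norm (1 / (\<Psi> q + l)) \<le> norm (max 1 (1 / l) * (1 / (1 + \<Psi> q)))"
      using assms \<Psi>_nonneg[of q] by (auto simp: abs_mult)
  qed
qed auto

text \<open>From \<open>exp (- y) \<le> 1 / (1 + y)\<close> with \<open>y = s * \<Psi> q\<close>, a
  multiple of the resolvent at \<open>1 / s\<close>.\<close>

lemma exp_\<Psi>_int:
  assumes "0 < s" shows "integrable lborel (\<lambda>q. exp (- s * \<Psi> q))"
proof (rule Bochner_Integration.integrable_bound)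
  show "integrable lborel (\<lambda>q. (1 / s) * (1 / (\<Psi> q + 1 / s)))" using assms by (intro integrable_mult_right resolvent_int) auto
  show "AE q in lborel. norm (exp (- s * \<Psi> q)) \<le> norm ((1 / s) * (1 / (\<Psi> q + 1 / s)))"
  proof (rule AE_I2)
    fix q
    have "exp (- s * \<Psi> q) = 1 / exp (s * \<Psi> q)" by (simp add: exp_minus field_simps)
    also have "\<dots> \<le> 1 / (1 + s * \<Psi> q)"
      using exp_ge_add_one_self[of "s * \<Psi> q"] assms \<Psi>_nonneg[of q] by (intro divide_left_mono mult_pos_pos) (auto simp: add_pos_nonneg)
    also have "\<dots> = (1 / s) * (1 / (\<Psi> q + 1 / s))" using assms by (simp add: field_simps)
    finally have "exp (- s * \<Psi> q) \<le> \<bar>(1 / s) * (1 / (\<Psi> q + 1 / s))\<bar>" by linarith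
    then show "norm (exp (- s * \<Psi> q)) \<le> norm ((1 / s) * (1 / (\<Psi> q + 1 / s)))"
      by (simp only: real_norm_def abs_of_nonneg exp_ge_zero)
  qed
qed auto

text \<open>\<open>g s\<close> is the density of \<open>\<xi> s\<close>, and \<open>u l\<close> is the density of the resolvent, i.e. the function
  $\psi_l$ of the paper.\<close>

definition g :: "real \<Rightarrow> real \<Rightarrow> real" where "g s = cos_transform (\<lambda>q. exp (- s * \<Psi> q))"
definition u :: "real \<Rightarrow> real \<Rightarrow> real" where "u l = cos_transform (\<lambda>q. 1 / (\<Psi> q + l))"

lemma g_meas [measurable]: "(\<lambda>(s, v). g s v) \<in> borel_measurable (borel \<Otimes>\<^sub>M borel)"
  unfolding g_def cos_transform_def by measurable

lemma integrable_real_char_\<xi>: "0 < s \<Longrightarrow> integrable_real_char (distr M borel (\<xi> s)) (\<lambda>q. exp (- s * \<Psi> q))"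
  by (intro integrable_real_char.intro real_distribution_distr integrable_real_char_axioms.intro \<Psi>_char exp_\<Psi>_int \<xi>_meas) auto

lemma distr_\<xi>: "0 < s \<Longrightarrow> distr M borel (\<xi> s) = density lborel (\<lambda>v. ennreal (g s v))"
  using integrable_real_char.density_eq[OF integrable_real_char_\<xi>] by (simp add: g_def)

lemma g_nonneg: "0 < s \<Longrightarrow> 0 \<le> g s v"
  using integrable_real_char.g_nonneg[OF integrable_real_char_\<xi>] by (simp add: g_def)

lemma g_le: "0 < s \<Longrightarrow> g s v \<le> g s 0"
  using integrable_real_char.g_le[OF integrable_real_char_\<xi>] by (simp add: g_def)

lemma g_cont: "0 < s \<Longrightarrow> isCont (g s) v"
  unfolding g_def using continuous_cos_transform[OF exp_\<Psi>_int] by (simp add: continuous_on_eq_continuous_at)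

lemma u_meas [measurable]: "u l \<in> borel_measurable borel"
  unfolding u_def cos_transform_def by measurable

text \<open>Supplies the strict positivity that the renewal theorem asks of its kernel: an integrand
  positive everywhere cannot have integral 0.\<close>

lemma g_0_pos:
  assumes "0 < s" shows "0 < g s 0"
proof -
  have "0 \<noteq> (LINT q|lborel. exp (- s * \<Psi> q))"
  proof
    assume "0 = (LINT q|lborel. exp (- s * \<Psi> q))"
    then have "AE q in lborel. exp (- s * \<Psi> q) = 0"
      by (subst (asm) eq_commute, subst (asm) integral_nonneg_eq_0_iff_AE[OF exp_\<Psi>_int[OF assms]]) auto
    then have "AE q::real in lborel. \<not> (0 < q \<and> q < 1)" by eventually_elim simp
    then show False using not_AE_interval[of 0 1] by simp
  qed
  moreover have "0 \<le> (LINT q|lborel. exp (- s * \<Psi> q))" by (intro Bochner_Integration.integral_nonneg) auto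
  ultimately have "0 < (LINT q|lborel. exp (- s * \<Psi> q))" by linarith
  then show ?thesis by (simp add: g_def cos_transform_def)
qed

text \<open>Integrating \<open>exp (- (\<Psi> q + l) * s)\<close> over \<open>s\<close> first gives
  \<open>1 / (\<Psi> q + l)\<close>; Fubini is justified because this is integrable in
  \<open>q\<close>. The equation is what makes the renewal kernel have mass
  \<open>\<mu> * u \<nu> 0\<close>.\<close>

lemma laplace_g:
  assumes l: "0 < l"
  shows "integrable lborel (\<lambda>s. indicator {0<..} s * (exp (- l * s) * g s v))"
    and "(LINT s|lborel. indicator {0<..} s * (exp (- l * s) * g s v)) = u l v"
proof -
  let ?f = "\<lambda>s q. indicator {0<..} s * (exp (- (\<Psi> q + l) * s) * cos (q * v) / (2 * pi))"
  have pt: "(\<integral>\<^sup>+s. ennreal (indicator {0<..} s * exp (- (\<Psi> q + l) * s)) \<partial>lborel) = ennreal (1 / (\<Psi> q + l))" for q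
    using nn_integral_exp_Ioi[of "\<Psi> q + l"] l \<Psi>_nonneg[of q]
    by (simp add: add_nonneg_pos mult.commute[of _ "indicator _ _"] ennreal_indicator ennreal_mult)
  have pt_int: "integrable lborel (\<lambda>s. indicator {0<..} s * exp (- (\<Psi> q + l) * s))" for q
    using pt[of q] by (intro integrableI_bounded) auto
  have pt_LINT: "(LINT s|lborel. indicator {0<..} s * exp (- (\<Psi> q + l) * s)) = 1 / (\<Psi> q + l)" for q
    using pt[of q] l \<Psi>_nonneg[of q] by (subst integral_eq_nn_integral) (auto simp: add_nonneg_pos)
  have int: "integrable (lborel \<Otimes>\<^sub>M lborel) (\<lambda>(q, s). ?f s q)"
  proof (rule lborel_pair.Fubini_integrable)
    show "(\<lambda>(q, s). ?f s q) \<in> borel_measurable (lborel \<Otimes>\<^sub>M lborel)" by measurable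
    have n: "norm (?f s q) = (\<bar>cos (q * v)\<bar> / (2 * pi)) * (indicator {0<..} s * exp (- (\<Psi> q + l) * s))" for q s
      by (simp add: abs_mult split: split_indicator)
    have "integrable lborel (\<lambda>q. \<bar>cos (q * v)\<bar> / (2 * pi) * (1 / (\<Psi> q + l)))"
    proof (rule Bochner_Integration.integrable_bound[OF resolvent_int[OF l]])
      show "AE q in lborel. norm (\<bar>cos (q * v)\<bar> / (2 * pi) * (1 / (\<Psi> q + l))) \<le> norm (1 / (\<Psi> q + l))"
      proof (rule AE_I2)
        fix q
        have "\<bar>cos (q * v)\<bar> / (2 * pi) \<le> 1" using pi_gt3 abs_cos_le_one[of "q * v"] by (simp add: divide_le_eq del: abs_cos_le_one)
        then have "\<bar>cos (q * v)\<bar> / (2 * pi) * (1 / (\<Psi> q + l)) \<le> 1 * (1 / (\<Psi> q + l))"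
          using l \<Psi>_nonneg[of q] by (intro mult_right_mono) auto
        then show "norm (\<bar>cos (q * v)\<bar> / (2 * pi) * (1 / (\<Psi> q + l))) \<le> norm (1 / (\<Psi> q + l))"
          using l \<Psi>_nonneg[of q] by (simp add: abs_mult)
      qed
    qed measurable
    moreover have "(LINT s|lborel. norm (?f s q)) = \<bar>cos (q * v)\<bar> / (2 * pi) * (1 / (\<Psi> q + l))" for q
      unfolding n pt_LINT[symmetric] by (rule integral_mult_right_zero)
    ultimately show "integrable lborel (\<lambda>q. LINT s|lborel. norm (case (q, s) of (q, s) \<Rightarrow> ?f s q))" by simp
    show "AE q in lborel. integrable lborel (\<lambda>s. case (q, s) of (q, s) \<Rightarrow> ?f s q)"
      unfolding prod.case by (intro AE_I2, subst integrable_norm_iff[symmetric], measurable, unfold n)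
        (intro integrable_mult_right pt_int)
  qed
  have eq: "indicator {0<..} s * (exp (- l * s) * g s v) = (LINT q|lborel. ?f s q)" for s
  proof -
    have "(LINT q|lborel. ?f s q) = (LINT q|lborel. (indicator {0<..} s * exp (- l * s) / (2 * pi)) * (cos (q * v) * exp (- s * \<Psi> q)))"
      by (intro Bochner_Integration.integral_cong) (auto simp: algebra_simps exp_add[symmetric] exp_diff[symmetric])
    also have "\<dots> = (indicator {0<..} s * exp (- l * s) / (2 * pi)) * (LINT q|lborel. cos (q * v) * exp (- s * \<Psi> q))"
      by (rule integral_mult_right_zero)
    also have "\<dots> = indicator {0<..} s * (exp (- l * s) * g s v)"
      unfolding g_def cos_transform_def by (simp only: times_divide_eq_right times_divide_eq_left mult.assoc)
    finally show ?thesis by (rule sym)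
  qed
  show "integrable lborel (\<lambda>s. indicator {0<..} s * (exp (- l * s) * g s v))"
    unfolding eq using lborel_pair.integrable_snd[OF int] by simp
  have "(LINT s|lborel. indicator {0<..} s * (exp (- l * s) * g s v)) = (LINT q|lborel. LINT s|lborel. ?f s q)"
    unfolding eq using lborel_pair.Fubini_integral[OF int] by simp
  also have "\<dots> = (LINT q|lborel. cos (q * v) / (2 * pi) * (1 / (\<Psi> q + l)))"
  proof (rule Bochner_Integration.integral_cong[OF refl])
    fix q
    have "(LINT s|lborel. ?f s q) = (LINT s|lborel. cos (q * v) / (2 * pi) * (indicator {0<..} s * exp (- (\<Psi> q + l) * s)))"
      by (intro Bochner_Integration.integral_cong) auto
    also have "\<dots> = cos (q * v) / (2 * pi) * (1 / (\<Psi> q + l))"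
      unfolding pt_LINT[symmetric] by (rule integral_mult_right_zero)
    finally show "(LINT s|lborel. ?f s q) = cos (q * v) / (2 * pi) * (1 / (\<Psi> q + l))" .
  qed
  also have "\<dots> = (LINT q|lborel. cos (q * v) * (1 / (\<Psi> q + l)) / (2 * pi))"
    by (intro Bochner_Integration.integral_cong) auto
  also have "\<dots> = u l v" unfolding u_def cos_transform_def by (rule integral_divide_zero)
  finally show "(LINT s|lborel. indicator {0<..} s * (exp (- l * s) * g s v)) = u l v" .
qed

lemma nn_laplace_g:
  assumes "0 < l"
  shows "(\<integral>\<^sup>+s. indicator {0<..} s * ennreal (exp (- l * s) * g s v) \<partial>lborel) = ennreal (u l v)"
proof -
  have "(\<integral>\<^sup>+s. indicator {0<..} s * ennreal (exp (- l * s) * g s v) \<partial>lborel) =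
      (\<integral>\<^sup>+s. ennreal (indicator {0<..} s * (exp (- l * s) * g s v)) \<partial>lborel)"
    by (intro nn_integral_cong) (auto split: split_indicator)
  also have "\<dots> = ennreal (u l v)"
    unfolding laplace_g(2)[OF assms, symmetric]
    by (intro nn_integral_eq_integral laplace_g(1)[OF assms]) (auto intro!: AE_I2 mult_nonneg_nonneg g_nonneg split: split_indicator)
  finally show ?thesis .
qed

lemma u_nonneg: "0 < l \<Longrightarrow> 0 \<le> u l v"
  unfolding laplace_g(2)[symmetric]
  by (intro Bochner_Integration.integral_nonneg) (auto split: split_indicator intro!: mult_nonneg_nonneg g_nonneg)

text \<open>Supplies the contraction constant in \<open>Zn_bound\<close>. The integrands decrease to
  0 and are dominated by the one at \<open>l = 1\<close>.\<close>

lemma u_tendsto_0: "(\<lambda>n. u (real (Suc n)) 0) \<longlonglongrightarrow> 0"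
proof -
  have "(\<lambda>n. LINT q|lborel. 1 / (\<Psi> q + real (Suc n))) \<longlonglongrightarrow> (LINT q|(lborel :: real measure). 0)"
  proof (rule integral_dominated_convergence[where w="\<lambda>q. 1 / (1 + \<Psi> q)"])
    show "AE q in lborel. (\<lambda>n. 1 / (\<Psi> q + real (Suc n))) \<longlonglongrightarrow> 0"
    proof (rule AE_I2)
      fix q
      have "filterlim (\<lambda>n. \<Psi> q + real (Suc n)) at_top sequentially"
        by (rule filterlim_tendsto_add_at_top[OF tendsto_const]) (rule filterlim_compose[OF filterlim_real_sequentially filterlim_Suc])
      then show "(\<lambda>n. 1 / (\<Psi> q + real (Suc n))) \<longlonglongrightarrow> 0"
        by (intro tendsto_divide_0[OF tendsto_const] filterlim_at_top_imp_at_infinity)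
    qed
    show "AE q in lborel. norm (1 / (\<Psi> q + real (Suc n))) \<le> 1 / (1 + \<Psi> q)" for n
    proof (rule AE_I2)
      fix q show "norm (1 / (\<Psi> q + real (Suc n))) \<le> 1 / (1 + \<Psi> q)"
        using \<Psi>_nonneg[of q] by (auto intro!: divide_left_mono mult_pos_pos)
    qed
  qed (use \<Psi>_int in auto)
  then have "(\<lambda>n. (LINT q|lborel. 1 / (\<Psi> q + real (Suc n))) / (2 * pi)) \<longlonglongrightarrow> 0 / (2 * pi)"
    by (intro tendsto_intros) auto
  then show ?thesis by (simp add: u_def cos_transform_def)
qed

end

section \<open>Exponential moments of mollified occupation times\<close>

context levy begin

text \<open>Additivity of occupation: the time spent near \<open>v\<close> after \<open>s\<close> is
  the time the shifted path spends near \<open>v - \<xi> s w\<close>.\<close>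

lemma occ_shift_path:
  assumes s: "0 \<le> s"
  shows "(LINT r|lborel. indicator {s..<t} r * bump n (v - full_path w (max 0 r))) =
    occ n (t - s) (v - \<xi> s w) (shift_path s w)"
proof -
  have "(LINT r|lborel. indicator {s..<t} r * bump n (v - full_path w (max 0 r))) =
      (LINT r|lborel. indicator {s..<t} (s + r) * bump n (v - full_path w (max 0 (s + r))))"
    using lborel_integral_real_affine[of 1 "\<lambda>r. indicator {s..<t} r * bump n (v - full_path w (max 0 r))" s] by simp
  also have "\<dots> = occ n (t - s) (v - \<xi> s w) (shift_path s w)"
    unfolding occ_def
  proof (rule Bochner_Integration.integral_cong[OF refl])
    fix r
    show "indicator {s..<t} (s + r) * bump n (v - full_path w (max 0 (s + r))) =
      indicator {0..<t - s} r * bump n (v - \<xi> s w - shift_path s w (max 0 r))"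
    proof (cases "0 \<le> r \<and> r < t - s")
      case True
      then show ?thesis using s by (simp add: full_path_def shift_path_def shifted_def algebra_simps)
    next
      case False
      then show ?thesis by (auto split: split_indicator)
    qed
  qed
  finally show ?thesis .
qed

lemma nn_integral_W: "f \<in> borel_measurable (path_space {0..}) \<Longrightarrow> (\<integral>\<^sup>+\<omega>. f \<omega> \<partial>W) = (\<integral>\<^sup>+w. f (full_path w) \<partial>M)"
  unfolding W_def by (rule nn_integral_distr[OF full_path_meas]) simp

definition Zn :: "nat \<Rightarrow> real \<Rightarrow> real \<Rightarrow> real \<Rightarrow> ennreal" where
  "Zn n \<mu> t v = (\<integral>\<^sup>+\<omega>. ennreal (exp (\<mu> * occ n t v \<omega>)) \<partial>W)"

lemma Zn_meas: "(\<lambda>(t, v). Zn n \<mu> t v) \<in> borel_measurable (borel \<Otimes>\<^sub>M borel)"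
proof -
  interpret W: prob_space W by (rule prob_space_W)
  have [measurable]: "(\<lambda>(x, \<omega>). occ n (fst x) (snd x) \<omega>) \<in> borel_measurable ((borel \<Otimes>\<^sub>M borel) \<Otimes>\<^sub>M W)"
    unfolding split_beta by (rule occ_meas) (auto intro: measurable_compose[OF measurable_snd])
  show ?thesis unfolding Zn_def split_beta by measurable
qed

lemma Zn_le: "0 \<le> t \<Longrightarrow> 0 \<le> \<mu> \<Longrightarrow> Zn n \<mu> t v \<le> ennreal (exp (\<mu> * (t * (real (Suc n) / 2))))"
proof -
  assume t: "0 \<le> t" and \<mu>: "0 \<le> \<mu>"
  interpret W: prob_space W by (rule prob_space_W)
  have "Zn n \<mu> t v \<le> (\<integral>\<^sup>+\<omega>. ennreal (exp (\<mu> * (t * (real (Suc n) / 2)))) \<partial>W)"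
    unfolding Zn_def using mult_left_mono[OF occ_le[OF t] \<mu>] by (intro nn_integral_mono ennreal_leI) simp
  then show ?thesis by (simp add: W.emeasure_space_1)
qed

end

context levy_exponential begin

text \<open>Expanding the exponential by \<open>nn_integral_exp_functional\<close> singles out a
  time \<open>s\<close> at which the path is near \<open>v\<close>, with the occupation after
  \<open>s\<close> in the exponent. The Markov property at \<open>s\<close> turns this exponential
  into \<open>Zn n \<mu> (t - s)\<close> at the level seen from the position
  \<open>\<xi> s\<close>.\<close>

lemma Zn_volterra:
  assumes t: "0 \<le> t" and \<mu>: "0 \<le> \<mu>"
  shows "Zn n \<mu> t v = 1 + (\<integral>\<^sup>+s. indicator {0<..<t} s *
    (\<integral>\<^sup>+z. ennreal (\<mu> * g s (v - z) * bump n z) * Zn n \<mu> (t - s) z \<partial>lborel) \<partial>lborel)"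
proof -
  interpret W: prob_space W by (rule prob_space_W)
  interpret MB: pair_sigma_finite M lborel ..
  have ev [measurable]: "(\<lambda>(w, r). full_path w (max 0 r)) \<in> borel_measurable (M \<Otimes>\<^sub>M borel)"
  proof -
    have "(\<lambda>(w, r). (r, full_path w)) \<in> measurable (M \<Otimes>\<^sub>M borel) (borel \<Otimes>\<^sub>M path_space {0..})"
      using full_path_meas by measurable
    from measurable_compose[OF this measurable_path_eval] show ?thesis by (simp add: split_beta)
  qed
  \<comment> \<open>The occupation still to come after time \<open>s\<close>.\<close>
  define A where "A w s = (LINT r|lborel. indicator {s..<t} r * bump n (v - full_path w (max 0 r)))" for w s
  have A_meas [measurable]: "(\<lambda>(w, s). A w s) \<in> borel_measurable (M \<Otimes>\<^sub>M borel)"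
  proof -
    have [measurable]: "(\<lambda>x. full_path (fst (fst x)) (max 0 (snd x))) \<in> borel_measurable ((M \<Otimes>\<^sub>M borel) \<Otimes>\<^sub>M lborel)"
    proof -
      have "(\<lambda>x. (fst (fst x), snd x)) \<in> measurable ((M \<Otimes>\<^sub>M (borel :: real measure)) \<Otimes>\<^sub>M lborel) (M \<Otimes>\<^sub>M borel)"
        by measurable
      from measurable_compose[OF this ev] show ?thesis by (simp add: split_beta)
    qed
    have "(\<lambda>x. LINT r|lborel. (if snd x \<le> r \<and> r < t then 1 else 0) * bump n (v - full_path (fst x) (max 0 r))) \<in> borel_measurable (M \<Otimes>\<^sub>M borel)"
      by measurable
    also have "(\<lambda>x. LINT r|lborel. (if snd x \<le> r \<and> r < t then 1 else 0) * bump n (v - full_path (fst x) (max 0 r))) = (\<lambda>(w, s). A w s)"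
      unfolding A_def by (auto intro!: ext Bochner_Integration.integral_cong split: split_indicator)
    finally show ?thesis .
  qed
  have sec: "(\<lambda>r. full_path w (max 0 r)) \<in> borel_measurable borel" if "w \<in> space M" for w
    using measurable_compose[OF measurable_Pair1'[OF that] ev] by simp
  have "Zn n \<mu> t v = (\<integral>\<^sup>+w. ennreal (exp (\<mu> * occ n t v (full_path w))) \<partial>M)"
    unfolding Zn_def by (rule nn_integral_W) (intro measurable_compose[OF _ measurable_ennreal] borel_measurable_exp borel_measurable_times borel_measurable_const measurable_compose[OF _ borel_measurable_exp] occ_meas measurable_ident_sets refl measurable_const, auto)
  also have "\<dots> = (\<integral>\<^sup>+w. 1 + (\<integral>\<^sup>+s. indicator {0..<t} s * ennreal (\<mu> * bump n (v - full_path w (max 0 s)) * exp (\<mu> * A w s)) \<partial>lborel) \<partial>M)"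
  proof (rule nn_integral_cong)
    fix w assume w: "w \<in> space M"
    note [measurable] = sec[OF w]
    show "ennreal (exp (\<mu> * occ n t v (full_path w))) = 1 + (\<integral>\<^sup>+s. indicator {0..<t} s * ennreal (\<mu> * bump n (v - full_path w (max 0 s)) * exp (\<mu> * A w s)) \<partial>lborel)"
      using nn_integral_exp_functional[of "\<lambda>s. bump n (v - full_path w (max 0 s))" "real (Suc n) / 2" t \<mu>] t \<mu> bump_nonneg bump_le
      unfolding A_def occ_def by simp
  qed
  also have "\<dots> = 1 + (\<integral>\<^sup>+w. \<integral>\<^sup>+s. indicator {0..<t} s * ennreal (\<mu> * bump n (v - full_path w (max 0 s)) * exp (\<mu> * A w s)) \<partial>lborel \<partial>M)"
    by (subst nn_integral_add) (auto simp: emeasure_space_1)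
  also have "(\<integral>\<^sup>+w. \<integral>\<^sup>+s. indicator {0..<t} s * ennreal (\<mu> * bump n (v - full_path w (max 0 s)) * exp (\<mu> * A w s)) \<partial>lborel \<partial>M) =
      (\<integral>\<^sup>+s. \<integral>\<^sup>+w. indicator {0..<t} s * ennreal (\<mu> * bump n (v - full_path w (max 0 s)) * exp (\<mu> * A w s)) \<partial>M \<partial>lborel)"
    by (rule MB.Fubini'[symmetric]) measurable
  also have "\<dots> = (\<integral>\<^sup>+s. indicator {0<..<t} s *
      (\<integral>\<^sup>+z. ennreal (\<mu> * g s (v - z) * bump n z) * Zn n \<mu> (t - s) z \<partial>lborel) \<partial>lborel)"
  proof (rule nn_integral_cong_AE)
    have main: "(\<integral>\<^sup>+w. ennreal (\<mu> * bump n (v - full_path w (max 0 s)) * exp (\<mu> * A w s)) \<partial>M) =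
        (\<integral>\<^sup>+z. ennreal (\<mu> * g s (v - z) * bump n z) * Zn n \<mu> (t - s) z \<partial>lborel)" if s: "0 < s" "s < t" for s
    proof -
      have Zm: "(\<lambda>z. Zn n \<mu> (t - s) z) \<in> borel_measurable borel"
        using measurable_compose[OF measurable_Pair1'[of "t - s" borel borel] Zn_meas] by simp
      have [measurable]: "\<xi> s \<in> borel_measurable M" using s by (intro \<xi>_meas) auto
      define h where "h = (\<lambda>(\<eta> :: real \<Rightarrow> real, \<omega>). ennreal (\<mu> * bump n (v - \<eta> s) * exp (\<mu> * occ n (t - s) (v - \<eta> s) \<omega>)))"
      have h: "h \<in> borel_measurable (path_space {0..s} \<Otimes>\<^sub>M path_space {0..})"
      proof -
        have [measurable]: "(\<lambda>x. fst x s) \<in> borel_measurable (path_space {0..s} \<Otimes>\<^sub>M path_space {0..})"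
          using s by (intro measurable_compose[OF measurable_fst measurable_path_space_eval]) auto
        have [measurable]: "(\<lambda>x. occ n (t - s) (v - fst x s) (snd x)) \<in> borel_measurable (path_space {0..s} \<Otimes>\<^sub>M path_space {0..})"
          by (rule occ_meas) measurable
        show ?thesis unfolding h_def split_beta by measurable
      qed
      have "(\<integral>\<^sup>+w. ennreal (\<mu> * bump n (v - full_path w (max 0 s)) * exp (\<mu> * A w s)) \<partial>M) =
          (\<integral>\<^sup>+w. h (past s w, shift_path s w) \<partial>M)"
        unfolding A_def occ_shift_path[OF less_imp_le[OF s(1)]] h_def
        using s by (intro nn_integral_cong) (simp add: past_def full_path_def)
      also have "\<dots> = (\<integral>\<^sup>+w. \<integral>\<^sup>+\<omega>. h (past s w, \<omega>) \<partial>W \<partial>M)"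
        using s by (intro markov_property h) auto
      also have "\<dots> = (\<integral>\<^sup>+w. ennreal (\<mu> * bump n (v - \<xi> s w)) * Zn n \<mu> (t - s) (v - \<xi> s w) \<partial>M)"
      proof (rule nn_integral_cong)
        fix w
        have "(\<integral>\<^sup>+\<omega>. h (past s w, \<omega>) \<partial>W) = (\<integral>\<^sup>+\<omega>. ennreal (\<mu> * bump n (v - \<xi> s w)) * ennreal (exp (\<mu> * occ n (t - s) (v - \<xi> s w) \<omega>)) \<partial>W)"
          unfolding h_def using s \<mu> bump_nonneg by (intro nn_integral_cong) (simp add: past_def ennreal_mult)
        also have "\<dots> = ennreal (\<mu> * bump n (v - \<xi> s w)) * Zn n \<mu> (t - s) (v - \<xi> s w)"
          unfolding Zn_def
        proof (rule nn_integral_cmult)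
          have [measurable]: "(\<lambda>\<omega>. occ n (t - s) (v - \<xi> s w) \<omega>) \<in> borel_measurable W"
            by (rule occ_meas) auto
          show "(\<lambda>\<omega>. ennreal (exp (\<mu> * occ n (t - s) (v - \<xi> s w) \<omega>))) \<in> borel_measurable W" by measurable
        qed
        finally show "(\<integral>\<^sup>+\<omega>. h (past s w, \<omega>) \<partial>W) = ennreal (\<mu> * bump n (v - \<xi> s w)) * Zn n \<mu> (t - s) (v - \<xi> s w)" .
      qed
      also have "\<dots> = (\<integral>\<^sup>+y. ennreal (\<mu> * bump n (v - y)) * Zn n \<mu> (t - s) (v - y) \<partial>(distr M borel (\<xi> s)))"
        by (rule nn_integral_distr[symmetric]) (use Zm in measurable)
      also have "\<dots> = (\<integral>\<^sup>+y. ennreal (g s y) * (ennreal (\<mu> * bump n (v - y)) * Zn n \<mu> (t - s) (v - y)) \<partial>lborel)"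
        unfolding distr_\<xi>[OF s(1)] by (rule nn_integral_density) (use Zm in measurable)
      \<comment> \<open>The reflection \<open>z = v - y\<close> moves the window of
        \<open>bump\<close> to 0, so that the limit in \<open>n\<close> will localize at
        \<open>z = 0\<close>.\<close>
      also have "\<dots> = (\<integral>\<^sup>+z. ennreal (g s (v - z)) * (ennreal (\<mu> * bump n (v - (v - z))) * Zn n \<mu> (t - s) (v - (v - z))) \<partial>lborel)"
        by (rule nn_integral_lborel_reflect[symmetric, of "\<lambda>y. ennreal (g s y) * (ennreal (\<mu> * bump n (v - y)) * Zn n \<mu> (t - s) (v - y))"]) (use Zm in measurable)
      also have "\<dots> = (\<integral>\<^sup>+z. ennreal (\<mu> * g s (v - z) * bump n z) * Zn n \<mu> (t - s) z \<partial>lborel)"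
        using \<mu> bump_nonneg g_nonneg[OF s(1)]
        by (intro nn_integral_cong) (simp add: ennreal_mult ac_simps)
      finally show ?thesis .
    qed
    show "AE s in lborel. (\<integral>\<^sup>+w. indicator {0..<t} s * ennreal (\<mu> * bump n (v - full_path w (max 0 s)) * exp (\<mu> * A w s)) \<partial>M) =
      indicator {0<..<t} s * (\<integral>\<^sup>+z. ennreal (\<mu> * g s (v - z) * bump n z) * Zn n \<mu> (t - s) z \<partial>lborel)"
      \<comment> \<open>At \<open>s = 0\<close> the process sits at 0 and its law has no
        density.\<close>
      using AE_lborel_singleton[of 0]
    proof eventually_elim
      case (elim s)
      show ?case
      proof (cases "0 < s \<and> s < t")
        case True
        then show ?thesis using main[of s] by simp
      next
        case False
        then show ?thesis using elim by (auto split: split_indicator)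
      qed
    qed
  qed
  finally show ?thesis .
qed

text \<open>Choose \<open>l\<close> such that \<open>\<mu> * u l 0 \<le> 1/2\<close>. The supremum \<open>S\<close> of \<open>exp (- l * t) * Zn n \<mu> t v\<close> over
  bounded times is finite for each \<open>n\<close> and satisfies \<open>S \<le> 1 + S / 2\<close>, whence \<open>S \<le> 2\<close> uniformly in \<open>n\<close>.\<close>

lemma Zn_bound:
  assumes \<mu>: "0 \<le> \<mu>"
  shows "\<exists>l>0. \<forall>n t v. 0 \<le> t \<longrightarrow> Zn n \<mu> t v \<le> ennreal (2 * exp (l * t))"
proof -
  have "(\<lambda>n. \<mu> * u (real (Suc n)) 0) \<longlonglongrightarrow> \<mu> * 0" by (intro tendsto_intros u_tendsto_0)
  then have "eventually (\<lambda>n. \<mu> * u (real (Suc n)) 0 < 1 / 2) sequentially"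
    by (rule order_tendstoD) simp
  then obtain m where m: "\<mu> * u (real (Suc m)) 0 < 1 / 2" by (auto simp: eventually_sequentially)
  define l where "l = real (Suc m)"
  have l: "0 < l" "\<mu> * u l 0 < 1 / 2" using m by (auto simp: l_def)
  have "Zn n \<mu> T x \<le> ennreal (2 * exp (l * T))" if T: "0 \<le> T" for n T x
  proof -
    define F where "F t v = ennreal (exp (- l * t)) * Zn n \<mu> t v" for t v
    define S where "S = (SUP q\<in>{0..T} \<times> UNIV. F (fst q) (snd q))"
    have FS: "F t v \<le> S" if "0 \<le> t" "t \<le> T" for t v
      unfolding S_def using that by (intro SUP_upper2[of "(t, v)"]) auto
    have "S \<le> ennreal (exp (\<mu> * (T * (real (Suc n) / 2))))"
      unfolding S_def
    proof (rule SUP_least)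
      fix q :: "real \<times> real" assume q: "q \<in> {0..T} \<times> UNIV"
      then have t: "0 \<le> fst q" "fst q \<le> T" by auto
      have "F (fst q) (snd q) \<le> 1 * ennreal (exp (\<mu> * (fst q * (real (Suc n) / 2))))"
        unfolding F_def using t l by (intro mult_mono Zn_le \<mu>) auto
      also have "\<dots> \<le> ennreal (exp (\<mu> * (T * (real (Suc n) / 2))))"
        using t \<mu> by (auto intro!: ennreal_leI mult_left_mono mult_right_mono)
      finally show "F (fst q) (snd q) \<le> ennreal (exp (\<mu> * (T * (real (Suc n) / 2))))" .
    qed
    then have S_fin: "S < top" using le_less_trans ennreal_less_top by blast
    have "F t v \<le> 1 + ennreal (\<mu> * u l 0) * S" if t: "0 \<le> t" "t \<le> T" for t v
    proof -
      have "F t v = ennreal (exp (- l * t)) * 1 + ennreal (exp (- l * t)) * (\<integral>\<^sup>+s. indicator {0<..<t} s *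
          (\<integral>\<^sup>+z. ennreal (\<mu> * g s (v - z) * bump n z) * Zn n \<mu> (t - s) z \<partial>lborel) \<partial>lborel)"
        unfolding F_def by (subst Zn_volterra[OF t(1) \<mu>]) (rule distrib_left)
      also have "ennreal (exp (- l * t)) * 1 \<le> 1" using l t by simp
      also have "ennreal (exp (- l * t)) * (\<integral>\<^sup>+s. indicator {0<..<t} s *
          (\<integral>\<^sup>+z. ennreal (\<mu> * g s (v - z) * bump n z) * Zn n \<mu> (t - s) z \<partial>lborel) \<partial>lborel) \<le>
          (\<integral>\<^sup>+s. ennreal (exp (- l * t)) * (indicator {0<..<t} s *
          (\<integral>\<^sup>+z. ennreal (\<mu> * g s (v - z) * bump n z) * Zn n \<mu> (t - s) z \<partial>lborel)) \<partial>lborel)"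
      proof (rule eq_refl, rule nn_integral_cmult[symmetric])
        have [measurable]: "(\<lambda>x. Zn n \<mu> (t - fst x) (snd x)) \<in> borel_measurable (borel \<Otimes>\<^sub>M lborel)"
          using measurable_compose[OF _ Zn_meas, of "\<lambda>x. (t - fst x, snd x)" "borel \<Otimes>\<^sub>M lborel"] by simp
        show "(\<lambda>s. indicator {0<..<t} s * (\<integral>\<^sup>+z. ennreal (\<mu> * g s (v - z) * bump n z) * Zn n \<mu> (t - s) z \<partial>lborel)) \<in> borel_measurable lborel"
          by measurable
      qed
      also have "\<dots> \<le> (\<integral>\<^sup>+s. ennreal \<mu> * S * (indicator {0<..} s * ennreal (exp (- l * s) * g s 0)) \<partial>lborel)"
      proof (rule nn_integral_mono)
        fix s
        show "ennreal (exp (- l * t)) * (indicator {0<..<t} s *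
          (\<integral>\<^sup>+z. ennreal (\<mu> * g s (v - z) * bump n z) * Zn n \<mu> (t - s) z \<partial>lborel)) \<le> ennreal \<mu> * S * (indicator {0<..} s * ennreal (exp (- l * s) * g s 0))"
        proof (cases "0 < s \<and> s < t")
          case True
          then have s: "0 < s" "s < t" by auto
          have [measurable]: "(\<lambda>z. Zn n \<mu> (t - s) z) \<in> borel_measurable borel"
            using measurable_compose[OF measurable_Pair1'[of "t - s" borel borel] Zn_meas] by simp
          \<comment> \<open>One factor becomes the Laplace weight of \<open>g s\<close>, the other
            completes \<open>Zn n \<mu> (t - s)\<close> to \<open>F (t - s)\<close>.\<close>
          have e: "exp (- l * t) = exp (- l * s) * exp (- l * (t - s))" by (simp add: exp_add[symmetric] algebra_simps)
          have "ennreal (exp (- l * t)) * (\<integral>\<^sup>+z. ennreal (\<mu> * g s (v - z) * bump n z) * Zn n \<mu> (t - s) z \<partial>lborel) =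
            (\<integral>\<^sup>+z. ennreal (exp (- l * t)) * (ennreal (\<mu> * g s (v - z) * bump n z) * Zn n \<mu> (t - s) z) \<partial>lborel)"
            by (rule nn_integral_cmult[symmetric]) measurable
          also have "\<dots> \<le> (\<integral>\<^sup>+z. (ennreal \<mu> * S * ennreal (exp (- l * s) * g s 0)) * ennreal (bump n z) \<partial>lborel)"
          proof (rule nn_integral_mono)
            fix z
            have "ennreal (exp (- l * t)) * (ennreal (\<mu> * g s (v - z) * bump n z) * Zn n \<mu> (t - s) z) =
              ennreal (\<mu> * (exp (- l * s) * g s (v - z)) * bump n z) * F (t - s) z"
              unfolding F_def e using \<mu> g_nonneg[OF s(1)] bump_nonneg by (simp add: ennreal_mult ac_simps)
            also have "\<dots> \<le> ennreal (\<mu> * (exp (- l * s) * g s 0) * bump n z) * S"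
              using s t g_le[OF s(1)] \<mu> bump_nonneg
              by (intro mult_mono FS ennreal_leI mult_right_mono mult_left_mono) auto
            also have "\<dots> = (ennreal \<mu> * S * ennreal (exp (- l * s) * g s 0)) * ennreal (bump n z)"
              using \<mu> g_nonneg[OF s(1)] bump_nonneg by (simp add: ennreal_mult ac_simps)
            finally show "ennreal (exp (- l * t)) * (ennreal (\<mu> * g s (v - z) * bump n z) * Zn n \<mu> (t - s) z) \<le> (ennreal \<mu> * S * ennreal (exp (- l * s) * g s 0)) * ennreal (bump n z)" .
          qed
          also have "\<dots> = ennreal \<mu> * S * ennreal (exp (- l * s) * g s 0)"
            by (subst nn_integral_cmult) (auto simp: nn_integral_bump)
          finally show ?thesis using s by simp
        qed auto
      qed
      also have "\<dots> = ennreal \<mu> * S * (\<integral>\<^sup>+s. indicator {0<..} s * ennreal (exp (- l * s) * g s 0) \<partial>lborel)"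
        by (rule nn_integral_cmult) measurable
      also have "\<dots> = ennreal (\<mu> * u l 0) * S"
        unfolding nn_laplace_g[OF l(1)] using \<mu> u_nonneg[OF l(1)] by (simp add: ennreal_mult ac_simps)
      finally show ?thesis by (simp add: add_mono)
    qed
    then have "S \<le> 1 + ennreal (\<mu> * u l 0) * S" unfolding S_def by (intro SUP_least) auto
    moreover obtain r where r: "S = ennreal r" "0 \<le> r" using S_fin by (cases S) auto
    ultimately have "ennreal r \<le> ennreal (1 + \<mu> * u l 0 * r)"
      using \<mu> u_nonneg[OF l(1), of 0] by (simp add: ennreal_mult)
    then have "r \<le> 1 + \<mu> * u l 0 * r" using r \<mu> u_nonneg[OF l(1), of 0] by (subst (asm) ennreal_le_iff) auto
    also have "\<dots> \<le> 1 + 1 / 2 * r" using r l by (intro add_left_mono mult_right_mono) auto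
    finally have "S \<le> 2" using r by (simp add: ennreal_numeral[symmetric] del: ennreal_numeral)
    then have "F T x \<le> 2" using FS[OF T order_refl, of x] by (rule order_trans[rotated])
    then have "ennreal (exp (l * T)) * F T x \<le> ennreal (exp (l * T)) * 2" by (intro mult_left_mono) auto
    moreover have "ennreal (exp (l * T)) * F T x = Zn n \<mu> T x"
      unfolding F_def by (simp add: mult.assoc[symmetric] ennreal_mult[symmetric] exp_add[symmetric])
    ultimately show ?thesis by (simp add: ennreal_mult mult.commute)
  qed
  then show ?thesis using l(1) by blast
qed

end

section \<open>Local time and the growth of its exponential moments\<close>

text \<open>Bounded second moments give uniform integrability. Fatou's lemma yields the lower bound;
  for the upper one, \<open>f \<le> min f K + f^2 / K\<close> separates a bounded part, to which
  dominated convergence applies, from an error of at most \<open>C / K\<close>, and then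
  \<open>K\<close> tends to infinity.\<close>

lemma (in prob_space) nn_integral_tendsto_bounded_second_moment:
  fixes f :: "nat \<Rightarrow> 'a \<Rightarrow> real"
  assumes f [measurable]: "\<And>n. f n \<in> borel_measurable M" "h \<in> borel_measurable M"
    and pos: "\<And>n w. 0 \<le> f n w"
    and lim: "AE w in M. (\<lambda>n. f n w) \<longlonglongrightarrow> h w"
    and bd: "\<And>n. (\<integral>\<^sup>+w. ennreal ((f n w)\<^sup>2) \<partial>M) \<le> ennreal C"
  shows "(\<lambda>n. \<integral>\<^sup>+w. ennreal (f n w) \<partial>M) \<longlonglongrightarrow> (\<integral>\<^sup>+w. ennreal (h w) \<partial>M)"
proof -
  let ?a = "\<lambda>n. \<integral>\<^sup>+w. ennreal (f n w) \<partial>M" and ?b = "\<integral>\<^sup>+w. ennreal (h w) \<partial>M"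
  have "?b = (\<integral>\<^sup>+w. liminf (\<lambda>n. ennreal (f n w)) \<partial>M)"
  proof (rule nn_integral_cong_AE)
    show "AE w in M. ennreal (h w) = liminf (\<lambda>n. ennreal (f n w))"
      using lim by eventually_elim (metis lim_imp_Liminf sequentially_bot tendsto_ennrealI)
  qed
  also have "\<dots> \<le> liminf ?a" by (rule nn_integral_liminf) measurable
  finally have inf: "?b \<le> liminf ?a" .
  have up: "limsup ?a \<le> ?b + ennreal (C / K)" if K: "0 < K" for K
  proof -
    have le: "?a n \<le> (\<integral>\<^sup>+w. ennreal (min (f n w) K) \<partial>M) + ennreal (C / K)" for n
    proof -
      have "?a n \<le> (\<integral>\<^sup>+w. ennreal (min (f n w) K) + ennreal (1 / K) * ennreal ((f n w)\<^sup>2) \<partial>M)"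
      proof (rule nn_integral_mono)
        fix w
        have "f n w \<le> min (f n w) K + 1 / K * (f n w)\<^sup>2"
        proof (cases "f n w \<le> K")
          case False
          then have "K * f n w \<le> f n w * f n w" using K by (intro mult_right_mono) auto
          then have "f n w \<le> 1 / K * (f n w)\<^sup>2" using K by (simp add: field_simps power2_eq_square)
          then show ?thesis using False K by (auto simp: min_def)
        qed (use K in auto)
        then have "ennreal (f n w) \<le> ennreal (min (f n w) K + 1 / K * (f n w)\<^sup>2)" by (rule ennreal_leI)
        also have "\<dots> = ennreal (min (f n w) K) + ennreal (1 / K) * ennreal ((f n w)\<^sup>2)"
          using K pos[of n w] by (subst ennreal_plus) (auto simp: ennreal_mult'[symmetric])
        finally show "ennreal (f n w) \<le> ennreal (min (f n w) K) + ennreal (1 / K) * ennreal ((f n w)\<^sup>2)" .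
      qed
      also have "\<dots> = (\<integral>\<^sup>+w. ennreal (min (f n w) K) \<partial>M) + ennreal (1 / K) * (\<integral>\<^sup>+w. ennreal ((f n w)\<^sup>2) \<partial>M)"
        by (subst nn_integral_add) (auto simp: nn_integral_cmult)
      also have "\<dots> \<le> (\<integral>\<^sup>+w. ennreal (min (f n w) K) \<partial>M) + ennreal (1 / K) * ennreal C"
        using bd by (intro add_left_mono mult_left_mono) auto
      also have "ennreal (1 / K) * ennreal C = ennreal (C / K)" using K by (simp add: ennreal_mult'[symmetric])
      finally show ?thesis .
    qed
    have "(\<lambda>n. \<integral>\<^sup>+w. ennreal (min (f n w) K) \<partial>M) \<longlonglongrightarrow> (\<integral>\<^sup>+w. ennreal (min (h w) K) \<partial>M)"
    proof (rule nn_integral_dominated_convergence[where w="\<lambda>_. ennreal K"])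
      show "AE w in M. (\<lambda>n. ennreal (min (f n w) K)) \<longlonglongrightarrow> ennreal (min (h w) K)"
        using lim by eventually_elim (intro tendsto_intros)
      show "(\<integral>\<^sup>+w. ennreal K \<partial>M) < \<infinity>" by (simp add: emeasure_space_1)
    qed (auto intro!: ennreal_leI)
    then have "(\<lambda>n. (\<integral>\<^sup>+w. ennreal (min (f n w) K) \<partial>M) + ennreal (C / K)) \<longlonglongrightarrow> (\<integral>\<^sup>+w. ennreal (min (h w) K) \<partial>M) + ennreal (C / K)"
      by (intro tendsto_add tendsto_const)
    then have "limsup (\<lambda>n. (\<integral>\<^sup>+w. ennreal (min (f n w) K) \<partial>M) + ennreal (C / K)) = (\<integral>\<^sup>+w. ennreal (min (h w) K) \<partial>M) + ennreal (C / K)"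
      by (intro lim_imp_Limsup) auto
    moreover have "limsup ?a \<le> limsup (\<lambda>n. (\<integral>\<^sup>+w. ennreal (min (f n w) K) \<partial>M) + ennreal (C / K))"
      using le by (intro Limsup_mono always_eventually) auto
    ultimately have "limsup ?a \<le> (\<integral>\<^sup>+w. ennreal (min (h w) K) \<partial>M) + ennreal (C / K)" by simp
    also have "\<dots> \<le> ?b + ennreal (C / K)" by (intro add_right_mono nn_integral_mono ennreal_leI) auto
    finally show ?thesis .
  qed
  have "(\<lambda>n. ?b + ennreal (C / real (Suc n))) \<longlonglongrightarrow> ?b + ennreal 0"
  proof (intro tendsto_add tendsto_const tendsto_ennrealI)
    show "(\<lambda>n. C / real (Suc n)) \<longlonglongrightarrow> 0"
      using tendsto_mult[OF tendsto_const LIMSEQ_Suc[OF lim_1_over_n], of C] by simp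
  qed
  then have "limsup ?a \<le> ?b + ennreal 0"
    by (rule LIMSEQ_le_const) (use up in \<open>auto simp del: of_nat_Suc\<close>)
  then have sup: "limsup ?a \<le> ?b" by simp
  have "liminf ?a \<le> limsup ?a" by (rule Liminf_le_Limsup) simp
  then have "liminf ?a = ?b" "limsup ?a = ?b" using inf sup by (auto intro: order.antisym order_trans)
  then show ?thesis by (intro Liminf_eq_Limsup) auto
qed

lemma measurable_path_section:
  assumes "\<omega> \<in> cadlag_paths {0..}" shows "(\<lambda>r. \<omega> (max 0 r)) \<in> borel_measurable borel"
proof -
  have "(\<lambda>r. (r, \<omega>)) \<in> measurable borel (borel \<Otimes>\<^sub>M path_space {0..})"
    using assms by (intro measurable_Pair measurable_const) (auto simp: space_path_space)
  from measurable_compose[OF this measurable_path_eval] show ?thesis by simp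
qed

lemma occ_integrable:
  assumes "\<omega> \<in> cadlag_paths {0..}"
  shows "integrable lborel (\<lambda>r. indicator {a..<b} r * bump n (v - \<omega> (max 0 r)))"
proof (rule Bochner_Integration.integrable_bound)
  note [measurable] = measurable_path_section[OF assms]
  show "integrable lborel (\<lambda>r. indicator {a..<b} r * (real (Suc n) / 2))"
    by (cases "a \<le> b") (auto simp: integrable_indicator_iff)
  show "(\<lambda>r. indicator {a..<b} r * bump n (v - \<omega> (max 0 r))) \<in> borel_measurable lborel" by measurable
  show "AE r in lborel. norm (indicator {a..<b} r * bump n (v - \<omega> (max 0 r))) \<le> norm (indicator {a..<b} r * (real (Suc n) / 2))"
  proof (rule AE_I2)
    fix r show "norm (indicator {a..<b} r * bump n (v - \<omega> (max 0 r))) \<le> norm (indicator {a..<b} r * (real (Suc n) / 2))"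
      using bump_le[of n "v - \<omega> (max 0 r)"] bump_nonneg[of n "v - \<omega> (max 0 r)"] by (auto simp del: of_nat_Suc split: split_indicator)
  qed
qed

lemma occ_mono:
  assumes "\<omega> \<in> cadlag_paths {0..}" "s \<le> t"
  shows "occ n s v \<omega> \<le> occ n t v \<omega>"
  unfolding occ_def by (intro Bochner_Integration.integral_mono occ_integrable assms)
    (use assms(2) bump_nonneg in \<open>auto split: split_indicator\<close>)

lemma occ_diff:
  assumes "\<omega> \<in> cadlag_paths {0..}" "0 \<le> s" "s \<le> t"
  shows "(LINT r|lborel. indicator {s..<t} r * bump n (v - \<omega> (max 0 r))) = occ n t v \<omega> - occ n s v \<omega>"
  unfolding occ_def
  by (subst Bochner_Integration.integral_diff[symmetric, OF occ_integrable occ_integrable, OF assms(1) assms(1)])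
    (use assms in \<open>auto intro!: Bochner_Integration.integral_cong split: split_indicator\<close>)

text \<open>Once the window lies within the \<open>d\<close> of continuity, the average is trapped
  between \<open>f v - e / 2\<close> and \<open>f v + e / 2\<close>. The centres may move because
  the mollified moments are later evaluated at points that tend to 0 with \<open>n\<close>.\<close>

lemma average_tendsto:
  fixes f :: "real \<Rightarrow> real"
  assumes cont: "isCont f v" and f0: "\<And>y. 0 \<le> f y" and X: "X \<longlonglongrightarrow> v" and a0: "\<And>n. 0 \<le> a n"
    and a: "\<And>n. ennreal (a n) = ennreal (real (Suc n) / 2) *
      (\<integral>\<^sup>+y\<in>{X n - 1 / real (Suc n)<..<X n + 1 / real (Suc n)}. ennreal (f y) \<partial>lborel)"
  shows "a \<longlonglongrightarrow> f v"
proof (rule tendstoI)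
  fix e :: real assume e: "0 < e"
  then have e2: "0 < e / 2" by simp
  obtain d where d: "0 < d" "\<And>y. \<bar>y - v\<bar> < d \<Longrightarrow> \<bar>f y - f v\<bar> < e / 2"
    using cont e2 unfolding continuous_at_eps_delta dist_real_def by metis
  have "eventually (\<lambda>n. \<bar>X n - v\<bar> < d / 2) sequentially"
    using tendstoD[OF X, of "d / 2"] d(1) by (simp add: dist_real_def)
  moreover have "eventually (\<lambda>n. 1 / real (Suc n) < d / 2) sequentially"
    using order_tendstoD(2)[OF LIMSEQ_Suc[OF lim_1_over_n], of "d / 2"] d(1) by simp
  ultimately show "eventually (\<lambda>n. dist (a n) (f v) < e) sequentially"
  proof eventually_elim
    case (elim n)
    let ?I = "{X n - 1 / real (Suc n)<..<X n + 1 / real (Suc n)}"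
    have near: "\<bar>f y - f v\<bar> < e / 2" if "y \<in> ?I" for y
    proof (rule d(2))
      show "\<bar>y - v\<bar> < d" using that elim unfolding greaterThanLessThan_iff abs_less_iff by linarith
    qed
    have const: "ennreal (real (Suc n) / 2) * (\<integral>\<^sup>+y. ennreal c * indicator ?I y \<partial>lborel) = ennreal c" for c
    proof -
      have "(\<integral>\<^sup>+y. ennreal c * indicator ?I y \<partial>lborel) = ennreal c * ennreal (2 / real (Suc n))"
        by (subst nn_integral_cmult_indicator) (auto simp: divide_simps)
      moreover have "ennreal (real (Suc n) / 2) * ennreal (2 / real (Suc n)) = 1"
        by (subst ennreal_mult[symmetric]) (auto simp del: of_nat_Suc)
      ultimately show ?thesis by (simp add: mult.left_commute del: of_nat_Suc)
    qed
    have "ennreal (real (Suc n) / 2) * (\<integral>\<^sup>+y. ennreal (f y) * indicator ?I y \<partial>lborel) \<le>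
        ennreal (real (Suc n) / 2) * (\<integral>\<^sup>+y. ennreal (f v + e / 2) * indicator ?I y \<partial>lborel)"
    proof (intro mult_left_mono nn_integral_mono)
      fix y show "ennreal (f y) * indicator ?I y \<le> ennreal (f v + e / 2) * indicator ?I y"
      proof (cases "y \<in> ?I")
        case True
        from near[OF True] show ?thesis using True unfolding abs_less_iff
          by (auto simp del: of_nat_Suc intro!: ennreal_leI)
      qed auto
    qed auto
    then have "ennreal (a n) \<le> ennreal (f v + e / 2)" unfolding a[symmetric] const .
    then have 1: "a n \<le> f v + e / 2" using f0[of v] e by (subst (asm) ennreal_le_iff) auto
    have "ennreal (real (Suc n) / 2) * (\<integral>\<^sup>+y. ennreal (f v - e / 2) * indicator ?I y \<partial>lborel) \<le>
        ennreal (real (Suc n) / 2) * (\<integral>\<^sup>+y. ennreal (f y) * indicator ?I y \<partial>lborel)"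
    proof (intro mult_left_mono nn_integral_mono)
      fix y show "ennreal (f v - e / 2) * indicator ?I y \<le> ennreal (f y) * indicator ?I y"
      proof (cases "y \<in> ?I")
        case True
        from near[OF True] show ?thesis using True unfolding abs_less_iff
          by (auto simp del: of_nat_Suc intro!: ennreal_leI)
      qed auto
    qed auto
    then have "ennreal (f v - e / 2) \<le> ennreal (a n)" unfolding a[symmetric] const .
    then have 2: "f v - e / 2 \<le> a n" using a0[of n] by (subst (asm) ennreal_le_iff) auto
    show ?case using 1 2 e unfolding dist_real_def by linarith
  qed
qed

text \<open>The local time as a functional of the path; junk outside the almost sure event on which the limit exists.\<close>

definition ell :: "real \<Rightarrow> real \<Rightarrow> (real \<Rightarrow> real) \<Rightarrow> real" where
  "ell t v \<omega> = lim (\<lambda>n. occ n t v \<omega>)"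

lemma ell_meas:
  assumes "T \<in> borel_measurable N" "V \<in> borel_measurable N" "X \<in> measurable N (path_space {0..})"
  shows "(\<lambda>x. ell (T x) (V x) (X x)) \<in> borel_measurable N"
  unfolding ell_def by (intro borel_measurable_lim_metric occ_meas assms)

locale feynman_kac = levy_exponential +
  fixes L :: "real \<Rightarrow> real \<Rightarrow> 'a \<Rightarrow> real"
  assumes L: "local_time M \<xi> L"
begin

lemma L_meas: "0 \<le> t \<Longrightarrow> L t v \<in> borel_measurable M"
  using L unfolding local_time_def by blast

lemma full_path_in: "w \<in> space M \<Longrightarrow> full_path w \<in> cadlag_paths {0..}"
  using measurable_space[OF full_path_meas] by (simp add: space_path_space)

text \<open>Brings \<open>occ\<close> into the form of the occupation density formula: normalized
  time spent in an open interval before \<open>t\<close>.\<close>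

lemma occ_eq_emeasure:
  assumes w: "w \<in> space M" and t: "0 \<le> t"
  shows "ennreal (occ n t v (full_path w)) = ennreal (real (Suc n) / 2) *
    emeasure lborel {\<tau>. 0 \<le> \<tau> \<and> \<tau> < t \<and> \<xi> \<tau> w \<in> {v - 1 / real (Suc n)<..<v + 1 / real (Suc n)}}"
proof -
  note sec = measurable_path_section[OF full_path_in[OF w]]
  let ?S = "{\<tau>. 0 \<le> \<tau> \<and> \<tau> < t \<and> \<xi> \<tau> w \<in> {v - 1 / real (Suc n)<..<v + 1 / real (Suc n)}}"
  have S: "?S = {0..<t} \<inter> (\<lambda>r. full_path w (max 0 r)) -` {v - 1 / real (Suc n)<..<v + 1 / real (Suc n)}"
    by (auto simp: full_path_def max_def)
  have S_sets: "?S \<in> sets lborel"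
    unfolding S using measurable_sets[OF sec, of "{v - 1 / real (Suc n)<..<v + 1 / real (Suc n)}"] by simp
  have "ennreal (occ n t v (full_path w)) = (\<integral>\<^sup>+r. ennreal (indicator {0..<t} r * bump n (v - full_path w (max 0 r))) \<partial>lborel)"
    unfolding occ_def by (rule nn_integral_eq_integral[symmetric, OF occ_integrable[OF full_path_in[OF w]]]) (auto simp: bump_nonneg)
  also have "\<dots> = (\<integral>\<^sup>+r. ennreal (real (Suc n) / 2) * indicator ?S r \<partial>lborel)"
  proof (rule nn_integral_cong)
    fix r
    have "r \<in> ?S \<longleftrightarrow> r \<in> {0..<t} \<and> v - full_path w (max 0 r) \<in> {- 1 / real (Suc n)<..<1 / real (Suc n)}"
      unfolding S by (auto simp del: of_nat_Suc)
    then show "ennreal (indicator {0..<t} r * bump n (v - full_path w (max 0 r))) = ennreal (real (Suc n) / 2) * indicator ?S r"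
      unfolding bump_def by (auto split: split_indicator)
  qed
  also have "\<dots> = ennreal (real (Suc n) / 2) * emeasure lborel ?S"
    using S_sets by (rule nn_integral_cmult_indicator)
  finally show ?thesis .
qed

text \<open>A single null set serves all \<open>t\<close>, \<open>v\<close> and \<open>X\<close>,
  since the properties of the local time hold jointly off one null set. This is essential, as the
  level will be the random point \<open>v + \<xi> s w\<close>.\<close>

lemma AE_occ_tendsto:
  "AE w in M. \<forall>t\<ge>0. \<forall>(v :: real) (X :: nat \<Rightarrow> real). X \<longlonglongrightarrow> v \<longrightarrow> (\<lambda>n. occ n t (X n) (full_path w)) \<longlonglongrightarrow> L t v w"
proof -
  have "AE w in M.
        (\<forall>t\<ge>0. \<forall>v. 0 \<le> L t v w) \<and>
        (\<forall>t\<ge>0. \<forall>\<Gamma>\<in>sets borel. emeasure lborel {\<tau>. 0 \<le> \<tau> \<and> \<tau> < t \<and> \<xi> \<tau> w \<in> \<Gamma>} =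
            (\<integral>\<^sup>+v\<in>\<Gamma>. ennreal (L t v w) \<partial>lborel)) \<and>
        continuous_on ({0..} \<times> UNIV) (\<lambda>(t, v). L t v w)"
    using L unfolding local_time_def by blast
  then show ?thesis
    using AE_space
  proof eventually_elim
    case (elim w)
    show ?case
    proof (intro allI impI)
      fix t v :: real and X :: "nat \<Rightarrow> real" assume t: "0 \<le> t" and X: "X \<longlonglongrightarrow> v"
      have em: "emeasure lborel {\<tau>. 0 \<le> \<tau> \<and> \<tau> < t \<and> \<xi> \<tau> w \<in> \<Gamma>} = (\<integral>\<^sup>+v\<in>\<Gamma>. ennreal (L t v w) \<partial>lborel)"
        if "\<Gamma> \<in> sets borel" for \<Gamma>
        using elim(1) t that by blast
      have "continuous_on UNIV (\<lambda>y. (\<lambda>(t, v). L t v w) (t, y))"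
      proof (rule continuous_on_compose2[of "{0..} \<times> UNIV" "\<lambda>(t, v). L t v w"])
        show "continuous_on ({0..} \<times> UNIV) (\<lambda>(t, v). L t v w)" using elim(1) by blast
        show "continuous_on UNIV (\<lambda>y :: real. (t, y))"
          by (intro continuous_on_Pair continuous_on_const continuous_on_id)
      qed (use t in auto)
      then have cont: "isCont (\<lambda>y. L t y w) v" by (simp add: continuous_on_eq_continuous_at)
      show "(\<lambda>n. occ n t (X n) (full_path w)) \<longlonglongrightarrow> L t v w"
      proof (rule average_tendsto[OF cont _ X occ_nonneg])
        show "0 \<le> L t y w" for y using elim t by blast
        show "ennreal (occ n t (X n) (full_path w)) = ennreal (real (Suc n) / 2) *
            (\<integral>\<^sup>+y\<in>{X n - 1 / real (Suc n)<..<X n + 1 / real (Suc n)}. ennreal (L t y w) \<partial>lborel)" for n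
          unfolding occ_eq_emeasure[OF elim(2) t] by (subst em) auto
      qed
    qed
  qed
qed

text \<open>Occupation of the shifted path is a difference of two occupations of the full path at
  the level moved by \<open>\<xi> s w\<close>, and each of them converges.\<close>

lemma AE_occ_shift_tendsto:
  assumes s: "0 \<le> s"
  shows "AE w in M. \<forall>t\<ge>0. \<forall>(v :: real) (X :: nat \<Rightarrow> real). X \<longlonglongrightarrow> v \<longrightarrow> (\<lambda>n. occ n t (X n) (shift_path s w)) \<longlonglongrightarrow> L (s + t) (v + \<xi> s w) w - L s (v + \<xi> s w) w"
  using AE_occ_tendsto AE_space
proof eventually_elim
  case (elim w)
  show ?case
  proof (intro allI impI)
    fix t v :: real and X :: "nat \<Rightarrow> real" assume t: "0 \<le> t" and X: "X \<longlonglongrightarrow> v"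
    have X': "(\<lambda>n. X n + \<xi> s w) \<longlonglongrightarrow> v + \<xi> s w" using X by (intro tendsto_intros)
    have "occ n t (X n) (shift_path s w) = occ n (s + t) (X n + \<xi> s w) (full_path w) - occ n s (X n + \<xi> s w) (full_path w)" for n
      using occ_shift_path[OF s, of "s + t" n "X n + \<xi> s w" w] occ_diff[OF full_path_in[OF elim(2)] s, of "s + t" n "X n + \<xi> s w"] t by simp
    moreover have "(\<lambda>n. occ n (s + t) (X n + \<xi> s w) (full_path w) - occ n s (X n + \<xi> s w) (full_path w)) \<longlonglongrightarrow> L (s + t) (v + \<xi> s w) w - L s (v + \<xi> s w) w"
      using elim(1) s t X' by (intro tendsto_diff) auto
    ultimately show "(\<lambda>n. occ n t (X n) (shift_path s w)) \<longlonglongrightarrow> L (s + t) (v + \<xi> s w) w - L s (v + \<xi> s w) w" by simp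
  qed
qed

lemma AE_ell: "AE w in M. \<forall>t\<ge>0. \<forall>v. ell t v (full_path w) = L t v w"
  using AE_occ_tendsto unfolding ell_def by eventually_elim (auto intro!: limI)

lemma AE_ell_shift:
  assumes "0 \<le> s"
  shows "AE w in M. \<forall>t\<ge>0. \<forall>v. ell t v (shift_path s w) = L (s + t) (v + \<xi> s w) w - L s (v + \<xi> s w) w"
  using AE_occ_shift_tendsto[OF assms] unfolding ell_def by eventually_elim (auto intro!: limI)

lemma AE_L_nonneg: "AE w in M. \<forall>t\<ge>0. \<forall>v. 0 \<le> L t v w"
  using L unfolding local_time_def by auto

definition Z :: "real \<Rightarrow> real \<Rightarrow> real \<Rightarrow> ennreal" where
  "Z \<mu> t v = (\<integral>\<^sup>+\<omega>. ennreal (exp (\<mu> * ell t v \<omega>)) \<partial>W)"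

lemma Z_meas: "(\<lambda>(t, v). Z \<mu> t v) \<in> borel_measurable (borel \<Otimes>\<^sub>M borel)"
proof -
  interpret W: prob_space W by (rule prob_space_W)
  have [measurable]: "(\<lambda>(x, \<omega>). ell (fst x) (snd x) \<omega>) \<in> borel_measurable ((borel \<Otimes>\<^sub>M borel) \<Otimes>\<^sub>M W)"
    unfolding split_beta by (rule ell_meas) (auto intro: measurable_compose[OF measurable_snd])
  show ?thesis unfolding Z_def split_beta by measurable
qed

lemma Z_eq:
  assumes t: "0 \<le> t" shows "Z \<mu> t v = (\<integral>\<^sup>+w. ennreal (exp (\<mu> * L t v w)) \<partial>M)"
proof -
  have [measurable]: "(\<lambda>\<omega>. ell t v \<omega>) \<in> borel_measurable (path_space {0..})" by (rule ell_meas) auto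
  have "Z \<mu> t v = (\<integral>\<^sup>+w. ennreal (exp (\<mu> * ell t v (full_path w))) \<partial>M)"
    unfolding Z_def by (rule nn_integral_W) measurable
  also have "\<dots> = (\<integral>\<^sup>+w. ennreal (exp (\<mu> * L t v w)) \<partial>M)"
      proof (rule nn_integral_cong_AE)
    show "AE w in M. ennreal (exp (\<mu> * ell t v (full_path w))) = ennreal (exp (\<mu> * L t v w))"
      using AE_ell by eventually_elim (use t in auto)
  qed
  finally show ?thesis .
qed

text \<open>The square of the exponential with parameter \<open>\<mu>\<close> is the exponential
  with \<open>2 * \<mu>\<close>, so \<open>Zn_bound\<close> at \<open>2 * \<mu>\<close> is a second
  moment bound uniform in \<open>n\<close>.\<close>

lemma Zn_tendsto:
  assumes t: "0 \<le> t" and \<mu>: "0 \<le> \<mu>" and X: "X \<longlonglongrightarrow> v"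
  shows "(\<lambda>n. Zn n \<mu> t (X n)) \<longlonglongrightarrow> Z \<mu> t v"
proof -
  have occ_m: "(\<lambda>\<omega>. occ n t x \<omega>) \<in> borel_measurable (path_space {0..})" for n x by (rule occ_meas) auto
  have occ_m' [measurable]: "(\<lambda>w. occ n t x (full_path w)) \<in> borel_measurable M" for n x
    by (rule occ_meas) (auto intro: full_path_meas)
  note [measurable] = L_meas[OF t] occ_m
  have Zn_eq: "Zn n m t x = (\<integral>\<^sup>+w. ennreal (exp (m * occ n t x (full_path w))) \<partial>M)" for n m x
    unfolding Zn_def by (rule nn_integral_W) measurable
  obtain l where l: "\<And>n t v. 0 \<le> t \<Longrightarrow> Zn n (2 * \<mu>) t v \<le> ennreal (2 * exp (l * t))"
    using Zn_bound[of "2 * \<mu>"] \<mu> by auto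
  show ?thesis
    unfolding Zn_eq Z_eq[OF t]
  proof (rule nn_integral_tendsto_bounded_second_moment)
    show "AE w in M. (\<lambda>n. exp (\<mu> * occ n t (X n) (full_path w))) \<longlonglongrightarrow> exp (\<mu> * L t v w)"
      using AE_occ_tendsto by eventually_elim (use t X in \<open>auto intro!: tendsto_intros\<close>)
    show "(\<integral>\<^sup>+w. ennreal ((exp (\<mu> * occ n t (X n) (full_path w)))\<^sup>2) \<partial>M) \<le> ennreal (2 * exp (l * t))" for n
      using l[OF t, of n "X n"] unfolding Zn_eq by (simp add: power2_eq_square exp_add[symmetric] mult.assoc)
  qed auto
qed

lemma Z_bound:
  assumes "0 \<le> \<mu>"
  shows "\<exists>l>0. \<forall>t v. 0 \<le> t \<longrightarrow> Z \<mu> t v \<le> ennreal (2 * exp (l * t))"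
proof -
  obtain l where l: "0 < l" "\<And>n t v. 0 \<le> t \<Longrightarrow> Zn n \<mu> t v \<le> ennreal (2 * exp (l * t))"
    using Zn_bound[OF assms] by auto
  have "Z \<mu> t v \<le> ennreal (2 * exp (l * t))" if "0 \<le> t" for t v
    by (rule LIMSEQ_le_const2[OF Zn_tendsto[OF that assms tendsto_const]]) (use l(2)[OF that] in auto)
  then show ?thesis using l(1) by blast
qed

lemma Z_mono:
  assumes "0 \<le> s" "s \<le> t" "0 \<le> \<mu>" shows "Z \<mu> s v \<le> Z \<mu> t v"
proof (rule LIMSEQ_le[OF Zn_tendsto Zn_tendsto])
  show "\<exists>N. \<forall>n\<ge>N. Zn n \<mu> s v \<le> Zn n \<mu> t v"
    unfolding Zn_def using occ_mono[OF _ assms(2)] assms(3)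
    by (intro exI[of _ 0] allI impI nn_integral_mono ennreal_leI) (auto simp: space_W intro!: mult_left_mono)
qed (use assms in auto)

lemma Z_ge_1:
  assumes "0 \<le> t" "0 \<le> \<mu>" shows "1 \<le> Z \<mu> t v"
proof -
  have "1 = (\<integral>\<^sup>+w. 1 \<partial>M)" by (simp add: emeasure_space_1)
  also have "\<dots> \<le> (\<integral>\<^sup>+w. ennreal (exp (\<mu> * L t v w)) \<partial>M)"
  proof (rule nn_integral_mono_AE)
    show "AE w in M. 1 \<le> ennreal (exp (\<mu> * L t v w))"
      using AE_L_nonneg by eventually_elim (use assms in auto)
  qed
  finally show ?thesis using Z_eq[OF assms(1)] by simp
qed

end

section \<open>The Volterra equation for the local time and the growth of its exponential
  moments\<close>

lemma bump_rescale:
  assumes [measurable]: "f \<in> borel_measurable borel"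
  shows "(\<integral>\<^sup>+z. f z * ennreal (bump n z) \<partial>lborel) =
    (\<integral>\<^sup>+y. f (y / real (Suc n)) * ennreal (indicator {-1<..<1} y / 2) \<partial>lborel)"
proof -
  have "(\<integral>\<^sup>+z. f z * ennreal (bump n z) \<partial>lborel) =
      ennreal (1 / real (Suc n)) * (\<integral>\<^sup>+y. f (y / real (Suc n)) * ennreal (bump n (y / real (Suc n))) \<partial>lborel)"
    using nn_integral_real_affine[of "\<lambda>z. f z * ennreal (bump n z)" "1 / real (Suc n)" 0] by simp
  also have "\<dots> = (\<integral>\<^sup>+y. ennreal (1 / real (Suc n)) * (f (y / real (Suc n)) * ennreal (bump n (y / real (Suc n)))) \<partial>lborel)"
    by (rule nn_integral_cmult[symmetric]) measurable
  also have "\<dots> = (\<integral>\<^sup>+y. f (y / real (Suc n)) * ennreal (indicator {-1<..<1} y / 2) \<partial>lborel)"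
  proof (rule nn_integral_cong)
    fix y :: real
    have "1 / real (Suc n) * bump n (y / real (Suc n)) = indicator {-1<..<1} y / 2"
      unfolding bump_def by (auto simp: divide_simps split: split_indicator simp del: of_nat_Suc)
    then have "ennreal (1 / real (Suc n)) * ennreal (bump n (y / real (Suc n))) = ennreal (indicator {-1<..<1} y / 2)"
      by (subst ennreal_mult[symmetric]) (auto simp: bump_nonneg simp del: of_nat_Suc)
    then show "ennreal (1 / real (Suc n)) * (f (y / real (Suc n)) * ennreal (bump n (y / real (Suc n)))) = f (y / real (Suc n)) * ennreal (indicator {-1<..<1} y / 2)"
      by (metis mult.left_commute)
  qed
  finally show ?thesis .
qed

text \<open>The rescaled window density has mass 1, so averaging a constant against it changes
  nothing.\<close>

lemma half_indicator_integral: "(\<integral>\<^sup>+y. ennreal (indicator {-1<..<1::real} y / 2) \<partial>lborel) = 1"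
proof -
  have "(\<integral>\<^sup>+y. ennreal (indicator {-1<..<1::real} y / 2) \<partial>lborel) = (\<integral>\<^sup>+y. ennreal (1 / 2) * indicator {-1<..<1::real} y \<partial>lborel)"
    by (intro nn_integral_cong) (auto split: split_indicator)
  also have "\<dots> = ennreal (1 / 2) * ennreal 2" by (subst nn_integral_cmult_indicator) auto
  also have "\<dots> = 1" by (subst ennreal_mult[symmetric]) auto
  finally show ?thesis .
qed

context feynman_kac begin

lemma Zn_section [measurable]: "(\<lambda>z. Zn n \<mu> t z) \<in> borel_measurable borel"
  using measurable_compose[OF measurable_Pair1'[of t borel borel] Zn_meas] by simp

lemma Z_section [measurable]: "(\<lambda>t. Z \<mu> t v) \<in> borel_measurable borel"
  using measurable_compose[OF measurable_Pair2'[of v borel borel] Z_meas] by simp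

text \<open>After rescaling the window to \<open>{-1<..<1}\<close>, the arguments
  \<open>y / Suc n\<close> tend to 0. There \<open>g s\<close> is continuous and \<open>Zn\<close>
  converges along moving points; the bounds by \<open>g s 0\<close> and \<open>Zn_bound\<close>
  dominate.\<close>

lemma inner_tendsto:
  assumes s: "0 < s" "s < t" and \<mu>: "0 \<le> \<mu>"
  shows "(\<lambda>n. \<integral>\<^sup>+z. ennreal (\<mu> * g s (v - z) * bump n z) * Zn n \<mu> (t - s) z \<partial>lborel) \<longlonglongrightarrow>
    ennreal (\<mu> * g s v) * Z \<mu> (t - s) 0"
proof -
  obtain l where l: "0 < l" "\<And>n t v. 0 \<le> t \<Longrightarrow> Zn n \<mu> t v \<le> ennreal (2 * exp (l * t))"
    using Zn_bound[OF \<mu>] by auto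
  define f where "f n z = ennreal (\<mu> * g s (v - z)) * Zn n \<mu> (t - s) z" for n z
  have [measurable]: "f n \<in> borel_measurable borel" for n unfolding f_def by measurable
  have eq: "(\<integral>\<^sup>+z. ennreal (\<mu> * g s (v - z) * bump n z) * Zn n \<mu> (t - s) z \<partial>lborel) =
      (\<integral>\<^sup>+y. f n (y / real (Suc n)) * ennreal (indicator {-1<..<1} y / 2) \<partial>lborel)" for n
  proof -
    have "(\<integral>\<^sup>+z. ennreal (\<mu> * g s (v - z) * bump n z) * Zn n \<mu> (t - s) z \<partial>lborel) = (\<integral>\<^sup>+z. f n z * ennreal (bump n z) \<partial>lborel)"
      unfolding f_def using \<mu> g_nonneg[OF s(1)] bump_nonneg by (intro nn_integral_cong) (simp add: ennreal_mult ac_simps)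
    also have "\<dots> = (\<integral>\<^sup>+y. f n (y / real (Suc n)) * ennreal (indicator {-1<..<1} y / 2) \<partial>lborel)"
      by (rule bump_rescale) measurable
    finally show ?thesis .
  qed
  have "(\<lambda>n. \<integral>\<^sup>+y. f n (y / real (Suc n)) * ennreal (indicator {-1<..<1} y / 2) \<partial>lborel) \<longlonglongrightarrow>
      (\<integral>\<^sup>+y. ennreal (\<mu> * g s v) * Z \<mu> (t - s) 0 * ennreal (indicator {-1<..<1::real} y / 2) \<partial>lborel)"
  proof (rule nn_integral_dominated_convergence[where w="\<lambda>y. ennreal (\<mu> * g s 0) * ennreal (2 * exp (l * (t - s))) * ennreal (indicator {-1<..<1} y / 2)"])
    show "AE y in lborel. f n (y / real (Suc n)) * ennreal (indicator {-1<..<1} y / 2) \<le>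
        ennreal (\<mu> * g s 0) * ennreal (2 * exp (l * (t - s))) * ennreal (indicator {-1<..<1} y / 2)" for n
      unfolding f_def using s \<mu> g_le[OF s(1)]
      by (intro AE_I2 mult_right_mono mult_mono ennreal_leI mult_left_mono l(2)) auto
    show "(\<integral>\<^sup>+y. ennreal (\<mu> * g s 0) * ennreal (2 * exp (l * (t - s))) * ennreal (indicator {-1<..<1::real} y / 2) \<partial>lborel) < \<infinity>"
      by (subst nn_integral_cmult) (auto simp: half_indicator_integral ennreal_mult_less_top)
    show "AE y in lborel. (\<lambda>n. f n (y / real (Suc n)) * ennreal (indicator {-1<..<1} y / 2)) \<longlonglongrightarrow>
        ennreal (\<mu> * g s v) * Z \<mu> (t - s) 0 * ennreal (indicator {-1<..<1} y / 2)"
    proof (rule AE_I2)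
      fix y :: real
      have y0: "(\<lambda>n. y / real (Suc n)) \<longlonglongrightarrow> 0"
        using tendsto_mult[OF tendsto_const LIMSEQ_Suc[OF lim_1_over_n], of y] by simp
      have "(\<lambda>n. v - y / real (Suc n)) \<longlonglongrightarrow> v - 0" by (intro tendsto_intros y0)
      then have "(\<lambda>n. g s (v - y / real (Suc n))) \<longlonglongrightarrow> g s v"
        using isCont_tendsto_compose[OF g_cont[OF s(1)], of "\<lambda>n. v - y / real (Suc n)"] by simp
      then have "(\<lambda>n. ennreal (\<mu> * g s (v - y / real (Suc n)))) \<longlonglongrightarrow> ennreal (\<mu> * g s v)"
        by (intro tendsto_intros)
      moreover have Zt: "(\<lambda>n. Zn n \<mu> (t - s) (y / real (Suc n))) \<longlonglongrightarrow> Z \<mu> (t - s) 0"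
        using s by (intro Zn_tendsto \<mu> y0) auto
      moreover have "Z \<mu> (t - s) 0 < top"
      proof -
        have "Z \<mu> (t - s) 0 \<le> ennreal (2 * exp (l * (t - s)))"
          by (rule LIMSEQ_le_const2[OF Zt]) (use l(2) s in auto)
        then show ?thesis using le_less_trans ennreal_less_top by blast
      qed
      ultimately have "(\<lambda>n. f n (y / real (Suc n))) \<longlonglongrightarrow> ennreal (\<mu> * g s v) * Z \<mu> (t - s) 0"
        unfolding f_def by (intro tendsto_mult_ennreal) auto
      then show "(\<lambda>n. f n (y / real (Suc n)) * ennreal (indicator {-1<..<1} y / 2)) \<longlonglongrightarrow>
          ennreal (\<mu> * g s v) * Z \<mu> (t - s) 0 * ennreal (indicator {-1<..<1} y / 2)"
        using \<open>Z \<mu> (t - s) 0 < top\<close> by (intro tendsto_mult_ennreal tendsto_const) (auto simp: ennreal_mult_eq_top_iff)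
    qed
  qed auto
  then show ?thesis unfolding eq by (subst (asm) nn_integral_cmult) (auto simp: half_indicator_integral)
qed

text \<open>Both sides of \<open>Zn_volterra\<close> converge as the window shrinks: the left one by
  \<open>Zn_tendsto\<close>, the inner integral by \<open>inner_tendsto\<close>, and the time
  integral by dominated convergence.\<close>

lemma Z_volterra:
  assumes t: "0 \<le> t" and \<mu>: "0 \<le> \<mu>"
  shows "Z \<mu> t v = 1 + (\<integral>\<^sup>+s. indicator {0<..<t} s * (ennreal (\<mu> * g s v) * Z \<mu> (t - s) 0) \<partial>lborel)"
proof -
  obtain l where l: "0 < l" "\<And>n t v. 0 \<le> t \<Longrightarrow> Zn n \<mu> t v \<le> ennreal (2 * exp (l * t))"
    using Zn_bound[OF \<mu>] by auto
  define I where "I n s = (\<integral>\<^sup>+z. ennreal (\<mu> * g s (v - z) * bump n z) * Zn n \<mu> (t - s) z \<partial>lborel)" for n s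
  have [measurable]: "I n \<in> borel_measurable borel" for n
  proof -
    have [measurable]: "(\<lambda>x. Zn n \<mu> (t - fst x) (snd x)) \<in> borel_measurable (borel \<Otimes>\<^sub>M lborel)"
      using measurable_compose[OF _ Zn_meas, of "\<lambda>x. (t - fst x, snd x)" "borel \<Otimes>\<^sub>M lborel"] by simp
    show ?thesis unfolding I_def by measurable
  qed
  \<comment> \<open>A majorant free of \<open>n\<close>. The possible blow-up of
    \<open>g s 0\<close> at small \<open>s\<close> is integrable against
    \<open>exp (- l * s)\<close> by \<open>nn_laplace_g\<close>.\<close>
  have I_le: "I n s \<le> ennreal (2 * \<mu> * exp (2 * l * t)) * ennreal (exp (- l * s) * g s 0)" if s: "0 < s" "s < t" for n s
  proof -
    have "I n s \<le> (\<integral>\<^sup>+z. ennreal (2 * \<mu> * exp (l * (t - s)) * g s 0) * ennreal (bump n z) \<partial>lborel)"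
      unfolding I_def
    proof (rule nn_integral_mono)
      fix z
      have "ennreal (\<mu> * g s (v - z) * bump n z) * Zn n \<mu> (t - s) z \<le> ennreal (\<mu> * g s 0 * bump n z) * ennreal (2 * exp (l * (t - s)))"
        using s \<mu> g_le[OF s(1)] bump_nonneg by (intro mult_mono ennreal_leI mult_right_mono mult_left_mono l(2)) auto
      also have "\<dots> = ennreal (2 * \<mu> * exp (l * (t - s)) * g s 0) * ennreal (bump n z)"
        using \<mu> g_nonneg[OF s(1)] bump_nonneg by (simp add: ennreal_mult[symmetric] ac_simps)
      finally show "ennreal (\<mu> * g s (v - z) * bump n z) * Zn n \<mu> (t - s) z \<le> ennreal (2 * \<mu> * exp (l * (t - s)) * g s 0) * ennreal (bump n z)" .
    qed
    also have "\<dots> = ennreal (2 * \<mu> * exp (l * (t - s)) * g s 0)"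
      by (subst nn_integral_cmult) (auto simp: nn_integral_bump)
    also have "\<dots> \<le> ennreal (2 * \<mu> * exp (2 * l * t) * (exp (- l * s) * g s 0))"
    proof (rule ennreal_leI)
      have "exp (l * (t - s)) \<le> exp (2 * l * t) * exp (- l * s)"
        using l t by (simp add: exp_add[symmetric] algebra_simps)
      then have "2 * \<mu> * exp (l * (t - s)) \<le> 2 * \<mu> * (exp (2 * l * t) * exp (- l * s))" using \<mu> by (intro mult_left_mono) auto
      then have "2 * \<mu> * exp (l * (t - s)) * g s 0 \<le> 2 * \<mu> * (exp (2 * l * t) * exp (- l * s)) * g s 0"
        using g_nonneg[OF s(1)] by (rule mult_right_mono)
      then show "2 * \<mu> * exp (l * (t - s)) * g s 0 \<le> 2 * \<mu> * exp (2 * l * t) * (exp (- l * s) * g s 0)"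
        by (simp add: mult.assoc)
    qed
    also have "\<dots> = ennreal (2 * \<mu> * exp (2 * l * t)) * ennreal (exp (- l * s) * g s 0)"
      using \<mu> g_nonneg[OF s(1)] by (subst ennreal_mult) auto
    finally show ?thesis .
  qed
  have "(\<lambda>n. \<integral>\<^sup>+s. indicator {0<..<t} s * I n s \<partial>lborel) \<longlonglongrightarrow> (\<integral>\<^sup>+s. indicator {0<..<t} s * (ennreal (\<mu> * g s v) * Z \<mu> (t - s) 0) \<partial>lborel)"
  proof (rule nn_integral_dominated_convergence[where w="\<lambda>s. ennreal (2 * \<mu> * exp (2 * l * t)) * (indicator {0<..} s * ennreal (exp (- l * s) * g s 0))"])
    show "(\<integral>\<^sup>+s. ennreal (2 * \<mu> * exp (2 * l * t)) * (indicator {0<..} s * ennreal (exp (- l * s) * g s 0)) \<partial>lborel) < \<infinity>"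
      by (subst nn_integral_cmult, measurable, subst nn_laplace_g[OF l(1)]) (auto simp: ennreal_mult_less_top)
    show "AE s in lborel. indicator {0<..<t} s * I n s \<le> ennreal (2 * \<mu> * exp (2 * l * t)) * (indicator {0<..} s * ennreal (exp (- l * s) * g s 0))" for n
      using I_le by (intro AE_I2) (auto split: split_indicator)
    show "AE s in lborel. (\<lambda>n. indicator {0<..<t} s * I n s) \<longlonglongrightarrow> indicator {0<..<t} s * (ennreal (\<mu> * g s v) * Z \<mu> (t - s) 0)"
      using inner_tendsto[OF _ _ \<mu>] unfolding I_def by (intro AE_I2) (auto split: split_indicator)
  qed auto
  then have "(\<lambda>n. 1 + (\<integral>\<^sup>+s. indicator {0<..<t} s * I n s \<partial>lborel)) \<longlonglongrightarrow> 1 + (\<integral>\<^sup>+s. indicator {0<..<t} s * (ennreal (\<mu> * g s v) * Z \<mu> (t - s) 0) \<partial>lborel)"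
    by (intro tendsto_add tendsto_const)
  moreover have "(\<lambda>n. 1 + (\<integral>\<^sup>+s. indicator {0<..<t} s * I n s \<partial>lborel)) \<longlonglongrightarrow> Z \<mu> t v"
    using Zn_tendsto[OF t \<mu> tendsto_const, of v] unfolding Zn_volterra[OF t \<mu>] I_def .
  ultimately show ?thesis by (rule LIMSEQ_unique[rotated])
qed

definition Zr :: "real \<Rightarrow> real \<Rightarrow> real \<Rightarrow> real" where "Zr \<mu> t v = enn2real (Z \<mu> t v)"

lemma Z_Zr: "0 \<le> t \<Longrightarrow> 0 \<le> \<mu> \<Longrightarrow> Z \<mu> t v = ennreal (Zr \<mu> t v)"
  using Z_bound[of \<mu>] unfolding Zr_def
  by (metis ennreal_enn2real_if ennreal_neq_top neq_top_trans)

lemma Zr_ge_1: "0 \<le> t \<Longrightarrow> 0 \<le> \<mu> \<Longrightarrow> 1 \<le> Zr \<mu> t v"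
  using Z_ge_1[of t \<mu> v] Z_Zr[of t \<mu> v] by simp

lemma Zr_meas [measurable]: "(\<lambda>(t, v). Zr \<mu> t v) \<in> borel_measurable (borel \<Otimes>\<^sub>M borel)"
proof -
  have "(\<lambda>x. enn2real ((\<lambda>(t, v). Z \<mu> t v) x)) \<in> borel_measurable (borel \<Otimes>\<^sub>M borel)"
    using Z_meas by measurable
  then show ?thesis by (simp add: Zr_def split_beta)
qed

text \<open>Multiplied by \<open>exp (- \<nu> * t)\<close>, the Volterra equation at level 0 is the
  renewal equation of \<open>renewal_exponential\<close>; the kernel has mass
  \<open>\<mu> * u \<nu> 0 = 1\<close>. The constant is the renewal limit times
  \<open>\<mu>\<close>, the same for every level.\<close>

lemma Z_asymptotics:
  assumes \<mu>: "0 < \<mu>" and \<nu>: "0 < \<nu>" and eq: "\<mu> * u \<nu> 0 = 1"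
  shows "\<exists>c>0. \<forall>v. ((\<lambda>t. exp (- \<nu> * t) * Zr \<mu> t v) \<longlongrightarrow> c * u \<nu> v) at_top"
proof -
  have \<mu>0: "0 \<le> \<mu>" using \<mu> by simp
  define k where "k s v = indicator {0<..} s * (\<mu> * (exp (- \<nu> * s) * g s v))" for s v
  define z where "z t = (if 0 \<le> t then exp (- \<nu> * t) * Zr \<mu> t 0 else 0)" for t
  have [measurable]: "(\<lambda>s. k s v) \<in> borel_measurable borel" for v unfolding k_def by measurable
  have [measurable]: "z \<in> borel_measurable borel"
  proof -
    have [measurable]: "(\<lambda>t. Zr \<mu> t 0) \<in> borel_measurable borel" unfolding Zr_def by measurable
    show ?thesis unfolding z_def by measurable
  qed
  have k_int: "integrable lborel (\<lambda>s. k s v)" for v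
  proof -
    have "integrable lborel (\<lambda>s. \<mu> * (indicator {0<..} s * (exp (- \<nu> * s) * g s v)))"
      by (intro integrable_mult_right laplace_g(1) \<nu>)
    then show ?thesis unfolding k_def by (simp add: ac_simps)
  qed
  have k_LINT: "(LINT s|lborel. k s v) = \<mu> * u \<nu> v" for v
  proof -
    have "(LINT s|lborel. k s v) = (LINT s|lborel. \<mu> * (indicator {0<..} s * (exp (- \<nu> * s) * g s v)))"
      unfolding k_def by (simp add: ac_simps)
    also have "\<dots> = \<mu> * u \<nu> v" unfolding laplace_g(2)[OF \<nu>, symmetric] by (rule integral_mult_right_zero)
    finally show ?thesis .
  qed
  have k_nonneg: "0 \<le> k s v" for s v using \<mu> g_nonneg[of s v] by (auto simp: k_def split: split_indicator)
  have z_nonneg: "0 \<le> z t" for t using Zr_ge_1[of t \<mu> 0] \<mu> by (auto simp: z_def)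
  have conv: "ennreal (exp (- \<nu> * t) * Zr \<mu> t v) = ennreal (exp (- \<nu> * t)) + (\<integral>\<^sup>+s. ennreal (k s v * z (t - s)) \<partial>lborel)"
    if t: "0 \<le> t" for t v
  proof -
    have "ennreal (exp (- \<nu> * t) * Zr \<mu> t v) = ennreal (exp (- \<nu> * t)) * Z \<mu> t v"
      using Z_Zr[OF t \<mu>0] by (simp add: ennreal_mult')
    also have "\<dots> = ennreal (exp (- \<nu> * t)) + ennreal (exp (- \<nu> * t)) * (\<integral>\<^sup>+s. indicator {0<..<t} s * (ennreal (\<mu> * g s v) * Z \<mu> (t - s) 0) \<partial>lborel)"
      by (subst Z_volterra[OF t \<mu>0]) (simp add: distrib_left)
    also have "ennreal (exp (- \<nu> * t)) * (\<integral>\<^sup>+s. indicator {0<..<t} s * (ennreal (\<mu> * g s v) * Z \<mu> (t - s) 0) \<partial>lborel) =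
        (\<integral>\<^sup>+s. ennreal (exp (- \<nu> * t)) * (indicator {0<..<t} s * (ennreal (\<mu> * g s v) * Z \<mu> (t - s) 0)) \<partial>lborel)"
      by (rule nn_integral_cmult[symmetric]) measurable
    also have "\<dots> = (\<integral>\<^sup>+s. ennreal (k s v * z (t - s)) \<partial>lborel)"
    proof (rule nn_integral_cong_AE)
      show "AE s in lborel. ennreal (exp (- \<nu> * t)) * (indicator {0<..<t} s * (ennreal (\<mu> * g s v) * Z \<mu> (t - s) 0)) = ennreal (k s v * z (t - s))"
        \<comment> \<open>At \<open>s = t\<close> the right-hand side contains \<open>z 0\<close>,
          which the open interval on the left leaves out.\<close>
        using AE_lborel_singleton[of t]
      proof eventually_elim
        case (elim s)
        show ?case
        proof (cases "0 < s \<and> s < t")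
          case True
          have e: "exp (- \<nu> * t) = exp (- \<nu> * s) * exp (- \<nu> * (t - s))" by (simp add: exp_add[symmetric] algebra_simps)
          have "ennreal (exp (- \<nu> * t)) * (indicator {0<..<t} s * (ennreal (\<mu> * g s v) * Z \<mu> (t - s) 0)) =
             ennreal (exp (- \<nu> * t) * (\<mu> * g s v * Zr \<mu> (t - s) 0))"
            using True \<mu> g_nonneg[of s v] Z_Zr[of "t - s" \<mu> 0] Zr_ge_1[of "t - s" \<mu> 0]
            by (simp add: ennreal_mult)
          also have "exp (- \<nu> * t) * (\<mu> * g s v * Zr \<mu> (t - s) 0) = k s v * z (t - s)"
            unfolding k_def z_def e using True by simp
          finally show ?thesis .
        next
          case False
          then show ?thesis using elim by (auto simp: k_def z_def split: split_indicator)
        qed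
      qed
    qed
    finally show ?thesis .
  qed
  have "(\<exists>C. \<forall>t. z t \<le> C) \<and> (\<exists>c>0. (z \<longlongrightarrow> c) at_top)"
  proof (rule renewal_exponential[of "\<lambda>s. k s 0"])
    show "0 < k s 0" if "0 < s" for s using that \<mu> g_0_pos[OF that] by (simp add: k_def)
    show "(LINT s|lborel. k s 0) = 1" using eq by (simp add: k_LINT)
    \<comment> \<open>Half of the exponential weight absorbs the factor \<open>s\<close>; the other
      half leaves the Laplace transform of \<open>g\<close> at \<open>\<nu> / 2\<close>.\<close>
    show "integrable lborel (\<lambda>s. s * k s 0)"
    proof (rule Bochner_Integration.integrable_bound)
      have "integrable lborel (\<lambda>s. 2 * \<mu> / \<nu> * (indicator {0<..} s * (exp (- (\<nu> / 2) * s) * g s 0)))"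
        using \<nu> by (intro integrable_mult_right laplace_g(1)) auto
      then show "integrable lborel (\<lambda>s. 2 * \<mu> / \<nu> * (indicator {0<..} s * (exp (- (\<nu> / 2) * s) * g s 0)))" .
      show "AE s in lborel. norm (s * k s 0) \<le> norm (2 * \<mu> / \<nu> * (indicator {0<..} s * (exp (- (\<nu> / 2) * s) * g s 0)))"
      proof (rule AE_I2)
        fix s
        show "norm (s * k s 0) \<le> norm (2 * \<mu> / \<nu> * (indicator {0<..} s * (exp (- (\<nu> / 2) * s) * g s 0)))"
        proof (cases "0 < s")
          case True
          have "\<nu> / 2 * s \<le> exp (\<nu> / 2 * s)" using exp_ge_add_one_self[of "\<nu> / 2 * s"] by linarith
          then have "s \<le> 2 / \<nu> * exp (\<nu> / 2 * s)" using \<nu> by (simp add: field_simps)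
          then have "s * exp (- \<nu> * s) \<le> (2 / \<nu> * exp (\<nu> / 2 * s)) * exp (- \<nu> * s)" by (intro mult_right_mono) auto
          also have "\<dots> = 2 / \<nu> * exp (- (\<nu> / 2) * s)" by (simp add: mult.assoc exp_add[symmetric] algebra_simps)
          finally have "(s * exp (- \<nu> * s)) * (\<mu> * g s 0) \<le> (2 / \<nu> * exp (- (\<nu> / 2) * s)) * (\<mu> * g s 0)"
            using \<mu> g_nonneg[OF True] by (intro mult_right_mono) auto
          then show ?thesis using True \<mu> \<nu> g_nonneg[OF True, of 0] by (simp add: k_def abs_mult ac_simps)
        qed (auto simp: k_def)
      qed
    qed measurable
    show "exp (\<nu> * s) * z s \<le> exp (\<nu> * t) * z t" if "0 \<le> s" "s \<le> t" for s t
    proof -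
      have "Zr \<mu> s 0 \<le> Zr \<mu> t 0"
        using Z_mono[OF that \<mu>0, of 0] Z_Zr[of s \<mu> 0] Z_Zr[of t \<mu> 0] that \<mu>0 Zr_ge_1[of t \<mu> 0] by simp
      moreover have "exp (\<nu> * r) * z r = Zr \<mu> r 0" if "0 \<le> r" for r
        using that by (simp add: z_def mult.assoc[symmetric] exp_add[symmetric])
      ultimately show ?thesis using that by simp
    qed
    show "ennreal (z t) = ennreal (exp (- \<nu> * t)) + (\<integral>\<^sup>+s. ennreal (k s 0 * z (t - s)) \<partial>lborel)" if "0 \<le> t" for t
      using conv[OF that, of 0] that by (simp add: z_def)
  qed (use k_int \<nu> z_nonneg in \<open>auto simp: k_def z_def\<close>)
  then obtain C c where C: "\<And>t. z t \<le> C" and c: "0 < c" "(z \<longlongrightarrow> c) at_top" by auto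
  have C0: "0 \<le> C" using C[of 0] z_nonneg[of 0] by linarith
  \<comment> \<open>Whatever the level \<open>v\<close>, the unknown under the integral is the same
    \<open>z\<close>; its boundedness and convergence settle the general case by dominated
    convergence.\<close>
  have "((\<lambda>t. exp (- \<nu> * t) * Zr \<mu> t v) \<longlongrightarrow> (\<mu> * c) * u \<nu> v) at_top" for v
  proof -
    have "((\<lambda>t. LINT s|lborel. k s v * z (t - s)) \<longlongrightarrow> (LINT s|lborel. k s v * c)) at_top"
    proof (rule integral_dominated_convergence_at_top[where w="\<lambda>s. k s v * C"])
      show "AE s in lborel. ((\<lambda>t. k s v * z (t - s)) \<longlongrightarrow> k s v * c) at_top"
      proof (rule AE_I2)
        fix s
        have "filterlim (\<lambda>t :: real. - s + t) at_top at_top"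
          by (rule filterlim_tendsto_add_at_top[OF tendsto_const filterlim_ident])
        from filterlim_compose[OF c(2) this] have "((\<lambda>t. z (t - s)) \<longlongrightarrow> c) at_top" by simp
        then show "((\<lambda>t. k s v * z (t - s)) \<longlongrightarrow> k s v * c) at_top" by (intro tendsto_intros)
      qed
      show "\<forall>\<^sub>F t in at_top. AE s in lborel. norm (k s v * z (t - s)) \<le> k s v * C"
        using C k_nonneg z_nonneg by (auto simp: abs_mult intro!: always_eventually AE_I2 mult_left_mono)
    qed (use k_int[of v] in auto)
    moreover have "(LINT s|lborel. k s v * c) = (\<mu> * c) * u \<nu> v"
      using k_LINT[of v] by simp
    ultimately have 1: "((\<lambda>t. LINT s|lborel. k s v * z (t - s)) \<longlongrightarrow> (\<mu> * c) * u \<nu> v) at_top"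
      by (simp only:)
    have 0: "((\<lambda>t. exp (- \<nu> * t)) \<longlongrightarrow> 0) at_top"
      by (rule filterlim_compose[OF exp_at_bot], rule filterlim_tendsto_neg_mult_at_bot[OF tendsto_const _ filterlim_ident])
        (use \<nu> in auto)
    have lim: "((\<lambda>t. exp (- \<nu> * t) + (LINT s|lborel. k s v * z (t - s))) \<longlongrightarrow> 0 + (\<mu> * c) * u \<nu> v) at_top"
      by (rule tendsto_add[OF 0 1])
    have "eventually (\<lambda>t. exp (- \<nu> * t) + (LINT s|lborel. k s v * z (t - s)) = exp (- \<nu> * t) * Zr \<mu> t v) at_top"
      using eventually_ge_at_top[of 0]
    proof eventually_elim
      case (elim t)
      have int: "integrable lborel (\<lambda>s. k s v * z (t - s))"
        by (rule Bochner_Integration.integrable_bound[of _ "\<lambda>s. k s v * C"])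
          (use k_int C C0 k_nonneg z_nonneg in \<open>auto simp: abs_mult intro!: mult_left_mono\<close>)
      have "(\<integral>\<^sup>+s. ennreal (k s v * z (t - s)) \<partial>lborel) = ennreal (LINT s|lborel. k s v * z (t - s))"
        using k_nonneg z_nonneg by (intro nn_integral_eq_integral int) auto
      moreover have "0 \<le> (LINT s|lborel. k s v * z (t - s))"
        using k_nonneg z_nonneg by (intro Bochner_Integration.integral_nonneg) auto
      ultimately have "ennreal (exp (- \<nu> * t) * Zr \<mu> t v) = ennreal (exp (- \<nu> * t) + (LINT s|lborel. k s v * z (t - s)))"
        using conv[OF elim, of v] by (simp add: ennreal_plus)
      then show ?case
        using \<open>0 \<le> (LINT s|lborel. k s v * z (t - s))\<close> Zr_ge_1[OF elim \<mu>0, of v]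
        by (subst (asm) ennreal_inj) auto
    qed
    from Lim_transform_eventually[OF lim this] show ?thesis by simp
  qed
  then show ?thesis using \<mu> c(1) by (intro exI[of _ "\<mu> * c"]) auto
qed

end

section \<open>The Feynman-Kac kernel and the limit law\<close>

lemma borel_eq_open_intervals: "(borel :: real measure) = sigma UNIV (range (\<lambda>(a, b). {a<..<b}))"
  unfolding borel_eq_box box_real by (rule refl)

text \<open>A priori \<open>q\<close> has no sign and is only locally integrable, so it cannot be
  treated as a density at once. Test functions determine its integrals over intervals, then over
  Borel subsets of a bounded window; this forces \<open>q\<close> to be nonnegative, after which the
  windows are exhausted.\<close>

lemma kernel_density:
  fixes q :: "real \<Rightarrow> real" and \<kappa> :: "real measure"
  assumes \<kappa>: "finite_measure \<kappa>" "sets \<kappa> = sets borel"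
    and q [measurable]: "q \<in> borel_measurable borel"
    and test: "\<And>\<phi> K. continuous_on UNIV \<phi> \<Longrightarrow> (\<And>y. 0 \<le> \<phi> y \<and> \<phi> y \<le> (1 :: real)) \<Longrightarrow> (\<And>y. K < \<bar>y\<bar> \<Longrightarrow> \<phi> y = 0) \<Longrightarrow>
      integrable lborel (\<lambda>y. q y * \<phi> y) \<and> (LINT y|lborel. q y * \<phi> y) = (LINT y|\<kappa>. \<phi> y)"
  shows "AE y in lborel. 0 \<le> q y" and "density lborel (\<lambda>y. ennreal (q y)) = \<kappa>"
proof -
  interpret K: finite_measure \<kappa> by (rule \<kappa>(1))
  note [measurable_cong] = \<kappa>(2)
  have sp: "space \<kappa> = UNIV" using sets_eq_imp_space_eq[OF \<kappa>(2)] by simp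
  \<comment> \<open>Trapezoids: continuous, zero off \<open>{c<..<d}\<close>, and with slopes
    \<open>n\<close> at the ends, so they converge to the indicator of the open interval.\<close>
  define T where "T n c d y = max 0 (min 1 (real n * min (y - c) (d - y)))" for n :: nat and c d y :: real
  have T_cont: "continuous_on UNIV (T n c d)" for n c d unfolding T_def by (intro continuous_intros)
  have T_01: "0 \<le> T n c d y \<and> T n c d y \<le> 1" for n c d y by (auto simp: T_def)
  have T_supp: "T n c d y = 0" if "y \<notin> {c<..<d}" for n c d y
  proof -
    have "min (y - c) (d - y) \<le> 0" using that by (auto simp: min_def)
    then have "real n * min (y - c) (d - y) \<le> 0" by (intro mult_nonneg_nonpos) auto
    then show ?thesis by (auto simp: T_def)
  qed
  have T_supp': "T n c d y = 0" if "max \<bar>c\<bar> \<bar>d\<bar> < \<bar>y\<bar>" for n c d y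
    using that by (intro T_supp) auto
  have T_lim: "(\<lambda>n. T n c d y) \<longlonglongrightarrow> indicator {c<..<d} y" for c d y
  proof (cases "y \<in> {c<..<d}")
    case True
    then have m: "0 < min (y - c) (d - y)" by auto
    obtain N :: nat where N: "1 / min (y - c) (d - y) < real N" using reals_Archimedean2 by blast
    have "eventually (\<lambda>n. T n c d y = 1) sequentially"
      using eventually_ge_at_top[of N]
    proof eventually_elim
      case (elim n)
      have "1 / min (y - c) (d - y) \<le> real n" using N elim by (meson less_imp_le of_nat_le_iff order_trans)
      then have "1 \<le> real n * min (y - c) (d - y)" using m by (subst (asm) pos_divide_le_eq) auto
      then show ?case unfolding T_def by (simp only: min_absorb1 max_absorb2 zero_le_one)
    qed
    then show ?thesis using True by (auto intro: tendsto_eventually)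
  next
    case False
    then show ?thesis using T_supp by simp
  qed
  \<comment> \<open>The trapezoid of slope 1 over the interval enlarged by 1 on each side equals 1
    on \<open>{c<..<d}\<close>.\<close>
  have loc_int: "integrable lborel (\<lambda>y. q y * indicator {c<..<d} y)" for c d
  proof (rule Bochner_Integration.integrable_bound)
    show "integrable lborel (\<lambda>y. q y * T 1 (c - 1) (d + 1) y)"
      using test[OF T_cont T_01 T_supp'] by blast
    show "AE y in lborel. norm (q y * indicator {c<..<d} y) \<le> norm (q y * T 1 (c - 1) (d + 1) y)"
    proof (rule AE_I2)
      fix y
      have "T 1 (c - 1) (d + 1) y = 1" if "y \<in> {c<..<d}" using that by (auto simp: T_def)
      then show "norm (q y * indicator {c<..<d} y) \<le> norm (q y * T 1 (c - 1) (d + 1) y)"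
        by (auto split: split_indicator)
    qed
  qed measurable
  have interval: "(LINT y|lborel. q y * indicator {c<..<d} y) = measure \<kappa> {c<..<d}" for c d
  proof (rule LIMSEQ_unique)
    show "(\<lambda>n. LINT y|lborel. q y * T n c d y) \<longlonglongrightarrow> (LINT y|lborel. q y * indicator {c<..<d} y)"
    proof (rule integral_dominated_convergence[where w="\<lambda>y. \<bar>q y * indicator {c<..<d} y\<bar>"])
      show "AE y in lborel. (\<lambda>n. q y * T n c d y) \<longlonglongrightarrow> q y * indicator {c<..<d} y"
        by (intro AE_I2 tendsto_intros T_lim)
      show "AE y in lborel. norm (q y * T n c d y) \<le> \<bar>q y * indicator {c<..<d} y\<bar>" for n
      proof (rule AE_I2)
        fix y show "norm (q y * T n c d y) \<le> \<bar>q y * indicator {c<..<d} y\<bar>"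
          using T_01[of n c d y] T_supp[of y c d n] by (auto simp: abs_mult mult_left_le split: split_indicator)
      qed
      show "(\<lambda>y. q y * T n c d y) \<in> borel_measurable lborel" for n
        using borel_measurable_continuous_onI[OF T_cont] by measurable
    qed (use loc_int in auto)
    have "(\<lambda>n. LINT y|\<kappa>. T n c d y) \<longlonglongrightarrow> (LINT y|\<kappa>. indicator {c<..<d} y)"
    proof (rule integral_dominated_convergence[where w="\<lambda>_. 1"])
      show "AE y in \<kappa>. (\<lambda>n. T n c d y) \<longlonglongrightarrow> indicator {c<..<d} y"
        by (intro AE_I2 T_lim)
      show "T n c d \<in> borel_measurable \<kappa>" for n
        using borel_measurable_continuous_onI[OF T_cont] by measurable
    qed (use T_01 in auto)
    moreover have "(LINT y|lborel. q y * T n c d y) = (LINT y|\<kappa>. T n c d y)" for n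
      using test[OF T_cont T_01 T_supp'] by blast
    ultimately show "(\<lambda>n. LINT y|lborel. q y * T n c d y) \<longlonglongrightarrow> measure \<kappa> {c<..<d}" by (simp add: sp)
  qed
  \<comment> \<open>Inside the window \<open>{-N<..<N}\<close> the function \<open>q\<close> is
    integrable, so both sides are finite and complements can be subtracted in the Dynkin
    argument.\<close>
  have sets_eq: "(LINT y:B|lborel. q y * indicator {-N<..<N} y) = measure \<kappa> (B \<inter> {-N<..<N})" if B: "B \<in> sets borel" for B and N :: real
  proof -
    let ?f = "\<lambda>y. q y * indicator {-N<..<N} y"
    have f_int: "integrable lborel ?f" by (rule loc_int)
    have si: "set_integrable lborel A ?f" if "A \<in> sets borel" for A
      using integrable_mult_indicator[OF _ f_int, of A] that unfolding set_integrable_def by simp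
    let ?G = "range (\<lambda>(a, b). {a<..<b::real})"
    have "Int_stable ?G"
    proof (rule Int_stableI, safe)
      fix a b c d :: real
      have "{a<..<b} \<inter> {c<..<d} = {max a c<..<min b d}" by auto
      then show "{a<..<b} \<inter> {c<..<d} \<in> ?G" by (metis (no_types, lifting) case_prod_conv rangeI)
    qed
    moreover have "?G \<subseteq> Pow UNIV" by simp
    moreover have "B \<in> sigma_sets UNIV ?G"
      using B unfolding borel_eq_open_intervals by simp
    ultimately show ?thesis
    proof (induction rule: sigma_sets_induct_disjoint)
      case (basic A)
      then obtain a b where A: "A = {a<..<b}" by auto
      have *: "{a<..<b} \<inter> {-N<..<N} = {max a (-N)<..<min b N}" by auto
      have "(LINT y:A|lborel. ?f y) = (LINT y|lborel. q y * indicator {max a (-N)<..<min b N} y)"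
        unfolding A set_lebesgue_integral_def by (intro Bochner_Integration.integral_cong) (auto split: split_indicator)
      then show ?case unfolding interval A * .
    next
      case empty
      then show ?case by (simp add: set_lebesgue_integral_def)
    next
      case (compl A)
      have A: "A \<in> sets borel" using compl(1) unfolding borel_eq_open_intervals by simp
      have "(LINT y:UNIV|lborel. ?f y) = (LINT y:A|lborel. ?f y) + (LINT y:UNIV - A|lborel. ?f y)"
        using set_integral_Un[of A "UNIV - A" lborel ?f] si A by auto
      moreover have "(LINT y:UNIV|lborel. ?f y) = measure \<kappa> {-N<..<N}" using interval[of "-N" N] by (simp add: set_lebesgue_integral_def)
      moreover have "measure \<kappa> {-N<..<N} = measure \<kappa> (A \<inter> {-N<..<N}) + measure \<kappa> ((UNIV - A) \<inter> {-N<..<N})"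
        using A by (subst K.finite_measure_Union[symmetric]) (auto intro!: arg_cong[where f="measure \<kappa>"])
      ultimately show ?case using compl(2) by simp
    next
      case (union A)
      have A: "A i \<in> sets borel" for i using union(2) unfolding borel_eq_open_intervals by auto
      have "(LINT y:(\<Union>i. A i)|lborel. ?f y) = (\<Sum>i. LINT y:A i|lborel. ?f y)"
        using A union(1) si by (intro lebesgue_integral_countable_add) (auto simp: disjoint_family_on_def)
      also have "\<dots> = (\<Sum>i. measure \<kappa> (A i \<inter> {-N<..<N}))" using union(3) by simp
      also have "\<dots> = measure \<kappa> (\<Union>i. A i \<inter> {-N<..<N})"
        using A union(1) by (intro sums_unique[symmetric] K.finite_measure_UNION) (auto simp: disjoint_family_on_def)
      finally show ?case by simp
    qed
  qed
  \<comment> \<open>Otherwise the part of \<open>{y. q y < 0}\<close> in some window would have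
    negative \<open>\<kappa>\<close>-measure.\<close>
  show nonneg: "AE y in lborel. 0 \<le> q y"
  proof -
    have "AE y in lborel. \<bar>y\<bar> < real n \<longrightarrow> 0 \<le> q y" for n :: nat
    proof -
      let ?B = "{y. q y < 0}" and ?f = "\<lambda>y. q y * indicator {-real n<..<real n} y"
      have B: "?B \<in> sets borel" by measurable
      have f_int: "integrable lborel ?f" by (rule loc_int)
      have int: "integrable lborel (\<lambda>y. - (indicator ?B y *\<^sub>R ?f y))"
        using integrable_mult_indicator[OF _ f_int, of ?B] B by simp
      have "0 \<le> (LINT y:?B|lborel. ?f y)" unfolding sets_eq[OF B] by simp
      then have le: "(LINT y|lborel. - (indicator ?B y *\<^sub>R ?f y)) \<le> 0"
        unfolding set_lebesgue_integral_def by simp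
      have pos: "0 \<le> - (indicator ?B y *\<^sub>R ?f y)" for y by (auto split: split_indicator)
      then have "0 \<le> (LINT y|lborel. - (indicator ?B y *\<^sub>R ?f y))"
        by (intro Bochner_Integration.integral_nonneg)
      then have "(LINT y|lborel. - (indicator ?B y *\<^sub>R ?f y)) = 0"
        using le by (intro order.antisym)
      then have "AE y in lborel. - (indicator ?B y *\<^sub>R ?f y) = 0"
        using integral_nonneg_eq_0_iff_AE[OF int] pos by auto
      then show ?thesis by eventually_elim (auto split: split_indicator_asm)
    qed
    then have "AE y in lborel. \<forall>n :: nat. \<bar>y\<bar> < real n \<longrightarrow> 0 \<le> q y" unfolding AE_all_countable by blast
    then show ?thesis by eventually_elim (metis reals_Archimedean2)
  qed
  show "density lborel (\<lambda>y. ennreal (q y)) = \<kappa>"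
  proof (rule measure_eqI)
    fix B assume "B \<in> sets (density lborel (\<lambda>y. ennreal (q y)))"
    then have B: "B \<in> sets borel" by simp
    let ?A = "\<lambda>n :: nat. B \<inter> {-real n<..<real n}"
    have UB: "B = (\<Union>n. ?A n)"
    proof safe
      fix y assume y: "y \<in> B"
      obtain n :: nat where "\<bar>y\<bar> < real n" using reals_Archimedean2 by blast
      then show "y \<in> (\<Union>n. ?A n)" using y by (auto simp: abs_less_iff intro!: exI[of _ n])
    qed
    have r: "range ?A \<subseteq> sets borel" using B by auto
    have inc: "incseq ?A" by (auto simp: incseq_def)
    have "emeasure (density lborel (\<lambda>y. ennreal (q y))) (?A n) = emeasure \<kappa> (?A n)" for n
    proof -
      let ?f = "\<lambda>y. q y * indicator {-real n<..<real n} y"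
      have f_int: "integrable lborel (\<lambda>y. indicator B y *\<^sub>R ?f y)"
        using integrable_mult_indicator[OF _ loc_int, of B] B by simp
      have "emeasure (density lborel (\<lambda>y. ennreal (q y))) (?A n) = (\<integral>\<^sup>+y. ennreal (q y) * indicator (?A n) y \<partial>lborel)"
        using B by (intro emeasure_density) auto
      also have "\<dots> = (\<integral>\<^sup>+y. ennreal (indicator B y *\<^sub>R ?f y) \<partial>lborel)"
        by (intro nn_integral_cong) (auto split: split_indicator)
      also have "\<dots> = ennreal (LINT y:B|lborel. ?f y)"
        unfolding set_lebesgue_integral_def
      proof (rule nn_integral_eq_integral[OF f_int])
        show "AE y in lborel. 0 \<le> indicator B y *\<^sub>R ?f y"
          using nonneg by eventually_elim (auto split: split_indicator)
      qed
      finally show ?thesis unfolding sets_eq[OF B] by (simp add: K.emeasure_eq_measure)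
    qed
    moreover have "(SUP n. emeasure (density lborel (\<lambda>y. ennreal (q y))) (?A n)) = emeasure (density lborel (\<lambda>y. ennreal (q y))) B"
      by (subst (2) UB, rule SUP_emeasure_incseq[OF _ inc]) (use r in simp)
    moreover have "(SUP n. emeasure \<kappa> (?A n)) = emeasure \<kappa> B"
      by (subst (2) UB, rule SUP_emeasure_incseq[OF _ inc]) (simp only: \<kappa>(2) r)
    ultimately show "emeasure (density lborel (\<lambda>y. ennreal (q y))) B = emeasure \<kappa> B" by simp
  qed (simp add: \<kappa>(2))
qed

section \<open>The Feynman-Kac semigroup on nonnegative functions\<close>

context feynman_kac begin

text \<open>Space is translated so that \<open>a\<close> becomes 0. Using the path functional
  \<open>ell\<close> under \<open>W\<close>, instead of \<open>L\<close> on the sample space, makes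
  the expression measurable in the starting point and ready for the Markov property.\<close>

definition sem :: "real \<Rightarrow> real \<Rightarrow> (real \<Rightarrow> ennreal) \<Rightarrow> real \<Rightarrow> ennreal" where
  "sem \<mu> t f v = (\<integral>\<^sup>+\<omega>. ennreal (exp (\<mu> * ell t v \<omega>)) * f (v - \<omega> t) \<partial>W)"

lemma sem_meas:
  assumes "0 \<le> t" and f [measurable]: "f \<in> borel_measurable borel"
  shows "sem \<mu> t f \<in> borel_measurable borel"
proof -
  interpret W: prob_space W by (rule prob_space_W)
  have [measurable]: "(\<lambda>(v, \<omega>). ell t v \<omega>) \<in> borel_measurable (borel \<Otimes>\<^sub>M W)"
    unfolding split_beta by (rule ell_meas) auto
  have [measurable]: "(\<lambda>\<omega>. \<omega> t) \<in> borel_measurable W"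
    using measurable_path_space_eval[of t "{0..}"] assms(1) by simp
  show ?thesis unfolding sem_def by measurable
qed

lemma sem_eq:
  assumes t: "0 \<le> t" and f [measurable]: "f \<in> borel_measurable borel"
  shows "sem \<mu> t f v = (\<integral>\<^sup>+w. ennreal (exp (\<mu> * L t v w)) * f (v - \<xi> t w) \<partial>M)"
proof -
  have [measurable]: "(\<lambda>\<omega>. ell t v \<omega>) \<in> borel_measurable (path_space {0..})" by (rule ell_meas) auto
  have [measurable]: "(\<lambda>\<omega>. \<omega> t) \<in> borel_measurable (path_space {0..})"
    using measurable_path_space_eval[of t "{0..}"] t by simp
  have "sem \<mu> t f v = (\<integral>\<^sup>+w. ennreal (exp (\<mu> * ell t v (full_path w))) * f (v - full_path w t) \<partial>M)"
    unfolding sem_def by (rule nn_integral_W) measurable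
  also have "\<dots> = (\<integral>\<^sup>+w. ennreal (exp (\<mu> * L t v w)) * f (v - \<xi> t w) \<partial>M)"
  proof (rule nn_integral_cong_AE)
    show "AE w in M. ennreal (exp (\<mu> * ell t v (full_path w))) * f (v - full_path w t) = ennreal (exp (\<mu> * L t v w)) * f (v - \<xi> t w)"
      using AE_ell by eventually_elim (use t in \<open>auto simp: full_path_def\<close>)
  qed
  finally show ?thesis .
qed

lemma sem_1: "sem \<mu> t (\<lambda>_. 1) v = Z \<mu> t v"
  by (simp add: sem_def Z_def)

text \<open>The approximations up to time \<open>S\<close> read the path only before
  \<open>S\<close>, so freezing it there changes nothing.\<close>

lemma ell_stop_past:
  "ell S v (\<lambda>r\<in>{0..}. past S w (min r S)) = ell S v (full_path w)"
proof -
  have "occ n S v (\<lambda>r\<in>{0..}. past S w (min r S)) = occ n S v (full_path w)" for n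
    unfolding occ_def by (intro Bochner_Integration.integral_cong) (auto simp: past_def full_path_def split: split_indicator)
  then show ?thesis by (simp add: ell_def)
qed

text \<open>Almost surely \<open>L T v\<close> is \<open>L S v\<close> plus the local time of the
  shifted path at level \<open>v - \<xi> S w\<close>. Both are path functionals, of the past and of
  the future, so the Markov property applies to their product \<open>h\<close>. The factor
  \<open>F\<close> carries an arbitrary event of the past.\<close>

lemma markov_L:
  assumes S: "0 \<le> S" "S \<le> T" and F [measurable]: "F \<in> borel_measurable (path_space {0..S})"
    and f [measurable]: "f \<in> borel_measurable borel"
  shows "(\<integral>\<^sup>+w. F (past S w) * (ennreal (exp (\<mu> * L T v w)) * f (v - \<xi> T w)) \<partial>M) =
    (\<integral>\<^sup>+w. F (past S w) * (ennreal (exp (\<mu> * L S v w)) * sem \<mu> (T - S) f (v - \<xi> S w)) \<partial>M)"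
proof -
  define h where "h = (\<lambda>(\<eta>, \<omega>). F \<eta> * ennreal (exp (\<mu> * ell S v (\<lambda>r\<in>{0..}. \<eta> (min r S)))) *
      (ennreal (exp (\<mu> * ell (T - S) (v - \<eta> S) \<omega>)) * f (v - \<eta> S - \<omega> (T - S))))"
  have [measurable]: "(\<lambda>\<eta>. \<eta> S) \<in> borel_measurable (path_space {0..S})"
    using S by (intro measurable_path_space_eval) auto
  have [measurable]: "(\<lambda>\<omega>. \<omega> (T - S)) \<in> borel_measurable (path_space {0..})"
    using S by (intro measurable_path_space_eval) auto
  have [measurable]: "(\<lambda>\<eta>. ell S v (\<lambda>r\<in>{0..}. \<eta> (min r S))) \<in> borel_measurable (path_space {0..S})"
    by (rule ell_meas) (auto intro: measurable_stop_path S)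
  have h: "h \<in> borel_measurable (path_space {0..S} \<Otimes>\<^sub>M path_space {0..})"
  proof -
    have [measurable]: "(\<lambda>x. ell (T - S) (v - fst x S) (snd x)) \<in> borel_measurable (path_space {0..S} \<Otimes>\<^sub>M path_space {0..})"
      by (rule ell_meas) measurable
    show ?thesis unfolding h_def split_beta by measurable
  qed
  have "(\<integral>\<^sup>+w. F (past S w) * (ennreal (exp (\<mu> * L T v w)) * f (v - \<xi> T w)) \<partial>M) = (\<integral>\<^sup>+w. h (past S w, shift_path S w) \<partial>M)"
  proof (rule nn_integral_cong_AE)
    show "AE w in M. F (past S w) * (ennreal (exp (\<mu> * L T v w)) * f (v - \<xi> T w)) = h (past S w, shift_path S w)"
      using AE_ell AE_ell_shift[OF S(1)]
    proof eventually_elim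
      case (elim w)
      have p: "past S w S = \<xi> S w" using S by (simp add: past_def)
      have e1: "ell S v (\<lambda>r\<in>{0..}. past S w (min r S)) = L S v w" using elim(1) S unfolding ell_stop_past by simp
      have e2: "ell (T - S) (v - \<xi> S w) (shift_path S w) = L T v w - L S v w"
        using elim(2) S by simp
      have e3: "v - \<xi> S w - shift_path S w (T - S) = v - \<xi> T w"
        using S by (simp add: shift_path_def shifted_def)
      have "exp (\<mu> * L T v w) = exp (\<mu> * L S v w) * exp (\<mu> * (L T v w - L S v w))"
        by (simp add: exp_add[symmetric] right_diff_distrib)
      then show ?case unfolding h_def prod.case p e1 e2 e3 by (simp add: ennreal_mult mult.assoc)
    qed
  qed
  also have "\<dots> = (\<integral>\<^sup>+w. \<integral>\<^sup>+\<omega>. h (past S w, \<omega>) \<partial>W \<partial>M)"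
    by (rule markov_property[OF S(1) h])
  also have "\<dots> = (\<integral>\<^sup>+w. F (past S w) * (ennreal (exp (\<mu> * L S v w)) * sem \<mu> (T - S) f (v - \<xi> S w)) \<partial>M)"
  proof (rule nn_integral_cong_AE)
    show "AE w in M. (\<integral>\<^sup>+\<omega>. h (past S w, \<omega>) \<partial>W) = F (past S w) * (ennreal (exp (\<mu> * L S v w)) * sem \<mu> (T - S) f (v - \<xi> S w))"
      using AE_ell
    proof eventually_elim
      case (elim w)
      have p: "past S w S = \<xi> S w" using S by (simp add: past_def)
      have e: "ell S v (\<lambda>r\<in>{0..}. past S w (min r S)) = L S v w" using elim(1) S unfolding ell_stop_past by simp
      have [measurable]: "(\<lambda>\<omega>. ell (T - S) (v - \<xi> S w) \<omega>) \<in> borel_measurable (path_space {0..})" by (rule ell_meas) auto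
      show ?case unfolding h_def prod.case p e sem_def
        by (subst nn_integral_cmult) (auto simp: mult.assoc)
    qed
  qed
  finally show ?thesis .
qed

lemma Z_semigroup:
  assumes "0 \<le> s" "0 \<le> t"
  shows "Z \<mu> (s + t) v = (\<integral>\<^sup>+w. ennreal (exp (\<mu> * L s v w)) * Z \<mu> t (v - \<xi> s w) \<partial>M)"
  using markov_L[of s "s + t" "\<lambda>_. 1" "\<lambda>_. 1" \<mu> v] assms Z_eq[of "s + t" \<mu> v] by (simp add: sem_1)

text \<open>Fatou's lemma in \<open>Z \<mu> (t + r) = sem \<mu> t (Z \<mu> r)\<close>, rescaled by \<open>exp (- \<nu> * r)\<close>, as \<open>r \<rightarrow> \<infinity>\<close>. Equality
  holds, but the inequality already covers the points where \<open>u \<nu>\<close> might vanish.\<close>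

lemma sem_u_le:
  assumes t: "0 \<le> t" and \<mu>: "0 < \<mu>" and \<nu>: "0 < \<nu>" and eq: "\<mu> * u \<nu> 0 = 1"
  shows "sem \<mu> t (\<lambda>y. ennreal (u \<nu> y)) v \<le> ennreal (exp (\<nu> * t) * u \<nu> v)"
proof -
  have \<mu>0: "0 \<le> \<mu>" using \<mu> by simp
  obtain c where c: "0 < c" "\<And>v. ((\<lambda>t. exp (- \<nu> * t) * Zr \<mu> t v) \<longlongrightarrow> c * u \<nu> v) at_top"
    using Z_asymptotics[OF \<mu> \<nu> eq] by auto
  have [measurable]: "\<xi> t \<in> borel_measurable M" "L t v \<in> borel_measurable M" using t by (auto intro: \<xi>_meas L_meas)
  have [measurable]: "(\<lambda>y. Zr \<mu> r y) \<in> borel_measurable borel" for r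
    using measurable_compose[OF measurable_Pair1'[of r borel borel] Zr_meas] by simp
  have lim1: "(\<lambda>n. exp (- \<nu> * real n) * Zr \<mu> (real n) y) \<longlonglongrightarrow> c * u \<nu> y" for y
    using filterlim_compose[OF c(2) filterlim_real_sequentially] .
  have "filterlim (\<lambda>n. t + real n) at_top sequentially"
    by (rule filterlim_tendsto_add_at_top[OF tendsto_const filterlim_real_sequentially])
  from filterlim_compose[OF c(2) this] have lim2: "(\<lambda>n. exp (\<nu> * t) * (exp (- \<nu> * (t + real n)) * Zr \<mu> (t + real n) v)) \<longlonglongrightarrow> exp (\<nu> * t) * (c * u \<nu> v)"
    by (rule tendsto_mult_left)
  have "ennreal c * sem \<mu> t (\<lambda>y. ennreal (u \<nu> y)) v = (\<integral>\<^sup>+w. ennreal c * (ennreal (exp (\<mu> * L t v w)) * ennreal (u \<nu> (v - \<xi> t w))) \<partial>M)"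
    by (subst sem_eq[OF t]) (auto simp: nn_integral_cmult)
  also have "\<dots> = (\<integral>\<^sup>+w. liminf (\<lambda>n. ennreal (exp (\<mu> * L t v w) * (exp (- \<nu> * real n) * Zr \<mu> (real n) (v - \<xi> t w)))) \<partial>M)"
  proof (rule nn_integral_cong)
    fix w
    have "(\<lambda>n. ennreal (exp (\<mu> * L t v w) * (exp (- \<nu> * real n) * Zr \<mu> (real n) (v - \<xi> t w)))) \<longlonglongrightarrow>
        ennreal (exp (\<mu> * L t v w) * (c * u \<nu> (v - \<xi> t w)))"
      by (intro tendsto_intros lim1)
    from lim_imp_Liminf[OF _ this] show "ennreal c * (ennreal (exp (\<mu> * L t v w)) * ennreal (u \<nu> (v - \<xi> t w))) =
        liminf (\<lambda>n. ennreal (exp (\<mu> * L t v w) * (exp (- \<nu> * real n) * Zr \<mu> (real n) (v - \<xi> t w))))"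
      using c(1) u_nonneg[OF \<nu>] by (simp add: ennreal_mult ac_simps)
  qed
  also have "\<dots> \<le> liminf (\<lambda>n. \<integral>\<^sup>+w. ennreal (exp (\<mu> * L t v w) * (exp (- \<nu> * real n) * Zr \<mu> (real n) (v - \<xi> t w))) \<partial>M)"
    by (rule nn_integral_liminf) measurable
  also have "\<dots> = liminf (\<lambda>n. ennreal (exp (\<nu> * t) * (exp (- \<nu> * (t + real n)) * Zr \<mu> (t + real n) v)))"
  proof (rule arg_cong[where f=liminf], rule ext)
    fix n :: nat
    have "(\<integral>\<^sup>+w. ennreal (exp (\<mu> * L t v w) * (exp (- \<nu> * real n) * Zr \<mu> (real n) (v - \<xi> t w))) \<partial>M) =
      (\<integral>\<^sup>+w. ennreal (exp (- \<nu> * real n)) * (ennreal (exp (\<mu> * L t v w)) * Z \<mu> (real n) (v - \<xi> t w)) \<partial>M)"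
    proof (rule nn_integral_cong)
      fix w
      have "0 \<le> Zr \<mu> (real n) (v - \<xi> t w)" using Zr_ge_1[of "real n" \<mu> "v - \<xi> t w"] \<mu> by simp
      then show "ennreal (exp (\<mu> * L t v w) * (exp (- \<nu> * real n) * Zr \<mu> (real n) (v - \<xi> t w))) =
        ennreal (exp (- \<nu> * real n)) * (ennreal (exp (\<mu> * L t v w)) * Z \<mu> (real n) (v - \<xi> t w))"
        using Z_Zr[of "real n" \<mu> "v - \<xi> t w"] \<mu> by (simp add: ennreal_mult ac_simps)
    qed
    also have "\<dots> = ennreal (exp (- \<nu> * real n)) * Z \<mu> (t + real n) v"
    proof -
      have [measurable]: "(\<lambda>y. Z \<mu> (real n) y) \<in> borel_measurable borel"
        using measurable_compose[OF measurable_Pair1'[of "real n" borel borel] Z_meas] by simp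
      show ?thesis unfolding Z_semigroup[OF t of_nat_0_le_iff] by (rule nn_integral_cmult) measurable
    qed
    also have "\<dots> = ennreal (exp (\<nu> * t) * (exp (- \<nu> * (t + real n)) * Zr \<mu> (t + real n) v))"
      using Z_Zr[of "t + real n" \<mu> v] t \<mu>
      by (simp add: ennreal_mult'[symmetric] mult.assoc[symmetric] exp_add[symmetric] algebra_simps)
    finally show "(\<integral>\<^sup>+w. ennreal (exp (\<mu> * L t v w) * (exp (- \<nu> * real n) * Zr \<mu> (real n) (v - \<xi> t w))) \<partial>M) = \<dots>" .
  qed
  also have "\<dots> = ennreal (exp (\<nu> * t) * (c * u \<nu> v))"
    by (intro lim_imp_Liminf tendsto_ennrealI lim2) simp
  also have "\<dots> = ennreal c * ennreal (exp (\<nu> * t) * u \<nu> v)"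
    using c(1) u_nonneg[OF \<nu>] by (simp add: ennreal_mult ac_simps)
  finally show ?thesis using c(1) by (subst (asm) ennreal_mult_le_mult_iff) auto
qed

end

section \<open>The kernel, the transition probabilities and the finite-dimensional laws of the limit
  process\<close>

locale penalized = feynman_kac +
  fixes \<mu> \<nu> a x :: real and p :: "real \<Rightarrow> real \<Rightarrow> real \<Rightarrow> real" and P :: "(real \<Rightarrow> real) measure"
  assumes \<mu>: "0 < \<mu>" and \<nu>: "0 < \<nu>" and \<nu>_eq: "of_real \<mu> * psi \<Psi> (of_real \<nu>) 0 = 1"
    and kernel: "feynman_kac_kernel M \<xi> L \<mu> a p"
    and law: "markov_law (rho \<Psi> p \<nu> a) x P"
begin

text \<open>Identifies the analytic normalization of the transition density with the resolvent
  density used so far; the real part of the exponential is the cosine.\<close>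

lemma Re_psi: "Re (psi \<Psi> (of_real \<nu>) v) = u \<nu> v"
proof -
  have int: "integrable lborel (\<lambda>q. exp (- \<i> * of_real (q * v)) / (of_real (\<Psi> q) + of_real \<nu>))"
  proof (rule Bochner_Integration.integrable_bound[OF resolvent_int[OF \<nu>]])
    show "AE q in lborel. norm (exp (- \<i> * of_real (q * v)) / (of_real (\<Psi> q) + of_real \<nu>)) \<le> norm (1 / (\<Psi> q + \<nu>))"
    proof (rule AE_I2)
      fix q
      have "norm (exp (- \<i> * of_real (q * v))) = 1" using norm_exp_i_times[of "- (q * v)"] by simp
      moreover have "norm (complex_of_real (\<Psi> q) + of_real \<nu>) = \<bar>\<Psi> q + \<nu>\<bar>"
        by (metis norm_of_real of_real_add)
      ultimately show "norm (exp (- \<i> * of_real (q * v)) / (of_real (\<Psi> q) + of_real \<nu>)) \<le> norm (1 / (\<Psi> q + \<nu>))"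
        by (simp add: norm_divide)
    qed
  qed measurable
  have "Re (psi \<Psi> (of_real \<nu>) v) = 1 / (2 * pi) * Re (CLINT q|lborel. exp (- \<i> * of_real (q * v)) / (of_real (\<Psi> q) + of_real \<nu>))"
  proof -
    have "psi \<Psi> (of_real \<nu>) v = of_real (1 / (2 * pi)) * (CLINT q|lborel. exp (- \<i> * of_real (q * v)) / (of_real (\<Psi> q) + of_real \<nu>))"
      unfolding psi_def by simp
    moreover have "Re (of_real r * z) = r * Re z" for r z by simp
    ultimately show ?thesis by (simp only:)
  qed
  also have "Re (CLINT q|lborel. exp (- \<i> * of_real (q * v)) / (of_real (\<Psi> q) + of_real \<nu>)) = (LINT q|lborel. cos (q * v) * (1 / (\<Psi> q + \<nu>)))"
    unfolding integral_Re[OF int, symmetric]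
  proof (rule Bochner_Integration.integral_cong[OF refl])
    fix q
    have "Re (exp (- \<i> * of_real (q * v)) / of_real (\<Psi> q + \<nu>)) = Re (exp (- \<i> * of_real (q * v))) / (\<Psi> q + \<nu>)"
      by (rule Re_divide_of_real)
    also have "Re (exp (- \<i> * of_real (q * v))) = cos (q * v)" by (simp add: Re_exp)
    finally show "Re (exp (- \<i> * of_real (q * v)) / (of_real (\<Psi> q) + of_real \<nu>)) = cos (q * v) * (1 / (\<Psi> q + \<nu>))" by simp
  qed
  finally show ?thesis by (simp add: u_def cos_transform_def)
qed

lemma \<nu>_u: "\<mu> * u \<nu> 0 = 1"
proof -
  have "Re (of_real \<mu> * psi \<Psi> (of_real \<nu>) 0) = 1" using \<nu>_eq by simp
  then show ?thesis using Re_psi[of 0] by simp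
qed

lemma p_meas: "0 < t \<Longrightarrow> (\<lambda>y. p t x' y) \<in> borel_measurable borel"
proof -
  assume "0 < t"
  then have "(\<lambda>(x, y). p t x y) \<in> borel_measurable (borel \<Otimes>\<^sub>M borel)" using kernel unfolding feynman_kac_kernel_def by blast
  from measurable_compose[OF measurable_Pair1'[of x' borel borel] this] show ?thesis by simp
qed

text \<open>The clause of the kernel that holds at every starting point covers compactly supported
  continuous test functions, since these lie in \<open>L2_fun\<close> and \<open>Cb_fun\<close>.
  \<open>kernel_density\<close> then identifies the kernel as a density of the reweighted law of
  \<open>x' - \<xi> t\<close>.\<close>

lemma kernel_law:
  assumes t: "0 < t"
  shows "AE y in lborel. 0 \<le> p t x' y"
    and "density lborel (\<lambda>y. ennreal (p t x' y)) = distr (density M (\<lambda>w. ennreal (exp (\<mu> * L t (x' - a) w)))) borel (\<lambda>w. x' - \<xi> t w)"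
proof -
  define \<kappa> where "\<kappa> = distr (density M (\<lambda>w. ennreal (exp (\<mu> * L t (x' - a) w)))) borel (\<lambda>w. x' - \<xi> t w)"
  have t0: "0 \<le> t" using t by simp
  have [measurable]: "\<xi> t \<in> borel_measurable M" "L t (x' - a) \<in> borel_measurable M"
    using t0 by (auto intro: \<xi>_meas L_meas)
  have fin: "finite_measure \<kappa>"
  proof (rule finite_measureI)
    have "emeasure \<kappa> (space \<kappa>) = Z \<mu> t (x' - a)"
      unfolding \<kappa>_def Z_eq[OF t0] by (simp add: emeasure_distr emeasure_density cong: nn_integral_cong)
    then show "emeasure \<kappa> (space \<kappa>) \<noteq> \<infinity>" using Z_Zr[OF t0, of \<mu> "x' - a"] \<mu> by simp
  qed
  have test: "integrable lborel (\<lambda>y. p t x' y * \<phi> y) \<and> (LINT y|lborel. p t x' y * \<phi> y) = (LINT y|\<kappa>. \<phi> y)"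
    if \<phi>: "continuous_on UNIV \<phi>" "\<And>y. 0 \<le> \<phi> y \<and> \<phi> y \<le> (1 :: real)" "\<And>y. K < \<bar>y\<bar> \<Longrightarrow> \<phi> y = 0" for \<phi> K
  proof -
    have [measurable]: "\<phi> \<in> borel_measurable borel" by (rule borel_measurable_continuous_onI[OF \<phi>(1)])
    let ?f = "\<lambda>y. complex_of_real (\<phi> y)"
    have "integrable lborel (\<lambda>y. (cmod (?f y))\<^sup>2)"
    proof (rule Bochner_Integration.integrable_bound[of _ "indicator {-K..K} :: real \<Rightarrow> real"])
      show "AE y in lborel. norm ((cmod (?f y))\<^sup>2) \<le> norm (indicator {-K..K} y :: real)"
      proof (rule AE_I2)
        fix y
        have "\<phi> y = 0 \<or> y \<in> {-K..K}" using \<phi>(3)[of y] by (cases "K < \<bar>y\<bar>") (auto simp: abs_le_iff not_less)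
        moreover have "(\<phi> y)\<^sup>2 \<le> 1" using \<phi>(2)[of y] by (intro power_le_one) auto
        ultimately show "norm ((cmod (?f y))\<^sup>2) \<le> norm (indicator {-K..K} y :: real)"
          by (auto split: split_indicator)
      qed
    qed (auto simp: integrable_indicator_iff emeasure_lborel_Icc_eq)
    then have "?f \<in> L2_fun" unfolding L2_fun_def by simp
    moreover have "?f \<in> Cb_fun"
    proof -
      have "continuous_on UNIV ?f" using \<phi>(1) by (intro continuous_intros)
      moreover have "bounded (range ?f)" using \<phi>(2) by (auto simp: bounded_iff intro!: exI[of _ 1])
      ultimately show ?thesis by (simp add: Cb_fun_def)
    qed
    ultimately have k: "integrable lborel (\<lambda>y. of_real (p t x' y) * ?f y)"
      "(LINT y|lborel. of_real (p t x' y) * ?f y) = fk_functional M \<xi> L \<mu> a t ?f x'"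
      using conjunct2[OF conjunct2[OF kernel[unfolded feynman_kac_kernel_def]], rule_format, OF t IntI, of ?f x'] by auto
    have 1: "integrable lborel (\<lambda>y. p t x' y * \<phi> y)"
      using k(1) unfolding of_real_mult[symmetric] complex_of_real_integrable_eq .
    have "complex_of_real (LINT y|lborel. p t x' y * \<phi> y) = (LINT y|lborel. of_real (p t x' y) * ?f y)"
      unfolding of_real_mult[symmetric] by (rule integral_complex_of_real[symmetric])
    also have "\<dots> = complex_of_real (LINT w|M. \<phi> (x' - \<xi> t w) * exp (\<mu> * L t (x' - a) w))"
      by (rule trans[OF k(2)]) (unfold fk_functional_def of_real_mult[symmetric], rule integral_complex_of_real)
    finally have "(LINT y|lborel. p t x' y * \<phi> y) = (LINT w|M. \<phi> (x' - \<xi> t w) * exp (\<mu> * L t (x' - a) w))"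
      by (simp only: of_real_eq_iff)
    also have "\<dots> = (LINT y|\<kappa>. \<phi> y)"
    proof -
      have "(LINT y|\<kappa>. \<phi> y) = (LINT w|density M (\<lambda>w. ennreal (exp (\<mu> * L t (x' - a) w))). \<phi> (x' - \<xi> t w))"
        unfolding \<kappa>_def by (rule integral_distr) measurable
      also have "\<dots> = (LINT w|M. exp (\<mu> * L t (x' - a) w) *\<^sub>R \<phi> (x' - \<xi> t w))"
      proof (rule integral_density)
        show "(\<lambda>w. \<phi> (x' - \<xi> t w)) \<in> borel_measurable M" by measurable
        show "(\<lambda>w. exp (\<mu> * L t (x' - a) w)) \<in> borel_measurable M" by measurable
      qed simp
      finally show ?thesis by (simp add: mult.commute)
    qed
    finally show ?thesis using 1 by simp
  qed
  show "AE y in lborel. 0 \<le> p t x' y"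
    by (rule kernel_density(1)[OF fin _ p_meas[OF t] test]) (auto simp: \<kappa>_def)
  show "density lborel (\<lambda>y. ennreal (p t x' y)) = distr (density M (\<lambda>w. ennreal (exp (\<mu> * L t (x' - a) w)))) borel (\<lambda>w. x' - \<xi> t w)"
    unfolding \<kappa>_def[symmetric]
    by (rule kernel_density(2)[OF fin _ p_meas[OF t] test]) (auto simp: \<kappa>_def)
qed

text \<open>Translates between \<open>p\<close>, which uses original coordinates, and
  \<open>sem\<close>, which measures positions relative to \<open>a\<close>.\<close>

lemma nn_integral_kernel:
  assumes t: "0 < t" and f [measurable]: "f \<in> borel_measurable borel"
  shows "(\<integral>\<^sup>+y. ennreal (p t x' y) * f y \<partial>lborel) = sem \<mu> t (\<lambda>z. f (z + a)) (x' - a)"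
proof -
  have t0: "0 \<le> t" using t by simp
  have [measurable]: "\<xi> t \<in> borel_measurable M" "L t (x' - a) \<in> borel_measurable M"
    using t0 by (auto intro: \<xi>_meas L_meas)
  note [measurable] = p_meas[OF t, of x']
  have "(\<integral>\<^sup>+y. ennreal (p t x' y) * f y \<partial>lborel) = (\<integral>\<^sup>+y. f y \<partial>(density lborel (\<lambda>y. ennreal (p t x' y))))"
    by (rule nn_integral_density[symmetric]) measurable
  also have "\<dots> = (\<integral>\<^sup>+w. ennreal (exp (\<mu> * L t (x' - a) w)) * f (x' - \<xi> t w) \<partial>M)"
    unfolding kernel_law(2)[OF t] by (subst nn_integral_distr) (auto simp: nn_integral_density)
  also have "\<dots> = sem \<mu> t (\<lambda>z. f (z + a)) (x' - a)"
    by (subst sem_eq[OF t0]) (auto simp: algebra_simps)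
  finally show ?thesis .
qed

text \<open>The unnormalized Doob transform of the semigroup by \<open>u \<nu>\<close>:
  \<open>B\<close> lives in original coordinates, \<open>v\<close> and \<open>z\<close> in those
  relative to \<open>a\<close>. Normalized, it becomes the transition probability
  \<open>k\<close>.\<close>

definition K :: "real \<Rightarrow> real set \<Rightarrow> real \<Rightarrow> ennreal" where
  "K t B v = sem \<mu> t (\<lambda>z. indicator B (z + a) * ennreal (u \<nu> z)) v"

lemma K_meas: "0 \<le> t \<Longrightarrow> B \<in> sets borel \<Longrightarrow> K t B \<in> borel_measurable borel"
  unfolding K_def by (intro sem_meas) auto

lemma K_le: "0 \<le> t \<Longrightarrow> K t B v \<le> ennreal (exp (\<nu> * t) * u \<nu> v)"
  by (rule order_trans[OF _ sem_u_le[OF _ \<mu> \<nu> \<nu>_u]])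
    (auto simp: K_def sem_def intro!: nn_integral_mono mult_left_mono split: split_indicator)

lemma K_finite: "0 \<le> t \<Longrightarrow> K t B v < top"
  using K_le le_less_trans ennreal_less_top by blast

definition k :: "real \<Rightarrow> real set \<Rightarrow> real \<Rightarrow> real" where
  "k t B y = exp (- \<nu> * t) * enn2real (K t B (y - a)) / u \<nu> (y - a)"

lemma k_meas:
  assumes "0 \<le> t" "B \<in> sets borel" shows "k t B \<in> borel_measurable borel"
proof -
  note [measurable] = K_meas[OF assms]
  show ?thesis unfolding k_def by measurable
qed

lemma k_nonneg: "0 \<le> k t B y"
  unfolding k_def using u_nonneg[OF \<nu>] by auto

text \<open>Where \<open>u \<nu>\<close> vanishes, \<open>K_le\<close> forces \<open>K\<close> to
  vanish as well, so the normalization can be undone at every point, and positivity of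
  \<open>u \<nu>\<close> is required only at the starting point.\<close>

lemma u_k: "0 \<le> t \<Longrightarrow> ennreal (u \<nu> (y - a)) * ennreal (k t B y) = ennreal (exp (- \<nu> * t)) * K t B (y - a)"
proof (cases "u \<nu> (y - a) = 0")
  case True
  assume "0 \<le> t"
  then have "K t B (y - a) = 0" using K_le[of t B "y - a"] True by simp
  then show ?thesis using True by simp
next
  case False
  assume t: "0 \<le> t"
  have "ennreal (u \<nu> (y - a)) * ennreal (k t B y) = ennreal (u \<nu> (y - a) * k t B y)"
    using u_nonneg[OF \<nu>] k_nonneg by (simp add: ennreal_mult)
  also have "u \<nu> (y - a) * k t B y = exp (- \<nu> * t) * enn2real (K t B (y - a))"
    using False by (simp add: k_def)
  also have "ennreal \<dots> = ennreal (exp (- \<nu> * t)) * K t B (y - a)"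
    using K_finite[OF t, of B "y - a"] by (simp add: ennreal_mult)
  finally show ?thesis .
qed

lemma rho_integral:
  assumes t: "0 < t" and B [measurable]: "B \<in> sets borel"
  shows "(LINT y:B|lborel. rho \<Psi> p \<nu> a t x' y) = k t B x'"
proof -
  note [measurable] = p_meas[OF t, of x']
  have "(LINT y:B|lborel. rho \<Psi> p \<nu> a t x' y) =
      (LINT y|lborel. (exp (- \<nu> * t) / u \<nu> (x' - a)) * (p t x' y * (indicator B y * u \<nu> (y - a))))"
    unfolding set_lebesgue_integral_def rho_def Re_psi by (intro Bochner_Integration.integral_cong) auto
  also have "\<dots> = (exp (- \<nu> * t) / u \<nu> (x' - a)) * (LINT y|lborel. p t x' y * (indicator B y * u \<nu> (y - a)))"
    by (rule integral_mult_right_zero)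
  also have "(LINT y|lborel. p t x' y * (indicator B y * u \<nu> (y - a))) = enn2real (\<integral>\<^sup>+y. ennreal (p t x' y * (indicator B y * u \<nu> (y - a))) \<partial>lborel)"
  proof (rule integral_eq_nn_integral)
    show "AE y in lborel. 0 \<le> p t x' y * (indicator B y * u \<nu> (y - a))"
      using kernel_law(1)[OF t, of x'] by eventually_elim (use u_nonneg[OF \<nu>] in auto)
  qed measurable
  also have "(\<integral>\<^sup>+y. ennreal (p t x' y * (indicator B y * u \<nu> (y - a))) \<partial>lborel) =
      (\<integral>\<^sup>+y. ennreal (p t x' y) * (indicator B y * ennreal (u \<nu> (y - a))) \<partial>lborel)"
  proof (rule nn_integral_cong_AE)
    show "AE y in lborel. ennreal (p t x' y * (indicator B y * u \<nu> (y - a))) = ennreal (p t x' y) * (indicator B y * ennreal (u \<nu> (y - a)))"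
      using kernel_law(1)[OF t, of x']
      by eventually_elim (use u_nonneg[OF \<nu>] in \<open>auto simp: ennreal_mult split: split_indicator\<close>)
  qed
  also have "\<dots> = K t B (x' - a)"
    unfolding K_def by (subst nn_integral_kernel[OF t]) auto
  finally show ?thesis by (simp add: k_def)
qed

lemma P_prob: "prob_space P" and space_P: "space P = cadlag_paths {0..}"
  and sets_P: "sets P = sets (path_space {0..})" and P_start: "AE \<omega> in P. \<omega> 0 = x"
  using law unfolding markov_law_def by auto

lemma P_markov:
  assumes "0 \<le> s" "0 < t" "B \<in> sets borel"
  shows "AE \<omega> in P. real_cond_exp P (natural_filtration s) (\<lambda>\<omega>. indicator B (\<omega> (s + t))) \<omega> = k t B (\<omega> s)"
proof -
  have "AE \<omega> in P. real_cond_exp P (natural_filtration s) (\<lambda>\<omega>. indicator B (\<omega> (s + t))) \<omega> =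
      (LINT y:B|lborel. rho \<Psi> p \<nu> a t (\<omega> s) y)"
    using law assms unfolding markov_law_def by blast
  then show ?thesis unfolding rho_integral[OF assms(2,3)] .
qed

lemma measurable_P_iff: "f \<in> measurable P N \<longleftrightarrow> f \<in> measurable (path_space {0..}) N"
  by (rule arg_cong[where f="\<lambda>A. f \<in> A"], rule measurable_cong_sets[OF sets_P refl])

lemma P_eval: "0 \<le> t \<Longrightarrow> (\<lambda>\<omega>. \<omega> t) \<in> borel_measurable P"
  unfolding measurable_P_iff by (intro measurable_path_space_eval) auto

lemma restrict_PiM: "(\<lambda>\<omega>. restrict \<omega> {0..s}) \<in> measurable (path_space {0..}) (\<Pi>\<^sub>M t\<in>{0..s}. borel)"
  by (intro measurable_restrict measurable_path_space_eval) auto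

lemma subalgebra_P: "subalgebra P (natural_filtration s)"
  unfolding subalgebra_def
proof
  show "space (natural_filtration s) = space P" by (simp add: natural_filtration_def space_P)
  show "sets (natural_filtration s) \<subseteq> sets P"
    unfolding natural_filtration_def
    by (rule sets_image_in_sets[OF space_P]) (simp add: measurable_P_iff restrict_PiM)
qed

text \<open>Division by \<open>0\<close> yields \<open>0\<close>, so a vanishing \<open>u \<nu> (x - a)\<close> would give the transition density of the
  Markov process total mass \<open>0\<close>.\<close>

lemma u_start_pos: "0 < u \<nu> (x - a)"
proof -
  interpret P: prob_space P by (rule P_prob)
  interpret fs: finite_measure_subalgebra P "natural_filtration 0" by standard (rule subalgebra_P)
  have "AE \<omega> in P. real_cond_exp P (natural_filtration 0) (\<lambda>\<omega>. indicator UNIV (\<omega> (0 + 1))) \<omega> = 1"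
    using fs.real_cond_exp_F_meas[of "\<lambda>_. 1 :: real"] by simp
  moreover have "AE \<omega> in P. real_cond_exp P (natural_filtration 0) (\<lambda>\<omega>. indicator UNIV (\<omega> (0 + 1))) \<omega> = k 1 UNIV (\<omega> 0)"
    by (rule P_markov) auto
  ultimately have "AE \<omega> in P. k 1 UNIV x = 1"
    using P_start by eventually_elim simp
  then have "k 1 UNIV x = 1" by simp
  then have "u \<nu> (x - a) \<noteq> 0" by (auto simp: k_def)
  then show ?thesis using u_nonneg[OF \<nu>, of "x - a"] by simp
qed


text \<open>The law \<open>P\<close> against its expected density on the sample space. Multiplying
  by \<open>u \<nu> (x - a)\<close> avoids division in the extended reals. The free function
  \<open>f\<close> of the state at the last time \<open>s\<close> lets a transition to a later time
  be fed in.\<close>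

definition fidi_eq :: "real set \<Rightarrow> (real \<Rightarrow> real set) \<Rightarrow> real \<Rightarrow> bool" where
  "fidi_eq J E s \<longleftrightarrow> (\<forall>f \<in> borel_measurable borel.
     ennreal (u \<nu> (x - a)) * (\<integral>\<^sup>+\<omega>. (\<Prod>t\<in>J. indicator (E t) (\<omega> t)) * f (\<omega> s) \<partial>P) =
     ennreal (exp (- \<nu> * s)) * (\<integral>\<^sup>+w. (\<Prod>t\<in>J. indicator (E t) (x - \<xi> t w)) *
       (ennreal (exp (\<mu> * L s (x - a) w)) * (f (x - \<xi> s w) * ennreal (u \<nu> (x - a - \<xi> s w)))) \<partial>M))"

text \<open>Both sides are integrals of \<open>f\<close> against measures on the line, the images of
  weighted laws under the state at time \<open>s\<close>. Measures that agree on sets agree on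
  functions.\<close>

lemma fidi_eqI:
  assumes s: "0 \<le> s" and J: "J \<subseteq> {0..}" and E: "\<And>t. t \<in> J \<Longrightarrow> E t \<in> sets borel"
    and eq: "\<And>B. B \<in> sets borel \<Longrightarrow>
     ennreal (u \<nu> (x - a)) * (\<integral>\<^sup>+\<omega>. (\<Prod>t\<in>J. indicator (E t) (\<omega> t)) * indicator B (\<omega> s) \<partial>P) =
     ennreal (exp (- \<nu> * s)) * (\<integral>\<^sup>+w. (\<Prod>t\<in>J. indicator (E t) (x - \<xi> t w)) *
       (ennreal (exp (\<mu> * L s (x - a) w)) * (indicator B (x - \<xi> s w) * ennreal (u \<nu> (x - a - \<xi> s w)))) \<partial>M)"
  shows "fidi_eq J E s"
proof -
  interpret P: prob_space P by (rule P_prob)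
  have [measurable]: "\<xi> s \<in> borel_measurable M" "L s (x - a) \<in> borel_measurable M" "(\<lambda>\<omega>. \<omega> s) \<in> borel_measurable P"
    using s by (auto intro: \<xi>_meas L_meas P_eval)
  have [measurable]: "(\<lambda>w. \<Prod>t\<in>J. indicator (E t) (x - \<xi> t w) :: ennreal) \<in> borel_measurable M"
  proof (rule borel_measurable_prod_ennreal)
    fix t assume t: "t \<in> J"
    have [measurable]: "\<xi> t \<in> borel_measurable M" using t J by (auto intro: \<xi>_meas)
    note [measurable] = E[OF t]
    show "(\<lambda>w. indicator (E t) (x - \<xi> t w) :: ennreal) \<in> borel_measurable M" by measurable
  qed
  have [measurable]: "(\<lambda>\<omega>. \<Prod>t\<in>J. indicator (E t) (\<omega> t) :: ennreal) \<in> borel_measurable P"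
  proof (rule borel_measurable_prod_ennreal)
    fix t assume t: "t \<in> J"
    have [measurable]: "(\<lambda>\<omega>. \<omega> t) \<in> borel_measurable P" using t J by (auto intro: P_eval)
    note [measurable] = E[OF t]
    show "(\<lambda>\<omega>. indicator (E t) (\<omega> t) :: ennreal) \<in> borel_measurable P" by measurable
  qed
  define m1 where "m1 = distr (density P (\<lambda>\<omega>. ennreal (u \<nu> (x - a)) * (\<Prod>t\<in>J. indicator (E t) (\<omega> t)))) borel (\<lambda>\<omega>. \<omega> s)"
  define m2 where "m2 = distr (density M (\<lambda>w. ennreal (exp (- \<nu> * s)) * ((\<Prod>t\<in>J. indicator (E t) (x - \<xi> t w)) *
       (ennreal (exp (\<mu> * L s (x - a) w)) * ennreal (u \<nu> (x - a - \<xi> s w)))))) borel (\<lambda>w. x - \<xi> s w)"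
  have int1: "(\<integral>\<^sup>+y. f y \<partial>m1) = ennreal (u \<nu> (x - a)) * (\<integral>\<^sup>+\<omega>. (\<Prod>t\<in>J. indicator (E t) (\<omega> t)) * f (\<omega> s) \<partial>P)"
    if [measurable]: "f \<in> borel_measurable borel" for f
  proof -
    have "(\<integral>\<^sup>+y. f y \<partial>m1) = (\<integral>\<^sup>+\<omega>. ennreal (u \<nu> (x - a)) * ((\<Prod>t\<in>J. indicator (E t) (\<omega> t)) * f (\<omega> s)) \<partial>P)"
      unfolding m1_def by (subst nn_integral_distr) (auto simp: nn_integral_density mult.assoc)
    also have "\<dots> = ennreal (u \<nu> (x - a)) * (\<integral>\<^sup>+\<omega>. (\<Prod>t\<in>J. indicator (E t) (\<omega> t)) * f (\<omega> s) \<partial>P)"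
      by (rule nn_integral_cmult) measurable
    finally show ?thesis .
  qed
  have int2: "(\<integral>\<^sup>+y. f y \<partial>m2) = ennreal (exp (- \<nu> * s)) * (\<integral>\<^sup>+w. (\<Prod>t\<in>J. indicator (E t) (x - \<xi> t w)) *
       (ennreal (exp (\<mu> * L s (x - a) w)) * (f (x - \<xi> s w) * ennreal (u \<nu> (x - a - \<xi> s w)))) \<partial>M)"
    if [measurable]: "f \<in> borel_measurable borel" for f
  proof -
    have "(\<integral>\<^sup>+y. f y \<partial>m2) = (\<integral>\<^sup>+w. ennreal (exp (- \<nu> * s)) * ((\<Prod>t\<in>J. indicator (E t) (x - \<xi> t w)) *
       (ennreal (exp (\<mu> * L s (x - a) w)) * (f (x - \<xi> s w) * ennreal (u \<nu> (x - a - \<xi> s w))))) \<partial>M)"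
      unfolding m2_def by (subst nn_integral_distr) (auto simp: nn_integral_density ac_simps)
    also have "\<dots> = ennreal (exp (- \<nu> * s)) * (\<integral>\<^sup>+w. (\<Prod>t\<in>J. indicator (E t) (x - \<xi> t w)) *
       (ennreal (exp (\<mu> * L s (x - a) w)) * (f (x - \<xi> s w) * ennreal (u \<nu> (x - a - \<xi> s w)))) \<partial>M)"
      by (rule nn_integral_cmult) measurable
    finally show ?thesis .
  qed
  have "m1 = m2"
  proof (rule measure_eqI)
    fix B assume "B \<in> sets m1"
    then have B: "B \<in> sets borel" by (simp add: m1_def)
    have "emeasure m1 B = (\<integral>\<^sup>+y. indicator B y \<partial>m1)" using B by (simp add: m1_def)
    also have "\<dots> = (\<integral>\<^sup>+y. indicator B y \<partial>m2)" using B by (simp only: int1 int2 eq borel_measurable_indicator)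
    also have "\<dots> = emeasure m2 B" using B by (simp add: m2_def)
    finally show "emeasure m1 B = emeasure m2 B" .
  qed (simp add: m1_def m2_def)
  then show ?thesis unfolding fidi_eq_def using int1 int2 by simp
qed

text \<open>Under \<open>P\<close>, conditioning at time \<open>b\<close> replaces the indicator at
  time \<open>s\<close> by \<open>k (s - b) B\<close> at time \<open>b\<close>, and the hypothesis
  applies. On the sample space, \<open>u_k\<close> removes the normalization and
  \<open>markov_L\<close> turns \<open>K (s - b) B\<close> back into an integral at time
  \<open>s\<close>.\<close>

lemma fidi_eq_step:
  assumes b: "0 \<le> b" "b < s" and J: "J \<subseteq> {0..b}" "finite J" and E: "\<And>t. t \<in> J \<Longrightarrow> E t \<in> sets borel"
    and eq: "fidi_eq J E b"
  shows "fidi_eq J E s"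
proof (rule fidi_eqI)
  interpret P: prob_space P by (rule P_prob)
  interpret fs: finite_measure_subalgebra P "natural_filtration b" by standard (rule subalgebra_P)
  show "0 \<le> s" "J \<subseteq> {0..}" using b J by auto
  fix B :: "real set" assume B [measurable]: "B \<in> sets borel"
  have [measurable]: "\<xi> b \<in> borel_measurable M" "L b (x - a) \<in> borel_measurable M"
    "(\<lambda>\<omega>. \<omega> s) \<in> borel_measurable P" "(\<lambda>\<omega>. \<omega> b) \<in> borel_measurable P"
    using b by (auto intro: \<xi>_meas L_meas P_eval)
  have sb: "0 \<le> s - b" "0 < s - b" using b by auto
  note [measurable] = k_meas[OF sb(1) B] K_meas[OF sb(1) B]
  \<comment> \<open>Conditional expectations are real-valued, so the product of indicators is needed
    as a real function; \<open>G_enn\<close> translates back.\<close>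
  let ?G = "\<lambda>\<omega>. \<Prod>t\<in>J. indicator (E t) (\<omega> t) :: real"
  have G_F: "?G \<in> borel_measurable (natural_filtration b)"
  proof (rule borel_measurable_prod)
    fix t assume t: "t \<in> J"
    have "(\<lambda>\<omega>. restrict \<omega> {0..b}) \<in> measurable (natural_filtration b) (\<Pi>\<^sub>M t\<in>{0..b}. borel)"
      unfolding natural_filtration_def using measurable_space[OF restrict_PiM]
      by (intro measurable_vimage_algebra1) (auto simp: space_path_space)
    moreover have "(\<lambda>\<eta>. \<eta> t) \<in> borel_measurable (\<Pi>\<^sub>M t\<in>{0..b}. borel :: real measure)"
      using t J(1) by (intro measurable_component_singleton) auto
    ultimately have "(\<lambda>\<omega>. restrict \<omega> {0..b} t) \<in> borel_measurable (natural_filtration b)"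
      by (rule measurable_compose)
    then have [measurable]: "(\<lambda>\<omega>. \<omega> t) \<in> borel_measurable (natural_filtration b)" using t J(1) by auto
    note [measurable] = E[OF t]
    show "(\<lambda>\<omega>. indicator (E t) (\<omega> t) :: real) \<in> borel_measurable (natural_filtration b)" by measurable
  qed
  have G_P [measurable]: "?G \<in> borel_measurable P" by (rule measurable_from_subalg[OF subalgebra_P G_F])
  have G01: "0 \<le> ?G \<omega>" "?G \<omega> \<le> 1" for \<omega> by (auto intro!: prod_nonneg prod_le_1)
  have G_enn: "ennreal (?G \<omega>) = (\<Prod>t\<in>J. indicator (E t) (\<omega> t))" for \<omega>
    by (subst prod_ennreal[symmetric]) (auto simp: ennreal_indicator)
  have int1: "integrable P (\<lambda>\<omega>. ?G \<omega> * indicator B (\<omega> s))"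
    by (rule P.integrable_const_bound[where B=1]) (use G01 in \<open>auto simp: abs_mult split: split_indicator\<close>)
  have ae: "AE \<omega> in P. ?G \<omega> * real_cond_exp P (natural_filtration b) (\<lambda>\<omega>. indicator B (\<omega> s)) \<omega> = ?G \<omega> * k (s - b) B (\<omega> b)"
    using P_markov[OF b(1) sb(2) B] by eventually_elim simp
  note ce = fs.real_cond_exp_intg[OF int1 G_F]
  have int2: "integrable P (\<lambda>\<omega>. ?G \<omega> * k (s - b) B (\<omega> b))"
    using ce(1) by (rule integrable_cong_AE_imp) (use ae in auto)
  have "(\<integral>\<^sup>+\<omega>. ennreal (?G \<omega> * indicator B (\<omega> s)) \<partial>P) = (\<integral>\<^sup>+\<omega>. ennreal (?G \<omega> * k (s - b) B (\<omega> b)) \<partial>P)"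
  proof -
    have "(\<integral>\<^sup>+\<omega>. ennreal (?G \<omega> * indicator B (\<omega> s)) \<partial>P) = ennreal (LINT \<omega>|P. ?G \<omega> * indicator B (\<omega> s))"
      using G01 by (intro nn_integral_eq_integral int1) auto
    also have "(LINT \<omega>|P. ?G \<omega> * indicator B (\<omega> s)) = (LINT \<omega>|P. ?G \<omega> * k (s - b) B (\<omega> b))"
      unfolding ce(2)[symmetric, simplified]
      by (rule integral_cong_AE) (use ae borel_measurable_integrable[OF ce(1)] in auto)
    also have "ennreal \<dots> = (\<integral>\<^sup>+\<omega>. ennreal (?G \<omega> * k (s - b) B (\<omega> b)) \<partial>P)"
      using G01 k_nonneg by (intro nn_integral_eq_integral[symmetric] int2) auto
    finally show ?thesis .
  qed
  then have "(\<integral>\<^sup>+\<omega>. (\<Prod>t\<in>J. indicator (E t) (\<omega> t)) * indicator B (\<omega> s) \<partial>P) =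
      (\<integral>\<^sup>+\<omega>. (\<Prod>t\<in>J. indicator (E t) (\<omega> t)) * ennreal (k (s - b) B (\<omega> b)) \<partial>P)"
    using G01 k_nonneg by (simp add: ennreal_mult G_enn ennreal_indicator)
  \<comment> \<open>This is the hypothesis at time \<open>b\<close> with \<open>k (s - b) B\<close>
    for \<open>f\<close>.\<close>
  then have "ennreal (u \<nu> (x - a)) * (\<integral>\<^sup>+\<omega>. (\<Prod>t\<in>J. indicator (E t) (\<omega> t)) * indicator B (\<omega> s) \<partial>P) =
      ennreal (exp (- \<nu> * b)) * (\<integral>\<^sup>+w. (\<Prod>t\<in>J. indicator (E t) (x - \<xi> t w)) *
       (ennreal (exp (\<mu> * L b (x - a) w)) * (ennreal (k (s - b) B (x - \<xi> b w)) * ennreal (u \<nu> (x - a - \<xi> b w)))) \<partial>M)"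
    using bspec[OF eq[unfolded fidi_eq_def] measurable_compose[OF k_meas[OF sb(1) B] measurable_ennreal]] by (simp only:)
  also have "\<dots> = ennreal (exp (- \<nu> * b)) * (\<integral>\<^sup>+w. ennreal (exp (- \<nu> * (s - b))) * ((\<Prod>t\<in>J. indicator (E t) (x - \<xi> t w)) *
       (ennreal (exp (\<mu> * L b (x - a) w)) * K (s - b) B (x - a - \<xi> b w))) \<partial>M)"
  proof (intro arg_cong[where f="\<lambda>q. ennreal (exp (- \<nu> * b)) * q"] nn_integral_cong)
    fix w
    have c: "x - \<xi> b w - a = x - a - \<xi> b w" by simp
    have "ennreal (k (s - b) B (x - \<xi> b w)) * ennreal (u \<nu> (x - a - \<xi> b w)) = ennreal (exp (- \<nu> * (s - b))) * K (s - b) B (x - a - \<xi> b w)"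
      using u_k[OF sb(1), of "x - \<xi> b w" B] unfolding c by (simp add: mult.commute)
    then show "(\<Prod>t\<in>J. indicator (E t) (x - \<xi> t w)) * (ennreal (exp (\<mu> * L b (x - a) w)) * (ennreal (k (s - b) B (x - \<xi> b w)) * ennreal (u \<nu> (x - a - \<xi> b w)))) =
      ennreal (exp (- \<nu> * (s - b))) * ((\<Prod>t\<in>J. indicator (E t) (x - \<xi> t w)) * (ennreal (exp (\<mu> * L b (x - a) w)) * K (s - b) B (x - a - \<xi> b w)))"
      by (simp only: mult.left_commute)
  qed
  also have "\<dots> = ennreal (exp (- \<nu> * b)) * (ennreal (exp (- \<nu> * (s - b))) * (\<integral>\<^sup>+w. (\<Prod>t\<in>J. indicator (E t) (x - \<xi> t w)) *
       (ennreal (exp (\<mu> * L b (x - a) w)) * K (s - b) B (x - a - \<xi> b w)) \<partial>M))"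
  proof (intro arg_cong[where f="\<lambda>q. ennreal (exp (- \<nu> * b)) * q"] nn_integral_cmult)
    have [measurable]: "(\<lambda>w. \<Prod>t\<in>J. indicator (E t) (x - \<xi> t w) :: ennreal) \<in> borel_measurable M"
    proof (rule borel_measurable_prod_ennreal)
      fix t assume t: "t \<in> J"
      have "0 \<le> t" using t J(1) by auto
      from \<xi>_meas[OF this] have [measurable]: "\<xi> t \<in> borel_measurable M" .
      note [measurable] = E[OF t]
      show "(\<lambda>w. indicator (E t) (x - \<xi> t w) :: ennreal) \<in> borel_measurable M" by measurable
    qed
    show "(\<lambda>w. (\<Prod>t\<in>J. indicator (E t) (x - \<xi> t w)) * (ennreal (exp (\<mu> * L b (x - a) w)) * K (s - b) B (x - a - \<xi> b w))) \<in> borel_measurable M"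
      by measurable
  qed
  also have "\<dots> = ennreal (exp (- \<nu> * s)) * (\<integral>\<^sup>+w. (\<Prod>t\<in>J. indicator (E t) (x - \<xi> t w)) *
       (ennreal (exp (\<mu> * L b (x - a) w)) * K (s - b) B (x - a - \<xi> b w)) \<partial>M)"
  proof -
    have "ennreal (exp (- \<nu> * b)) * ennreal (exp (- \<nu> * (s - b))) = ennreal (exp (- \<nu> * s))"
      by (subst ennreal_mult[symmetric]) (simp_all add: exp_add[symmetric] right_diff_distrib)
    then show ?thesis by (simp only: mult.assoc[symmetric])
  qed
  also have "(\<integral>\<^sup>+w. (\<Prod>t\<in>J. indicator (E t) (x - \<xi> t w)) *
       (ennreal (exp (\<mu> * L b (x - a) w)) * K (s - b) B (x - a - \<xi> b w)) \<partial>M) =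
     (\<integral>\<^sup>+w. (\<Prod>t\<in>J. indicator (E t) (x - \<xi> t w)) *
       (ennreal (exp (\<mu> * L s (x - a) w)) * (indicator B (x - a - \<xi> s w + a) * ennreal (u \<nu> (x - a - \<xi> s w)))) \<partial>M)"
  proof -
    have F: "(\<lambda>\<eta>. \<Prod>t\<in>J. indicator (E t) (x - \<eta> t) :: ennreal) \<in> borel_measurable (path_space {0..b})"
    proof (rule borel_measurable_prod_ennreal)
      fix t assume t: "t \<in> J"
      have [measurable]: "(\<lambda>\<eta>. \<eta> t) \<in> borel_measurable (path_space {0..b})" using t J by (auto intro: measurable_path_space_eval)
      note [measurable] = E[OF t]
      show "(\<lambda>\<eta>. indicator (E t) (x - \<eta> t) :: ennreal) \<in> borel_measurable (path_space {0..b})" by measurable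
    qed
    have past: "(\<Prod>t\<in>J. indicator (E t) (x - past b w t)) = (\<Prod>t\<in>J. indicator (E t) (x - \<xi> t w) :: ennreal)" for w
      using J(1) by (intro prod.cong) (auto simp: past_def)
    have f: "(\<lambda>z. indicator B (z + a) * ennreal (u \<nu> z)) \<in> borel_measurable borel" by measurable
    show ?thesis
      using markov_L[OF b(1) less_imp_le[OF b(2)] F f, of \<mu> "x - a"] unfolding past K_def by simp
  qed
  finally show "ennreal (u \<nu> (x - a)) * (\<integral>\<^sup>+\<omega>. (\<Prod>t\<in>J. indicator (E t) (\<omega> t)) * indicator B (\<omega> s) \<partial>P) =
     ennreal (exp (- \<nu> * s)) * (\<integral>\<^sup>+w. (\<Prod>t\<in>J. indicator (E t) (x - \<xi> t w)) *
       (ennreal (exp (\<mu> * L s (x - a) w)) * (indicator B (x - \<xi> s w) * ennreal (u \<nu> (x - a - \<xi> s w)))) \<partial>M)"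
    by simp
qed (rule E)

lemma fidi_eq_0: "fidi_eq {} E 0"
proof (rule fidi_eqI)
  interpret P: prob_space P by (rule P_prob)
  fix B :: "real set" assume [measurable]: "B \<in> sets borel"
  have "(\<integral>\<^sup>+\<omega>. indicator B (\<omega> 0) \<partial>P) = (\<integral>\<^sup>+\<omega>. indicator B x \<partial>P)"
    by (rule nn_integral_cong_AE) (use P_start in \<open>auto\<close>)
  moreover have "(\<integral>\<^sup>+w. ennreal (exp (\<mu> * L 0 (x - a) w)) * (indicator B (x - \<xi> 0 w) * ennreal (u \<nu> (x - a - \<xi> 0 w))) \<partial>M) =
      (\<integral>\<^sup>+w. indicator B x * ennreal (u \<nu> (x - a)) \<partial>M)"
  proof (rule nn_integral_cong_AE)
    \<comment> \<open>The approximations integrate over an empty time interval, so the local time at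
      time 0 vanishes almost surely by \<open>AE_ell\<close>.\<close>
    have "occ n 0 v \<omega> = 0" for n v \<omega> by (simp add: occ_def)
    then have e0: "ell 0 v \<omega> = 0" for v \<omega> by (simp add: ell_def limI)
    show "AE w in M. ennreal (exp (\<mu> * L 0 (x - a) w)) * (indicator B (x - \<xi> 0 w) * ennreal (u \<nu> (x - a - \<xi> 0 w))) = indicator B x * ennreal (u \<nu> (x - a))"
      using AE_ell AE_space by eventually_elim (use e0 in \<open>auto simp: \<xi>_0\<close>)
  qed
  ultimately show "ennreal (u \<nu> (x - a)) * (\<integral>\<^sup>+\<omega>. (\<Prod>t\<in>{}. indicator (E t) (\<omega> t)) * indicator B (\<omega> 0) \<partial>P) =
     ennreal (exp (- \<nu> * 0)) * (\<integral>\<^sup>+w. (\<Prod>t\<in>{}. indicator (E t) (x - \<xi> t w)) *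
       (ennreal (exp (\<mu> * L 0 (x - a) w)) * (indicator B (x - \<xi> 0 w) * ennreal (u \<nu> (x - a - \<xi> 0 w)))) \<partial>M)"
    by (simp add: P.emeasure_space_1 emeasure_space_1 mult.commute)
qed auto

text \<open>The indicator at the final time is absorbed into the free function
  \<open>f\<close>.\<close>

lemma fidi_eq_insert:
  assumes eq: "fidi_eq J E b" and J: "finite J" "b \<notin> J" and E [measurable]: "E b \<in> sets borel"
  shows "fidi_eq (insert b J) E b"
  unfolding fidi_eq_def
proof
  fix f :: "real \<Rightarrow> ennreal" assume [measurable]: "f \<in> borel_measurable borel"
  have "(\<lambda>y. indicator (E b) y * f y) \<in> borel_measurable borel" by measurable
  then show "ennreal (u \<nu> (x - a)) * (\<integral>\<^sup>+\<omega>. (\<Prod>t\<in>insert b J. indicator (E t) (\<omega> t)) * f (\<omega> b) \<partial>P) =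
     ennreal (exp (- \<nu> * b)) * (\<integral>\<^sup>+w. (\<Prod>t\<in>insert b J. indicator (E t) (x - \<xi> t w)) *
       (ennreal (exp (\<mu> * L b (x - a) w)) * (f (x - \<xi> b w) * ennreal (u \<nu> (x - a - \<xi> b w)))) \<partial>M)"
    using bspec[OF eq[unfolded fidi_eq_def], of "\<lambda>y. indicator (E b) y * f y"] J by (simp add: ac_simps)
qed

text \<open>Times are added in increasing order: the identity for the earlier times is advanced to
  the new last time \<open>b\<close>, the indicator at \<open>b\<close> is inserted, and the result
  is advanced to \<open>s\<close>.\<close>

lemma fidi_eq_all:
  assumes "finite J" "J \<subseteq> {0..s}" "0 \<le> s" "\<And>t. t \<in> J \<Longrightarrow> E t \<in> sets borel"
  shows "fidi_eq J E s"
  using assms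
proof (induction J arbitrary: s rule: finite_linorder_max_induct)
  case empty
  show ?case
  proof (cases "s = 0")
    case False
    then show ?thesis using empty by (intro fidi_eq_step[OF _ _ _ _ _ fidi_eq_0]) auto
  qed (simp add: fidi_eq_0)
next
  case (insert b J)
  have b: "0 \<le> b" "b \<le> s" and J: "J \<subseteq> {0..b}" using insert.prems(1) insert.hyps(2) by (auto simp: less_imp_le)
  have "fidi_eq J E b" using J b insert.prems(3) by (intro insert.IH) auto
  then have *: "fidi_eq (insert b J) E b"
    using insert.hyps insert.prems(3) by (intro fidi_eq_insert) auto
  show ?case
  proof (cases "b = s")
    case False
    then show ?thesis using b J insert.hyps insert.prems by (intro fidi_eq_step[OF _ _ _ _ _ *]) auto
  qed (use * in simp)
qed

end

section \<open>Densities up to a fixed horizon and their convergence\<close>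

lemma prod_indicator_Ball:
  "finite J \<Longrightarrow> (\<Prod>t\<in>J. indicator (E t) (f t) :: ennreal) = (if \<forall>t\<in>J. f t \<in> E t then 1 else 0)"
  by (induction J rule: finite_induct) auto

text \<open>Freezing a path at time \<open>S\<close> is a measurable right inverse of restriction to
  \<open>{0..S}\<close>, so composing with it recovers \<open>F\<close>.\<close>

lemma measurable_of_restrict:
  fixes F :: "(real \<Rightarrow> real) \<Rightarrow> real"
  assumes S: "0 \<le> S" and I: "{0..S} \<subseteq> I" "I \<subseteq> {0..}" and F: "(\<lambda>\<omega>. F (restrict \<omega> {0..S})) \<in> borel_measurable (path_space I)"
  shows "F \<in> borel_measurable (path_space {0..S})"
proof -
  have "(\<lambda>\<eta>. restrict (\<lambda>r\<in>{0..}. \<eta> (min r S)) I) \<in> measurable (path_space {0..S}) (path_space I)"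
    by (rule measurable_compose[OF measurable_stop_path[OF S] measurable_restrict_path[OF I(2)]])
  from measurable_compose[OF this F]
  have "(\<lambda>\<eta>. F (restrict (restrict (\<lambda>r\<in>{0..}. \<eta> (min r S)) I) {0..S})) \<in> borel_measurable (path_space {0..S})" .
  also have "?this \<longleftrightarrow> F \<in> borel_measurable (path_space {0..S})"
  proof (rule measurable_cong)
    fix \<eta> assume "\<eta> \<in> space (path_space {0..S})"
    then have ext: "\<eta> \<in> extensional {0..S}" by (simp add: space_path_space cadlag_paths_def)
    have "restrict (restrict (\<lambda>r\<in>{0..}. \<eta> (min r S)) I) {0..S} = \<eta>"
      by (rule extensionalityI[OF _ ext]) (use I in auto)
    then show "F (restrict (restrict (\<lambda>r\<in>{0..}. \<eta> (min r S)) I) {0..S}) = F \<eta>" by simp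
  qed
  finally show ?thesis .
qed

context penalized begin

definition X :: "real \<Rightarrow> 'a \<Rightarrow> real \<Rightarrow> real" where "X S w = (\<lambda>t\<in>{0..S}. x - \<xi> t w)"

text \<open>On the paths up to time \<open>S\<close>, \<open>h S\<close> is the density of the limit law and \<open>hT S T\<close> that of the
  penalized law with horizon \<open>T\<close>, both relative to the law of \<open>x - \<xi>\<close>.\<close>

definition h :: "real \<Rightarrow> 'a \<Rightarrow> real" where
  "h S w = exp (- \<nu> * S) * (exp (\<mu> * L S (x - a) w) * u \<nu> (x - a - \<xi> S w)) / u \<nu> (x - a)"

definition hT :: "real \<Rightarrow> real \<Rightarrow> 'a \<Rightarrow> real" where
  "hT S T w = exp (\<mu> * L S (x - a) w) * Zr \<mu> (T - S) (x - a - \<xi> S w) / Zr \<mu> T (x - a)"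

lemma X_meas: "X S \<in> measurable M (path_space {0..S})"
proof (rule measurable_into_path_space)
  show "(\<lambda>w. X S w t) \<in> borel_measurable M" if "t \<in> {0..S}" for t
    using \<xi>_meas[of t] that by (simp add: X_def)
  show "X S w \<in> cadlag_paths {0..S}" if "w \<in> space M" for w
    unfolding X_def by (rule restrict_cadlag_paths[OF cadlag_on_const_diff[OF \<xi>_cadlag[OF that]]]) auto
qed

lemma h_nonneg: "0 \<le> h S w"
  using u_nonneg[OF \<nu>] by (auto simp: h_def)

lemma h_meas: "0 \<le> S \<Longrightarrow> h S \<in> borel_measurable M"
proof -
  assume "0 \<le> S"
  then have [measurable]: "\<xi> S \<in> borel_measurable M" "L S (x - a) \<in> borel_measurable M" by (auto intro: \<xi>_meas L_meas)
  show ?thesis unfolding h_def by measurable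
qed

lemma hT_nonneg: "0 \<le> hT S T w"
  by (auto simp: hT_def Zr_def)

lemma hT_meas: "0 \<le> S \<Longrightarrow> hT S T \<in> borel_measurable M"
proof -
  assume "0 \<le> S"
  then have [measurable]: "\<xi> S \<in> borel_measurable M" "L S (x - a) \<in> borel_measurable M" by (auto intro: \<xi>_meas L_meas)
  have [measurable]: "(\<lambda>y. Zr \<mu> (T - S) y) \<in> borel_measurable borel"
    using measurable_compose[OF measurable_Pair1'[of "T - S" borel borel] Zr_meas] by simp
  show ?thesis unfolding hT_def by measurable
qed

text \<open>On cylinders this is \<open>fidi_eq_all\<close> with \<open>f\<close> constantly 1; the
  factor \<open>u \<nu> (x - a)\<close> cancels because it is finite and, by
  \<open>u_start_pos\<close>, positive.\<close>

lemma limit_law_restrict: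
  assumes S: "0 \<le> S"
  shows "distr P (path_space {0..S}) (\<lambda>\<omega>. restrict \<omega> {0..S}) =
    distr (density M (\<lambda>w. ennreal (h S w))) (path_space {0..S}) (X S)"
proof (rule path_space_measure_eqI[where I="{0..S}"])
  have r: "(\<lambda>\<omega>. restrict \<omega> {0..S}) \<in> measurable P (path_space {0..S})"
    unfolding measurable_P_iff by (rule measurable_restrict_path) auto
  have X': "X S \<in> measurable (density M (\<lambda>w. ennreal (h S w))) (path_space {0..S})" using X_meas by simp
  interpret P: prob_space P by (rule P_prob)
  show "finite_measure (distr P (path_space {0..S}) (\<lambda>\<omega>. restrict \<omega> {0..S}))"
    by (rule P.finite_measure_distr[OF r])
  fix J :: "real set" and E assume J: "finite J" "J \<subseteq> {0..S}" "\<And>t. t \<in> J \<Longrightarrow> E t \<in> sets (borel :: real measure)"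
  let ?C = "{\<omega> \<in> cadlag_paths {0..S}. \<forall>t\<in>J. \<omega> t \<in> E t}"
  have C: "?C \<in> sets (path_space {0..S})"
    by (rule cylinder_sets_path_space[OF J(1,2)]) (rule J(3))
  have ind: "indicator ?C \<eta> = (\<Prod>t\<in>J. indicator (E t) (\<eta> t) :: ennreal)" if "\<eta> \<in> cadlag_paths {0..S}" for \<eta>
    using that by (simp add: prod_indicator_Ball[OF J(1)])
  have up: "0 < u \<nu> (x - a)" by (rule u_start_pos)
  have alg: "b * (c * i) = d * (i * (e * f))" if "b * c = d * (e * f)" for b c d e f i :: ennreal
  proof -
    have "b * (c * i) = (b * c) * i" by (simp only: mult.assoc)
    also have "\<dots> = d * (i * (e * f))" unfolding that by (simp only: ac_simps)
    finally show ?thesis .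
  qed
  have cancel: "b = c" if "ennreal r * b = ennreal r * c" "0 < r" for r b c
    using that by (auto simp: ennreal_mult_cancel_left)
  have [measurable]: "h S \<in> borel_measurable M" "\<xi> S \<in> borel_measurable M" "L S (x - a) \<in> borel_measurable M"
    using S by (auto intro: h_meas \<xi>_meas L_meas)
  have [measurable]: "(\<lambda>w. indicator ?C (X S w) :: ennreal) \<in> borel_measurable M"
    by (rule measurable_compose[OF X_meas borel_measurable_indicator[OF C]])
  have "fidi_eq J E S" by (rule fidi_eq_all[OF J(1,2) S]) (rule J(3))
  note fe = bspec[OF this[unfolded fidi_eq_def] borel_measurable_const[of "1 :: ennreal"]]
  have "emeasure (distr P (path_space {0..S}) (\<lambda>\<omega>. restrict \<omega> {0..S})) ?C = (\<integral>\<^sup>+\<omega>. indicator ?C (restrict \<omega> {0..S}) \<partial>P)"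
    using C by (subst nn_integral_distr[OF r, symmetric]) auto
  also have "\<dots> = (\<integral>\<^sup>+\<omega>. (\<Prod>t\<in>J. indicator (E t) (\<omega> t)) * 1 \<partial>P)"
  proof (rule nn_integral_cong)
    fix \<omega> assume "\<omega> \<in> space P"
    then have "restrict \<omega> {0..S} \<in> cadlag_paths {0..S}"
      using measurable_space[OF r] by (simp add: space_path_space)
    then have "indicator ?C (restrict \<omega> {0..S}) = (\<Prod>t\<in>J. indicator (E t) (restrict \<omega> {0..S} t) :: ennreal)" by (rule ind)
    also have "\<dots> = (\<Prod>t\<in>J. indicator (E t) (\<omega> t))" using J(2) by (intro prod.cong) auto
    finally show "indicator ?C (restrict \<omega> {0..S}) = (\<Prod>t\<in>J. indicator (E t) (\<omega> t)) * (1 :: ennreal)" by simp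
  qed
  finally have lhs: "emeasure (distr P (path_space {0..S}) (\<lambda>\<omega>. restrict \<omega> {0..S})) ?C = (\<integral>\<^sup>+\<omega>. (\<Prod>t\<in>J. indicator (E t) (\<omega> t)) * 1 \<partial>P)" .
  have "emeasure (distr (density M (\<lambda>w. ennreal (h S w))) (path_space {0..S}) (X S)) ?C =
      (\<integral>\<^sup>+\<eta>. indicator ?C \<eta> \<partial>(distr (density M (\<lambda>w. ennreal (h S w))) (path_space {0..S}) (X S)))"
    using C by simp
  also have "\<dots> = (\<integral>\<^sup>+w. ennreal (h S w) * indicator ?C (X S w) \<partial>M)"
    using C by (subst nn_integral_distr[OF X']) (auto simp: nn_integral_density)
  finally have rhs: "emeasure (distr (density M (\<lambda>w. ennreal (h S w))) (path_space {0..S}) (X S)) ?C = (\<integral>\<^sup>+w. ennreal (h S w) * indicator ?C (X S w) \<partial>M)" .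
  have "ennreal (u \<nu> (x - a)) * (\<integral>\<^sup>+w. ennreal (h S w) * indicator ?C (X S w) \<partial>M) =
      (\<integral>\<^sup>+w. ennreal (u \<nu> (x - a)) * (ennreal (h S w) * indicator ?C (X S w)) \<partial>M)"
    by (rule nn_integral_cmult[symmetric]) measurable
  also have "\<dots> = (\<integral>\<^sup>+w. ennreal (exp (- \<nu> * S)) * (indicator ?C (X S w) *
       (ennreal (exp (\<mu> * L S (x - a) w)) * ennreal (u \<nu> (x - a - \<xi> S w)))) \<partial>M)"
  proof (rule nn_integral_cong)
    fix w
    have "u \<nu> (x - a) * h S w = exp (- \<nu> * S) * (exp (\<mu> * L S (x - a) w) * u \<nu> (x - a - \<xi> S w))"
      using up by (simp add: h_def)
    then have "ennreal (u \<nu> (x - a)) * ennreal (h S w) = ennreal (exp (- \<nu> * S)) * (ennreal (exp (\<mu> * L S (x - a) w)) * ennreal (u \<nu> (x - a - \<xi> S w)))"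
      using u_nonneg[OF \<nu>] h_nonneg by (simp add: ennreal_mult[symmetric])
    then show "ennreal (u \<nu> (x - a)) * (ennreal (h S w) * indicator ?C (X S w)) =
      ennreal (exp (- \<nu> * S)) * (indicator ?C (X S w) * (ennreal (exp (\<mu> * L S (x - a) w)) * ennreal (u \<nu> (x - a - \<xi> S w))))"
      by (rule alg)
  qed
  also have "\<dots> = ennreal (exp (- \<nu> * S)) * (\<integral>\<^sup>+w. indicator ?C (X S w) *
       (ennreal (exp (\<mu> * L S (x - a) w)) * ennreal (u \<nu> (x - a - \<xi> S w))) \<partial>M)"
    by (rule nn_integral_cmult) measurable
  also have "(\<integral>\<^sup>+w. indicator ?C (X S w) * (ennreal (exp (\<mu> * L S (x - a) w)) * ennreal (u \<nu> (x - a - \<xi> S w))) \<partial>M) =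
      (\<integral>\<^sup>+w. (\<Prod>t\<in>J. indicator (E t) (x - \<xi> t w)) *
       (ennreal (exp (\<mu> * L S (x - a) w)) * (1 * ennreal (u \<nu> (x - a - \<xi> S w)))) \<partial>M)"
  proof (rule nn_integral_cong)
    fix w assume "w \<in> space M"
    then have "X S w \<in> cadlag_paths {0..S}" using measurable_space[OF X_meas] by (simp add: space_path_space)
    then have "indicator ?C (X S w) = (\<Prod>t\<in>J. indicator (E t) (X S w t) :: ennreal)" by (rule ind)
    also have "\<dots> = (\<Prod>t\<in>J. indicator (E t) (x - \<xi> t w))" using J(2) by (intro prod.cong) (auto simp: X_def)
    finally show "indicator ?C (X S w) * (ennreal (exp (\<mu> * L S (x - a) w)) * ennreal (u \<nu> (x - a - \<xi> S w))) =
      (\<Prod>t\<in>J. indicator (E t) (x - \<xi> t w)) * (ennreal (exp (\<mu> * L S (x - a) w)) * (1 * ennreal (u \<nu> (x - a - \<xi> S w))))"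
      by simp
  qed
  also have "ennreal (exp (- \<nu> * S)) * \<dots> = ennreal (u \<nu> (x - a)) * (\<integral>\<^sup>+\<omega>. (\<Prod>t\<in>J. indicator (E t) (\<omega> t)) * 1 \<partial>P)"
    by (rule fe[symmetric])
  finally show "emeasure (distr P (path_space {0..S}) (\<lambda>\<omega>. restrict \<omega> {0..S})) ?C =
      emeasure (distr (density M (\<lambda>w. ennreal (h S w))) (path_space {0..S}) (X S)) ?C"
    unfolding lhs rhs by (rule cancel[OF _ up, symmetric])
qed auto

text \<open>An event up to time \<open>S\<close> is a factor that depends on the past only, so
  \<open>markov_L\<close> replaces the weight at the horizon \<open>T\<close> by the weight at
  \<open>S\<close> times the exponential moment over the remaining time.\<close>

lemma penalized_law_restrict:
  assumes S: "0 \<le> S" "S \<le> T"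
  shows "distr (density M (\<lambda>w. ennreal (exp (\<mu> * L T (x - a) w) / Zr \<mu> T (x - a)))) (path_space {0..S}) (X S) =
    distr (density M (\<lambda>w. ennreal (hT S T w))) (path_space {0..S}) (X S)"
proof (rule measure_eqI)
  fix A assume "A \<in> sets (distr (density M (\<lambda>w. ennreal (exp (\<mu> * L T (x - a) w) / Zr \<mu> T (x - a)))) (path_space {0..S}) (X S))"
  then have A: "A \<in> sets (path_space {0..S})" by simp
  have T: "0 \<le> T" "0 \<le> T - S" using S by auto
  have \<mu>0: "0 \<le> \<mu>" using \<mu> by simp
  have [measurable]: "\<xi> S \<in> borel_measurable M" "L S (x - a) \<in> borel_measurable M" "L T (x - a) \<in> borel_measurable M"
    using S by (auto intro: \<xi>_meas L_meas)
  have [measurable]: "hT S T \<in> borel_measurable M" using S by (intro hT_meas)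
  have [measurable]: "(\<lambda>y. Z \<mu> (T - S) y) \<in> borel_measurable borel"
    using measurable_compose[OF measurable_Pair1'[of "T - S" borel borel] Z_meas] by simp
  have [measurable]: "(\<lambda>w. indicator A (X S w) :: ennreal) \<in> borel_measurable M"
    by (rule measurable_compose[OF X_meas borel_measurable_indicator[OF A]])
  have Zp: "0 < Zr \<mu> T (x - a)" using Zr_ge_1[OF T(1) \<mu>0, of "x - a"] by simp
  have em: "emeasure (distr (density M (\<lambda>w. ennreal (f w))) (path_space {0..S}) (X S)) A = (\<integral>\<^sup>+w. ennreal (f w) * indicator A (X S w) \<partial>M)"
    if [measurable]: "f \<in> borel_measurable M" for f
  proof -
    have X': "X S \<in> measurable (density M (\<lambda>w. ennreal (f w))) (path_space {0..S})" using X_meas by simp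
    have "emeasure (distr (density M (\<lambda>w. ennreal (f w))) (path_space {0..S}) (X S)) A =
        (\<integral>\<^sup>+\<eta>. indicator A \<eta> \<partial>(distr (density M (\<lambda>w. ennreal (f w))) (path_space {0..S}) (X S)))"
      using A by simp
    also have "\<dots> = (\<integral>\<^sup>+w. ennreal (f w) * indicator A (X S w) \<partial>M)"
      using A by (subst nn_integral_distr[OF X']) (auto simp: nn_integral_density)
    finally show ?thesis .
  qed
  \<comment> \<open>The event concerns the path \<open>x - \<xi>\<close>; \<open>markov_L\<close>
    wants it as a functional of the past of \<open>\<xi>\<close>.\<close>
  define F where "F \<eta> = (indicator A (\<lambda>t\<in>{0..S}. x - \<eta> t) :: ennreal)" for \<eta>
  have F: "F \<in> borel_measurable (path_space {0..S})"
  proof -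
    have "(\<lambda>\<eta>. \<lambda>t\<in>{0..S}. x - \<eta> t) \<in> measurable (path_space {0..S}) (path_space {0..S})"
    proof (rule measurable_into_path_space)
      fix t assume t: "t \<in> {0..S}"
      have [measurable]: "(\<lambda>\<eta>. \<eta> t) \<in> borel_measurable (path_space {0..S})" by (rule measurable_path_space_eval[OF t])
      show "(\<lambda>\<eta>. (\<lambda>t\<in>{0..S}. x - \<eta> t) t) \<in> borel_measurable (path_space {0..S})" using t by simp
    next
      fix \<eta> assume "\<eta> \<in> space (path_space {0..S})"
      then show "(\<lambda>t\<in>{0..S}. x - \<eta> t) \<in> cadlag_paths {0..S}"
        by (intro restrict_cadlag_paths[OF cadlag_on_const_diff]) (auto simp: space_path_space cadlag_paths_def)
    qed
    from measurable_compose[OF this borel_measurable_indicator[OF A]] show ?thesis unfolding F_def .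
  qed
  have F_past: "F (past S w) = indicator A (X S w)" for w
    unfolding F_def X_def past_def by (auto intro!: arg_cong[where f="indicator A"])
  have "(\<integral>\<^sup>+w. ennreal (exp (\<mu> * L T (x - a) w) / Zr \<mu> T (x - a)) * indicator A (X S w) \<partial>M) =
      (\<integral>\<^sup>+w. ennreal (1 / Zr \<mu> T (x - a)) * (F (past S w) * (ennreal (exp (\<mu> * L T (x - a) w)) * 1)) \<partial>M)"
  proof (rule nn_integral_cong)
    fix w
    have "ennreal (exp (\<mu> * L T (x - a) w) / Zr \<mu> T (x - a)) = ennreal (1 / Zr \<mu> T (x - a)) * ennreal (exp (\<mu> * L T (x - a) w))"
      using Zp by (subst ennreal_mult[symmetric]) auto
    then show "ennreal (exp (\<mu> * L T (x - a) w) / Zr \<mu> T (x - a)) * indicator A (X S w) =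
      ennreal (1 / Zr \<mu> T (x - a)) * (F (past S w) * (ennreal (exp (\<mu> * L T (x - a) w)) * 1))"
      by (simp add: F_past ac_simps)
  qed
  also have "\<dots> = ennreal (1 / Zr \<mu> T (x - a)) * (\<integral>\<^sup>+w. F (past S w) * (ennreal (exp (\<mu> * L T (x - a) w)) * 1) \<partial>M)"
    unfolding F_past by (rule nn_integral_cmult) measurable
  also have "(\<integral>\<^sup>+w. F (past S w) * (ennreal (exp (\<mu> * L T (x - a) w)) * 1) \<partial>M) =
      (\<integral>\<^sup>+w. F (past S w) * (ennreal (exp (\<mu> * L S (x - a) w)) * Z \<mu> (T - S) (x - a - \<xi> S w)) \<partial>M)"
    using markov_L[OF S F, of "\<lambda>_. 1" \<mu> "x - a"] by (simp add: sem_1)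
  also have "ennreal (1 / Zr \<mu> T (x - a)) * \<dots> = (\<integral>\<^sup>+w. ennreal (1 / Zr \<mu> T (x - a)) * (F (past S w) * (ennreal (exp (\<mu> * L S (x - a) w)) * Z \<mu> (T - S) (x - a - \<xi> S w))) \<partial>M)"
    unfolding F_past by (rule nn_integral_cmult[symmetric]) measurable
  also have "\<dots> = (\<integral>\<^sup>+w. ennreal (hT S T w) * indicator A (X S w) \<partial>M)"
  proof (rule nn_integral_cong)
    fix w
    have "0 \<le> Zr \<mu> (T - S) (x - a - \<xi> S w)" by (simp add: Zr_def)
    then have "ennreal (hT S T w) = ennreal (1 / Zr \<mu> T (x - a)) * (ennreal (exp (\<mu> * L S (x - a) w)) * Z \<mu> (T - S) (x - a - \<xi> S w))"
      unfolding Z_Zr[OF T(2) \<mu>0] hT_def using Zp by (simp add: ennreal_mult[symmetric])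
    then show "ennreal (1 / Zr \<mu> T (x - a)) * (F (past S w) * (ennreal (exp (\<mu> * L S (x - a) w)) * Z \<mu> (T - S) (x - a - \<xi> S w))) =
      ennreal (hT S T w) * indicator A (X S w)"
      by (simp add: F_past ac_simps)
  qed
  finally show "emeasure (distr (density M (\<lambda>w. ennreal (exp (\<mu> * L T (x - a) w) / Zr \<mu> T (x - a)))) (path_space {0..S}) (X S)) A =
    emeasure (distr (density M (\<lambda>w. ennreal (hT S T w))) (path_space {0..S}) (X S)) A"
    by (simp add: em)
qed simp

lemma LINT_exp_L: "0 \<le> T \<Longrightarrow> (LINT w|M. exp (\<mu> * L T v w)) = Zr \<mu> T v"
proof -
  assume T: "0 \<le> T"
  note [measurable] = L_meas[OF T, of v]
  show ?thesis unfolding Zr_def Z_eq[OF T] by (intro integral_eq_nn_integral AE_I2 exp_ge_zero) measurable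
qed

text \<open>The mass is inherited from the probability measure \<open>P\<close> through
  \<open>limit_law_restrict\<close>.\<close>

lemma integral_h: assumes S: "0 \<le> S" shows "(\<integral>\<^sup>+w. ennreal (h S w) \<partial>M) = 1"
proof -
  have r: "(\<lambda>\<omega>. restrict \<omega> {0..S}) \<in> measurable P (path_space {0..S})"
    unfolding measurable_P_iff by (rule measurable_restrict_path) auto
  have X': "X S \<in> measurable (density M (\<lambda>w. ennreal (h S w))) (path_space {0..S})" using X_meas by simp
  interpret R: prob_space "distr P (path_space {0..S}) (\<lambda>\<omega>. restrict \<omega> {0..S})"
    by (rule prob_space.prob_space_distr[OF P_prob r])
  have "1 = emeasure (distr (density M (\<lambda>w. ennreal (h S w))) (path_space {0..S}) (X S)) (space (path_space {0..S}))"
    using R.emeasure_space_1 unfolding limit_law_restrict[OF S] by simp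
  also have "\<dots> = emeasure (density M (\<lambda>w. ennreal (h S w))) (space M)"
    by (subst emeasure_distr[OF X' sets.top])
      (use measurable_space[OF X_meas] in \<open>auto intro!: arg_cong2[where f=emeasure]\<close>)
  also have "\<dots> = (\<integral>\<^sup>+w. ennreal (h S w) \<partial>M)"
    using h_meas[OF S] by (subst emeasure_density) (auto cong: nn_integral_cong)
  finally show ?thesis by simp
qed

lemma integral_hT: assumes S: "0 \<le> S" "S \<le> T" shows "(\<integral>\<^sup>+w. ennreal (hT S T w) \<partial>M) = 1"
proof -
  have T: "0 \<le> T" using S by simp
  have [measurable]: "\<xi> S \<in> borel_measurable M" "L S (x - a) \<in> borel_measurable M"
    using S by (auto intro: \<xi>_meas L_meas)
  have [measurable]: "(\<lambda>y. Z \<mu> (T - S) y) \<in> borel_measurable borel"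
    using measurable_compose[OF measurable_Pair1'[of "T - S" borel borel] Z_meas] by simp
  have \<mu>0: "0 \<le> \<mu>" using \<mu> by simp
  have Zp: "0 < Zr \<mu> T (x - a)" using Zr_ge_1[OF T \<mu>0, of "x - a"] by simp
  have "(\<integral>\<^sup>+w. ennreal (hT S T w) \<partial>M) = (\<integral>\<^sup>+w. ennreal (1 / Zr \<mu> T (x - a)) * (ennreal (exp (\<mu> * L S (x - a) w)) * Z \<mu> (T - S) (x - a - \<xi> S w)) \<partial>M)"
  proof (rule nn_integral_cong)
    fix w
    have "0 \<le> Zr \<mu> (T - S) (x - a - \<xi> S w)" by (simp add: Zr_def)
    then show "ennreal (hT S T w) = ennreal (1 / Zr \<mu> T (x - a)) * (ennreal (exp (\<mu> * L S (x - a) w)) * Z \<mu> (T - S) (x - a - \<xi> S w))"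
      using Z_Zr[of "T - S" \<mu>] \<mu>0 S Zp by (simp add: hT_def ennreal_mult[symmetric])
  qed
  also have "\<dots> = ennreal (1 / Zr \<mu> T (x - a)) * Z \<mu> T (x - a)"
    using Z_semigroup[of S "T - S" \<mu> "x - a"] S by (subst nn_integral_cmult) auto
  also have "\<dots> = 1"
    unfolding Z_Zr[OF T \<mu>0] using Zp by (subst ennreal_mult[symmetric]) auto
  finally show ?thesis .
qed

text \<open>Weighted by exponentials, numerator and denominator converge to multiples of
  \<open>u \<nu>\<close> with the same unknown constant \<open>c\<close>, which cancels. The limit
  of the denominator is nonzero by \<open>u_start_pos\<close>.\<close>

lemma hT_tendsto:
  assumes S: "0 \<le> S"
  shows "((\<lambda>T. hT S T w) \<longlongrightarrow> h S w) at_top"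
proof -
  obtain c where c: "0 < c" "\<And>v. ((\<lambda>t. exp (- \<nu> * t) * Zr \<mu> t v) \<longlongrightarrow> c * u \<nu> v) at_top"
    using Z_asymptotics[OF \<mu> \<nu> \<nu>_u] by auto
  have up: "0 < u \<nu> (x - a)" by (rule u_start_pos)
  have "filterlim (\<lambda>T :: real. - S + T) at_top at_top"
    by (rule filterlim_tendsto_add_at_top[OF tendsto_const filterlim_ident])
  from filterlim_compose[OF c(2) this]
  have 1: "((\<lambda>T. exp (- \<nu> * (T - S)) * Zr \<mu> (T - S) v) \<longlongrightarrow> c * u \<nu> v) at_top" for v by simp
  have lim: "((\<lambda>T. exp (\<mu> * L S (x - a) w) * (exp (- \<nu> * S) * ((exp (- \<nu> * (T - S)) * Zr \<mu> (T - S) (x - a - \<xi> S w)) / (exp (- \<nu> * T) * Zr \<mu> T (x - a))))) \<longlongrightarrow>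
      exp (\<mu> * L S (x - a) w) * (exp (- \<nu> * S) * ((c * u \<nu> (x - a - \<xi> S w)) / (c * u \<nu> (x - a))))) at_top"
    by (intro tendsto_mult_left tendsto_divide 1 c(2)) (use c(1) up in auto)
  \<comment> \<open>The exponential weights introduced for the limit cancel exactly: the factor
    \<open>exp (- \<nu> * S)\<close> makes up for the shorter remaining time
    \<open>T - S\<close>.\<close>
  have e: "exp (\<mu> * L S (x - a) w) * (exp (- \<nu> * S) * ((exp (- \<nu> * (T - S)) * z1) / (exp (- \<nu> * T) * z2))) = exp (\<mu> * L S (x - a) w) * z1 / z2" for T z1 z2
  proof -
    have "exp (- \<nu> * S) * exp (- \<nu> * (T - S)) = exp (- \<nu> * T)" by (simp add: exp_add[symmetric] algebra_simps)
    then have "exp (- \<nu> * S) * ((exp (- \<nu> * (T - S)) * z1) / (exp (- \<nu> * T) * z2)) = (exp (- \<nu> * T) * z1) / (exp (- \<nu> * T) * z2)"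
      by (simp add: mult.assoc[symmetric])
    also have "\<dots> = z1 / z2" by simp
    finally show ?thesis by simp
  qed
  have "exp (\<mu> * L S (x - a) w) * (exp (- \<nu> * S) * ((c * u \<nu> (x - a - \<xi> S w)) / (c * u \<nu> (x - a)))) = h S w"
    using c(1) by (simp add: h_def)
  then show ?thesis using lim unfolding e hT_def by simp
qed

text \<open>Pulled back to the sample space, both laws are densities relative to \<open>M\<close>;
  convergence of these in L1 controls every bounded measurable functional of the path.\<close>

lemma penalized_integral_tendsto:
  fixes F :: "(real \<Rightarrow> real) \<Rightarrow> real"
  assumes S: "0 \<le> S" and F [measurable]: "F \<in> borel_measurable (path_space {0..S})"
    and bd: "\<And>\<eta>. \<eta> \<in> cadlag_paths {0..S} \<Longrightarrow> \<bar>F \<eta>\<bar> \<le> C"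
  shows "((\<lambda>T. LINT \<omega>|penalized_law M \<xi> L \<mu> a x T. F (restrict \<omega> {0..S})) \<longlongrightarrow> (LINT \<omega>|P. F (restrict \<omega> {0..S}))) at_top"
proof (rule tendsto_at_topI_sequentially)
  fix Y :: "nat \<Rightarrow> real" assume Y: "filterlim Y at_top sequentially"
  \<comment> \<open>Raised to at least \<open>S\<close>, so that \<open>hT S (T n)\<close> has total
    mass 1 for every \<open>n\<close>; eventually \<open>T n = Y n\<close>.\<close>
  define T where "T n = max S (Y n)" for n
  have TS: "S \<le> T n" for n by (simp add: T_def)
  have T_top: "filterlim T at_top sequentially"
    by (rule filterlim_at_top_mono[OF Y]) (simp add: T_def)
  have FX [measurable]: "(\<lambda>w. F (X S w)) \<in> borel_measurable M" by (rule measurable_compose[OF X_meas F])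
  have FX_bd: "\<bar>F (X S w)\<bar> \<le> C" if "w \<in> space M" for w
    using bd measurable_space[OF X_meas that] by (simp add: space_path_space)
  note [measurable] = h_meas[OF S] hT_meas[OF S]
  have h_int: "integrable M (h S)"
    using integral_h[OF S] h_nonneg by (intro integrableI_bounded) (auto simp: h_meas[OF S])
  have hT_int: "integrable M (hT S (T n))" for n
    using integral_hT[OF S TS] hT_nonneg by (intro integrableI_bounded) (auto simp: hT_meas[OF S])
  have Q: "(LINT \<omega>|penalized_law M \<xi> L \<mu> a x t. F (restrict \<omega> {0..S})) = (LINT w|M. hT S t w * F (X S w))" if t: "S \<le> t" for t
  proof -
    have t0: "0 \<le> t" using S t by simp
    have [measurable]: "L t (x - a) \<in> borel_measurable M" by (rule L_meas[OF t0])
    let ?D = "density M (\<lambda>w. ennreal (exp (\<mu> * L t (x - a) w) / Zr \<mu> t (x - a)))"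
    have X': "X r \<in> measurable ?D (path_space {0..r})" for r using X_meas by simp
    have sub: "(\<lambda>\<omega>. restrict \<omega> {0..S}) \<in> measurable (path_space {0..t}) (path_space {0..S})"
      using t by (intro measurable_restrict_path) auto
    have "penalized_law M \<xi> L \<mu> a x t = distr ?D (path_space {0..t}) (X t)"
      unfolding penalized_law_def LINT_exp_L[OF t0] X_def by (rule refl)
    then have "(LINT \<omega>|penalized_law M \<xi> L \<mu> a x t. F (restrict \<omega> {0..S})) = (LINT w|?D. F (restrict (X t w) {0..S}))"
      by (simp add: integral_distr[OF X' measurable_compose[OF sub F]])
    also have "\<dots> = (LINT w|?D. F (X S w))"
      using t by (intro Bochner_Integration.integral_cong refl arg_cong[where f=F]) (auto simp: X_def)
    also have "\<dots> = (LINT \<eta>|distr ?D (path_space {0..S}) (X S). F \<eta>)"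
      by (rule integral_distr[OF X' F, symmetric])
    also have "\<dots> = (LINT w|density M (\<lambda>w. ennreal (hT S t w)). F (X S w))"
      unfolding penalized_law_restrict[OF S t] using X_meas by (intro integral_distr F) simp
    also have "\<dots> = (LINT w|M. hT S t w *\<^sub>R F (X S w))"
      by (rule integral_density[OF FX hT_meas[OF S]]) (simp add: hT_nonneg)
    finally show ?thesis by simp
  qed
  have Plim: "(LINT \<omega>|P. F (restrict \<omega> {0..S})) = (LINT w|M. h S w * F (X S w))"
  proof -
    have r: "(\<lambda>\<omega>. restrict \<omega> {0..S}) \<in> measurable P (path_space {0..S})"
      unfolding measurable_P_iff by (rule measurable_restrict_path) auto
    have "(LINT \<omega>|P. F (restrict \<omega> {0..S})) = (LINT \<eta>|distr P (path_space {0..S}) (\<lambda>\<omega>. restrict \<omega> {0..S}). F \<eta>)"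
      by (rule integral_distr[OF r F, symmetric])
    also have "\<dots> = (LINT w|density M (\<lambda>w. ennreal (h S w)). F (X S w))"
      unfolding limit_law_restrict[OF S] using X_meas by (intro integral_distr F) simp
    also have "\<dots> = (LINT w|M. h S w *\<^sub>R F (X S w))"
      by (rule integral_density[OF FX h_meas[OF S]]) (simp add: h_nonneg)
    finally show ?thesis by simp
  qed
  have "(\<lambda>n. \<integral>\<^sup>+w. norm (hT S (T n) w - h S w) \<partial>M) \<longlonglongrightarrow> 0"
  proof (rule Scheffe_lemma2[OF _ h_int])
    show "AE w in M. (\<lambda>n. hT S (T n) w) \<longlonglongrightarrow> h S w"
      using filterlim_compose[OF hT_tendsto[OF S] T_top] by (intro AE_I2)
    show "(\<integral>\<^sup>+w. norm (hT S (T n) w) \<partial>M) \<le> (\<integral>\<^sup>+w. norm (h S w) \<partial>M)" for n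
      using integral_h[OF S] integral_hT[OF S TS] h_nonneg hT_nonneg by simp
  qed (rule hT_meas[OF S])
  then have L1: "(\<lambda>n. LINT w|M. \<bar>hT S (T n) w - h S w\<bar>) \<longlonglongrightarrow> 0"
  proof -
    have "(\<integral>\<^sup>+w. norm (hT S (T n) w - h S w) \<partial>M) = ennreal (LINT w|M. \<bar>hT S (T n) w - h S w\<bar>)" for n
      using hT_int h_int by (subst nn_integral_eq_integral) auto
    then show ?thesis
      using \<open>(\<lambda>n. \<integral>\<^sup>+w. norm (hT S (T n) w - h S w) \<partial>M) \<longlonglongrightarrow> 0\<close>
      by (simp add: ennreal_tendsto_0_iff)
  qed
  have FXh: "integrable M (\<lambda>w. f w * F (X S w))" if "integrable M f" for f
  proof (rule Bochner_Integration.integrable_bound)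
    show "integrable M (\<lambda>w. C * f w)" using that by simp
    show "AE w in M. norm (f w * F (X S w)) \<le> norm (C * f w)"
    proof (rule AE_I2)
      fix w assume "w \<in> space M"
      from FX_bd[OF this] have "\<bar>F (X S w)\<bar> \<le> \<bar>C\<bar>" by linarith
      then show "norm (f w * F (X S w)) \<le> norm (C * f w)"
        unfolding real_norm_def abs_mult mult.commute[of "\<bar>f w\<bar>"] by (rule mult_right_mono) simp
    qed
  qed (use that in measurable)
  have "(\<lambda>n. (LINT w|M. hT S (T n) w * F (X S w)) - (LINT w|M. h S w * F (X S w))) \<longlonglongrightarrow> 0"
  proof (rule Lim_null_comparison)
    have "(\<lambda>n. C * (LINT w|M. \<bar>hT S (T n) w - h S w\<bar>)) \<longlonglongrightarrow> C * 0" by (intro tendsto_intros L1)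
    then show "(\<lambda>n. C * (LINT w|M. \<bar>hT S (T n) w - h S w\<bar>)) \<longlonglongrightarrow> 0" by simp
    have "norm ((LINT w|M. hT S (T n) w * F (X S w)) - (LINT w|M. h S w * F (X S w))) \<le> C * (LINT w|M. \<bar>hT S (T n) w - h S w\<bar>)" for n
    proof -
      have "norm ((LINT w|M. hT S (T n) w * F (X S w)) - (LINT w|M. h S w * F (X S w))) = norm (LINT w|M. (hT S (T n) w - h S w) * F (X S w))"
        by (subst Bochner_Integration.integral_diff[symmetric]) (auto intro: FXh hT_int h_int simp: left_diff_distrib)
      also have "\<dots> \<le> (LINT w|M. norm ((hT S (T n) w - h S w) * F (X S w)))"
        by (rule integral_norm_bound)
      also have "\<dots> \<le> (LINT w|M. C * \<bar>hT S (T n) w - h S w\<bar>)"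
      proof (rule Bochner_Integration.integral_mono)
        show "integrable M (\<lambda>w. norm ((hT S (T n) w - h S w) * F (X S w)))"
          using hT_int h_int by (intro integrable_norm FXh) auto
        show "integrable M (\<lambda>w. C * \<bar>hT S (T n) w - h S w\<bar>)" using hT_int h_int by auto
        show "norm ((hT S (T n) w - h S w) * F (X S w)) \<le> C * \<bar>hT S (T n) w - h S w\<bar>" if "w \<in> space M" for w
          using mult_right_mono[OF FX_bd[OF that], of "\<bar>hT S (T n) w - h S w\<bar>"] by (simp add: abs_mult mult.commute)
      qed
      finally show ?thesis by simp
    qed
    then show "\<forall>\<^sub>F n in sequentially. norm ((LINT w|M. hT S (T n) w * F (X S w)) - (LINT w|M. h S w * F (X S w))) \<le> C * (LINT w|M. \<bar>hT S (T n) w - h S w\<bar>)"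
      by (auto intro: always_eventually)
  qed
  then have lim: "(\<lambda>n. LINT w|M. hT S (T n) w * F (X S w)) \<longlonglongrightarrow> (LINT w|M. h S w * F (X S w))"
    by (rule LIM_zero_cancel)
  have "eventually (\<lambda>n. S \<le> Y n) sequentially" using Y by (simp add: filterlim_at_top)
  then have "eventually (\<lambda>n. (LINT w|M. hT S (T n) w * F (X S w)) = (LINT \<omega>|penalized_law M \<xi> L \<mu> a x (Y n). F (restrict \<omega> {0..S}))) sequentially"
    by eventually_elim (simp add: Q T_def max_absorb2)
  from Lim_transform_eventually[OF lim this]
  show "(\<lambda>n. LINT \<omega>|penalized_law M \<xi> L \<mu> a x (Y n). F (restrict \<omega> {0..S})) \<longlonglongrightarrow> (LINT \<omega>|P. F (restrict \<omega> {0..S}))"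
    unfolding Plim .
qed

lemma weak_convergence: "weakly_converges_paths (\<lambda>T. penalized_law M \<xi> L \<mu> a x T) P"
  unfolding weakly_converges_paths_def
proof (intro allI impI)
  fix S :: real and F :: "(real \<Rightarrow> real) \<Rightarrow> real" assume S: "0 < S" and F: "continuous_map (skorokhod_topology S) euclideanreal F \<and> bounded (F ` cadlag_paths {0..S})"
  obtain C where C: "\<And>\<eta>. \<eta> \<in> cadlag_paths {0..S} \<Longrightarrow> \<bar>F \<eta>\<bar> \<le> C"
    using conjunct2[OF F] unfolding bounded_iff by auto
  show "((\<lambda>T. LINT \<omega>|penalized_law M \<xi> L \<mu> a x T. F (restrict \<omega> {0..S})) \<longlongrightarrow> (LINT \<omega>|P. F (restrict \<omega> {0..S}))) at_top"
  proof (cases "F \<in> borel_measurable (path_space {0..S})")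
    case True
    then show ?thesis using S C by (intro penalized_integral_tendsto) auto
  next
    \<comment> \<open>The Bochner integral of a non-measurable function is \<open>0\<close>, and the restriction map reflects measurability.\<close>
    case False
    have "(\<lambda>\<omega>. F (restrict \<omega> {0..S})) \<notin> borel_measurable P"
      unfolding measurable_P_iff
    proof
      assume "(\<lambda>\<omega>. F (restrict \<omega> {0..S})) \<in> borel_measurable (path_space {0..})"
      from measurable_of_restrict[OF less_imp_le[OF S] _ _ this] False show False by force
    qed
    then have P0: "(LINT \<omega>|P. F (restrict \<omega> {0..S})) = 0"
      by (metis borel_measurable_integrable not_integrable_integral_eq)
    have "eventually (\<lambda>T. (LINT \<omega>|penalized_law M \<xi> L \<mu> a x T. F (restrict \<omega> {0..S})) = 0) at_top"
      using eventually_ge_at_top[of S]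
    proof eventually_elim
      case (elim T)
      have "(\<lambda>\<omega>. F (restrict \<omega> {0..S})) \<notin> borel_measurable (path_space {0..T})"
      proof
        assume "(\<lambda>\<omega>. F (restrict \<omega> {0..S})) \<in> borel_measurable (path_space {0..T})"
        from measurable_of_restrict[OF less_imp_le[OF S] _ _ this] False elim show False by force
      qed
      then have "(\<lambda>\<omega>. F (restrict \<omega> {0..S})) \<notin> borel_measurable (penalized_law M \<xi> L \<mu> a x T)"
        by (simp add: penalized_law_def)
      then show ?case by (metis borel_measurable_integrable not_integrable_integral_eq)
    qed
    then show ?thesis unfolding P0 by (rule tendsto_eventually)
  qed
qed

end

lemma levy_exponent_nonneg: "0 \<le> levy_exponent \<sigma> \<Lambda> q"
  unfolding levy_exponent_def set_lebesgue_integral_def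
  by (intro add_nonneg_nonneg Bochner_Integration.integral_nonneg) (auto split: split_indicator)

theorem theorem6p5:
  fixes M :: "'w measure"
    and \<xi> :: "real \<Rightarrow> 'w \<Rightarrow> real"
    and L :: "real \<Rightarrow> real \<Rightarrow> 'w \<Rightarrow> real"
    and \<Lambda> :: "real measure"
    and \<sigma> \<mu> \<nu> a x :: real
    and p :: "real \<Rightarrow> real \<Rightarrow> real \<Rightarrow> real"
    and P :: "(real \<Rightarrow> real) measure"
  assumes "levy_process M \<xi>"
    and "symmetric_levy_measure \<Lambda>"
    and "\<And>t q. t \<ge> 0 \<Longrightarrow>
           char (distr M borel (\<xi> t)) q = of_real (exp (- t * levy_exponent \<sigma> \<Lambda> q))"
    and "integrable lborel (\<lambda>q. 1 / (1 + levy_exponent \<sigma> \<Lambda> q))"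
    and "local_time M \<xi> L"
    and "\<mu> > 0"
    and "\<nu> > 0"
    and "of_real \<mu> * psi (levy_exponent \<sigma> \<Lambda>) (of_real \<nu>) 0 = 1"
    and "feynman_kac_kernel M \<xi> L \<mu> a p"
    and "markov_law (rho (levy_exponent \<sigma> \<Lambda>) p \<nu> a) x P"
  shows "weakly_converges_paths (\<lambda>T. penalized_law M \<xi> L \<mu> a x T) P"
proof -
  interpret penalized M \<xi> "levy_exponent \<sigma> \<Lambda>" L \<mu> \<nu> a x p P
  proof
    show "integrable lborel (\<lambda>q. 1 / (1 + levy_exponent \<sigma> \<Lambda> q))" by (rule assms(4))
  qed (use assms levy_exponent_nonneg in auto)
  show ?thesis by (rule weak_convergence)
qed

end
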